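(* Let $n,N\ge 1$, let $0<t_0<T<\infty$, and let $h\in C_0^\infty(\mathbb{R}^n)$. Consider the Cauchy problem for the variable coefficient wave equation $$\Big(\frac{2t}{N}\,\frac{\partial^2}{\partial t^2}-\Delta_{x,y}\Big)u=0,\qquad (t,x,y)\in[t_0,T]\times\mathbb{R}^n_x\times\mathbb{R}^N_y,\qquad u(T,x,y)=h(x),$$ where $\Delta_{x,y}=\sum_{i=1}^n\partial_{x_i}^2+\sum_{j=1}^N\partial_{y_j}^2$. Then for each $N$ there exists a solution $u=u^{(N)}(t,x,y)$ of this Cauchy problem which is radial in the $y$-coordinates, i.e. $u^{(N)}(t,x,y)=u^{(N)}(t,x,Ay)$ for all $A\in SO(N)$, such that the limit $$u(t,x):=\lim_{N\to\infty}u^{(N)}(t,x,y)\big|_{\{t=|y|^2/(2N)\}}$$ exists at all points of $[t_0,T]\times\mathbb{R}^n_x$. Moreover $u\in C^\infty([t_0,T]\times\mathbb{R}^n_x)$ and $u$ solves the backward heat equation $$\partial_t u+\Delta_x u=0,\qquad u(T,x)=h(x),\qquad (t,x)\in[t_0,T]\times\mathbb{R}^n_x.$$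
   Context: Here $\mathbb{R}^n_x\times\mathbb{R}^N_y$ carries the Euclidean metric $dx^2+dy^2$. The restriction $u^{(N)}|_{\{t=|y|^2/(2N)\}}$ means: since $u^{(N)}$ depends on $y$ only through $|y|$, one evaluates $u^{(N)}(t,x,y)$ at $|y|=\sqrt{2Nt}$, giving a function of $(t,x)$. *)

theory Defs
  imports "HOL-Analysis.Analysis"
begin

text \<open>Points of R^d are represented as functions nat => real vanishing at all
coordinates >= d (the dimension N varies inside the statement, so a type-indexed
representation is not possible).  The topology is the product topology, which on
this finite-dimensional subspace is the Euclidean one.\<close>

definition Rsp :: "nat \<Rightarrow> (nat \<Rightarrow> real) set" where
  "Rsp d = {p. \<forall>i\<ge>d. p i = 0}"

definition pd :: "nat \<Rightarrow> ((nat \<Rightarrow> real) \<Rightarrow> real) \<Rightarrow> (nat \<Rightarrow> real) \<Rightarrow> real" where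
  "pd k f p = deriv (\<lambda>s. f (p(k := p k + s))) 0"

definition pds :: "nat list \<Rightarrow> ((nat \<Rightarrow> real) \<Rightarrow> real) \<Rightarrow> (nat \<Rightarrow> real) \<Rightarrow> real" where
  "pds ks f = foldr pd ks f"

definition Ck_on :: "nat \<Rightarrow> nat \<Rightarrow> (nat \<Rightarrow> real) set \<Rightarrow> ((nat \<Rightarrow> real) \<Rightarrow> real) \<Rightarrow> bool" where
  "Ck_on k d V f \<longleftrightarrow>
     (\<forall>ks. set ks \<subseteq> {..<d} \<and> length ks \<le> k \<longrightarrow> continuous_on V (pds ks f)) \<and>
     (\<forall>ks. set ks \<subseteq> {..<d} \<and> length ks < k \<longrightarrow>
        (\<forall>j<d. \<forall>p\<in>V. (\<lambda>s. pds ks f (p(j := p j + s))) differentiable (at 0)))"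

text \<open>The closed slab [a,b] x R^(d-1) inside R^d (coordinate 0 is time).\<close>
definition slab :: "nat \<Rightarrow> real \<Rightarrow> real \<Rightarrow> (nat \<Rightarrow> real) set" where
  "slab d a b = {p \<in> Rsp d. a \<le> p 0 \<and> p 0 \<le> b}"

text \<open>Splitting a point p = (t,x,y) of R^(1+n+N): p 0 = t, p 1..p n = x,
p (n+1)..p (n+N) = y.\<close>
definition xof :: "nat \<Rightarrow> (nat \<Rightarrow> real) \<Rightarrow> (nat \<Rightarrow> real)" where
  "xof n p = (\<lambda>i. if i < n then p (Suc i) else 0)"

definition yof :: "nat \<Rightarrow> nat \<Rightarrow> (nat \<Rightarrow> real) \<Rightarrow> (nat \<Rightarrow> real)" where
  "yof n N p = (\<lambda>j. if j < N then p (Suc n + j) else 0)"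

text \<open>f is C^k on a closed slab: it is the restriction of a C^k function g on a
relatively open neighbourhood V of the slab (standard meaning of C^k up to the boundary).\<close>
definition Ck_ext :: "nat \<Rightarrow> nat \<Rightarrow> real \<Rightarrow> real \<Rightarrow> ((nat \<Rightarrow> real) \<Rightarrow> real)
                      \<Rightarrow> (nat \<Rightarrow> real) set \<Rightarrow> ((nat \<Rightarrow> real) \<Rightarrow> real) \<Rightarrow> bool" where
  "Ck_ext k d a b f V g \<longleftrightarrow> openin (top_of_set (Rsp d)) V \<and> slab d a b \<subseteq> V \<and>
      Ck_on k d V g \<and> (\<forall>p\<in>slab d a b. g p = f p)"

definition C0_inf :: "nat \<Rightarrow> ((nat \<Rightarrow> real) \<Rightarrow> real) \<Rightarrow> bool" where
  "C0_inf n h \<longleftrightarrow> (\<forall>k. Ck_on k n (Rsp n) h) \<and>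
     (\<exists>R. \<forall>x\<in>Rsp n. (\<Sum>i<n. (x i)\<^sup>2) > R\<^sup>2 \<longrightarrow> h x = 0)"

definition detN :: "nat \<Rightarrow> (nat \<Rightarrow> nat \<Rightarrow> real) \<Rightarrow> real" where
  "detN N A = (\<Sum>\<sigma> | \<sigma> permutes {..<N}. of_int (sign \<sigma>) * (\<Prod>i<N. A i (\<sigma> i)))"

definition SO :: "nat \<Rightarrow> (nat \<Rightarrow> nat \<Rightarrow> real) set" where
  "SO N = {A. (\<forall>i<N. \<forall>j<N. (\<Sum>k<N. A k i * A k j) = (if i = j then 1 else 0)) \<and> detN N A = 1}"

definition matvec :: "nat \<Rightarrow> (nat \<Rightarrow> nat \<Rightarrow> real) \<Rightarrow> (nat \<Rightarrow> real) \<Rightarrow> (nat \<Rightarrow> real)" where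
  "matvec N A y = (\<lambda>i. if i < N then (\<Sum>j<N. A i j * y j) else 0)"

definition wave_solution :: "nat \<Rightarrow> nat \<Rightarrow> real \<Rightarrow> real \<Rightarrow> ((nat \<Rightarrow> real) \<Rightarrow> real)
     \<Rightarrow> (real \<Rightarrow> (nat \<Rightarrow> real) \<Rightarrow> (nat \<Rightarrow> real) \<Rightarrow> real) \<Rightarrow> bool" where
  "wave_solution n N t0 T h v \<longleftrightarrow>
     (\<exists>V g. Ck_ext 2 (Suc (n + N)) t0 T (\<lambda>p. v (p 0) (xof n p) (yof n N p)) V g \<and>
        (\<forall>p\<in>slab (Suc (n + N)) t0 T.
           2 * p 0 / real N * pd 0 (pd 0 g) p - (\<Sum>k\<in>{1..n + N}. pd k (pd k g) p) = 0)) \<and>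
     (\<forall>x\<in>Rsp n. \<forall>y\<in>Rsp N. v T x y = h x)"

definition backward_heat_smooth :: "nat \<Rightarrow> real \<Rightarrow> real \<Rightarrow> ((nat \<Rightarrow> real) \<Rightarrow> real)
     \<Rightarrow> (real \<Rightarrow> (nat \<Rightarrow> real) \<Rightarrow> real) \<Rightarrow> bool" where
  "backward_heat_smooth n t0 T h u \<longleftrightarrow>
     (\<exists>V g. Ck_ext 0 (Suc n) t0 T (\<lambda>p. u (p 0) (xof n p)) V g \<and> (\<forall>k. Ck_on k (Suc n) V g) \<and>
        (\<forall>p\<in>slab (Suc n) t0 T. pd 0 g p + (\<Sum>k\<in>{1..n}. pd k (pd k g) p) = 0)) \<and>
     (\<forall>x\<in>Rsp n. u T x = h x)"

text \<open>The point y = sqrt(2 N t) e_1 of R^N, on the sphere |y|^2 = 2 N t.\<close>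
definition ypt :: "nat \<Rightarrow> real \<Rightarrow> (nat \<Rightarrow> real)" where
  "ypt N t = (\<lambda>j. if j = 0 then sqrt (2 * real N * t) else 0)"

end

theory Submission
  imports Defs "HOL-Complex_Analysis.Complex_Analysis" "HOL-Probability.Probability"
begin

text \<open>By Fourier inversion \<open>h\<close> is a superposition of waves of frequency \<open>\<xi>\<close>, so with \<open>q = |\<xi>|\<^sup>2\<close> it is
  enough to choose radial solutions of \<open>(2t/N) A'' - \<Delta>\<^sub>y A + q A = 0\<close>, \<open>A = 1\<close> at \<open>t = T\<close>, whose restriction
  to \<open>|y|\<^sup>2 = 2Nt\<close> tends to \<open>exp (- (T - t) q)\<close>. Let \<open>f\<^sub>\<kappa>\<close> be the solution of \<open>4t f'' = - \<kappa>\<^sup>2 f\<close> with \<open>f\<^sub>\<kappa>(T) = 1\<close>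
  that is outgoing at \<open>t = t\<^sub>0/2\<close>; it behaves like \<open>exp (i \<kappa> (sqrt T - sqrt t))\<close>, so it is bounded and holomorphic for
  \<open>Im \<kappa> \<ge> 0\<close> and, for \<open>t < T\<close>, tends to zero there as \<open>Im \<kappa> \<rightarrow> \<infinity>\<close>. With \<open>Y\<^sub>\<mu>\<close> the radial solution of
  \<open>\<Delta>\<^sub>y Y = \<mu> Y\<close>, \<open>Y(0) = 1\<close>, take
  \<open>A = Re f\<^sub>\<kappa>(t) at \<kappa> = sqrt (2 N q), plus exp (- T q) (2/\<pi>) \<integral> Im f\<^sub>\<kappa>(t)/\<kappa> Y\<^sub>\<mu>(y) d\<kappa>\<close> over \<open>0 < \<kappa> < N\<^bsup>1/4\<^esup>\<close>, with
  \<open>\<mu> = q - \<kappa>\<^sup>2/(2N)\<close>. At \<open>t = T\<close> the second term vanishes and the first is 1.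
  As \<open>N \<rightarrow> \<infinity>\<close> the first term disappears after integration in \<open>\<xi>\<close> (Riemann-Lebesgue). In the
  second, \<open>Y\<^sub>\<mu> \<rightarrow> exp (t q)\<close> on \<open>|y|\<^sup>2 = 2Nt\<close>, and \<open>(2/\<pi>) \<integral> Im f\<^sub>\<kappa>(t)/\<kappa> d\<kappa>\<close> over \<open>(0, \<infinity>)\<close> equals
  \<open>f\<^sub>0(t) = 1\<close> by Cauchy's theorem on a half disc. Smoothness of the heat solution up to \<open>t = T\<close> uses a bounded
  smooth extension of \<open>exp (- s)\<close> from \<open>s \<ge> 0\<close> to the whole line.\<close>

section \<open>A bounded smooth extension of the exponential\<close>

text \<open>Only the value at \<open>t = T\<close> is prescribed, so the time derivative there is
  free; the construction spends this freedom. The natural candidate is the mode constant in time,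
  \<open>exp (- T q) Y\<close> with \<open>\<Delta> Y = q Y\<close>: on the parabola it tends to
  \<open>exp (- (T - t) q)\<close>, but at \<open>t = T\<close> it still depends on \<open>y\<close>
  and misses the datum. It is replaced by a packet of low frequencies \<open>\<kappa>\<close> whose
  amplitude is exactly 0 at \<open>T\<close> and yet tends to 1 for each fixed \<open>t < T\<close>.
  Two demands shape the width \<open>R\<close> of the packet: \<open>R\<close> must tend to infinity
  so that the truncated integral approaches the full one, and a radial error of order
  \<open>R^2 / N\<close>, integrated over a frequency range of length \<open>R\<close>, must vanish,
  that is \<open>R^3 / N\<close> must tend to 0. Smoothness up to the boundary of the slab means
  smoothness on a neighbourhood, so the modes start below \<open>t0\<close> and are controlled up to
  \<open>T + 1\<close>. Normalising them at \<open>T\<close> requires that the unnormalised mode has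
  no zero there for any \<open>\<kappa>\<close> in the closed upper half plane; the outgoing
  condition is chosen to guarantee this.\<close>

definition flat :: "nat \<Rightarrow> real \<Rightarrow> real" where
  "flat k s = (if s < 0 then (1/s)^k * exp (1/s) else 0)"

lemma pow_exp_neg_le_fact:
  fixes u :: real
  assumes "0 \<le> u"
  shows "u^k * exp (-u) \<le> fact k"
proof -
  have "u^k / fact k \<le> exp u"
  proof -
    have "(\<Sum>i\<in>{k}. u^i /\<^sub>R fact i) \<le> (\<Sum>i. u^i /\<^sub>R fact i)"
      by (rule sum_le_suminf[OF summable_exp_generic]) (use assms in auto)
    thus ?thesis by (simp add: exp_def divide_inverse mult.commute)
  qed
  thus ?thesis by (simp add: exp_minus field_simps)
qed

lemma flat_bounded: "\<bar>flat k s\<bar> \<le> fact k"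
proof (cases "s < 0")
  case True
  have "(-1/s)^k * exp (-(-1/s)) \<le> fact k"
    by (rule pow_exp_neg_le_fact) (use True in auto)
  thus ?thesis using True by (simp add: flat_def abs_mult power_abs)
qed (simp add: flat_def)

text \<open>\<open>flat k s = flat (k+2) s * s\<^sup>2\<close> with \<open>flat (k+2)\<close>
  bounded: vanishing of second order at 0, which makes the derivative at the junction point equal to
  0.\<close>

lemma flat_le: assumes "s \<le> 0" shows "\<bar>flat k s\<bar> \<le> fact (k+2) * s\<^sup>2"
proof (cases "s < 0")
  case True
  have "flat k s = flat (k+2) s * s\<^sup>2" using True by (simp add: flat_def power_divide power2_eq_square)
  thus ?thesis using flat_bounded[of "k+2" s] by (simp add: abs_mult mult_right_mono)
qed (use assms in \<open>auto simp: flat_def\<close>)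

lemma flat_deriv:
  "(flat k has_real_derivative (- real k * flat (k+1) s - flat (k+2) s)) (at s)"
proof -
  consider "s < 0" | "s > 0" | "s = 0" by linarith
  thus ?thesis
  proof cases
    case 1
    have "((\<lambda>s. (1/s)^k * exp (1/s)) has_real_derivative (- real k * flat (k+1) s - flat (k+2) s)) (at s)"
    proof -
      have i: "((\<lambda>s. 1 / s) has_real_derivative (-1 / s\<^sup>2)) (at s)"
        using DERIV_inverse[of s UNIV] 1 by (simp add: inverse_eq_divide power2_eq_square)
      have "((\<lambda>s. (1 / s)^k * exp (1 / s)) has_real_derivative
          (1 / s)^k * (exp (1 / s) * (-1 / s\<^sup>2)) + (real k * ((-1 / s\<^sup>2) * (1 / s)^(k - Suc 0))) * exp (1 / s)) (at s)"
        by (rule DERIV_mult'[OF DERIV_power[OF i] DERIV_fun_exp[OF i]])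
      moreover have "(1 / s)^k * (exp (1 / s) * (-1 / s\<^sup>2)) + (real k * ((-1 / s\<^sup>2) * (1 / s)^(k - Suc 0))) * exp (1 / s)
          = - real k * flat (k+1) s - flat (k+2) s"
        using 1 by (cases k) (simp_all add: flat_def power2_eq_square algebra_simps add_divide_distrib diff_divide_distrib)
      ultimately show ?thesis by simp
    qed
    thus ?thesis
      by (rule has_field_derivative_transform_within_open[of _ _ _ "{..<0}"])
         (use 1 in \<open>auto simp: flat_def\<close>)
  next
    case 2
    have "((\<lambda>s. 0) has_real_derivative (- real k * flat (k+1) s - flat (k+2) s)) (at s)"
      using 2 by (simp add: flat_def)
    thus ?thesis
      by (rule has_field_derivative_transform_within_open[of _ _ _ "{0<..}"])
         (use 2 in \<open>auto simp: flat_def\<close>)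
  next
    case 3
    have b: "norm (flat k h / h) \<le> fact (k+2) * \<bar>h\<bar>" for h
    proof (cases "h < 0")
      case True
      have "\<bar>flat k h\<bar> \<le> fact (k+2) * h\<^sup>2" using flat_le[of h k] True by simp
      thus ?thesis using True by (simp add: divide_simps power2_eq_square abs_mult)
    qed (auto simp: flat_def)
    have "((\<lambda>h. flat k h / h) \<longlongrightarrow> 0) (at 0)"
    proof (rule Lim_null_comparison)
      show "\<forall>\<^sub>F h in at 0. norm (flat k h / h) \<le> fact (k+2) * \<bar>h\<bar>" using b by simp
      show "((\<lambda>h. fact (k+2) * \<bar>h\<bar> :: real) \<longlongrightarrow> 0) (at 0)" by (rule tendsto_eq_intros refl | simp)+
    qed
    thus ?thesis using 3 by (simp add: DERIV_def flat_def)
  qed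
qed

text \<open>Explicit higher derivatives of the extension would be unwieldy. It is enough that they
  lie in an algebra of bounded functions closed under differentiation; the functions
  \<open>flat k\<close>, pole powers times \<open>exp (1/s)\<close>, generate one.\<close>

inductive flat_alg :: "(real \<Rightarrow> real) \<Rightarrow> bool" where
  const: "flat_alg (\<lambda>s. c)"
| flat: "flat_alg (flat k)"
| add: "flat_alg f \<Longrightarrow> flat_alg g \<Longrightarrow> flat_alg (\<lambda>s. f s + g s)"
| mult: "flat_alg f \<Longrightarrow> flat_alg g \<Longrightarrow> flat_alg (\<lambda>s. f s * g s)"

lemma flat_alg_bounded: "flat_alg f \<Longrightarrow> \<exists>C. \<forall>s. \<bar>f s\<bar> \<le> C"
proof (induction rule: flat_alg.induct)
  case (add f g)
  then obtain A B where AB: "\<And>s. \<bar>f s\<bar> \<le> A" "\<And>s. \<bar>g s\<bar> \<le> B" by auto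
  show ?case by (rule exI[of _ "A+B"]) (meson AB abs_triangle_ineq add_mono order_trans)
next
  case (mult f g)
  then obtain A B where AB: "\<And>s. \<bar>f s\<bar> \<le> A" "\<And>s. \<bar>g s\<bar> \<le> B" by auto
  show ?case by (rule exI[of _ "A*B"])
    (auto simp: abs_mult intro!: mult_mono AB order_trans[OF abs_ge_zero AB(1)])
qed (auto intro: flat_bounded)

lemma flat_alg_deriv:
  "flat_alg f \<Longrightarrow> \<exists>f'. flat_alg f' \<and> (\<forall>s. (f has_real_derivative f' s) (at s))"
proof (induction rule: flat_alg.induct)
  case (const c)
  show ?case by (rule exI[of _ "\<lambda>_. 0"]) (auto intro: flat_alg.intros)
next
  case (flat k)
  show ?case
  proof (intro exI conjI allI)
    show "flat_alg (\<lambda>s. (- real k) * flat (k+1) s + (-1) * flat (k+2) s)"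
      by (intro flat_alg.intros)
    show "(flat k has_real_derivative (- real k) * flat (k+1) s + (-1) * flat (k+2) s) (at s)" for s
      using flat_deriv[of k s] by simp
  qed
next
  case (add f g)
  then obtain f' g' where "flat_alg f'" "flat_alg g'"
    "\<And>s. (f has_real_derivative f' s) (at s)" "\<And>s. (g has_real_derivative g' s) (at s)" by auto
  thus ?case by (intro exI[of _ "\<lambda>s. f' s + g' s"]) (auto intro!: flat_alg.intros derivative_intros)
next
  case (mult f g)
  then obtain f' g' where *: "flat_alg f'" "flat_alg g'"
    "\<And>s. (f has_real_derivative f' s) (at s)" "\<And>s. (g has_real_derivative g' s) (at s)" by auto
  show ?case using mult.hyps *
    by (intro exI[of _ "\<lambda>s. f s * g' s + f' s * g s"])
       (auto intro!: flat_alg.intros DERIV_mult' )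
qed

lemma smooth_bounded_extension_of_exp:
  obtains \<phi> :: "nat \<Rightarrow> real \<Rightarrow> real"
  where "\<And>m s. (\<phi> m has_real_derivative \<phi> (Suc m) s) (at s)"
    and "\<And>m. \<exists>C. \<forall>s. \<bar>\<phi> m s\<bar> \<le> C"
    and "\<And>m s. 0 \<le> s \<Longrightarrow> \<phi> m s = (-1)^m * exp (-s)"
proof -
  \<comment> \<open>For \<open>s \<ge> 0\<close> the correction vanishes and
    \<open>e s = exp (- s)\<close>. For \<open>s < 0\<close> the exponent is
    \<open>- s * (1 - exp (1/s))\<close>, which tends to 1 as \<open>s\<close> goes to minus
    infinity, so the growth of \<open>exp (- s)\<close> is cancelled.\<close>
  define e where "e = (\<lambda>s. exp (- s + s * flat 0 s))"
  define D where "D f = (SOME f'. flat_alg f' \<and> (\<forall>s. (f has_real_derivative f' s) (at s)))" for f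
  have D: "flat_alg (D f) \<and> (\<forall>s. (f has_real_derivative D f s) (at s))" if "flat_alg f" for f
    unfolding D_def by (rule someI_ex[OF flat_alg_deriv[OF that]])
  \<comment> \<open>\<open>e * F m\<close> will be the \<open>m\<close>-th derivative of
    \<open>e\<close>. The factor \<open>-1 + flat 0 s - flat 1 s\<close> is the logarithmic
    derivative of \<open>e\<close>, because \<open>s * flat 2 s = flat 1 s\<close>.\<close>
  define F where "F = rec_nat (\<lambda>_. 1) (\<lambda>_ f s. D f s + f s * (-1 + (flat 0 s + (-1) * flat 1 s)))"
  have F: "flat_alg (F m)" for m
  proof (induction m)
    case 0
    show ?case unfolding F_def by (simp add: flat_alg.const)
  next
    case (Suc m)
    hence "flat_alg (\<lambda>s. D (F m) s + F m s * (-1 + (flat 0 s + (-1) * flat 1 s)))"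
      by (intro flat_alg.intros D[THEN conjunct1])
    thus ?case by (simp only: F_def nat.rec)
  qed
  define \<phi> where "\<phi> m s = e s * F m s" for m s
  have e': "(e has_real_derivative e s * (-1 + (flat 0 s + (-1) * flat 1 s))) (at s)" for s
  proof -
    have "s * flat 2 s = flat 1 s" by (simp add: flat_def power2_eq_square)
    have "(e has_real_derivative e s * (-1 + (1 * flat 0 s + (- real 0 * flat (0+1) s - flat (0+2) s) * s))) (at s)"
      unfolding e_def by (rule derivative_eq_intros flat_deriv refl | simp)+
    thus ?thesis using \<open>s * flat 2 s = flat 1 s\<close> by (simp add: mult.commute numeral_2_eq_2)
  qed
  have e_le: "\<bar>e s\<bar> \<le> exp 1" for s
  proof (cases "s < 0")
    case True
    have "1 - exp (1/s) \<le> - (1/s)" using exp_ge_add_one_self[of "1/s"] by linarith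
    hence "(-s) * (1 - exp (1/s)) \<le> (-s) * (-(1/s))" by (rule mult_left_mono) (use True in simp)
    thus ?thesis using True by (simp add: e_def flat_def algebra_simps)
  qed (auto simp: e_def flat_def)
  have 1: "(\<phi> m has_real_derivative \<phi> (Suc m) s) (at s)" for m s
  proof -
    have "((\<lambda>s. e s * F m s) has_real_derivative
        e s * D (F m) s + (e s * (-1 + (flat 0 s + (-1) * flat 1 s))) * F m s) (at s)"
      by (rule DERIV_mult'[OF e']) (use D[OF F] in auto)
    moreover have "\<phi> m = (\<lambda>s. e s * F m s)" by (auto simp: \<phi>_def)
    moreover have "\<phi> (Suc m) s = e s * D (F m) s + (e s * (-1 + (flat 0 s + (-1) * flat 1 s))) * F m s"
      by (simp add: \<phi>_def F_def algebra_simps)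
    ultimately show ?thesis by simp
  qed
  have 2: "\<exists>C. \<forall>s. \<bar>\<phi> m s\<bar> \<le> C" for m
  proof -
    obtain C where "\<And>s. \<bar>F m s\<bar> \<le> C" using flat_alg_bounded[OF F] by auto
    thus ?thesis by (intro exI[of _ "exp 1 * C"]) (auto simp: \<phi>_def abs_mult intro!: mult_mono e_le)
  qed
  have 3: "\<phi> m s = (-1)^m * exp (-s)" if "0 \<le> s" for m s
    using that
  proof (induction m arbitrary: s)
    case 0
    thus ?case by (simp add: \<phi>_def F_def e_def flat_def)
  next
    case (Suc m)
    \<comment> \<open>Uniqueness of the derivative within \<open>{0..}\<close> carries the formula
      to the next order, the endpoint 0 included, where the formula is known on one side
      only.\<close>
    have a: "(\<phi> m has_real_derivative \<phi> (Suc m) s) (at s within {0..})"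
      using 1 by (rule has_field_derivative_at_within)
    have "((\<lambda>s. (-1)^m * exp (-s)) has_real_derivative (-1)^Suc m * exp (-s)) (at s within {0..})"
      by (rule derivative_eq_intros refl | simp)+
    hence b: "(\<phi> m has_real_derivative (-1)^Suc m * exp (-s)) (at s within {0..})"
      by (rule has_field_derivative_transform_within[of _ _ _ _ 1]) (use Suc in auto)
    have nb: "at s within {0..} \<noteq> bot"
    proof -
      have "at_right s \<le> at s within {0..}" by (rule at_le) (use Suc in auto)
      thus ?thesis using trivial_limit_at_right_real[of s] by (metis bot.extremum_uniqueI)
    qed
    show ?case using a b nb
      unfolding has_field_derivative_iff by (rule tendsto_unique[rotated])
  qed
  show thesis using 1 2 3 by (rule that)
qed

section \<open>Differentiation under the integral sign\<close>

lemma Rsp_upd: "p \<in> Rsp d \<Longrightarrow> j < d \<Longrightarrow> p(j := s) \<in> Rsp d"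
  by (auto simp: Rsp_def)

lemma continuous_on_fun_upd_coord: "continuous_on UNIV (\<lambda>s::real. (p::nat \<Rightarrow> real)(j := s))"
proof (rule continuous_on_coordinatewise_then_product)
  show "continuous_on UNIV (\<lambda>s. (p(j := s)) i)" for i by (cases "i = j") auto
qed

lemma continuous_on_coord: "continuous_on A (\<lambda>p::nat \<Rightarrow> real. p j)"
  by (rule continuous_on_subset[OF continuous_on_product_coordinates]) simp

text \<open>\<open>Rsp d\<close> is not open in the space of sequences, so neighbourhoods are
  relative. Moving a single coordinate \<open>j < d\<close> stays inside \<open>Rsp d\<close>; this
  is why two-sided difference quotients make sense at every point of \<open>V\<close>.\<close>

lemma openin_coord_segment:
  assumes "openin (top_of_set (Rsp d)) V" "open U" "p \<in> V" "p \<in> U" "j < d"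
  obtains e where "e > 0" "\<And>s. \<bar>s - p j\<bar> < e \<Longrightarrow> p(j := s) \<in> V \<inter> U"
proof -
  obtain W where W: "open W" "V = Rsp d \<inter> W" using assms(1) by (auto simp: openin_open)
  have "open ((\<lambda>s. p(j := s)) -` (W \<inter> U))"
    using continuous_on_fun_upd_coord[of p j] W assms(2) by (auto simp: continuous_on_open_vimage)
  moreover have "p j \<in> (\<lambda>s. p(j := s)) -` (W \<inter> U)" using assms W by simp
  ultimately obtain e where e: "e > 0" "ball (p j) e \<subseteq> (\<lambda>s. p(j := s)) -` (W \<inter> U)"
    using openE by blast
  show thesis
  proof (rule that[OF e(1)])
    fix s assume "\<bar>s - p j\<bar> < e"
    hence "s \<in> ball (p j) e" by (simp add: dist_real_def abs_minus_commute)
    thus "p(j := s) \<in> V \<inter> U" using e(2) W assms Rsp_upd[of p d j s] by auto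
  qed
qed

lemma pd_eqI:
  assumes "((\<lambda>s. f (p(j := s))) has_real_derivative D) (at (p j))"
  shows "pd j f p = D" "(\<lambda>s. f (p(j := p j + s))) differentiable (at 0)"
proof -
  have *: "((\<lambda>s. f (p(j := p j + s))) has_real_derivative D) (at 0)"
    using DERIV_shift[of "\<lambda>s. f (p(j := s))" D 0 "p j"] assms by (simp add: add.commute)
  show "pd j f p = D" unfolding pd_def using * by (rule DERIV_imp_deriv)
  show "(\<lambda>s. f (p(j := p j + s))) differentiable (at 0)"
    using * real_differentiable_def by blast
qed

lemma pd_cong_openin:
  assumes "openin (top_of_set (Rsp d)) V" "p \<in> V" "j < d" "\<And>p. p \<in> V \<Longrightarrow> f p = g p"
  shows "pd j f p = pd j g p"
    "(\<lambda>s. f (p(j := p j + s))) differentiable (at 0) \<longleftrightarrow> (\<lambda>s. g (p(j := p j + s))) differentiable (at 0)"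
proof -
  obtain e where e: "e > 0" "\<And>s. \<bar>s - p j\<bar> < e \<Longrightarrow> p(j := s) \<in> V \<inter> UNIV"
    using openin_coord_segment[OF assms(1) open_UNIV assms(2) _ assms(3)] by auto
  have ev: "\<forall>\<^sub>F s in nhds 0. f (p(j := p j + s)) = g (p(j := p j + s))"
  proof -
    have "\<forall>\<^sub>F s in nhds 0. s \<in> {-e<..<e}" by (rule eventually_nhds_in_open) (use e in auto)
    thus ?thesis by eventually_elim (use e(2) assms(4) in auto)
  qed
  show "pd j f p = pd j g p" unfolding pd_def by (rule deriv_cong_ev[OF ev refl])
  show "(\<lambda>s. f (p(j := p j + s))) differentiable (at 0) \<longleftrightarrow> (\<lambda>s. g (p(j := p j + s))) differentiable (at 0)"
    unfolding real_differentiable_def using DERIV_cong_ev[OF refl ev refl] by blast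
qed

lemma pds_cong_openin:
  assumes V: "openin (top_of_set (Rsp d)) V" and "set ks \<subseteq> {..<d}" "\<And>p. p \<in> V \<Longrightarrow> f p = g p" "p \<in> V"
  shows "pds ks f p = pds ks g p"
  using assms(2,4)
proof (induction ks arbitrary: p)
  case Nil thus ?case by (simp add: pds_def assms(3))
next
  case (Cons k ks)
  have "pd k (pds ks f) p = pd k (pds ks g) p"
    by (rule pd_cong_openin[OF V]) (use Cons in auto)
  thus ?case by (simp add: pds_def)
qed

lemma pds_snoc: "pds (ks @ [k]) f = pds ks (pd k f)"
  by (simp add: pds_def)

lemma Ck_on_cong:
  assumes V: "openin (top_of_set (Rsp d)) V" and eq: "\<And>p. p \<in> V \<Longrightarrow> f p = g p" and C: "Ck_on k d V g"
  shows "Ck_on k d V f"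
  unfolding Ck_on_def
proof (intro conjI allI impI ballI)
  fix ks assume ks: "set ks \<subseteq> {..<d} \<and> length ks \<le> k"
  show "continuous_on V (pds ks f)"
  proof (rule continuous_on_eq[of _ "pds ks g"])
    show "continuous_on V (pds ks g)" using C ks by (auto simp: Ck_on_def)
    show "pds ks g p = pds ks f p" if "p \<in> V" for p
      using pds_cong_openin[OF V _ eq that, of ks] ks by simp
  qed
next
  fix ks j p assume ks: "set ks \<subseteq> {..<d} \<and> length ks < k" and j: "j < d" and p: "p \<in> V"
  have "(\<lambda>s. pds ks g (p(j := p j + s))) differentiable (at 0)" using C ks j p by (auto simp: Ck_on_def)
  thus "(\<lambda>s. pds ks f (p(j := p j + s))) differentiable (at 0)"
    using pd_cong_openin(2)[OF V p j, of "pds ks f" "pds ks g"] pds_cong_openin[OF V _ eq, of ks] ks by auto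
qed

lemma Ck_on_0: "Ck_on 0 d V f \<longleftrightarrow> continuous_on V f"
  by (auto simp: Ck_on_def pds_def)

text \<open>\<open>pds\<close> applies the last index of its list first. A list is therefore peeled
  at its end, and the remaining indices act on \<open>pd j f\<close>; the order can be raised by
  computing first derivatives only.\<close>

lemma Ck_on_SucI:
  assumes "continuous_on V f"
    and "\<And>j p. j < d \<Longrightarrow> p \<in> V \<Longrightarrow> (\<lambda>s. f (p(j := p j + s))) differentiable (at 0)"
    and "\<And>j. j < d \<Longrightarrow> Ck_on k d V (pd j f)"
  shows "Ck_on (Suc k) d V f"
  unfolding Ck_on_def
proof (intro conjI allI impI ballI)
  fix ks assume ks: "set ks \<subseteq> {..<d} \<and> length ks \<le> Suc k"
  show "continuous_on V (pds ks f)"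
  proof (cases ks rule: rev_cases)
    case Nil thus ?thesis using assms(1) by (simp add: pds_def)
  next
    case (snoc ys y)
    thus ?thesis using assms(3)[of y] ks by (auto simp: pds_snoc Ck_on_def)
  qed
next
  fix ks j p assume ks: "set ks \<subseteq> {..<d} \<and> length ks < Suc k" and j: "j < d" and p: "p \<in> V"
  show "(\<lambda>s. pds ks f (p(j := p j + s))) differentiable (at 0)"
  proof (cases ks rule: rev_cases)
    case Nil thus ?thesis using assms(2)[OF j p] by (simp add: pds_def)
  next
    case (snoc ys y)
    thus ?thesis using assms(3)[of y] ks j p by (auto simp: pds_snoc Ck_on_def)
  qed
qed

text \<open>\<open>Q\<close> is a weight on the parameter space all of whose powers are integrable.
  Polynomial bounds in \<open>Q\<close> survive sums and products, and each of them is an integrable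
  majorant, so one class of integrands serves both the heat and the wave solutions.\<close>

locale param_family =
  fixes M :: "'w measure" and Q :: "'w \<Rightarrow> real" and d :: nat and V :: "(nat \<Rightarrow> real) set"
  assumes Q_meas [measurable]: "Q \<in> borel_measurable M"
    and Q_ge_1: "\<And>w. w \<in> space M \<Longrightarrow> 1 \<le> Q w"
    and Q_int: "\<And>m. integrable M (\<lambda>w. Q w ^ m)"
    and V_open: "openin (top_of_set (Rsp d)) V"
begin

definition fam0 :: "('w \<Rightarrow> (nat \<Rightarrow> real) \<Rightarrow> real) \<Rightarrow> bool" where
  "fam0 \<Phi> \<longleftrightarrow> (\<forall>p\<in>V. (\<lambda>w. \<Phi> w p) \<in> borel_measurable M) \<and>
     (\<forall>w\<in>space M. continuous_on V (\<Phi> w)) \<and>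
     (\<forall>p\<in>V. \<exists>U C m. open U \<and> p \<in> U \<and> (\<forall>w\<in>space M. \<forall>p'\<in>V \<inter> U. \<bar>\<Phi> w p'\<bar> \<le> C * Q w ^ m))"

text \<open>A derivative in each coordinate is only required to exist within the class of one order
  less. Iterated derivatives need no formula this way, and closure properties follow by induction on
  \<open>k\<close>.\<close>

primrec fam :: "nat \<Rightarrow> ('w \<Rightarrow> (nat \<Rightarrow> real) \<Rightarrow> real) \<Rightarrow> bool" where
  "fam 0 \<Phi> = fam0 \<Phi>"
| "fam (Suc k) \<Phi> = (fam0 \<Phi> \<and> (\<forall>j<d. \<exists>\<Psi>. fam k \<Psi> \<and> (\<forall>w\<in>space M. \<forall>p\<in>V.
      ((\<lambda>s. \<Phi> w (p(j := s))) has_real_derivative \<Psi> w p) (at (p j)))))"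

lemma fam_fam0: "fam k \<Phi> \<Longrightarrow> fam0 \<Phi>" by (cases k) auto

lemma fam_SucD:
  assumes "fam (Suc k) \<Phi>" "j < d"
  shows "\<exists>\<Psi>. fam k \<Psi> \<and> (\<forall>w\<in>space M. \<forall>p\<in>V.
      ((\<lambda>s. \<Phi> w (p(j := s))) has_real_derivative \<Psi> w p) (at (p j)))"
  using assms by simp

lemma fam_Suc: "fam (Suc k) \<Phi> \<Longrightarrow> fam k \<Phi>"
proof (induction k arbitrary: \<Phi>)
  case (Suc k)
  show ?case unfolding fam.simps(2)[of k]
  proof (intro conjI allI impI)
    show "fam0 \<Phi>" using Suc.prems by simp
    fix j assume "j < d"
    then obtain \<Psi> where "fam (Suc k) \<Psi>" "\<forall>w\<in>space M. \<forall>p\<in>V. ((\<lambda>s. \<Phi> w (p(j := s))) has_real_derivative \<Psi> w p) (at (p j))"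
      using Suc.prems unfolding fam.simps(2)[of "Suc k"] by blast
    thus "\<exists>\<Psi>. fam k \<Psi> \<and> (\<forall>w\<in>space M. \<forall>p\<in>V. ((\<lambda>s. \<Phi> w (p(j := s))) has_real_derivative \<Psi> w p) (at (p j)))"
      using Suc.IH by blast
  qed
qed simp

lemma fam0_add: assumes "fam0 \<Phi>" "fam0 \<Psi>" shows "fam0 (\<lambda>w p. \<Phi> w p + \<Psi> w p)"
  unfolding fam0_def
proof (intro conjI ballI)
  fix p assume p: "p \<in> V"
  show "(\<lambda>w. \<Phi> w p + \<Psi> w p) \<in> borel_measurable M" using assms p unfolding fam0_def
    by (intro borel_measurable_add borel_measurable_times) auto
  obtain U C m where 1: "open U" "p \<in> U" "\<And>w p'. w\<in>space M \<Longrightarrow> p'\<in>V \<inter> U \<Longrightarrow> \<bar>\<Phi> w p'\<bar> \<le> C * Q w ^ m"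
    using assms(1) p unfolding fam0_def by meson
  obtain U' C' m' where 2: "open U'" "p \<in> U'" "\<And>w p'. w\<in>space M \<Longrightarrow> p'\<in>V \<inter> U' \<Longrightarrow> \<bar>\<Psi> w p'\<bar> \<le> C' * Q w ^ m'"
    using assms(2) p unfolding fam0_def by meson
  show "\<exists>U C m. open U \<and> p \<in> U \<and> (\<forall>w\<in>space M. \<forall>p'\<in>V \<inter> U. \<bar>\<Phi> w p' + \<Psi> w p'\<bar> \<le> C * Q w ^ m)"
  proof (intro exI conjI ballI)
    show "open (U \<inter> U')" "p \<in> U \<inter> U'" using 1 2 by auto
    fix w p' assume w: "w \<in> space M" and p': "p' \<in> V \<inter> (U \<inter> U')"
    have "\<bar>\<Phi> w p'\<bar> \<le> \<bar>C\<bar> * Q w ^ (m+m')"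
    proof -
      have "\<bar>\<Phi> w p'\<bar> \<le> C * Q w ^ m" using 1 w p' by auto
      also have "\<dots> \<le> \<bar>C\<bar> * Q w ^ (m+m')" using Q_ge_1[OF w] by (intro mult_mono power_increasing) auto
      finally show ?thesis .
    qed
    moreover have "\<bar>\<Psi> w p'\<bar> \<le> \<bar>C'\<bar> * Q w ^ (m+m')"
    proof -
      have "\<bar>\<Psi> w p'\<bar> \<le> C' * Q w ^ m'" using 2 w p' by auto
      also have "\<dots> \<le> \<bar>C'\<bar> * Q w ^ (m+m')" using Q_ge_1[OF w] by (intro mult_mono power_increasing) auto
      finally show ?thesis .
    qed
    ultimately show "\<bar>\<Phi> w p' + \<Psi> w p'\<bar> \<le> (\<bar>C\<bar>+\<bar>C'\<bar>) * Q w ^ (m+m')"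
      by (simp add: distrib_right)
  qed
next
  show "continuous_on V (\<lambda>p. \<Phi> w p + \<Psi> w p)" if "w \<in> space M" for w
    using assms that by (auto simp: fam0_def intro!: continuous_intros)
qed

lemma fam0_mult: assumes "fam0 \<Phi>" "fam0 \<Psi>" shows "fam0 (\<lambda>w p. \<Phi> w p * \<Psi> w p)"
  unfolding fam0_def
proof (intro conjI ballI)
  fix p assume p: "p \<in> V"
  show "(\<lambda>w. \<Phi> w p * \<Psi> w p) \<in> borel_measurable M" using assms p unfolding fam0_def
    by (intro borel_measurable_add borel_measurable_times) auto
  obtain U C m where 1: "open U" "p \<in> U" "\<And>w p'. w\<in>space M \<Longrightarrow> p'\<in>V \<inter> U \<Longrightarrow> \<bar>\<Phi> w p'\<bar> \<le> C * Q w ^ m"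
    using assms(1) p unfolding fam0_def by meson
  obtain U' C' m' where 2: "open U'" "p \<in> U'" "\<And>w p'. w\<in>space M \<Longrightarrow> p'\<in>V \<inter> U' \<Longrightarrow> \<bar>\<Psi> w p'\<bar> \<le> C' * Q w ^ m'"
    using assms(2) p unfolding fam0_def by meson
  show "\<exists>U C m. open U \<and> p \<in> U \<and> (\<forall>w\<in>space M. \<forall>p'\<in>V \<inter> U. \<bar>\<Phi> w p' * \<Psi> w p'\<bar> \<le> C * Q w ^ m)"
  proof (intro exI conjI ballI)
    show "open (U \<inter> U')" "p \<in> U \<inter> U'" using 1 2 by auto
    fix w p' assume w: "w \<in> space M" and p': "p' \<in> V \<inter> (U \<inter> U')"
    have a: "\<bar>\<Phi> w p'\<bar> \<le> C * Q w ^ m" and b: "\<bar>\<Psi> w p'\<bar> \<le> C' * Q w ^ m'" using 1 2 w p' by auto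
    have "\<bar>\<Phi> w p'\<bar> * \<bar>\<Psi> w p'\<bar> \<le> (C * Q w ^ m) * (C' * Q w ^ m')"
      by (rule mult_mono[OF a b]) (use a in \<open>auto intro: order_trans[OF abs_ge_zero]\<close>)
    thus "\<bar>\<Phi> w p' * \<Psi> w p'\<bar> \<le> (C * C') * Q w ^ (m+m')"
      by (simp add: abs_mult power_add mult_ac)
  qed
next
  show "continuous_on V (\<lambda>p. \<Phi> w p * \<Psi> w p)" if "w \<in> space M" for w
    using assms that by (auto simp: fam0_def intro!: continuous_intros)
qed

lemma fam_add: "fam k \<Phi> \<Longrightarrow> fam k \<Psi> \<Longrightarrow> fam k (\<lambda>w p. \<Phi> w p + \<Psi> w p)"
proof (induction k arbitrary: \<Phi> \<Psi>)
  case 0 thus ?case by (simp add: fam0_add)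
next
  case (Suc k)
  show ?case unfolding fam.simps
  proof (intro conjI allI impI)
    show "fam0 (\<lambda>w p. \<Phi> w p + \<Psi> w p)" using Suc.prems by (simp add: fam0_add)
    fix j assume j: "j < d"
    obtain A where A: "fam k A" "\<forall>w\<in>space M. \<forall>p\<in>V. ((\<lambda>s. \<Phi> w (p(j := s))) has_real_derivative A w p) (at (p j))"
      using fam_SucD[OF Suc.prems(1) j] by metis
    obtain B where B: "fam k B" "\<forall>w\<in>space M. \<forall>p\<in>V. ((\<lambda>s. \<Psi> w (p(j := s))) has_real_derivative B w p) (at (p j))"
      using fam_SucD[OF Suc.prems(2) j] by metis
    show "\<exists>X. fam k X \<and> (\<forall>w\<in>space M. \<forall>p\<in>V.
        ((\<lambda>s. \<Phi> w (p(j := s)) + \<Psi> w (p(j := s))) has_real_derivative X w p) (at (p j)))"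
      by (intro exI[of _ "\<lambda>w p. A w p + B w p"] conjI ballI Suc.IH A(1) B(1) DERIV_add) (use A B in auto)
  qed
qed

lemma fam_mult: "fam k \<Phi> \<Longrightarrow> fam k \<Psi> \<Longrightarrow> fam k (\<lambda>w p. \<Phi> w p * \<Psi> w p)"
proof (induction k arbitrary: \<Phi> \<Psi>)
  case 0 thus ?case by (simp add: fam0_mult)
next
  case (Suc k)
  show ?case unfolding fam.simps
  proof (intro conjI allI impI)
    show "fam0 (\<lambda>w p. \<Phi> w p * \<Psi> w p)" using Suc.prems by (simp add: fam0_mult)
    fix j assume j: "j < d"
    obtain A where A: "fam k A" "\<forall>w\<in>space M. \<forall>p\<in>V. ((\<lambda>s. \<Phi> w (p(j := s))) has_real_derivative A w p) (at (p j))"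
      using fam_SucD[OF Suc.prems(1) j] by metis
    obtain B where B: "fam k B" "\<forall>w\<in>space M. \<forall>p\<in>V. ((\<lambda>s. \<Psi> w (p(j := s))) has_real_derivative B w p) (at (p j))"
      using fam_SucD[OF Suc.prems(2) j] by metis
    show "\<exists>X. fam k X \<and> (\<forall>w\<in>space M. \<forall>p\<in>V.
        ((\<lambda>s. \<Phi> w (p(j := s)) * \<Psi> w (p(j := s))) has_real_derivative X w p) (at (p j)))"
    proof (rule exI[of _ "\<lambda>w p. \<Phi> w p * B w p + A w p * \<Psi> w p"], intro conjI ballI)
      show "fam k (\<lambda>w p. \<Phi> w p * B w p + A w p * \<Psi> w p)"
        by (rule fam_add[OF Suc.IH[OF fam_Suc[OF Suc.prems(1)] B(1)] Suc.IH[OF A(1) fam_Suc[OF Suc.prems(2)]]])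
      fix w p assume w: "w \<in> space M" "p \<in> V"
      have "((\<lambda>s. \<Phi> w (p(j := s)) * \<Psi> w (p(j := s))) has_real_derivative
          \<Phi> w (p(j := p j)) * B w p + A w p * \<Psi> w (p(j := p j))) (at (p j))"
        by (rule DERIV_mult') (use A B w in auto)
      thus "((\<lambda>s. \<Phi> w (p(j := s)) * \<Psi> w (p(j := s))) has_real_derivative
          \<Phi> w p * B w p + A w p * \<Psi> w p) (at (p j))" by simp
    qed
  qed
qed

lemma fam_coeff:
  assumes "c \<in> borel_measurable M" "\<And>w. w \<in> space M \<Longrightarrow> \<bar>c w\<bar> \<le> C * Q w ^ m"
  shows "fam k (\<lambda>w p. c w)"
proof -
  have 0: "fam0 (\<lambda>w p. c w)" if "c \<in> borel_measurable M" "\<And>w. w \<in> space M \<Longrightarrow> \<bar>c w\<bar> \<le> C * Q w ^ m" for c C m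
    unfolding fam0_def using that by (auto intro!: exI[of _ UNIV])
  have z: "fam k (\<lambda>w p. 0)" for k
    by (induction k) (auto intro!: 0[of "\<lambda>_. 0" 0 0] exI[of _ "\<lambda>w p. 0"])
  show ?thesis
  proof (cases k)
    case (Suc k')
    show ?thesis unfolding Suc fam.simps
      using 0[OF assms] z[of k'] by (auto intro!: exI[of _ "\<lambda>w p. 0"])
  qed (use 0[OF assms] in simp)
qed

lemma fam_const: "fam k (\<lambda>w p. c)"
  by (rule fam_coeff[of _ "\<bar>c\<bar>" 0]) auto

lemma fam_sum: "finite I \<Longrightarrow> (\<And>i. i \<in> I \<Longrightarrow> fam k (\<Phi> i)) \<Longrightarrow> fam k (\<lambda>w p. \<Sum>i\<in>I. \<Phi> i w p)"
  by (induction I rule: finite_induct) (auto intro: fam_add fam_const)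

lemma fam0_indep:
  assumes "continuous_on V f" shows "fam0 (\<lambda>w. f)"
  unfolding fam0_def
proof (intro conjI ballI)
  fix p assume p: "p \<in> V"
  have "openin (top_of_set V) (V \<inter> f -` ball (f p) 1)"
    using assms by (rule continuous_openin_preimage_gen) simp
  then obtain U where U: "open U" "V \<inter> f -` ball (f p) 1 = V \<inter> U" by (auto simp: openin_open)
  show "\<exists>U C m. open U \<and> p \<in> U \<and> (\<forall>w\<in>space M. \<forall>p'\<in>V \<inter> U. \<bar>f p'\<bar> \<le> C * Q w ^ m)"
  proof (intro exI conjI ballI)
    show "open U" by fact
    show "p \<in> U" using U p by auto
    fix w p' assume "p' \<in> V \<inter> U"
    hence "f p' \<in> ball (f p) 1" using U by auto
    thus "\<bar>f p'\<bar> \<le> (\<bar>f p\<bar> + 1) * Q w ^ 0" by (auto simp: dist_real_def)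
  qed
qed (use assms in auto)

lemma fam_coord: "fam k (\<lambda>w p. p i)"
proof (cases k)
  case (Suc k')
  show ?thesis unfolding Suc fam.simps
  proof (intro conjI allI impI)
    show "fam0 (\<lambda>w p. p i)" by (intro fam0_indep continuous_on_coord)
    fix j assume "j < d"
    show "\<exists>\<Psi>. fam k' \<Psi> \<and> (\<forall>w\<in>space M. \<forall>p\<in>V. ((\<lambda>s. (p(j := s)) i) has_real_derivative \<Psi> w p) (at (p j)))"
      by (intro exI[of _ "\<lambda>w p. if i = j then 1 else 0"]) (auto intro!: fam_const)
  qed
qed (auto intro!: fam0_indep continuous_on_coord)

text \<open>\<open>e l\<close> is a ladder of derivatives in one real variable, possibly depending
  on \<open>w\<close>. Bounding every rung along \<open>\<theta>\<close> suffices: the chain rule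
  produces the next rung times a derivative of \<open>\<theta>\<close>, again a product within the
  class.\<close>

lemma fam_compose:
  assumes \<theta>: "\<And>k. fam k \<theta>"
    and e0: "\<And>l. fam0 (\<lambda>w p. e l w (\<theta> w p))"
    and e': "\<And>l w p. w \<in> space M \<Longrightarrow> p \<in> V \<Longrightarrow> (e l w has_real_derivative e (Suc l) w (\<theta> w p)) (at (\<theta> w p))"
  shows "fam k (\<lambda>w p. e l w (\<theta> w p))"
proof (induction k arbitrary: l)
  case 0 thus ?case by (simp add: e0)
next
  case (Suc k)
  show ?case unfolding fam.simps
  proof (intro conjI allI impI e0)
    fix j assume j: "j < d"
    obtain A where A: "fam k A" "\<forall>w\<in>space M. \<forall>p\<in>V. ((\<lambda>s. \<theta> w (p(j := s))) has_real_derivative A w p) (at (p j))"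
      using fam_SucD[OF \<theta> j] by metis
    show "\<exists>X. fam k X \<and> (\<forall>w\<in>space M. \<forall>p\<in>V.
        ((\<lambda>s. e l w (\<theta> w (p(j := s)))) has_real_derivative X w p) (at (p j)))"
    proof (rule exI[of _ "\<lambda>w p. e (Suc l) w (\<theta> w p) * A w p"], intro conjI ballI)
      show "fam k (\<lambda>w p. e (Suc l) w (\<theta> w p) * A w p)" by (intro fam_mult Suc.IH A(1))
      fix w p assume w: "w \<in> space M" "p \<in> V"
      show "((\<lambda>s. e l w (\<theta> w (p(j := s)))) has_real_derivative e (Suc l) w (\<theta> w p) * A w p) (at (p j))"
        by (rule DERIV_chain2[of "e l w"]) (use e' A w in auto)
    qed
  qed
qed

lemma fam0_integrable: assumes "fam0 \<Phi>" "p \<in> V" shows "integrable M (\<lambda>w. \<Phi> w p)"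
proof -
  obtain U C m where U: "p \<in> U" "\<And>w p'. w\<in>space M \<Longrightarrow> p'\<in>V \<inter> U \<Longrightarrow> \<bar>\<Phi> w p'\<bar> \<le> C * Q w ^ m"
    using assms unfolding fam0_def by meson
  show ?thesis
  proof (rule Bochner_Integration.integrable_bound)
    show "integrable M (\<lambda>w. C * Q w ^ m)" using Q_int by simp
    show "AE w in M. norm (\<Phi> w p) \<le> norm (C * Q w ^ m)"
      using U assms(2) by (intro AE_I2) (auto intro: order_trans[OF _ abs_ge_self])
  qed (use assms in \<open>auto simp: fam0_def\<close>)
qed

text \<open>Sequential continuity is enough in this topology, and dominated convergence handles
  sequences. The majorant is only local, hence the passage to the tail of the sequence beyond
  \<open>n0\<close>.\<close>

lemma fam0_continuous_integral: assumes "fam0 \<Phi>" shows "continuous_on V (\<lambda>p. \<integral>w. \<Phi> w p \<partial>M)"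
  unfolding continuous_on_sequentially
proof (intro allI ballI impI, elim conjE)
  fix X p assume p: "p \<in> V" and XV: "\<forall>n. X n \<in> V" and lim: "X \<longlonglongrightarrow> p"
  obtain U C m where U: "open U" "p \<in> U" "\<And>w p'. w\<in>space M \<Longrightarrow> p'\<in>V \<inter> U \<Longrightarrow> \<bar>\<Phi> w p'\<bar> \<le> C * Q w ^ m"
    using assms p unfolding fam0_def by meson
  have "\<forall>\<^sub>F n in sequentially. X n \<in> U" using lim U by (simp add: topological_tendstoD)
  then obtain n0 where n0: "\<And>n. n \<ge> n0 \<Longrightarrow> X n \<in> U" by (auto simp: eventually_sequentially)
  have "(\<lambda>n. \<integral>w. \<Phi> w (X (n + n0)) \<partial>M) \<longlonglongrightarrow> (\<integral>w. \<Phi> w p \<partial>M)"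
  proof (rule integral_dominated_convergence)
    show "integrable M (\<lambda>w. C * Q w ^ m)" using Q_int by simp
    show "AE w in M. (\<lambda>n. \<Phi> w (X (n + n0))) \<longlonglongrightarrow> \<Phi> w p"
    proof (intro AE_I2)
      fix w assume "w \<in> space M"
      hence "continuous_on V (\<Phi> w)" using assms by (auto simp: fam0_def)
      hence "(\<lambda>n. \<Phi> w (X n)) \<longlonglongrightarrow> \<Phi> w p"
        using XV lim p unfolding continuous_on_sequentially comp_def by blast
      thus "(\<lambda>n. \<Phi> w (X (n + n0))) \<longlonglongrightarrow> \<Phi> w p" by (rule LIMSEQ_ignore_initial_segment)
    qed
    show "AE w in M. norm (\<Phi> w (X (n + n0))) \<le> C * Q w ^ m" for n
      using U(3) XV n0 by (intro AE_I2) auto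
  qed (use assms XV p in \<open>auto simp: fam0_def\<close>)
  hence "(\<lambda>n. \<integral>w. \<Phi> w (X n) \<partial>M) \<longlonglongrightarrow> (\<integral>w. \<Phi> w p \<partial>M)" by (rule LIMSEQ_offset)
  thus "((\<lambda>p. \<integral>w. \<Phi> w p \<partial>M) \<circ> X) \<longlonglongrightarrow> (\<integral>w. \<Phi> w p \<partial>M)" by (simp add: comp_def)
qed

text \<open>By the mean value inequality on a coordinate segment inside \<open>V \<inter> U\<close>,
  the difference quotients of \<open>\<Phi> w\<close> are bounded by the local majorant of
  \<open>\<Psi>\<close>; dominated convergence then applies along every sequence tending to
  \<open>p j\<close>.\<close>

lemma fam0_deriv_integral:
  assumes \<Phi>: "fam0 \<Phi>" and \<Psi>: "fam0 \<Psi>" and j: "j < d" and p: "p \<in> V"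
    and der: "\<And>w p. w \<in> space M \<Longrightarrow> p \<in> V \<Longrightarrow> ((\<lambda>s. \<Phi> w (p(j := s))) has_real_derivative \<Psi> w p) (at (p j))"
  shows "((\<lambda>s. \<integral>w. \<Phi> w (p(j := s)) \<partial>M) has_real_derivative (\<integral>w. \<Psi> w p \<partial>M)) (at (p j))"
proof -
  obtain U C m where U: "open U" "p \<in> U" "\<And>w p'. w\<in>space M \<Longrightarrow> p'\<in>V \<inter> U \<Longrightarrow> \<bar>\<Psi> w p'\<bar> \<le> C * Q w ^ m"
    using \<Psi> p unfolding fam0_def by meson
  obtain e where e: "e > 0" "\<And>s. \<bar>s - p j\<bar> < e \<Longrightarrow> p(j := s) \<in> V \<inter> U"
    using openin_coord_segment[OF V_open U(1) p U(2) j] by metis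
  have der': "((\<lambda>s. \<Phi> w (p(j := s))) has_real_derivative \<Psi> w (p(j := s))) (at s)"
    if "w \<in> space M" "\<bar>s - p j\<bar> < e" for w s
    using der[OF that(1), of "p(j := s)"] e(2)[OF that(2)] by simp
  have lip: "\<bar>(\<Phi> w (p(j := s)) - \<Phi> w p) / (s - p j)\<bar> \<le> C * Q w ^ m"
    if w: "w \<in> space M" and s: "\<bar>s - p j\<bar> < e" "s \<noteq> p j" for w s
  proof -
    have "norm (\<Phi> w (p(j := s)) - \<Phi> w (p(j := p j))) \<le> C * Q w ^ m * norm (s - p j)"
    proof (rule field_differentiable_bound[where S="ball (p j) e" and f' = "\<lambda>s. \<Psi> w (p(j := s))"])
      show "\<And>z. z \<in> ball (p j) e \<Longrightarrow> ((\<lambda>s. \<Phi> w (p(j := s))) has_real_derivative \<Psi> w (p(j := z))) (at z within ball (p j) e)"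
        using der'[OF w] by (auto simp: dist_real_def abs_minus_commute intro: has_field_derivative_at_within)
      show "\<And>z. z \<in> ball (p j) e \<Longrightarrow> norm (\<Psi> w (p(j := z))) \<le> C * Q w ^ m"
        using U(3)[OF w] e(2) by (auto simp: dist_real_def abs_minus_commute)
    qed (use s e in \<open>auto simp: dist_real_def abs_minus_commute\<close>)
    thus ?thesis using s by (simp add: divide_simps)
  qed
  have "((\<lambda>s. ((\<integral>w. \<Phi> w (p(j := s)) \<partial>M) - (\<integral>w. \<Phi> w p \<partial>M)) / (s - p j)) \<longlongrightarrow> (\<integral>w. \<Psi> w p \<partial>M)) (at (p j))"
    unfolding tendsto_at_iff_sequentially
  proof (intro allI impI)
    fix X assume X: "\<forall>i. X i \<in> UNIV - {p j}" and lim: "X \<longlonglongrightarrow> p j"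
    have "\<forall>\<^sub>F i in sequentially. dist (X i) (p j) < e" using lim e(1) by (simp add: tendstoD)
    then obtain n0 where n0: "\<And>n. n \<ge> n0 \<Longrightarrow> \<bar>X n - p j\<bar> < e" by (auto simp: eventually_sequentially dist_real_def)
    have inV: "p(j := X (n+n0)) \<in> V" for n using e(2)[OF n0] by auto
    have "(\<lambda>i. \<integral>w. (\<Phi> w (p(j := X (i+n0))) - \<Phi> w p) / (X (i+n0) - p j) \<partial>M) \<longlonglongrightarrow> (\<integral>w. \<Psi> w p \<partial>M)"
    proof (rule integral_dominated_convergence)
      show "integrable M (\<lambda>w. C * Q w ^ m)" using Q_int by simp
      show "(\<lambda>w. (\<Phi> w (p(j := X (i+n0))) - \<Phi> w p) / (X (i+n0) - p j)) \<in> borel_measurable M" for i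
        using \<Phi> inV p by (auto simp: fam0_def intro!: borel_measurable_divide borel_measurable_diff)
      show "AE w in M. (\<lambda>i. (\<Phi> w (p(j := X (i+n0))) - \<Phi> w p) / (X (i+n0) - p j)) \<longlonglongrightarrow> \<Psi> w p"
      proof (intro AE_I2)
        fix w assume w: "w \<in> space M"
        have "((\<lambda>s. (\<Phi> w (p(j := s)) - \<Phi> w (p(j := p j))) / (s - p j)) \<longlongrightarrow> \<Psi> w p) (at (p j))"
          using der[OF w p] by (simp only: has_field_derivative_iff)
        hence "(\<lambda>i. (\<Phi> w (p(j := X i)) - \<Phi> w p) / (X i - p j)) \<longlonglongrightarrow> \<Psi> w p"
          using X lim unfolding tendsto_at_iff_sequentially comp_def by auto
        thus "(\<lambda>i. (\<Phi> w (p(j := X (i+n0))) - \<Phi> w p) / (X (i+n0) - p j)) \<longlonglongrightarrow> \<Psi> w p"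
          by (rule LIMSEQ_ignore_initial_segment[where f="\<lambda>i. (\<Phi> w (p(j := X i)) - \<Phi> w p) / (X i - p j)"])
      qed
      show "AE w in M. norm ((\<Phi> w (p(j := X (i+n0))) - \<Phi> w p) / (X (i+n0) - p j)) \<le> C * Q w ^ m" for i
        using lip[OF _ n0[of "i+n0"]] X by (intro AE_I2) auto
    qed (use \<Psi> p in \<open>auto simp: fam0_def\<close>)
    moreover have "(\<lambda>i. \<integral>w. (\<Phi> w (p(j := X (i+n0))) - \<Phi> w p) / (X (i+n0) - p j) \<partial>M) =
       (\<lambda>i. ((\<integral>w. \<Phi> w (p(j := X (i+n0))) \<partial>M) - (\<integral>w. \<Phi> w p \<partial>M)) / (X (i+n0) - p j))"
      using fam0_integrable[OF \<Phi>] inV p by (intro ext) simp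
    ultimately have "(\<lambda>i. ((\<integral>w. \<Phi> w (p(j := X (i+n0))) \<partial>M) - (\<integral>w. \<Phi> w p \<partial>M)) / (X (i+n0) - p j)) \<longlonglongrightarrow> (\<integral>w. \<Psi> w p \<partial>M)"
      by (simp only:)
    hence "(\<lambda>i. ((\<integral>w. \<Phi> w (p(j := X i)) \<partial>M) - (\<integral>w. \<Phi> w p \<partial>M)) / (X i - p j)) \<longlonglongrightarrow> (\<integral>w. \<Psi> w p \<partial>M)"
      by (rule LIMSEQ_offset)
    thus "((\<lambda>s. ((\<integral>w. \<Phi> w (p(j := s)) \<partial>M) - (\<integral>w. \<Phi> w p \<partial>M)) / (s - p j)) \<circ> X) \<longlonglongrightarrow> (\<integral>w. \<Psi> w p \<partial>M)"
      by (simp add: comp_def)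
  qed
  thus ?thesis by (simp add: has_field_derivative_iff)
qed

lemma pd_integral:
  assumes "fam0 \<Phi>" "fam0 \<Psi>" "j < d" "p \<in> V"
    and "\<And>w p. w \<in> space M \<Longrightarrow> p \<in> V \<Longrightarrow> ((\<lambda>s. \<Phi> w (p(j := s))) has_real_derivative \<Psi> w p) (at (p j))"
  shows "pd j (\<lambda>p. \<integral>w. \<Phi> w p \<partial>M) p = (\<integral>w. \<Psi> w p \<partial>M)"
  by (rule pd_eqI) (rule fam0_deriv_integral[OF assms])

lemma pd_pd_integral:
  assumes "fam0 \<Phi>" "fam0 \<Psi>" "fam0 X" "j < d" "p \<in> V"
    and "\<And>w p. w \<in> space M \<Longrightarrow> p \<in> V \<Longrightarrow> ((\<lambda>s. \<Phi> w (p(j := s))) has_real_derivative \<Psi> w p) (at (p j))"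
    and "\<And>w p. w \<in> space M \<Longrightarrow> p \<in> V \<Longrightarrow> ((\<lambda>s. \<Psi> w (p(j := s))) has_real_derivative X w p) (at (p j))"
  shows "pd j (pd j (\<lambda>p. \<integral>w. \<Phi> w p \<partial>M)) p = (\<integral>w. X w p \<partial>M)"
proof -
  have "pd j (pd j (\<lambda>p. \<integral>w. \<Phi> w p \<partial>M)) p = pd j (\<lambda>p. \<integral>w. \<Psi> w p \<partial>M) p"
    by (rule pd_cong_openin[OF V_open assms(5,4)]) (rule pd_integral[OF assms(1,2,4) _ assms(6)])
  also have "\<dots> = (\<integral>w. X w p \<partial>M)" by (rule pd_integral[OF assms(2,3,4,5,7)])
  finally show ?thesis .
qed

lemma Ck_on_integral: "fam k \<Phi> \<Longrightarrow> Ck_on k d V (\<lambda>p. \<integral>w. \<Phi> w p \<partial>M)"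
proof (induction k arbitrary: \<Phi>)
  case 0 thus ?case by (simp add: Ck_on_0 fam0_continuous_integral)
next
  case (Suc k)
  show ?case
  proof (rule Ck_on_SucI)
    show "continuous_on V (\<lambda>p. \<integral>w. \<Phi> w p \<partial>M)" using Suc.prems by (simp add: fam0_continuous_integral)
    fix j assume j: "j < d"
    obtain \<Psi> where \<Psi>: "fam k \<Psi>" "\<And>w p. w \<in> space M \<Longrightarrow> p \<in> V \<Longrightarrow> ((\<lambda>s. \<Phi> w (p(j := s))) has_real_derivative \<Psi> w p) (at (p j))"
      using fam_SucD[OF Suc.prems j] by metis
    have der: "((\<lambda>s. \<integral>w. \<Phi> w (p(j := s)) \<partial>M) has_real_derivative (\<integral>w. \<Psi> w p \<partial>M)) (at (p j))" if "p \<in> V" for p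
      by (rule fam0_deriv_integral[OF fam_fam0[OF Suc.prems] fam_fam0[OF \<Psi>(1)] j that \<Psi>(2)])
    show "(\<lambda>s. \<integral>w. \<Phi> w (p(j := p j + s)) \<partial>M) differentiable (at 0)" if "p \<in> V" for p
      by (rule pd_eqI(2)[of "\<lambda>p. \<integral>w. \<Phi> w p \<partial>M"]) (rule der[OF that])
    show "Ck_on k d V (pd j (\<lambda>p. \<integral>w. \<Phi> w p \<partial>M))"
      by (rule Ck_on_cong[OF V_open _ Suc.IH[OF \<Psi>(1)]]) (rule pd_eqI(1)[OF der])
  qed
qed

end

section \<open>Fourier inversion for test functions\<close>

interpretation lborel_prod: product_sigma_finite "\<lambda>_::nat. lborel :: real measure"
  by (simp add: product_sigma_finite_def lborel.sigma_finite_measure_axioms)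

abbreviation leb :: "nat \<Rightarrow> (nat \<Rightarrow> real) measure" where
  "leb n \<equiv> PiM {..<n} (\<lambda>_. lborel)"

text \<open>\<open>leb n\<close> lives on extensional functions, which are \<open>undefined\<close>
  outside \<open>{..<n}\<close>, whereas points of \<open>Rsp n\<close> vanish there. This map
  translates the former into the latter.\<close>

definition emb :: "nat \<Rightarrow> (nat \<Rightarrow> real) \<Rightarrow> nat \<Rightarrow> real" where
  "emb n z = (\<lambda>i. if i < n then z i else 0)"

definition dot :: "nat \<Rightarrow> (nat \<Rightarrow> real) \<Rightarrow> (nat \<Rightarrow> real) \<Rightarrow> real" where
  "dot n x y = (\<Sum>i<n. x i * y i)"

definition nsq :: "nat \<Rightarrow> (nat \<Rightarrow> real) \<Rightarrow> real" where
  "nsq n x = (\<Sum>i<n. (x i)\<^sup>2)"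

lemma nsq_nonneg: "0 \<le> nsq n x" by (simp add: nsq_def sum_nonneg)

lemma coord_le_nsq: "i < n \<Longrightarrow> (x i)\<^sup>2 \<le> nsq n x"
  unfolding nsq_def by (rule member_le_sum) auto

lemma leb_sigma_finite: "sigma_finite_measure (leb n)"
  by (rule lborel_prod.sigma_finite) simp

lemma leb_coord [measurable]: "i < n \<Longrightarrow> (\<lambda>z. z i) \<in> borel_measurable (leb n)"
  using measurable_component_singleton[of i "{..<n}" "\<lambda>_. lborel :: real measure"] by simp

lemma dot_measurable [measurable]: "(\<lambda>z. dot n x z) \<in> borel_measurable (leb n)"
  "(\<lambda>z. dot n z x) \<in> borel_measurable (leb n)"
  unfolding dot_def by (intro borel_measurable_sum borel_measurable_times; simp add: leb_coord)+

lemma nsq_measurable [measurable]: "nsq n \<in> borel_measurable (leb n)"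
  unfolding nsq_def by (intro borel_measurable_sum borel_measurable_power) (simp add: leb_coord)

lemma emb_Rsp: "emb n z \<in> Rsp n" by (simp add: emb_def Rsp_def)

lemma emb_id: "x \<in> Rsp n \<Longrightarrow> emb n x = x" by (auto simp: emb_def Rsp_def)

lemma emb_measurable: "emb n \<in> borel_measurable (leb n)"
proof (rule measurable_coordinatewise_then_product)
  show "(\<lambda>z. emb n z i) \<in> borel_measurable (leb n)" for i
    by (cases "i < n") (auto simp: emb_def leb_coord)
qed

lemma measurable_emb:
  assumes "continuous_on (Rsp n) H"
  shows "(\<lambda>z. H (emb n z)) \<in> borel_measurable (leb n)"
proof -
  have "emb n \<in> measurable (leb n) (restrict_space borel (Rsp n))"
    by (rule measurable_restrict_space2) (use emb_measurable emb_Rsp in auto)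
  moreover have "H \<in> borel_measurable (restrict_space borel (Rsp n))"
    using assms by (rule borel_measurable_continuous_on_restrict)
  ultimately show ?thesis by (rule measurable_compose)
qed

lemma integrable_inverse_1_plus_square_lborel: "integrable lborel (\<lambda>x::real. inverse (1 + x\<^sup>2))"
  using integrable_inverse_1_plus_square by (simp add: set_integrable_def)

lemma prod_le_nsq: "(\<Prod>i<n. 1 + (x i)\<^sup>2) \<le> (1 + nsq n x) ^ n"
proof -
  have "(\<Prod>i<n. 1 + (x i)\<^sup>2) \<le> (\<Prod>i<n. 1 + nsq n x)"
    by (rule prod_mono) (auto simp: coord_le_nsq)
  thus ?thesis by simp
qed

text \<open>\<open>(1 + nsq n x) ^ n\<close> dominates the product of the factors
  \<open>1 + (x i)\<^sup>2\<close>, whose reciprocal is a product of integrable functions of one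
  variable.\<close>

lemma integrable_decay:
  assumes "G \<in> borel_measurable (leb n)"
    and "\<And>x. x \<in> space (leb n) \<Longrightarrow> (1 + nsq n x) ^ n * \<bar>G x\<bar> \<le> C"
  shows "integrable (leb n) G"
proof (rule Bochner_Integration.integrable_bound[OF _ assms(1)])
  show "integrable (leb n) (\<lambda>x. C * (\<Prod>i<n. inverse (1 + (x i)\<^sup>2)))"
    by (intro integrable_mult_right lborel_prod.product_integrable_prod integrable_inverse_1_plus_square_lborel) simp
  show "AE x in leb n. norm (G x) \<le> norm (C * (\<Prod>i<n. inverse (1 + (x i)\<^sup>2)))"
  proof (intro AE_I2)
    fix x assume x: "x \<in> space (leb n)"
    have p: "(\<Prod>i<n. 1 + (x i)\<^sup>2) > 0" by (intro prod_pos) (auto intro: add_pos_nonneg)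
    have "(\<Prod>i<n. 1 + (x i)\<^sup>2) * \<bar>G x\<bar> \<le> (1 + nsq n x) ^ n * \<bar>G x\<bar>"
      using prod_le_nsq by (intro mult_right_mono) auto
    also have "\<dots> \<le> C" by (rule assms(2)[OF x])
    finally have "\<bar>G x\<bar> \<le> C * inverse (\<Prod>i<n. 1 + (x i)\<^sup>2)"
      using p by (simp add: field_simps)
    thus "norm (G x) \<le> norm (C * (\<Prod>i<n. inverse (1 + (x i)\<^sup>2)))"
      by (simp add: prod_inversef[symmetric] comp_def)
  qed
qed

text \<open>A product measure is determined by its values on boxes. There the one-dimensional
  scaling rule contributes one factor \<open>c\<close> for each coordinate.\<close>

lemma leb_affine:
  fixes c :: real and x :: "nat \<Rightarrow> real" and n :: nat
  assumes c: "c > 0"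
  defines "\<phi> \<equiv> \<lambda>w. \<lambda>i\<in>{..<n}. x i + c * w i"
  shows "\<phi> \<in> measurable (leb n) (leb n)"
    and "leb n = density (distr (leb n) (leb n) \<phi>) (\<lambda>_. ennreal (c ^ n))"
proof -
  show m: "\<phi> \<in> measurable (leb n) (leb n)"
    unfolding \<phi>_def
    by (intro measurable_restrict) (simp add: leb_coord)
  have "density (distr (leb n) (leb n) \<phi>) (\<lambda>_. ennreal (c ^ n)) = leb n"
  proof (rule lborel_prod.PiM_eqI)
    fix A :: "nat \<Rightarrow> real set" assume A: "\<And>i. i \<in> {..<n} \<Longrightarrow> A i \<in> sets lborel"
    have AP: "Pi\<^sub>E {..<n} A \<in> sets (leb n)" using A by (intro sets_PiM_I_finite) auto
    let ?B = "\<lambda>i. (\<lambda>w. x i + c * w) -` A i"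
    have B: "?B i \<in> sets lborel" if "i < n" for i
    proof -
      have "(\<lambda>w. x i + c * w) \<in> borel_measurable borel" by simp
      from measurable_sets[OF this, of "A i"] show ?thesis using A that by simp
    qed
    have pre: "\<phi> -` Pi\<^sub>E {..<n} A \<inter> space (leb n) = Pi\<^sub>E {..<n} ?B"
      by (auto simp: \<phi>_def space_PiM PiE_iff extensional_def restrict_def split: if_splits)
    have one: "emeasure lborel (A i) = ennreal c * emeasure lborel (?B i)" if "i < n" for i
    proof -
      have Ai: "A i \<in> sets borel" using A that by simp
      have "emeasure lborel (A i) = emeasure (density (distr lborel borel (\<lambda>w. x i + c * w)) (\<lambda>_. ennreal \<bar>c\<bar>)) (A i)"
        using lborel_real_affine[of c "x i"] c by simp
      also have "\<dots> = ennreal c * emeasure (distr lborel borel (\<lambda>w. x i + c * w)) (A i)"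
        using Ai c by (subst emeasure_density_const) auto
      also have "\<dots> = ennreal c * emeasure lborel (?B i)" using Ai by (subst emeasure_distr) auto
      finally show ?thesis .
    qed
    have "emeasure (density (distr (leb n) (leb n) \<phi>) (\<lambda>_. ennreal (c ^ n))) (Pi\<^sub>E {..<n} A)
        = ennreal (c ^ n) * emeasure (leb n) (Pi\<^sub>E {..<n} ?B)"
      using AP m by (simp add: emeasure_density_const emeasure_distr pre)
    also have "emeasure (leb n) (Pi\<^sub>E {..<n} ?B) = (\<Prod>i<n. emeasure lborel (?B i))"
      using B by (intro lborel_prod.emeasure_PiM) auto
    also have "ennreal (c ^ n) * \<dots> = (\<Prod>i<n. ennreal c * emeasure lborel (?B i))"
      using c by (simp add: prod.distrib ennreal_power)
    also have "\<dots> = (\<Prod>i<n. emeasure lborel (A i))" using one by (intro prod.cong) auto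
    finally show "emeasure (density (distr (leb n) (leb n) \<phi>) (\<lambda>_. ennreal (c ^ n))) (Pi\<^sub>E {..<n} A)
       = (\<Prod>i<n. emeasure lborel (A i))" .
  qed simp_all
  thus "leb n = density (distr (leb n) (leb n) \<phi>) (\<lambda>_. ennreal (c ^ n))" by simp
qed

lemma integral_leb_affine:
  fixes c :: real and x :: "nat \<Rightarrow> real" and F :: "(nat \<Rightarrow> real) \<Rightarrow> real"
  assumes c: "c > 0" and F: "F \<in> borel_measurable (leb n)"
  shows "(\<integral>z. F z \<partial>leb n) = c ^ n * (\<integral>w. F (\<lambda>i\<in>{..<n}. x i + c * w i) \<partial>leb n)"
proof -
  let ?\<phi> = "\<lambda>w. \<lambda>i\<in>{..<n}. x i + c * w i"
  have m: "?\<phi> \<in> measurable (leb n) (leb n)" using leb_affine(1)[OF c] .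
  have "(\<integral>z. F z \<partial>leb n) = (\<integral>z. F z \<partial>density (distr (leb n) (leb n) ?\<phi>) (\<lambda>_. ennreal (c ^ n)))"
    by (subst leb_affine(2)[OF c, of n x]) simp
  also have "\<dots> = (\<integral>z. c ^ n *\<^sub>R F z \<partial>distr (leb n) (leb n) ?\<phi>)"
    using c F by (intro integral_density) auto
  also have "\<dots> = (\<integral>w. c ^ n *\<^sub>R F (?\<phi> w) \<partial>leb n)"
    using m F by (intro integral_distr) auto
  finally show ?thesis by simp
qed

section \<open>Test functions and the decay of their transforms\<close>

lemma C0_inf_cont: "C0_inf n h \<Longrightarrow> continuous_on (Rsp n) h"
  using Ck_on_0[of n "Rsp n" h] unfolding C0_inf_def by blast

lemma C0_inf_deriv:
  assumes "C0_inf n h" "k < n" "p \<in> Rsp n"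
  shows "((\<lambda>s. h (p(k := s))) has_real_derivative pd k h p) (at (p k))"
proof -
  have "Ck_on 1 n (Rsp n) h" using assms by (auto simp: C0_inf_def)
  from this[unfolded Ck_on_def, THEN conjunct2, rule_format, of "[]" k p]
  have "(\<lambda>s. pds [] h (p(k := p k + s))) differentiable (at 0)" using assms by simp
  hence "(\<lambda>s. h (p(k := p k + s))) differentiable (at 0)" by (simp add: pds_def)
  hence "((\<lambda>s. h (p(k := p k + s))) has_real_derivative pd k h p) (at 0)"
    unfolding pd_def using DERIV_deriv_iff_real_differentiable by blast
  thus ?thesis using DERIV_shift[of "\<lambda>s. h (p(k := s))" "pd k h p" 0 "p k"] by (simp add: add.commute)
qed

text \<open>Regularity is that of \<open>h\<close> with one index appended to the list. Far out,
  \<open>h\<close> vanishes on a relatively open set, hence so does its derivative.\<close>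

lemma C0_inf_pd:
  assumes "C0_inf n h" "k < n" shows "C0_inf n (pd k h)"
proof -
  have "Ck_on m n (Rsp n) (pd k h)" for m
    unfolding Ck_on_def
  proof (intro conjI allI impI ballI)
    have C: "Ck_on (Suc m) n (Rsp n) h" using assms by (auto simp: C0_inf_def)
    show "continuous_on (Rsp n) (pds ks (pd k h))" if "set ks \<subseteq> {..<n} \<and> length ks \<le> m" for ks
      using C that assms(2) unfolding Ck_on_def pds_snoc[symmetric] by auto
    show "(\<lambda>s. pds ks (pd k h) (p(j := p j + s))) differentiable (at 0)"
      if "set ks \<subseteq> {..<n} \<and> length ks < m" "j < n" "p \<in> Rsp n" for ks j p
      using C that assms(2) unfolding Ck_on_def pds_snoc[symmetric] by auto
  qed
  moreover obtain R where R: "\<forall>x\<in>Rsp n. (\<Sum>i<n. (x i)\<^sup>2) > R\<^sup>2 \<longrightarrow> h x = 0" using assms by (auto simp: C0_inf_def)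
  have "pd k h x = 0" if x: "x \<in> Rsp n" "(\<Sum>i<n. (x i)\<^sup>2) > R\<^sup>2" for x
  proof -
    let ?V = "{p \<in> Rsp n. (\<Sum>i<n. (p i)\<^sup>2) > R\<^sup>2}"
    have "open {p::nat\<Rightarrow>real. (\<Sum>i<n. (p i)\<^sup>2) > R\<^sup>2}"
      by (rule open_Collect_less) (intro continuous_intros continuous_on_coord)+
    hence "openin (top_of_set (Rsp n)) ?V" unfolding openin_open by (intro exI[of _ "{p. (\<Sum>i<n. (p i)\<^sup>2) > R\<^sup>2}"]) auto
    hence "pd k h x = pd k (\<lambda>_. 0) x"
      by (rule pd_cong_openin) (use x R assms(2) in auto)
    thus ?thesis by (simp add: pd_def)
  qed
  ultimately show ?thesis unfolding C0_inf_def by blast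
qed

text \<open>A product of intervals, with factors \<open>{0}\<close> beyond \<open>n\<close>, is
  compact by Tychonoff's theorem, and \<open>h\<close> vanishes off it on \<open>Rsp n\<close>.
  Indicators are used in the bound because their product is integrable for the product
  measure.\<close>

lemma C0_inf_bound:
  assumes "C0_inf n h"
  obtains B R where "B \<ge> 0" "R > 0" "\<And>x. x \<in> Rsp n \<Longrightarrow> \<bar>h x\<bar> \<le> B * (\<Prod>i<n. indicator {-R..R} (x i))"
proof -
  obtain R where R: "\<forall>x\<in>Rsp n. (\<Sum>i<n. (x i)\<^sup>2) > R\<^sup>2 \<longrightarrow> h x = 0" using assms by (auto simp: C0_inf_def)
  define r where "r = \<bar>R\<bar> + 1"
  define S :: "nat \<Rightarrow> real set" where "S = (\<lambda>i. if i < n then {-r..r} else {0})"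
  have "compactin (product_topology (\<lambda>_. euclidean) UNIV) (Pi\<^sub>E UNIV S)"
    by (subst compactin_PiE) (auto simp: S_def)
  hence "compact (Pi\<^sub>E UNIV S)" by (simp add: euclidean_product_topology)
  moreover have "Pi\<^sub>E UNIV S \<subseteq> Rsp n" by (auto simp: S_def Rsp_def PiE_iff) (metis leD singletonD)
  hence "continuous_on (Pi\<^sub>E UNIV S) h" using C0_inf_cont[OF assms] continuous_on_subset by blast
  ultimately have "bounded (h ` Pi\<^sub>E UNIV S)" by (intro compact_imp_bounded compact_continuous_image)
  then obtain B where B: "\<And>x. x \<in> Pi\<^sub>E UNIV S \<Longrightarrow> norm (h x) \<le> B" unfolding bounded_iff by blast
  show thesis
  proof (rule that[of "\<bar>B\<bar>" r])
    fix x assume x: "x \<in> Rsp n"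
    show "\<bar>h x\<bar> \<le> \<bar>B\<bar> * (\<Prod>i<n. indicator {-r..r} (x i))"
    proof (cases "x \<in> Pi\<^sub>E UNIV S")
      case True
      hence "x i \<in> {-r..r}" if "i < n" for i using that by (auto simp: S_def PiE_iff split: if_splits)
      hence "(\<Prod>i<n. indicator {-r..r} (x i)) = (1::real)" by (intro prod.neutral) auto
      thus ?thesis using B[OF True] by simp
    next
      case False
      then obtain i where i: "x i \<notin> S i" by (auto simp: PiE_iff)
      have "i < n" using i x by (auto simp: S_def Rsp_def split: if_splits)
      hence "\<bar>x i\<bar> > r" using i by (auto simp: S_def)
      hence "\<bar>x i\<bar> > \<bar>R\<bar>" by (simp add: r_def)
      hence "(x i)\<^sup>2 > R\<^sup>2" by (metis abs_le_square_iff not_le)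
      hence "(\<Sum>i<n. (x i)\<^sup>2) > R\<^sup>2" using coord_le_nsq[OF \<open>i < n\<close>, of x] by (simp add: nsq_def)
      hence "h x = 0" using R x by auto
      thus ?thesis by (simp add: prod_nonneg)
    qed
  qed (auto simp: r_def)
qed

lemma indicator_prod_integrable: "integrable (leb n) (\<lambda>z. \<Prod>i<n. indicator {-R..R::real} (z i) :: real)"
  by (rule lborel_prod.product_integrable_prod)
     (auto intro!: integrable_real_indicator simp: emeasure_lborel_Icc_eq)

lemma emb_indicator: "(\<Prod>i<n. indicator {-R..R} (emb n z i)) = (\<Prod>i<n. indicator {-R..R::real} (z i) :: real)"
  by (rule prod.cong) (auto simp: emb_def)

lemma C0_inf_integrable:
  assumes "C0_inf n h" "g \<in> borel_measurable (leb n)" "\<And>z. \<bar>g z\<bar> \<le> 1"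
  shows "integrable (leb n) (\<lambda>z. h (emb n z) * g z)"
proof -
  obtain B R where B: "B \<ge> 0" "R > 0" "\<And>x. x \<in> Rsp n \<Longrightarrow> \<bar>h x\<bar> \<le> B * (\<Prod>i<n. indicator {-R..R} (x i))"
    using C0_inf_bound[OF assms(1)] by metis
  show ?thesis
  proof (rule Bochner_Integration.integrable_bound)
    show "integrable (leb n) (\<lambda>z. B * (\<Prod>i<n. indicator {-R..R::real} (z i) :: real))"
      by (intro integrable_mult_right indicator_prod_integrable)
    show "(\<lambda>z. h (emb n z) * g z) \<in> borel_measurable (leb n)"
      by (intro borel_measurable_times measurable_emb C0_inf_cont assms)
    show "AE z in leb n. norm (h (emb n z) * g z) \<le> norm (B * (\<Prod>i<n. indicator {-R..R::real} (z i) :: real))"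
    proof (intro AE_I2)
      fix z
      have "\<bar>h (emb n z)\<bar> * \<bar>g z\<bar> \<le> (B * (\<Prod>i<n. indicator {-R..R} (z i))) * 1"
        using B(3)[OF emb_Rsp, of z] assms(3)[of z] B(1)
        by (intro mult_mono) (auto simp: emb_indicator prod_nonneg)
      hence "\<bar>h (emb n z) * g z\<bar> \<le> B * (\<Prod>i<n. indicator {-R..R} (z i))" by (simp only: abs_mult mult_1_right)
      thus "norm (h (emb n z) * g z) \<le> norm (B * (\<Prod>i<n. indicator {-R..R::real} (z i) :: real))"
        unfolding real_norm_def by (rule order_trans[OF _ abs_ge_self])
    qed
  qed
qed

text \<open>A real Fourier transform with adjustable phase: \<open>\<alpha> = 0\<close> gives the
  cosine transform and \<open>\<alpha> = - pi/2\<close> the sine transform. Differentiating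
  \<open>h\<close> amounts to shifting the phase by \<open>pi/2\<close>, so complex values can be
  avoided.\<close>

definition FT :: "nat \<Rightarrow> ((nat \<Rightarrow> real) \<Rightarrow> real) \<Rightarrow> real \<Rightarrow> (nat \<Rightarrow> real) \<Rightarrow> real" where
  "FT n h \<alpha> \<xi> = (\<integral>z. h (emb n z) * cos (dot n \<xi> z + \<alpha>) \<partial>leb n)"

lemma dot_upd: "k < n \<Longrightarrow> dot n \<xi> (x(k := y)) = dot n \<xi> x - \<xi> k * x k + \<xi> k * y"
  unfolding dot_def by (simp add: sum.remove[of "{..<n}" k])

text \<open>Integration by parts in coordinate \<open>k\<close>. The function \<open>\<Phi>\<close>
  is the derivative in that coordinate of a compactly supported function, so the inner integral of
  Fubini's theorem vanishes for every choice of the other coordinates.\<close>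

lemma FT_pd:
  assumes h: "C0_inf n h" and k: "k < n"
  shows "FT n (pd k h) (\<alpha> + pi/2) \<xi> = \<xi> k * FT n h \<alpha> \<xi>"
proof -
  define \<Phi> where "\<Phi> z = pd k h (emb n z) * cos (dot n \<xi> z + (\<alpha> + pi/2)) + h (emb n z) * (- \<xi> k * cos (dot n \<xi> z + \<alpha>))" for z
  have i1: "integrable (leb n) (\<lambda>z. pd k h (emb n z) * cos (dot n \<xi> z + (\<alpha> + pi/2)))"
    by (intro C0_inf_integrable C0_inf_pd h k) auto
  have i2: "integrable (leb n) (\<lambda>z. h (emb n z) * cos (dot n \<xi> z + \<alpha>))"
    by (intro C0_inf_integrable h) auto
  have i2': "integrable (leb n) (\<lambda>z. h (emb n z) * (- \<xi> k * cos (dot n \<xi> z + \<alpha>)))"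
    using integrable_mult_right[OF i2, of "- \<xi> k"] by (simp add: mult_ac)
  have ins: "insert k ({..<n} - {k}) = {..<n}" using k by auto
  have "integrable (leb n) \<Phi>" unfolding \<Phi>_def by (intro Bochner_Integration.integrable_add i1 i2')
  hence "(\<integral>z. \<Phi> z \<partial>leb n) = (\<integral>x. (\<integral>y. \<Phi> (x(k := y)) \<partial>lborel) \<partial>PiM ({..<n} - {k}) (\<lambda>_. lborel))"
    using lborel_prod.product_integral_insert[of "{..<n} - {k}" k \<Phi>] ins by simp
  also have "\<dots> = 0"
  proof -
    obtain B R where B: "B \<ge> 0" "R > 0" "\<And>x. x \<in> Rsp n \<Longrightarrow> \<bar>h x\<bar> \<le> B * (\<Prod>i<n. indicator {-R..R} (x i))"
      using C0_inf_bound[OF h] by metis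
    obtain B' R' where B': "B' \<ge> 0" "R' > 0" "\<And>x. x \<in> Rsp n \<Longrightarrow> \<bar>pd k h x\<bar> \<le> B' * (\<Prod>i<n. indicator {-R'..R'} (x i))"
      using C0_inf_bound[OF C0_inf_pd[OF h k]] by metis
    define r where "r = max R R' + 1"
    have vanish: "h x = 0" "pd k h x = 0" if "x \<in> Rsp n" "\<bar>x k\<bar> \<ge> r" for x
    proof -
      have "x k \<notin> {-R..R}" "x k \<notin> {-R'..R'}" using that by (auto simp: r_def)
      hence "(\<Prod>i<n. indicator {-R..R} (x i)) = (0::real)" "(\<Prod>i<n. indicator {-R'..R'} (x i)) = (0::real)"
        using k by (auto intro!: prod_zero bexI[of _ k])
      hence "\<bar>h x\<bar> \<le> B * 0" "\<bar>pd k h x\<bar> \<le> B' * 0" using B(3)[OF that(1)] B'(3)[OF that(1)] by (simp_all only:)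
      thus "h x = 0" "pd k h x = 0" by auto
    qed
    have "(\<integral>y. \<Phi> (x(k := y)) \<partial>lborel) = 0" for x
    proof -
      define p where "p = emb n x"
      have p: "p \<in> Rsp n" by (simp add: p_def emb_Rsp)
      have pe: "emb n (x(k := y)) = p(k := y)" for y using k by (auto simp: p_def emb_def)
      have py: "p(k := y) \<in> Rsp n" for y using p k by (rule Rsp_upd)
      define a where "a = dot n \<xi> x - \<xi> k * x k + \<alpha>"
      have d: "dot n \<xi> (x(k := y)) + \<alpha> = a + \<xi> k * y" for y using dot_upd[OF k, of \<xi> x y] by (simp add: a_def)
      have d2: "dot n \<xi> (x(k := y)) + (\<alpha> + pi/2) = a + \<xi> k * y + pi/2" for y using d[of y] by simp
      define F where "F y = h (p(k := y)) * cos (a + \<xi> k * y + pi/2)" for y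
      have F': "(F has_real_derivative \<Phi> (x(k := y))) (at y)" for y
      proof -
        have h': "((\<lambda>s. h (p(k := s))) has_real_derivative pd k h (p(k := y))) (at y)"
          using C0_inf_deriv[OF h k py, of y] by simp
        have c': "((\<lambda>y. cos (a + \<xi> k * y + pi/2)) has_real_derivative (- \<xi> k * cos (a + \<xi> k * y))) (at y)"
          by (rule derivative_eq_intros refl | simp add: sin_add)+
        have "(F has_real_derivative (h (p(k := y)) * (- \<xi> k * cos (a + \<xi> k * y)) + pd k h (p(k := y)) * cos (a + \<xi> k * y + pi/2))) (at y)"
          unfolding F_def by (rule DERIV_mult'[OF h' c'])
        thus ?thesis unfolding \<Phi>_def pe d d2 by (simp add: add.commute)
      qed
      have cont: "isCont (\<lambda>y. \<Phi> (x(k := y))) y" for y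
      proof -
        have c1: "continuous_on UNIV (\<lambda>y. H (p(k := y)))" if "continuous_on (Rsp n) H" for H :: "(nat \<Rightarrow> real) \<Rightarrow> real"
          by (rule continuous_on_compose2[OF that continuous_on_fun_upd_coord]) (use py in auto)
        have "continuous_on UNIV (\<lambda>y. \<Phi> (x(k := y)))"
          unfolding \<Phi>_def pe d d2
          by (intro continuous_intros c1 C0_inf_cont C0_inf_pd h k)
        thus ?thesis by (simp add: continuous_on_eq_continuous_at)
      qed
      have "(\<integral>y. \<Phi> (x(k := y)) * indicator {-r..r} y \<partial>lborel) = F r - F (-r)"
        by (rule integral_FTC_Icc_real) (use B B' F' cont in \<open>auto simp: r_def\<close>)
      moreover have "F r = 0" "F (-r) = 0" using vanish(1)[OF py, of r] vanish(1)[OF py, of "-r"] by (auto simp: F_def)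
      moreover have "\<Phi> (x(k := y)) * indicator {-r..r} y = \<Phi> (x(k := y))" for y
        using vanish[OF py, of y] by (cases "\<bar>y\<bar> \<ge> r") (auto simp: \<Phi>_def pe indicator_def)
      ultimately show ?thesis by simp
    qed
    thus ?thesis by simp
  qed
  finally have "(\<integral>z. \<Phi> z \<partial>leb n) = 0" .
  moreover have "(\<integral>z. \<Phi> z \<partial>leb n) = FT n (pd k h) (\<alpha> + pi/2) \<xi> + (\<integral>z. h (emb n z) * (- \<xi> k * cos (dot n \<xi> z + \<alpha>)) \<partial>leb n)"
    unfolding \<Phi>_def FT_def by (rule Bochner_Integration.integral_add[OF i1 i2'])
  moreover have "(\<integral>z. h (emb n z) * (- \<xi> k * cos (dot n \<xi> z + \<alpha>)) \<partial>leb n) = - \<xi> k * FT n h \<alpha> \<xi>"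
    unfolding FT_def by (subst Bochner_Integration.integral_mult_right_zero[symmetric]) (simp add: mult_ac)
  ultimately show ?thesis by simp
qed

text \<open>Each use of \<open>FT_pd\<close> trades a power of \<open>\<xi> k\<close> for a
  derivative of \<open>h\<close>. The bound is uniform in \<open>\<alpha>\<close> because each use
  shifts the phase, and because the phase will later depend on \<open>\<xi>\<close> itself.\<close>

lemma FT_coord_decay:
  assumes "C0_inf n h" "k < n" shows "\<exists>C. \<forall>\<alpha> \<xi>. \<bar>\<xi> k\<bar> ^ m * \<bar>FT n h \<alpha> \<xi>\<bar> \<le> C"
  using assms(1)
proof (induction m arbitrary: h)
  case 0
  have "\<bar>FT n h \<alpha> \<xi>\<bar> \<le> (\<integral>z. \<bar>h (emb n z)\<bar> \<partial>leb n)" for \<alpha> \<xi>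
  proof -
    have i: "integrable (leb n) (\<lambda>z. h (emb n z) * cos (dot n \<xi> z + \<alpha>))" by (intro C0_inf_integrable 0) auto
    have i': "integrable (leb n) (\<lambda>z. h (emb n z) * 1)" by (intro C0_inf_integrable 0) auto
    have "\<bar>FT n h \<alpha> \<xi>\<bar> \<le> (\<integral>z. \<bar>h (emb n z) * cos (dot n \<xi> z + \<alpha>)\<bar> \<partial>leb n)"
      unfolding FT_def by (rule integral_abs_bound)
    also have "\<dots> \<le> (\<integral>z. \<bar>h (emb n z)\<bar> \<partial>leb n)"
      using integrable_abs[OF i'] by (intro integral_mono integrable_abs[OF i]) (auto simp: abs_mult mult_left_le)
    finally show ?thesis .
  qed
  thus ?case by auto
next
  case (Suc m)
  obtain C where C: "\<forall>\<alpha> \<xi>. \<bar>\<xi> k\<bar> ^ m * \<bar>FT n (pd k h) \<alpha> \<xi>\<bar> \<le> C"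
    using Suc.IH[OF C0_inf_pd[OF Suc.prems assms(2)]] by auto
  have "\<bar>\<xi> k\<bar> ^ Suc m * \<bar>FT n h \<alpha> \<xi>\<bar> \<le> C" for \<alpha> \<xi>
  proof -
    have "\<bar>\<xi> k\<bar> ^ Suc m * \<bar>FT n h \<alpha> \<xi>\<bar> = \<bar>\<xi> k\<bar> ^ m * \<bar>\<xi> k * FT n h \<alpha> \<xi>\<bar>" by (simp add: abs_mult)
    also have "\<dots> = \<bar>\<xi> k\<bar> ^ m * \<bar>FT n (pd k h) (\<alpha> + pi/2) \<xi>\<bar>" unfolding FT_pd[OF Suc.prems assms(2)] ..
    also have "\<dots> \<le> C" using C by blast
    finally show ?thesis .
  qed
  thus ?case by blast
qed

lemma FT_decay:
  assumes h: "C0_inf n h" and n: "n \<ge> 1"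
  shows "\<exists>C. \<forall>\<alpha> \<xi>. (1 + nsq n \<xi>) ^ m * \<bar>FT n h \<alpha> \<xi>\<bar> \<le> C"
proof -
  obtain D where D: "\<And>\<alpha> \<xi>. \<bar>FT n h \<alpha> \<xi>\<bar> \<le> D" using FT_coord_decay[OF h, of 0 0] n by auto
  have "\<forall>k\<in>{..<n}. \<exists>C. \<forall>\<alpha> \<xi>. \<bar>\<xi> k\<bar> ^ (2*m) * \<bar>FT n h \<alpha> \<xi>\<bar> \<le> C" using FT_coord_decay[OF h] by auto
  then obtain C where C: "\<And>k \<alpha> \<xi>. k < n \<Longrightarrow> \<bar>\<xi> k\<bar> ^ (2*m) * \<bar>FT n h \<alpha> \<xi>\<bar> \<le> C k" by (metis lessThan_iff bchoice)
  define E where "E = D + (\<Sum>k<n. \<bar>C k\<bar>)"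
  have "(1 + nsq n \<xi>) ^ m * \<bar>FT n h \<alpha> \<xi>\<bar> \<le> real (Suc n) ^ m * E" for \<alpha> \<xi>
  proof (cases "1 + nsq n \<xi> \<le> real (Suc n)")
    case True
    have "(1 + nsq n \<xi>) ^ m * \<bar>FT n h \<alpha> \<xi>\<bar> \<le> real (Suc n) ^ m * D"
      using True nsq_nonneg[of n \<xi>] D[of \<alpha> \<xi>] by (intro mult_mono power_mono) auto
    also have "\<dots> \<le> real (Suc n) ^ m * E" unfolding E_def by (intro mult_left_mono) (auto intro: sum_nonneg)
    finally show ?thesis .
  next
    case False
    \<comment> \<open>Some coordinate carries at least the share \<open>1 / (n + 1)\<close> of
      \<open>1 + nsq n \<xi>\<close>; otherwise summation over the coordinates would give
      \<open>nsq n \<xi> < n\<close>, which the case assumption excludes.\<close>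
    have "\<exists>k<n. 1 + nsq n \<xi> \<le> real (Suc n) * (\<xi> k)\<^sup>2"
    proof (rule ccontr)
      assume "\<not> ?thesis"
      hence "(\<Sum>k<n. real (Suc n) * (\<xi> k)\<^sup>2) < (\<Sum>k<n. 1 + nsq n \<xi>)" using n by (intro sum_strict_mono) (auto simp: not_le lessThan_empty_iff)
      hence "real (Suc n) * nsq n \<xi> < real n * (1 + nsq n \<xi>)" by (simp add: nsq_def sum_distrib_left)
      thus False using False by (simp add: algebra_simps)
    qed
    then obtain k where k: "k < n" "1 + nsq n \<xi> \<le> real (Suc n) * (\<xi> k)\<^sup>2" by auto
    have "(1 + nsq n \<xi>) ^ m * \<bar>FT n h \<alpha> \<xi>\<bar> \<le> (real (Suc n) * (\<xi> k)\<^sup>2) ^ m * \<bar>FT n h \<alpha> \<xi>\<bar>"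
      using k nsq_nonneg[of n \<xi>] by (intro mult_right_mono power_mono) auto
    also have "\<dots> = real (Suc n) ^ m * (\<bar>\<xi> k\<bar> ^ (2*m) * \<bar>FT n h \<alpha> \<xi>\<bar>)" by (simp add: power_mult_distrib power_mult)
    also have "\<dots> \<le> real (Suc n) ^ m * E"
    proof (intro mult_left_mono)
      have "C k \<le> (\<Sum>k<n. \<bar>C k\<bar>)"
        using member_le_sum[of k "{..<n}" "\<lambda>k. \<bar>C k\<bar>"] k(1) by auto
      moreover have "D \<ge> 0" using D[of 0 undefined] by linarith
      ultimately show "\<bar>\<xi> k\<bar> ^ (2*m) * \<bar>FT n h \<alpha> \<xi>\<bar> \<le> E" using C[OF k(1), of \<xi> \<alpha>] by (simp add: E_def)
    qed auto
    finally show ?thesis .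
  qed
  thus ?thesis by blast
qed

lemma FT_cont: assumes "C0_inf n h" shows "continuous_on UNIV (FT n h \<alpha>)"
  unfolding continuous_on_sequentially
proof (intro allI ballI impI, elim conjE)
  fix X :: "nat \<Rightarrow> nat \<Rightarrow> real" and \<xi> assume lim: "X \<longlonglongrightarrow> \<xi>"
  have "(\<lambda>i. \<integral>z. h (emb n z) * cos (dot n (X i) z + \<alpha>) \<partial>leb n) \<longlonglongrightarrow> (\<integral>z. h (emb n z) * cos (dot n \<xi> z + \<alpha>) \<partial>leb n)"
  proof (rule integral_dominated_convergence[where w = "\<lambda>z. \<bar>h (emb n z) * 1\<bar>"])
    show "integrable (leb n) (\<lambda>z. \<bar>h (emb n z) * 1\<bar>)" by (intro integrable_abs C0_inf_integrable assms) auto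
    show "AE z in leb n. (\<lambda>i. h (emb n z) * cos (dot n (X i) z + \<alpha>)) \<longlonglongrightarrow> h (emb n z) * cos (dot n \<xi> z + \<alpha>)"
    proof (intro AE_I2)
      fix z
      have c: "(\<lambda>i. X i j) \<longlonglongrightarrow> \<xi> j" for j
        using lim continuous_on_coord[of UNIV j] unfolding continuous_on_sequentially by (auto simp: comp_def)
      show "(\<lambda>i. h (emb n z) * cos (dot n (X i) z + \<alpha>)) \<longlonglongrightarrow> h (emb n z) * cos (dot n \<xi> z + \<alpha>)"
        unfolding dot_def by (intro tendsto_intros c)
    qed
    show "AE z in leb n. norm (h (emb n z) * cos (dot n (X i) z + \<alpha>)) \<le> \<bar>h (emb n z) * 1\<bar>" for i
      by (intro AE_I2) (auto simp: abs_mult mult_left_le)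
  qed (intro borel_measurable_times measurable_emb C0_inf_cont assms; measurable)+
  thus "(FT n h \<alpha> \<circ> X) \<longlonglongrightarrow> FT n h \<alpha> \<xi>" by (simp add: comp_def FT_def)
qed

lemma FT_emb: "FT n h \<alpha> (emb n \<xi>) = FT n h \<alpha> \<xi>"
proof -
  have "dot n (emb n \<xi>) z = dot n \<xi> z" for z unfolding dot_def by (rule sum.cong) (auto simp: emb_def)
  thus ?thesis by (simp add: FT_def)
qed

lemma measurable_of_continuous:
  assumes "continuous_on UNIV G" "\<And>\<xi>. G (emb n \<xi>) = G \<xi>"
  shows "(G :: (nat \<Rightarrow> real) \<Rightarrow> real) \<in> borel_measurable (leb n)"
proof -
  have "(\<lambda>z. G (emb n z)) \<in> borel_measurable (leb n)"
    by (rule measurable_emb) (use assms continuous_on_subset in blast)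
  thus ?thesis by (simp add: assms)
qed

section \<open>Gaussian kernels and the inversion formula\<close>

lemma std_normal_FT:
  "integrable lborel (\<lambda>x. complex_of_real (std_normal_density x) * iexp (u * x))"
  "(\<integral>x. complex_of_real (std_normal_density x) * iexp (u * x) \<partial>lborel) = of_real (exp (- u\<^sup>2 / 2))"
proof -
  show "integrable lborel (\<lambda>x. complex_of_real (std_normal_density x) * iexp (u * x))"
  proof (rule Bochner_Integration.integrable_bound)
    show "integrable lborel std_normal_density" using integrable_std_normal_moment[of 0] by simp
  qed (auto simp: norm_mult)
  have "(\<integral>x. complex_of_real (std_normal_density x) * iexp (u * x) \<partial>lborel) = char std_normal_distribution u"
    unfolding char_def by (subst integral_density) (auto simp: scaleR_conv_of_real)
  thus "(\<integral>x. complex_of_real (std_normal_density x) * iexp (u * x) \<partial>lborel) = of_real (exp (- u\<^sup>2 / 2))"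
    by (simp add: char_std_normal_distribution)
qed

definition gauss :: "nat \<Rightarrow> (nat \<Rightarrow> real) \<Rightarrow> real" where
  "gauss n w = (\<Prod>i<n. std_normal_density (w i))"

lemma gauss_nonneg: "gauss n w \<ge> 0" unfolding gauss_def by (intro prod_nonneg) auto

lemma gauss_eq: "gauss n w = (1 / sqrt (2 * pi)) ^ n * exp (- nsq n w / 2)"
proof -
  have "gauss n w = (\<Prod>i<n. 1 / sqrt (2 * pi)) * (\<Prod>i<n. exp (- (w i)\<^sup>2 / 2))"
    unfolding gauss_def std_normal_density_def by (rule prod.distrib)
  also have "(\<Prod>i<n. exp (- (w i)\<^sup>2 / 2)) = exp (- nsq n w / 2)"
    by (simp add: exp_sum[symmetric] nsq_def sum_negf sum_divide_distrib)
  finally show ?thesis by simp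
qed

lemma gauss_measurable [measurable]: "gauss n \<in> borel_measurable (leb n)"
  unfolding gauss_eq[abs_def] by measurable

lemma gauss_integrable: "integrable (leb n) (gauss n)"
  unfolding gauss_def using integrable_std_normal_moment[of 0]
  by (intro lborel_prod.product_integrable_prod) auto

lemma gauss_FT: "(\<integral>w. gauss n w * cos (dot n w u) \<partial>leb n) = exp (- nsq n u / 2)"
proof -
  have eq: "(\<Prod>i<n. complex_of_real (std_normal_density (w i)) * iexp (u i * w i)) = of_real (gauss n w) * iexp (dot n w u)" for w
    by (simp add: gauss_def dot_def prod.distrib exp_sum[symmetric] sum_distrib_left mult_ac)
  have i: "integrable (leb n) (\<lambda>w. \<Prod>i<n. complex_of_real (std_normal_density (w i)) * iexp (u i * w i))"
    by (rule lborel_prod.product_integrable_prod) (use std_normal_FT in auto)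
  have "(\<integral>w. (\<Prod>i<n. complex_of_real (std_normal_density (w i)) * iexp (u i * w i)) \<partial>leb n)
     = (\<Prod>i<n. (\<integral>x. complex_of_real (std_normal_density x) * iexp (u i * x) \<partial>lborel))"
    by (rule lborel_prod.product_integral_prod) (use std_normal_FT in auto)
  also have "\<dots> = of_real (exp (- nsq n u / 2))"
    unfolding std_normal_FT by (simp add: nsq_def exp_sum[symmetric] sum_negf sum_divide_distrib flip: of_real_prod)
  finally have "Re (\<integral>w. of_real (gauss n w) * iexp (dot n w u) \<partial>leb n) = exp (- nsq n u / 2)" unfolding eq by simp
  moreover have "Re (\<integral>w. of_real (gauss n w) * iexp (dot n w u) \<partial>leb n) = (\<integral>w. Re (of_real (gauss n w) * iexp (dot n w u)) \<partial>leb n)"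
    using i unfolding eq by (rule integral_Re[symmetric])
  ultimately show ?thesis by (simp add: Re_exp)
qed

lemma gauss_total: "(\<integral>w. gauss n w \<partial>leb n) = 1"
  using gauss_FT[of n "\<lambda>_. 0"] by (simp add: dot_def nsq_def)

lemma gauss_scaled_FT:
  assumes e: "e > 0"
  shows "(\<integral>\<xi>. gauss n (\<lambda>i. e * \<xi> i) * cos (dot n \<xi> u) \<partial>leb n) = (1/e) ^ n * exp (- nsq n (\<lambda>i. u i / e) / 2)"
proof -
  have m: "(\<lambda>\<xi>. gauss n (\<lambda>i. e * \<xi> i) * cos (dot n \<xi> u)) \<in> borel_measurable (leb n)"
  proof -
    have "nsq n (\<lambda>i. e * \<xi> i) = e\<^sup>2 * nsq n \<xi>" for \<xi> by (simp add: nsq_def power_mult_distrib sum_distrib_left)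
    thus ?thesis unfolding gauss_eq by simp
  qed
  have "(\<integral>\<xi>. gauss n (\<lambda>i. e * \<xi> i) * cos (dot n \<xi> u) \<partial>leb n) =
     (1/e) ^ n * (\<integral>w. gauss n (\<lambda>i. e * (\<lambda>i\<in>{..<n}. 0 + (1/e) * w i) i) * cos (dot n (\<lambda>i\<in>{..<n}. 0 + (1/e) * w i) u) \<partial>leb n)"
    using integral_leb_affine[of "1/e", OF _ m, of "\<lambda>_. 0"] e by simp
  also have "(\<lambda>w. gauss n (\<lambda>i. e * (\<lambda>i\<in>{..<n}. 0 + (1/e) * w i) i) * cos (dot n (\<lambda>i\<in>{..<n}. 0 + (1/e) * w i) u))
     = (\<lambda>w. gauss n w * cos (dot n w (\<lambda>i. u i / e)))"
    using e by (intro ext arg_cong2[of _ _ _ _ "(*)"] arg_cong[of _ _ cos])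
       (auto simp: gauss_def dot_def intro!: prod.cong sum.cong)
  finally show ?thesis by (simp add: gauss_FT)
qed

text \<open>The integral of \<open>h z * cos (dot n \<xi> (z - x))\<close> over \<open>z\<close>:
  the contribution of the frequency \<open>\<xi>\<close> to the inversion formula at
  \<open>x\<close>.\<close>

definition Gx :: "nat \<Rightarrow> ((nat \<Rightarrow> real) \<Rightarrow> real) \<Rightarrow> (nat \<Rightarrow> real) \<Rightarrow> (nat \<Rightarrow> real) \<Rightarrow> real" where
  "Gx n h x \<xi> = FT n h (- dot n \<xi> x) \<xi>"

text \<open>Separates \<open>x\<close> from the transforms: the dependence on \<open>x\<close> is
  confined to the cosine and sine of \<open>dot n \<xi> x\<close>, so derivatives in
  \<open>x\<close> become explicit.\<close>

lemma FT_shift: assumes "C0_inf n h"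
  shows "FT n h (- b) \<xi> = cos b * FT n h 0 \<xi> + sin b * FT n h (- pi/2) \<xi>"
proof -
  have i: "integrable (leb n) (\<lambda>z. h (emb n z) * cos (dot n \<xi> z + \<alpha>))" for \<alpha> by (intro C0_inf_integrable assms) auto
  have "FT n h (- b) \<xi> = (\<integral>z. cos b * (h (emb n z) * cos (dot n \<xi> z + 0)) + sin b * (h (emb n z) * cos (dot n \<xi> z + (- pi/2))) \<partial>leb n)"
    unfolding FT_def by (intro Bochner_Integration.integral_cong) (auto simp: cos_add cos_diff algebra_simps)
  also have "\<dots> = cos b * FT n h 0 \<xi> + sin b * FT n h (- pi/2) \<xi>"
    using i[of 0] i[of "- pi/2"] unfolding FT_def by (subst Bochner_Integration.integral_add) auto
  finally show ?thesis .
qed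

lemma Gx_cont: assumes "C0_inf n h" shows "continuous_on UNIV (Gx n h x)"
  unfolding Gx_def FT_shift[OF assms]
  unfolding dot_def by (intro continuous_intros FT_cont assms continuous_on_coord)

lemma Gx_emb: "Gx n h x (emb n \<xi>) = Gx n h x \<xi>"
proof -
  have "dot n (emb n \<xi>) x = dot n \<xi> x" unfolding dot_def by (rule sum.cong) (auto simp: emb_def)
  thus ?thesis by (simp add: Gx_def FT_emb)
qed

lemma Gx_measurable: "C0_inf n h \<Longrightarrow> Gx n h x \<in> borel_measurable (leb n)"
  using Gx_cont Gx_emb by (rule measurable_of_continuous)

lemma Gx_decay: "C0_inf n h \<Longrightarrow> n \<ge> 1 \<Longrightarrow> \<exists>C. \<forall>x \<xi>. (1 + nsq n \<xi>) ^ m * \<bar>Gx n h x \<xi>\<bar> \<le> C"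
  unfolding Gx_def using FT_decay by blast

lemma Gx_integrable: "C0_inf n h \<Longrightarrow> n \<ge> 1 \<Longrightarrow> integrable (leb n) (Gx n h x)"
  using Gx_decay[of n h n] Gx_measurable[of n h x] integrable_decay by metis

text \<open>The inversion formula regularised at scale \<open>e\<close>. Fubini's theorem makes the
  \<open>\<xi>\<close> integral the transform of a Gaussian, and the substitution
  \<open>z = x + e w\<close> turns the result into a Gaussian average of \<open>h\<close> around
  \<open>x\<close>.\<close>

lemma gauss_pairing:
  assumes h: "C0_inf n h" and e: "e > 0" and x: "x \<in> Rsp n"
  shows "(\<integral>\<xi>. gauss n (\<lambda>i. e * \<xi> i) * Gx n h x \<xi> \<partial>leb n)
     = sqrt (2 * pi) ^ n * (\<integral>w. h (emb n (\<lambda>i. x i + e * w i)) * gauss n w \<partial>leb n)"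
proof -
  interpret L: sigma_finite_measure "leb n" by (rule leb_sigma_finite)
  interpret P: pair_sigma_finite "leb n" "leb n" ..
  have nsqe: "nsq n (\<lambda>i. e * \<xi> i) = e\<^sup>2 * nsq n \<xi>" for \<xi> by (simp add: nsq_def power_mult_distrib sum_distrib_left)
  have gm: "(\<lambda>\<xi>. gauss n (\<lambda>i. e * \<xi> i)) \<in> borel_measurable (leb n)" unfolding gauss_eq nsqe by measurable
  have hm: "(\<lambda>z. h (emb n z)) \<in> borel_measurable (leb n)" by (intro measurable_emb C0_inf_cont h)
  have dz: "dot n \<xi> z - dot n \<xi> x = dot n \<xi> (\<lambda>i. z i - x i)" for \<xi> z
    by (simp add: dot_def sum_subtractf algebra_simps)
  have gi: "integrable (leb n) (\<lambda>\<xi>. gauss n (\<lambda>i. e * \<xi> i))"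
  proof -
    have "integrable (distr (leb n) (leb n) (\<lambda>w. \<lambda>i\<in>{..<n}. 0 + (1/e) * w i)) (\<lambda>\<xi>. gauss n (\<lambda>i. e * \<xi> i))"
    proof (subst integrable_distr_eq)
      show "(\<lambda>w. \<lambda>i\<in>{..<n}. 0 + (1/e) * w i) \<in> measurable (leb n) (leb n)" using leb_affine(1)[where c = "1/e" and n = n and x = "\<lambda>_. 0"] e by simp
      have "(\<lambda>w. gauss n (\<lambda>i. e * (\<lambda>i\<in>{..<n}. 0 + (1/e) * w i) i)) = gauss n"
        using e by (auto simp: gauss_def fun_eq_iff intro!: prod.cong)
      thus "integrable (leb n) (\<lambda>w. gauss n (\<lambda>i. e * (\<lambda>i\<in>{..<n}. 0 + (1/e) * w i) i))" using gauss_integrable by simp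
    qed (rule gm)
    hence "integrable (density (distr (leb n) (leb n) (\<lambda>w. \<lambda>i\<in>{..<n}. 0 + (1/e) * w i)) (\<lambda>_. ennreal ((1/e)^n))) (\<lambda>\<xi>. gauss n (\<lambda>i. e * \<xi> i))"
      using e gm by (subst integrable_density) auto
    thus ?thesis using leb_affine(2)[where c = "1/e" and n = n and x = "\<lambda>_. 0"] e by simp
  qed
  define \<Psi> where "\<Psi> \<xi> z = gauss n (\<lambda>i. e * \<xi> i) * (h (emb n z) * cos (dot n \<xi> z - dot n \<xi> x))" for \<xi> z
  have \<Psi>m: "case_prod \<Psi> \<in> borel_measurable (leb n \<Otimes>\<^sub>M leb n)"
  proof -
    have 1: "(\<lambda>p. dot n (fst p) (snd p)) \<in> borel_measurable (leb n \<Otimes>\<^sub>M leb n)"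
      unfolding dot_def by (intro borel_measurable_sum borel_measurable_times)
        (auto intro!: measurable_compose[OF measurable_fst leb_coord] measurable_compose[OF measurable_snd leb_coord])
    show ?thesis unfolding \<Psi>_def case_prod_beta
      by (intro borel_measurable_times borel_measurable_diff measurable_compose[OF measurable_fst gm] measurable_compose[OF measurable_snd hm]
         measurable_compose[OF _ borel_measurable_cos] borel_measurable_cos 1 measurable_compose[OF measurable_fst dot_measurable(2)])
  qed
  have \<Psi>i: "integrable (leb n \<Otimes>\<^sub>M leb n) (case_prod \<Psi>)"
  proof (rule Bochner_Integration.integrable_bound[OF _ \<Psi>m])
    have hi: "integrable (leb n) (\<lambda>z. h (emb n z) * 1)" by (intro C0_inf_integrable h) auto
    show "integrable (leb n \<Otimes>\<^sub>M leb n) (\<lambda>p. gauss n (\<lambda>i. e * fst p i) * h (emb n (snd p)))"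
    proof (rule P.Fubini_integrable)
      show "(\<lambda>p. gauss n (\<lambda>i. e * fst p i) * h (emb n (snd p))) \<in> borel_measurable (leb n \<Otimes>\<^sub>M leb n)"
        by (intro borel_measurable_times measurable_compose[OF measurable_fst gm] measurable_compose[OF measurable_snd hm])
      show "integrable (leb n) (\<lambda>\<xi>. \<integral>z. norm (gauss n (\<lambda>i. e * fst (\<xi>, z) i) * h (emb n (snd (\<xi>, z)))) \<partial>leb n)"
        using gi by (simp add: abs_mult abs_of_nonneg[OF gauss_nonneg])
      show "AE \<xi> in leb n. integrable (leb n) (\<lambda>z. gauss n (\<lambda>i. e * fst (\<xi>, z) i) * h (emb n (snd (\<xi>, z))))"
        using hi by (intro AE_I2) simp
    qed
    show "AE p in leb n \<Otimes>\<^sub>M leb n. norm (case_prod \<Psi> p) \<le> norm (gauss n (\<lambda>i. e * fst p i) * h (emb n (snd p)))"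
      by (intro AE_I2) (auto simp: \<Psi>_def abs_mult case_prod_beta intro!: mult_left_mono mult_left_le)
  qed
  have "(\<integral>\<xi>. gauss n (\<lambda>i. e * \<xi> i) * Gx n h x \<xi> \<partial>leb n) = (\<integral>\<xi>. (\<integral>z. \<Psi> \<xi> z \<partial>leb n) \<partial>leb n)"
    by (simp add: Gx_def FT_def \<Psi>_def)
  also have "\<dots> = (\<integral>z. (\<integral>\<xi>. \<Psi> \<xi> z \<partial>leb n) \<partial>leb n)" using P.Fubini_integral[OF \<Psi>i] by simp
  also have "\<dots> = (\<integral>z. h (emb n z) * ((1/e)^n * exp (- nsq n (\<lambda>i. (z i - x i) / e) / 2)) \<partial>leb n)"
  proof (rule Bochner_Integration.integral_cong[OF refl])
    fix z
    have "(\<integral>\<xi>. \<Psi> \<xi> z \<partial>leb n) = (\<integral>\<xi>. h (emb n z) * (gauss n (\<lambda>i. e * \<xi> i) * cos (dot n \<xi> (\<lambda>i. z i - x i))) \<partial>leb n)"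
      unfolding \<Psi>_def dz by (simp add: mult_ac)
    also have "\<dots> = h (emb n z) * ((1/e)^n * exp (- nsq n (\<lambda>i. (z i - x i) / e) / 2))"
      using gauss_scaled_FT[OF e, of n "\<lambda>i. z i - x i"] by simp
    finally show "(\<integral>\<xi>. \<Psi> \<xi> z \<partial>leb n) = h (emb n z) * ((1/e)^n * exp (- nsq n (\<lambda>i. (z i - x i) / e) / 2))" .
  qed
  also have "\<dots> = e ^ n * (\<integral>w. h (emb n (\<lambda>i\<in>{..<n}. x i + e * w i)) *
      ((1/e)^n * exp (- nsq n (\<lambda>i. ((\<lambda>i\<in>{..<n}. x i + e * w i) i - x i) / e) / 2)) \<partial>leb n)"
  proof (rule integral_leb_affine[OF e])
    have "(\<lambda>z. nsq n (\<lambda>i. (z i - x i) / e)) \<in> borel_measurable (leb n)"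
      unfolding nsq_def by (intro borel_measurable_sum borel_measurable_power borel_measurable_divide borel_measurable_diff) (auto simp: leb_coord)
    thus "(\<lambda>z. h (emb n z) * ((1/e)^n * exp (- nsq n (\<lambda>i. (z i - x i) / e) / 2))) \<in> borel_measurable (leb n)"
      using hm by measurable
  qed
  also have "(\<lambda>w. h (emb n (\<lambda>i\<in>{..<n}. x i + e * w i)) * ((1/e)^n * exp (- nsq n (\<lambda>i. ((\<lambda>i\<in>{..<n}. x i + e * w i) i - x i) / e) / 2)))
     = (\<lambda>w. ((1/e)^n * sqrt (2 * pi) ^ n) * (h (emb n (\<lambda>i. x i + e * w i)) * gauss n w))"
  proof
    fix w
    have 1: "emb n (\<lambda>i\<in>{..<n}. x i + e * w i) = emb n (\<lambda>i. x i + e * w i)" by (auto simp: emb_def)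
    have 2: "nsq n (\<lambda>i. ((\<lambda>i\<in>{..<n}. x i + e * w i) i - x i) / e) = nsq n w"
      unfolding nsq_def using e by (intro sum.cong) auto
    have 3: "exp (- nsq n w / 2) = sqrt (2 * pi) ^ n * gauss n w"
      unfolding gauss_eq by (simp add: power_one_over)
    show "h (emb n (\<lambda>i\<in>{..<n}. x i + e * w i)) * ((1/e)^n * exp (- nsq n (\<lambda>i. ((\<lambda>i\<in>{..<n}. x i + e * w i) i - x i) / e) / 2))
      = ((1/e)^n * sqrt (2 * pi) ^ n) * (h (emb n (\<lambda>i. x i + e * w i)) * gauss n w)"
      unfolding 1 2 3 by simp
  qed
  finally show ?thesis using e by (simp add: power_one_over)
qed

text \<open>Both sides of \<open>gauss_pairing\<close> converge as the scale tends to 0: the left to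
  the integral of \<open>Gx\<close> times the value of the Gaussian at 0, the right to
  \<open>sqrt (2 * pi) ^ n * h x\<close>. The two normalisations combine to
  \<open>(2 * pi) ^ n\<close>.\<close>

lemma fourier_inversion:
  assumes h: "C0_inf n h" and n: "n \<ge> 1" and x: "x \<in> Rsp n"
  shows "h x = (\<integral>\<xi>. Gx n h x \<xi> / (2 * pi) ^ n \<partial>leb n)"
proof -
  define e where "e k = 1 / real (Suc k)" for k
  have e0: "e k > 0" for k by (simp add: e_def)
  have elim: "e \<longlonglongrightarrow> 0" unfolding e_def using LIMSEQ_inverse_real_of_nat by (simp add: inverse_eq_divide)
  have nsqe: "nsq n (\<lambda>i. a * \<xi> i) = a\<^sup>2 * nsq n \<xi>" for \<xi> a by (simp add: nsq_def power_mult_distrib sum_distrib_left)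
  define c where "c = (1 / sqrt (2 * pi)) ^ n"
  have c0: "c > 0" by (simp add: c_def)
  have l1: "(\<lambda>k. \<integral>\<xi>. gauss n (\<lambda>i. e k * \<xi> i) * Gx n h x \<xi> \<partial>leb n) \<longlonglongrightarrow> (\<integral>\<xi>. c * Gx n h x \<xi> \<partial>leb n)"
  proof (rule integral_dominated_convergence[where w = "\<lambda>\<xi>. c * \<bar>Gx n h x \<xi>\<bar>"])
    show "integrable (leb n) (\<lambda>\<xi>. c * \<bar>Gx n h x \<xi>\<bar>)" using Gx_integrable[OF h n, of x] by simp
    show "AE \<xi> in leb n. (\<lambda>k. gauss n (\<lambda>i. e k * \<xi> i) * Gx n h x \<xi>) \<longlonglongrightarrow> c * Gx n h x \<xi>"
    proof (intro AE_I2)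
      fix \<xi>
      have "(\<lambda>k. c * exp (- ((e k)\<^sup>2 * nsq n \<xi>) / 2) * Gx n h x \<xi>) \<longlonglongrightarrow> c * exp (- (0\<^sup>2 * nsq n \<xi>) / 2) * Gx n h x \<xi>"
        by (intro tendsto_intros elim) simp
      thus "(\<lambda>k. gauss n (\<lambda>i. e k * \<xi> i) * Gx n h x \<xi>) \<longlonglongrightarrow> c * Gx n h x \<xi>"
        unfolding gauss_eq nsqe c_def by simp
    qed
    show "AE \<xi> in leb n. norm (gauss n (\<lambda>i. e k * \<xi> i) * Gx n h x \<xi>) \<le> c * \<bar>Gx n h x \<xi>\<bar>" for k
    proof (intro AE_I2)
      fix \<xi>
      have "gauss n (\<lambda>i. e k * \<xi> i) \<le> c * 1"
        unfolding gauss_eq nsqe c_def by (intro mult_left_mono) (auto simp: nsq_nonneg)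
      thus "norm (gauss n (\<lambda>i. e k * \<xi> i) * Gx n h x \<xi>) \<le> c * \<bar>Gx n h x \<xi>\<bar>"
        using gauss_nonneg by (simp add: abs_mult mult_right_mono)
    qed
    show "(\<lambda>\<xi>. gauss n (\<lambda>i. e k * \<xi> i) * Gx n h x \<xi>) \<in> borel_measurable (leb n)" for k
      unfolding gauss_eq nsqe using Gx_measurable[OF h, of x] by measurable
  qed (use Gx_measurable[OF h, of x] in simp)
  obtain B R where B: "B \<ge> 0" "\<And>x. x \<in> Rsp n \<Longrightarrow> \<bar>h x\<bar> \<le> B * (\<Prod>i<n. indicator {-R..R} (x i))"
    using C0_inf_bound[OF h] by metis
  have hB: "\<bar>h y\<bar> \<le> B" if "y \<in> Rsp n" for y
  proof -
    have "(\<Prod>i<n. indicator {-R..R} (y i)) \<le> (1::real)" by (intro prod_le_1) (auto simp: indicator_def)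
    thus ?thesis using B(2)[OF that] B(1) mult_left_le[of "\<Prod>i<n. indicator {-R..R} (y i)" B] by linarith
  qed
  have l2: "(\<lambda>k. \<integral>w. h (emb n (\<lambda>i. x i + e k * w i)) * gauss n w \<partial>leb n) \<longlonglongrightarrow> (\<integral>w. h x * gauss n w \<partial>leb n)"
  proof (rule integral_dominated_convergence[where w = "\<lambda>w. B * gauss n w"])
    show "integrable (leb n) (\<lambda>w. B * gauss n w)" using gauss_integrable by simp
    show "AE w in leb n. (\<lambda>k. h (emb n (\<lambda>i. x i + e k * w i)) * gauss n w) \<longlonglongrightarrow> h x * gauss n w"
    proof (intro AE_I2 tendsto_mult tendsto_const)
      fix w
      have "continuous_on UNIV (\<lambda>s. emb n (\<lambda>i. x i + s * w i))"
      proof (rule continuous_on_coordinatewise_then_product)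
        show "continuous_on UNIV (\<lambda>s. emb n (\<lambda>i. x i + s * w i) i)" for i
          by (cases "i < n") (auto simp: emb_def intro!: continuous_intros)
      qed
      hence "continuous_on UNIV (\<lambda>s. h (emb n (\<lambda>i. x i + s * w i)))"
        by (rule continuous_on_compose2[OF C0_inf_cont[OF h]]) (auto simp: emb_Rsp)
      hence "(\<lambda>k. h (emb n (\<lambda>i. x i + e k * w i))) \<longlonglongrightarrow> h (emb n (\<lambda>i. x i + 0 * w i))"
        by (rule continuous_on_tendsto_compose[OF _ elim]) auto
      thus "(\<lambda>k. h (emb n (\<lambda>i. x i + e k * w i))) \<longlonglongrightarrow> h x" using emb_id[OF x] by simp
    qed
    show "AE w in leb n. norm (h (emb n (\<lambda>i. x i + e k * w i)) * gauss n w) \<le> B * gauss n w" for k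
      using mult_right_mono[OF hB[OF emb_Rsp] gauss_nonneg]
      by (intro AE_I2) (simp add: abs_mult abs_of_nonneg[OF gauss_nonneg])
    show "(\<lambda>w. h (emb n (\<lambda>i. x i + e k * w i)) * gauss n w) \<in> borel_measurable (leb n)" for k
    proof -
      have "(\<lambda>w. h (emb n (\<lambda>i\<in>{..<n}. x i + e k * w i))) \<in> borel_measurable (leb n)"
        by (rule measurable_compose[OF leb_affine(1)[OF e0] measurable_emb[OF C0_inf_cont[OF h]]])
      moreover have "emb n (\<lambda>i\<in>{..<n}. x i + e k * w i) = emb n (\<lambda>i. x i + e k * w i)" for w by (auto simp: emb_def)
      ultimately show ?thesis by simp
    qed
  qed simp
  have "(\<lambda>k. \<integral>\<xi>. gauss n (\<lambda>i. e k * \<xi> i) * Gx n h x \<xi> \<partial>leb n) \<longlonglongrightarrow> sqrt (2 * pi) ^ n * (\<integral>w. h x * gauss n w \<partial>leb n)"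
    unfolding gauss_pairing[OF h e0 x] by (intro tendsto_intros l2)
  from LIMSEQ_unique[OF l1 this] have "c * (\<integral>\<xi>. Gx n h x \<xi> \<partial>leb n) = sqrt (2 * pi) ^ n * h x"
    by (simp add: gauss_total)
  hence "(\<integral>\<xi>. Gx n h x \<xi> \<partial>leb n) = (sqrt (2 * pi) ^ n * sqrt (2 * pi) ^ n) * h x"
    by (simp add: c_def power_one_over field_simps)
  also have "sqrt (2 * pi) ^ n * sqrt (2 * pi) ^ n = (2 * pi) ^ n"
  proof -
    have "sqrt (2 * pi) * sqrt (2 * pi) = 2 * pi" by simp
    thus ?thesis by (metis power_mult_distrib)
  qed
  finally show ?thesis by simp
qed

section \<open>A Riemann-Lebesgue lemma for dilations\<close>

abbreviation unit_leb :: "real measure" where "unit_leb \<equiv> restrict_space lborel {0..1}"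

lemma unit_leb_prob: "prob_space unit_leb"
  by (rule prob_space_restrict_space) auto

lemma unit_leb_integral:
  fixes g :: "real \<Rightarrow> real"
  shows "(\<integral>r. g r \<partial>unit_leb) = (\<integral>r. g r * indicator {0..1} r \<partial>lborel)"
  by (subst integral_restrict_space) (auto simp: mult.commute)

lemma leb_nonzero: assumes "n \<ge> 1" shows "AE \<xi> in leb n. nsq n \<xi> > 0"
proof -
  have "emeasure (leb n) (Pi\<^sub>E {..<n} (\<lambda>i. if i = 0 then {0} else UNIV)) =
      (\<Prod>i<n. emeasure lborel (if i = 0 then {0::real} else UNIV))"
    by (rule lborel_prod.emeasure_PiM) auto
  also have "\<dots> = 0" using assms by (intro prod_zero) (auto intro!: bexI[of _ 0])
  finally have 0: "emeasure (leb n) (Pi\<^sub>E {..<n} (\<lambda>i. if i = 0 then {0} else UNIV)) = 0" .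
  show ?thesis
  proof (rule AE_I[OF _ 0])
    show "Pi\<^sub>E {..<n} (\<lambda>i. if i = 0 then {0} else UNIV) \<in> sets (leb n)" by (rule sets_PiM_I_finite) auto
    show "{\<xi> \<in> space (leb n). \<not> 0 < nsq n \<xi>} \<subseteq> Pi\<^sub>E {..<n} (\<lambda>i. if i = 0 then {0} else UNIV)"
    proof
      fix \<xi> assume \<xi>: "\<xi> \<in> {\<xi> \<in> space (leb n). \<not> 0 < nsq n \<xi>}"
      have "(\<xi> 0)\<^sup>2 \<le> nsq n \<xi>" using assms by (intro coord_le_nsq) auto
      hence "\<xi> 0 = 0" using \<xi> by (auto simp: not_less) (metis order_trans power2_less_eq_zero_iff)
      thus "\<xi> \<in> Pi\<^sub>E {..<n} (\<lambda>i. if i = 0 then {0} else UNIV)" using \<xi> by (auto simp: space_PiM PiE_iff)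
    qed
  qed
qed

text \<open>Factors in \<open>{1..2}\<close> only push the argument outwards, so the decay bound of
  \<open>G\<close> also controls the dilated function and supplies the majorant \<open>w\<close>;
  pointwise convergence is continuity of \<open>G\<close>.\<close>

lemma dilation_L1_continuous:
  fixes G :: "(nat \<Rightarrow> real) \<Rightarrow> real"
  assumes G: "continuous_on UNIV G" "\<And>\<xi>. G (emb n \<xi>) = G \<xi>"
    and D: "\<And>\<xi>. (1 + nsq n \<xi>) ^ n * \<bar>G \<xi>\<bar> \<le> D" and X: "X \<longlonglongrightarrow> 1" and X1: "\<And>i. X i \<in> {1..2}"
  shows "(\<lambda>i. \<integral>\<xi>. \<bar>X i ^ n * G (\<lambda>j. X i * \<xi> j) - G \<xi>\<bar> \<partial>leb n) \<longlonglongrightarrow> 0"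
proof -
  have nsqa: "nsq n (\<lambda>i. a * \<xi> i) = a\<^sup>2 * nsq n \<xi>" for \<xi> a by (simp add: nsq_def power_mult_distrib sum_distrib_left)
  have Gm: "(\<lambda>\<xi>. G (\<lambda>j. a * \<xi> j)) \<in> borel_measurable (leb n)" for a
  proof (rule measurable_of_continuous)
    have "continuous_on UNIV (\<lambda>\<xi>::nat\<Rightarrow>real. (\<lambda>j. a * \<xi> j))"
      by (rule continuous_on_coordinatewise_then_product) (intro continuous_intros continuous_on_coord)
    thus "continuous_on UNIV (\<lambda>\<xi>. G (\<lambda>j. a * \<xi> j))" by (rule continuous_on_compose2[OF G(1)]) auto
    show "G (\<lambda>j. a * emb n \<xi> j) = G (\<lambda>j. a * \<xi> j)" for \<xi>
    proof -
      have "(\<lambda>j. a * emb n \<xi> j) = emb n (\<lambda>j. a * \<xi> j)" by (auto simp: emb_def)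
      thus ?thesis using G(2) by simp
    qed
  qed
  have Gm1: "G \<in> borel_measurable (leb n)" using Gm[of 1] by simp
  define w where "w \<xi> = (2 ^ n + 1) * D / (1 + nsq n \<xi>) ^ n" for \<xi>
  have pos: "(1 + nsq n \<xi>) ^ n > 0" for \<xi> using nsq_nonneg[of n \<xi>] by (intro zero_less_power) linarith
  have "(\<lambda>i. \<integral>\<xi>. \<bar>X i ^ n * G (\<lambda>j. X i * \<xi> j) - G \<xi>\<bar> \<partial>leb n) \<longlonglongrightarrow> (\<integral>\<xi>. 0 \<partial>leb n)"
  proof (rule integral_dominated_convergence)
    show "integrable (leb n) w"
    proof (rule integrable_decay)
      show "w \<in> borel_measurable (leb n)" unfolding w_def by measurable
      show "(1 + nsq n \<xi>) ^ n * \<bar>w \<xi>\<bar> \<le> \<bar>(2 ^ n + 1) * D\<bar>" for \<xi>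
        using pos[of \<xi>] by (simp add: w_def abs_mult)
    qed
    show "AE \<xi> in leb n. (\<lambda>i. \<bar>X i ^ n * G (\<lambda>j. X i * \<xi> j) - G \<xi>\<bar>) \<longlonglongrightarrow> 0"
    proof (intro AE_I2)
      fix \<xi> :: "nat \<Rightarrow> real"
      have "continuous_on UNIV (\<lambda>a::real. (\<lambda>j. a * \<xi> j))"
        by (rule continuous_on_coordinatewise_then_product) (intro continuous_intros)
      hence "continuous_on UNIV (\<lambda>a. G (\<lambda>j. a * \<xi> j))" by (rule continuous_on_compose2[OF G(1)]) auto
      hence "(\<lambda>i. G (\<lambda>j. X i * \<xi> j)) \<longlonglongrightarrow> G (\<lambda>j. 1 * \<xi> j)"
        by (rule continuous_on_tendsto_compose[OF _ X]) auto
      hence "(\<lambda>i. \<bar>X i ^ n * G (\<lambda>j. X i * \<xi> j) - G \<xi>\<bar>) \<longlonglongrightarrow> \<bar>1 ^ n * G (\<lambda>j. 1 * \<xi> j) - G \<xi>\<bar>"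
        by (intro tendsto_intros X)
      thus "(\<lambda>i. \<bar>X i ^ n * G (\<lambda>j. X i * \<xi> j) - G \<xi>\<bar>) \<longlonglongrightarrow> 0" by simp
    qed
    show "AE \<xi> in leb n. norm \<bar>X i ^ n * G (\<lambda>j. X i * \<xi> j) - G \<xi>\<bar> \<le> w \<xi>" for i
    proof (intro AE_I2)
      fix \<xi>
      have "\<bar>G \<xi>\<bar> \<le> D / (1 + nsq n \<xi>) ^ n" using D[of \<xi>] pos[of \<xi>] by (simp add: field_simps)
      moreover have "\<bar>G (\<lambda>j. X i * \<xi> j)\<bar> \<le> D / (1 + nsq n \<xi>) ^ n"
      proof -
        have "1 \<le> (X i)\<^sup>2" using X1[of i] by (auto simp: one_le_power)
        hence "1 * nsq n \<xi> \<le> (X i)\<^sup>2 * nsq n \<xi>" using nsq_nonneg by (intro mult_right_mono) auto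
        hence "(1 + nsq n \<xi>) ^ n \<le> (1 + nsq n (\<lambda>j. X i * \<xi> j)) ^ n"
          using nsq_nonneg[of n \<xi>] by (intro power_mono) (auto simp: nsqa)
        hence "(1 + nsq n \<xi>) ^ n * \<bar>G (\<lambda>j. X i * \<xi> j)\<bar> \<le> (1 + nsq n (\<lambda>j. X i * \<xi> j)) ^ n * \<bar>G (\<lambda>j. X i * \<xi> j)\<bar>"
          by (intro mult_right_mono) auto
        also have "\<dots> \<le> D" by (rule D)
        finally show ?thesis using pos[of \<xi>] by (simp add: field_simps)
      qed
      moreover have "X i ^ n \<le> 2 ^ n" "X i ^ n \<ge> 0" using X1[of i] by (auto intro!: power_mono)
      ultimately have "X i ^ n * \<bar>G (\<lambda>j. X i * \<xi> j)\<bar> \<le> 2 ^ n * (D / (1 + nsq n \<xi>) ^ n)"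
        by (intro mult_mono) auto
      hence "\<bar>X i ^ n * G (\<lambda>j. X i * \<xi> j)\<bar> \<le> 2 ^ n * (D / (1 + nsq n \<xi>) ^ n)"
        unfolding abs_mult abs_of_nonneg[OF \<open>X i ^ n \<ge> 0\<close>] .
      hence "\<bar>X i ^ n * G (\<lambda>j. X i * \<xi> j) - G \<xi>\<bar> \<le> 2 ^ n * (D / (1 + nsq n \<xi>) ^ n) + D / (1 + nsq n \<xi>) ^ n"
        using \<open>\<bar>G \<xi>\<bar> \<le> D / (1 + nsq n \<xi>) ^ n\<close> abs_triangle_ineq4[of "X i ^ n * G (\<lambda>j. X i * \<xi> j)" "G \<xi>"] by linarith
      thus "norm \<bar>X i ^ n * G (\<lambda>j. X i * \<xi> j) - G \<xi>\<bar> \<le> w \<xi>" by (simp add: w_def distrib_right add_divide_distrib)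
    qed
  qed (use Gm Gm1 in auto)
  thus ?thesis by simp
qed

lemma dilation_average:
  fixes \<phi> :: "real \<Rightarrow> real"
  assumes \<phi>: "continuous_on UNIV \<phi>" and \<delta>: "\<delta> > 0" and Y: "Y > 0"
  shows "(\<integral>r. \<phi> (Y * (1 + \<delta> * r)) \<partial>unit_leb)
     = (integral {0..Y * (1 + \<delta>)} \<phi> - integral {0..Y} \<phi>) / (\<delta> * Y)"
proof -
  define F where "F y = integral {0..y} \<phi>" for y
  have F': "(F has_real_derivative \<phi> y) (at y)" if "y > 0" for y
  proof -
    have "(F has_real_derivative \<phi> y) (at y within {0..y+1})"
      unfolding F_def by (rule integral_has_real_derivative) (use \<phi> that continuous_on_subset in auto)
    moreover have "at y within {0..y+1} = at y" using that by (intro at_within_interior) auto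
    ultimately show ?thesis by simp
  qed
  have der: "((\<lambda>r. F (Y * (1 + \<delta> * r)) / (\<delta> * Y)) has_real_derivative \<phi> (Y * (1 + \<delta> * r))) (at r)" if r: "r \<ge> 0" for r
  proof -
    have p: "Y * (1 + \<delta> * r) > 0" using Y \<delta> r by (intro mult_pos_pos add_pos_nonneg) auto
    have i: "((\<lambda>r. Y * (1 + \<delta> * r)) has_real_derivative (Y * \<delta>)) (at r)"
      by (rule derivative_eq_intros refl | simp)+
    have "((\<lambda>r. F (Y * (1 + \<delta> * r)) / (\<delta> * Y)) has_real_derivative \<phi> (Y * (1 + \<delta> * r)) * (Y * \<delta>) / (\<delta> * Y)) (at r)"
      by (intro DERIV_cdivide DERIV_chain2[OF F'[OF p] i])
    thus ?thesis using Y \<delta> by simp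
  qed
  have "(\<integral>r. \<phi> (Y * (1 + \<delta> * r)) * indicator {0..1} r \<partial>lborel) = F (Y * (1 + \<delta> * 1)) / (\<delta> * Y) - F (Y * (1 + \<delta> * 0)) / (\<delta> * Y)"
  proof (rule integral_FTC_Icc_real)
    show "isCont (\<lambda>r. \<phi> (Y * (1 + \<delta> * r))) r" for r
    proof -
      have "continuous_on UNIV (\<lambda>r. \<phi> (Y * (1 + \<delta> * r)))"
        by (rule continuous_on_compose2[OF \<phi>]) (auto intro!: continuous_intros)
      thus ?thesis by (simp add: continuous_on_eq_continuous_at)
    qed
  qed (use der in auto)
  thus ?thesis unfolding unit_leb_integral F_def by (simp add: diff_divide_distrib)
qed

text \<open>The integrand oscillates only through the length of \<open>\<xi>\<close>, and of
  \<open>\<phi>\<close> only a vanishing mean is known. A dilation by a factor \<open>a\<close> near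
  1 changes \<open>G\<close> little in the mean, so the integral may be averaged over
  \<open>a\<close> in \<open>[1, 1 + \<delta>]\<close>. The average turns \<open>\<phi>\<close> into
  its mean over a long interval, which tends to 0.\<close>

lemma riemann_lebesgue:
  fixes G :: "(nat \<Rightarrow> real) \<Rightarrow> real" and \<phi> :: "real \<Rightarrow> real"
  assumes n: "n \<ge> 1" and G: "continuous_on UNIV G" "\<And>\<xi>. G (emb n \<xi>) = G \<xi>"
    and D: "\<And>\<xi>. (1 + nsq n \<xi>) ^ n * \<bar>G \<xi>\<bar> \<le> D"
    and \<phi>: "continuous_on UNIV \<phi>" "\<And>x. \<bar>\<phi> x\<bar> \<le> C"
    and mean: "((\<lambda>y. integral {0..y} \<phi> / y) \<longlongrightarrow> 0) at_top"
    and X: "filterlim X at_top sequentially"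
  shows "(\<lambda>i. \<integral>\<xi>. G \<xi> * \<phi> (X i * sqrt (nsq n \<xi>)) \<partial>leb n) \<longlonglongrightarrow> 0"
proof (rule LIMSEQ_I)
  fix \<epsilon> :: real assume \<epsilon>: "\<epsilon> > 0"
  have C0: "C \<ge> 0" using \<phi>(2)[of 0] by linarith
  interpret L: sigma_finite_measure "leb n" by (rule leb_sigma_finite)
  interpret U: prob_space unit_leb by (rule unit_leb_prob)
  interpret P: pair_sigma_finite "leb n" unit_leb ..
  have [simp]: "U.prob {0..1} = 1" using U.prob_space by simp
  have nsqa: "nsq n (\<lambda>i. a * \<xi> i) = a\<^sup>2 * nsq n \<xi>" for \<xi> a by (simp add: nsq_def power_mult_distrib sum_distrib_left)
  have Gm: "G \<in> borel_measurable (leb n)" using G by (rule measurable_of_continuous)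
  have Gi: "integrable (leb n) G" using Gm D by (rule integrable_decay)
  have \<phi>m: "\<phi> \<in> borel_measurable borel" using \<phi>(1) by (rule borel_measurable_continuous_onI)
  define N where "N a = (\<integral>\<xi>. \<bar>a ^ n * G (\<lambda>j. a * \<xi> j) - G \<xi>\<bar> \<partial>leb n)" for a
  \<comment> \<open>The range of dilations is fixed before \<open>i\<close> grows:
    \<open>C * N a\<close> bounds the error caused by the factor \<open>a\<close> for every
    \<open>i\<close>. If no \<open>\<delta>\<close> worked, there would be factors tending to 1 that
    contradict \<open>dilation_L1_continuous\<close>.\<close>
  have "\<exists>\<delta>>0. \<delta> \<le> 1 \<and> (\<forall>a\<in>{1..1+\<delta>}. C * N a < \<epsilon> / 2)"
  proof (rule ccontr)
    assume neg: "\<not> ?thesis"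
    have "\<exists>a. a \<in> {1..1 + 1 / real (Suc i)} \<and> C * N a \<ge> \<epsilon> / 2" for i
    proof -
      have "1 / real (Suc i) > 0" "1 / real (Suc i) \<le> 1" by auto
      thus ?thesis using neg by (meson not_le)
    qed
    then obtain a where a: "\<And>i. a i \<in> {1..1 + 1 / real (Suc i)}" "\<And>i. C * N (a i) \<ge> \<epsilon> / 2" by metis
    have "a \<longlonglongrightarrow> 1"
    proof (rule tendsto_sandwich[of "\<lambda>_. 1" _ _ "\<lambda>i. 1 + 1 / real (Suc i)"])
      show "(\<lambda>i. 1 + 1 / real (Suc i)) \<longlonglongrightarrow> 1" using LIMSEQ_inverse_real_of_nat_add[of 1] by (simp add: inverse_eq_divide)
    qed (use a(1) in \<open>auto intro!: always_eventually\<close>)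
    moreover have "a i \<in> {1..2}" for i
    proof -
      have "1 / real (Suc i) \<le> 1" by simp
      thus ?thesis using a(1)[of i] unfolding atLeastAtMost_iff by linarith
    qed
    ultimately have "(\<lambda>i. N (a i)) \<longlonglongrightarrow> 0" unfolding N_def by (intro dilation_L1_continuous[OF G D])
    hence "(\<lambda>i. C * N (a i)) \<longlonglongrightarrow> C * 0" by (intro tendsto_intros)
    hence "\<epsilon> / 2 \<le> C * 0" by (rule LIMSEQ_le_const) (use a(2) in auto)
    thus False using \<epsilon> by simp
  qed
  then obtain \<delta> where \<delta>: "\<delta> > 0" "\<delta> \<le> 1" "\<And>a. a \<in> {1..1+\<delta>} \<Longrightarrow> C * N a < \<epsilon> / 2" by auto
  define I where "I i = (\<integral>\<xi>. G \<xi> * \<phi> (X i * sqrt (nsq n \<xi>)) \<partial>leb n)" for i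
  define H where "H i a = (\<integral>\<xi>. G \<xi> * \<phi> (X i * sqrt (nsq n \<xi>) * a) \<partial>leb n)" for i a
  define A where "A i \<xi> = (\<integral>r. \<phi> (X i * sqrt (nsq n \<xi>) * (1 + \<delta> * r)) \<partial>unit_leb)" for i \<xi>
  have Gma: "(\<lambda>\<xi>. G (\<lambda>j. a * \<xi> j)) \<in> borel_measurable (leb n)" for a
  proof -
    have 1: "(\<lambda>\<xi>. (\<lambda>j. a * emb n \<xi> j)) \<in> borel_measurable (leb n)"
    proof (rule measurable_coordinatewise_then_product)
      show "(\<lambda>\<xi>. a * emb n \<xi> j) \<in> borel_measurable (leb n)" for j
        by (cases "j < n") (auto simp: emb_def leb_coord)
    qed
    have "(\<lambda>j. a * emb n \<xi> j) = emb n (\<lambda>j. a * \<xi> j)" for \<xi> by (auto simp: emb_def)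
    hence eq: "G (\<lambda>j. a * \<xi> j) = G (\<lambda>j. a * emb n \<xi> j)" for \<xi> using G(2) by simp
    show ?thesis
      by (subst measurable_cong[OF eq]) (rule measurable_compose[OF 1 borel_measurable_continuous_onI[OF G(1)]])
  qed
  have im: "(\<lambda>\<xi>. \<phi> (X i * sqrt (nsq n \<xi>) * a)) \<in> borel_measurable (leb n)" for i a
    by (rule measurable_compose[OF _ \<phi>m]) measurable
  have close: "\<bar>I i - H i a\<bar> \<le> \<epsilon> / 2" if a: "a \<in> {1..1+\<delta>}" for i a
  proof -
    have a0: "a > 0" using a by auto
    have "I i = a ^ n * (\<integral>\<xi>. G (\<lambda>j\<in>{..<n}. 0 + a * \<xi> j) * \<phi> (X i * sqrt (nsq n (\<lambda>j\<in>{..<n}. 0 + a * \<xi> j))) \<partial>leb n)"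
      unfolding I_def using Gm im[of i 1] by (intro integral_leb_affine[OF a0]) simp
    also have "(\<lambda>\<xi>. G (\<lambda>j\<in>{..<n}. 0 + a * \<xi> j) * \<phi> (X i * sqrt (nsq n (\<lambda>j\<in>{..<n}. 0 + a * \<xi> j))))
       = (\<lambda>\<xi>. G (\<lambda>j. a * \<xi> j) * \<phi> (X i * sqrt (nsq n \<xi>) * a))"
    proof
      fix \<xi>
      have "emb n (\<lambda>j\<in>{..<n}. 0 + a * \<xi> j) = emb n (\<lambda>j. a * \<xi> j)" by (auto simp: emb_def)
      hence 1: "G (\<lambda>j\<in>{..<n}. 0 + a * \<xi> j) = G (\<lambda>j. a * \<xi> j)" by (metis G(2))
      have "nsq n (\<lambda>j\<in>{..<n}. 0 + a * \<xi> j) = nsq n (\<lambda>j. a * \<xi> j)" unfolding nsq_def by (rule sum.cong) auto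
      hence 2: "sqrt (nsq n (\<lambda>j\<in>{..<n}. 0 + a * \<xi> j)) = a * sqrt (nsq n \<xi>)" using a0 by (simp add: nsqa real_sqrt_mult)
      show "G (\<lambda>j\<in>{..<n}. 0 + a * \<xi> j) * \<phi> (X i * sqrt (nsq n (\<lambda>j\<in>{..<n}. 0 + a * \<xi> j)))
        = G (\<lambda>j. a * \<xi> j) * \<phi> (X i * sqrt (nsq n \<xi>) * a)" unfolding 1 2 by (simp add: mult_ac)
    qed
    finally have I: "I i = (\<integral>\<xi>. a ^ n * G (\<lambda>j. a * \<xi> j) * \<phi> (X i * sqrt (nsq n \<xi>) * a) \<partial>leb n)" by (simp add: mult_ac)
    have b: "integrable (leb n) (\<lambda>\<xi>. F \<xi> * \<phi> (X i * sqrt (nsq n \<xi>) * a))" if "integrable (leb n) F" for F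
    proof (rule Bochner_Integration.integrable_bound)
      show "integrable (leb n) (\<lambda>\<xi>. C * F \<xi>)" using that by simp
      show "AE \<xi> in leb n. norm (F \<xi> * \<phi> (X i * sqrt (nsq n \<xi>) * a)) \<le> norm (C * F \<xi>)"
      proof (intro AE_I2)
        fix \<xi>
        have "\<bar>F \<xi>\<bar> * \<bar>\<phi> (X i * sqrt (nsq n \<xi>) * a)\<bar> \<le> \<bar>F \<xi>\<bar> * C" using \<phi>(2) by (intro mult_left_mono) auto
        thus "norm (F \<xi> * \<phi> (X i * sqrt (nsq n \<xi>) * a)) \<le> norm (C * F \<xi>)" using C0 by (simp add: abs_mult mult.commute)
      qed
    qed (use that im in auto)
    have Gai: "integrable (leb n) (\<lambda>\<xi>. a ^ n * G (\<lambda>j. a * \<xi> j))"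
    proof (intro integrable_mult_right integrable_decay)
      show "(1 + nsq n \<xi>) ^ n * \<bar>G (\<lambda>j. a * \<xi> j)\<bar> \<le> D" for \<xi>
      proof -
        have "1 \<le> a\<^sup>2" using a by (auto simp: one_le_power)
        hence "1 * nsq n \<xi> \<le> a\<^sup>2 * nsq n \<xi>" using nsq_nonneg by (intro mult_right_mono) auto
        hence "(1 + nsq n \<xi>) ^ n \<le> (1 + nsq n (\<lambda>j. a * \<xi> j)) ^ n"
          using nsq_nonneg[of n \<xi>] by (intro power_mono) (auto simp: nsqa)
        hence "(1 + nsq n \<xi>) ^ n * \<bar>G (\<lambda>j. a * \<xi> j)\<bar> \<le> (1 + nsq n (\<lambda>j. a * \<xi> j)) ^ n * \<bar>G (\<lambda>j. a * \<xi> j)\<bar>"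
          by (intro mult_right_mono) auto
        also have "\<dots> \<le> D" by (rule D)
        finally show ?thesis .
      qed
    qed (rule Gma)
    have "I i - H i a = (\<integral>\<xi>. a ^ n * G (\<lambda>j. a * \<xi> j) * \<phi> (X i * sqrt (nsq n \<xi>) * a) - G \<xi> * \<phi> (X i * sqrt (nsq n \<xi>) * a) \<partial>leb n)"
      unfolding I H_def by (rule Bochner_Integration.integral_diff[symmetric, OF b[OF Gai] b[OF Gi]])
    hence "\<bar>I i - H i a\<bar> \<le> (\<integral>\<xi>. \<bar>a ^ n * G (\<lambda>j. a * \<xi> j) * \<phi> (X i * sqrt (nsq n \<xi>) * a) - G \<xi> * \<phi> (X i * sqrt (nsq n \<xi>) * a)\<bar> \<partial>leb n)"
      by simp
    also have "\<dots> \<le> (\<integral>\<xi>. C * \<bar>a ^ n * G (\<lambda>j. a * \<xi> j) - G \<xi>\<bar> \<partial>leb n)"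
    proof (rule integral_mono)
      show "integrable (leb n) (\<lambda>\<xi>. \<bar>a ^ n * G (\<lambda>j. a * \<xi> j) * \<phi> (X i * sqrt (nsq n \<xi>) * a) - G \<xi> * \<phi> (X i * sqrt (nsq n \<xi>) * a)\<bar>)"
        by (intro integrable_abs Bochner_Integration.integrable_diff b Gai Gi)
      show "integrable (leb n) (\<lambda>\<xi>. C * \<bar>a ^ n * G (\<lambda>j. a * \<xi> j) - G \<xi>\<bar>)"
        by (intro integrable_mult_right integrable_abs Bochner_Integration.integrable_diff Gai Gi)
      fix \<xi>
      have "\<bar>a ^ n * G (\<lambda>j. a * \<xi> j) - G \<xi>\<bar> * \<bar>\<phi> (X i * sqrt (nsq n \<xi>) * a)\<bar> \<le> \<bar>a ^ n * G (\<lambda>j. a * \<xi> j) - G \<xi>\<bar> * C"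
        using \<phi>(2) by (intro mult_left_mono) auto
      thus "\<bar>a ^ n * G (\<lambda>j. a * \<xi> j) * \<phi> (X i * sqrt (nsq n \<xi>) * a) - G \<xi> * \<phi> (X i * sqrt (nsq n \<xi>) * a)\<bar>
         \<le> C * \<bar>a ^ n * G (\<lambda>j. a * \<xi> j) - G \<xi>\<bar>"
        by (simp only: left_diff_distrib[symmetric] abs_mult mult.commute[of C])
    qed
    also have "\<dots> = C * N a" by (simp add: N_def)
    finally show ?thesis using \<delta>(3)[OF a] by simp
  qed
  have jm: "(\<lambda>p. G (fst p) * \<phi> (X i * sqrt (nsq n (fst p)) * (1 + \<delta> * snd p))) \<in> borel_measurable (leb n \<Otimes>\<^sub>M unit_leb)" for i
  proof -
    have [measurable]: "(\<lambda>r::real. r) \<in> borel_measurable unit_leb" by (simp add: borel_measurable_restrict_space_iff)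
    have 1: "(\<lambda>p. X i * sqrt (nsq n (fst p)) * (1 + \<delta> * snd p)) \<in> borel_measurable (leb n \<Otimes>\<^sub>M unit_leb)"
      by (intro borel_measurable_times borel_measurable_add borel_measurable_const measurable_compose[OF measurable_snd]
          measurable_compose[OF measurable_compose[OF measurable_fst nsq_measurable] borel_measurable_sqrt]) auto
    show ?thesis
      by (intro borel_measurable_times measurable_compose[OF measurable_fst Gm] measurable_compose[OF 1 \<phi>m])
  qed
  have ji: "integrable (leb n \<Otimes>\<^sub>M unit_leb) (\<lambda>p. G (fst p) * \<phi> (X i * sqrt (nsq n (fst p)) * (1 + \<delta> * snd p)))" for i
  proof (rule Bochner_Integration.integrable_bound[OF _ jm])
    show "integrable (leb n \<Otimes>\<^sub>M unit_leb) (\<lambda>p. C * G (fst p))"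
      by (rule P.Fubini_integrable) (use Gi Gm in \<open>auto simp: abs_mult\<close>)
    show "AE p in leb n \<Otimes>\<^sub>M unit_leb. norm (G (fst p) * \<phi> (X i * sqrt (nsq n (fst p)) * (1 + \<delta> * snd p))) \<le> norm (C * G (fst p))"
      using \<phi>(2) C0 by (intro AE_I2) (auto simp: abs_mult mult.commute[of C] intro!: mult_left_mono)
  qed
  \<comment> \<open>Fubini's theorem moves the average over dilations onto \<open>\<phi>\<close>
    alone.\<close>
  have avg: "(\<integral>r. H i (1 + \<delta> * r) \<partial>unit_leb) = (\<integral>\<xi>. G \<xi> * A i \<xi> \<partial>leb n)"
    and Hi: "integrable unit_leb (\<lambda>r. H i (1 + \<delta> * r))" for i
  proof -
    let ?f = "\<lambda>\<xi> r. G \<xi> * \<phi> (X i * sqrt (nsq n \<xi>) * (1 + \<delta> * r))"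
    have i: "integrable (leb n \<Otimes>\<^sub>M unit_leb) (case_prod ?f)" unfolding case_prod_beta' by (rule ji)
    show "(\<integral>r. H i (1 + \<delta> * r) \<partial>unit_leb) = (\<integral>\<xi>. G \<xi> * A i \<xi> \<partial>leb n)"
      using P.Fubini_integral[OF i] by (simp add: H_def A_def)
    show "integrable unit_leb (\<lambda>r. H i (1 + \<delta> * r))" unfolding H_def using P.integrable_snd[OF i] by simp
  qed
  have near: "\<bar>I i - (\<integral>\<xi>. G \<xi> * A i \<xi> \<partial>leb n)\<bar> \<le> \<epsilon> / 2" for i
  proof -
    have "I i - (\<integral>\<xi>. G \<xi> * A i \<xi> \<partial>leb n) = (\<integral>r. I i - H i (1 + \<delta> * r) \<partial>unit_leb)"
      using Hi[of i] by (simp add: avg[symmetric] U.prob_space)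
    also have "\<bar>\<dots>\<bar> \<le> (\<integral>r. \<bar>I i - H i (1 + \<delta> * r)\<bar> \<partial>unit_leb)" by (rule integral_abs_bound)
    also have "\<dots> \<le> (\<integral>r. \<epsilon> / 2 \<partial>unit_leb)"
    proof (rule integral_mono)
      show "integrable unit_leb (\<lambda>r. \<bar>I i - H i (1 + \<delta> * r)\<bar>)" using Hi[of i] by simp
      fix r assume "r \<in> space unit_leb"
      hence "1 + \<delta> * r \<in> {1..1+\<delta>}" using \<delta> by (auto simp: mult_left_le)
      thus "\<bar>I i - H i (1 + \<delta> * r)\<bar> \<le> \<epsilon> / 2" by (rule close)
    qed simp
    finally show ?thesis by (simp add: U.prob_space)
  qed
  have "(\<lambda>i. \<integral>\<xi>. G \<xi> * A i \<xi> \<partial>leb n) \<longlonglongrightarrow> (\<integral>\<xi>. G \<xi> * 0 \<partial>leb n)"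
  proof (rule integral_dominated_convergence[where w = "\<lambda>\<xi>. C * \<bar>G \<xi>\<bar>"])
    show "integrable (leb n) (\<lambda>\<xi>. C * \<bar>G \<xi>\<bar>)" using Gi by simp
    show "(\<lambda>\<xi>. G \<xi> * A i \<xi>) \<in> borel_measurable (leb n)" for i
    proof -
      have "(\<lambda>\<xi>. \<integral>r. G \<xi> * \<phi> (X i * sqrt (nsq n \<xi>) * (1 + \<delta> * r)) \<partial>unit_leb) \<in> borel_measurable (leb n)"
        by (intro U.borel_measurable_lebesgue_integral) (unfold case_prod_beta', rule jm)
      thus ?thesis by (simp add: A_def)
    qed
    show "AE \<xi> in leb n. norm (G \<xi> * A i \<xi>) \<le> C * \<bar>G \<xi>\<bar>" for i
    proof (intro AE_I2)
      fix \<xi>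
      have "\<bar>A i \<xi>\<bar> \<le> C"
      proof -
        have c: "continuous_on UNIV (\<lambda>r. \<phi> (X i * sqrt (nsq n \<xi>) * (1 + \<delta> * r)))"
          by (rule continuous_on_compose2[OF \<phi>(1)]) (auto intro!: continuous_intros)
        have m: "(\<lambda>r. \<phi> (X i * sqrt (nsq n \<xi>) * (1 + \<delta> * r))) \<in> borel_measurable unit_leb"
          using borel_measurable_continuous_onI[OF c] by (intro measurable_restrict_space1) simp
        have "\<bar>A i \<xi>\<bar> \<le> (\<integral>r. \<bar>\<phi> (X i * sqrt (nsq n \<xi>) * (1 + \<delta> * r))\<bar> \<partial>unit_leb)" unfolding A_def by (rule integral_abs_bound)
        also have "\<dots> \<le> (\<integral>r. C \<partial>unit_leb)"
          using m \<phi>(2) C0 by (intro integral_mono integrable_abs U.integrable_const_bound[of _ C]) auto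
        finally show ?thesis by (simp add: U.prob_space)
      qed
      hence "\<bar>G \<xi>\<bar> * \<bar>A i \<xi>\<bar> \<le> \<bar>G \<xi>\<bar> * C" by (intro mult_left_mono) auto
      thus "norm (G \<xi> * A i \<xi>) \<le> C * \<bar>G \<xi>\<bar>" by (simp add: abs_mult mult.commute)
    qed
    show "AE \<xi> in leb n. (\<lambda>i. G \<xi> * A i \<xi>) \<longlonglongrightarrow> G \<xi> * 0"
    \<comment> \<open>At \<open>\<xi> = 0\<close> the argument of \<open>\<phi>\<close> would not
      move with \<open>i\<close>; this is a null set.\<close>
    proof (rule AE_mp[OF leb_nonzero[OF n]], intro AE_I2 impI tendsto_mult tendsto_const)
      fix \<xi> assume q: "nsq n \<xi> > 0"
      define Y where "Y i = sqrt (nsq n \<xi>) * X i" for i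
      have Yl: "filterlim Y at_top sequentially" unfolding Y_def
        using q by (intro filterlim_tendsto_pos_mult_at_top[OF tendsto_const _ X]) auto
      have Yl': "filterlim (\<lambda>i. (1 + \<delta>) * Y i) at_top sequentially"
        using \<delta> by (intro filterlim_tendsto_pos_mult_at_top[OF tendsto_const _ Yl]) auto
      let ?M = "\<lambda>y. integral {0..y} \<phi> / y"
      \<comment> \<open>The mean over \<open>[Y, (1 + \<delta>) Y]\<close> is a fixed linear
        combination of the means over \<open>[0, (1 + \<delta>) Y]\<close> and
        \<open>[0, Y]\<close>, both of which tend to 0.\<close>
      have "(\<lambda>i. (1 + \<delta>) / \<delta> * ?M ((1 + \<delta>) * Y i) - 1 / \<delta> * ?M (Y i)) \<longlonglongrightarrow> (1 + \<delta>) / \<delta> * 0 - 1 / \<delta> * 0"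
        by (intro tendsto_intros filterlim_compose[OF mean] Yl Yl')
      hence l: "(\<lambda>i. (1 + \<delta>) / \<delta> * ?M ((1 + \<delta>) * Y i) - 1 / \<delta> * ?M (Y i)) \<longlonglongrightarrow> 0" by simp
      have "\<forall>\<^sub>F i in sequentially. Y i > 0" using Yl by (simp add: filterlim_at_top_dense)
      hence "\<forall>\<^sub>F i in sequentially. (1 + \<delta>) / \<delta> * ?M ((1 + \<delta>) * Y i) - 1 / \<delta> * ?M (Y i) = A i \<xi>"
      proof eventually_elim
        case (elim i)
        have YX: "X i * sqrt (nsq n \<xi>) = Y i" by (simp add: Y_def)
        have "A i \<xi> = (integral {0..Y i * (1 + \<delta>)} \<phi> - integral {0..Y i} \<phi>) / (\<delta> * Y i)"
          unfolding A_def YX by (rule dilation_average[OF \<phi>(1) \<delta>(1) elim])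
        also have "\<dots> = (1 + \<delta>) / \<delta> * ?M ((1 + \<delta>) * Y i) - 1 / \<delta> * ?M (Y i)"
        proof -
          have "(a - b) / (\<delta> * y) = (1 + \<delta>) / \<delta> * (a / ((1 + \<delta>) * y)) - 1 / \<delta> * (b / y)" if "y > 0" for a b y :: real
            using that \<delta>(1) by (simp add: diff_divide_distrib)
          from this[OF elim] show ?thesis by (simp only: mult.commute[of "Y i"])
        qed
        finally show ?case by simp
      qed
      with l show "(\<lambda>i. A i \<xi>) \<longlonglongrightarrow> 0" by (rule Lim_transform_eventually)
    qed
  qed (use Gm in simp)
  hence "(\<lambda>i. \<integral>\<xi>. G \<xi> * A i \<xi> \<partial>leb n) \<longlonglongrightarrow> 0" by simp
  from LIMSEQ_D[OF this, of "\<epsilon> / 2"] \<epsilon>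
  obtain i0 where i0: "\<And>i. i \<ge> i0 \<Longrightarrow> norm ((\<integral>\<xi>. G \<xi> * A i \<xi> \<partial>leb n) - 0) < \<epsilon> / 2" by auto
  have "norm (I i - 0) < \<epsilon>" if "i \<ge> i0" for i
    using near[of i] i0[OF that] by (simp only: real_norm_def)
  thus "\<exists>no. \<forall>i\<ge>no. norm ((\<integral>\<xi>. G \<xi> * \<phi> (X i * sqrt (nsq n \<xi>)) \<partial>leb n) - 0) < \<epsilon>" unfolding I_def by blast
qed

section \<open>The time equation with complex spectral parameter\<close>

definition ent :: "(nat \<Rightarrow> real) \<Rightarrow> complex \<Rightarrow> complex" where
  "ent c z = (\<Sum>n. of_real (c n) * z ^ n)"

text \<open>Coefficients dominated by those of the exponential series: an easily propagated
  condition for entire functions that is stable under termwise differentiation.\<close>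

definition fact_bounded :: "(nat \<Rightarrow> real) \<Rightarrow> bool" where
  "fact_bounded c \<longleftrightarrow> (\<forall>n. \<bar>c n\<bar> \<le> 1 / fact n)"

lemma fact_bounded_diffs: "fact_bounded c \<Longrightarrow> fact_bounded (diffs c)"
  unfolding fact_bounded_def
proof (intro allI)
  fix n assume "\<forall>n. \<bar>c n\<bar> \<le> 1 / fact n"
  hence "real (Suc n) * \<bar>c (Suc n)\<bar> \<le> real (Suc n) * (1 / fact (Suc n))" by (intro mult_left_mono) (auto simp del: fact_Suc)
  also have "\<dots> = 1 / fact n" by (simp add: divide_simps)
  finally show "\<bar>diffs c n\<bar> \<le> 1 / fact n" by (simp add: diffs_def abs_mult)
qed

lemma ent_summable: assumes "fact_bounded c" shows "summable (\<lambda>n. of_real (c n) * (z::complex) ^ n)"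
proof (rule summable_comparison_test')
  show "summable (\<lambda>n. norm z ^ n /\<^sub>R fact n)" by (rule summable_exp_generic)
  fix n :: nat
  have "\<bar>c n\<bar> * norm z ^ n \<le> (1 / fact n) * norm z ^ n"
    using assms by (intro mult_right_mono) (auto simp: fact_bounded_def)
  thus "norm (of_real (c n) * z ^ n) \<le> norm z ^ n /\<^sub>R fact n"
    by (simp add: norm_mult norm_power divide_inverse)
qed

lemma ent_sums: "fact_bounded c \<Longrightarrow> (\<lambda>n. of_real (c n) * z ^ n) sums ent c z"
  unfolding ent_def using ent_summable by (rule summable_sums)

lemma ent_deriv: assumes "fact_bounded c" shows "(ent c has_field_derivative ent (diffs c) z) (at z)"
proof -
  have "diffs (\<lambda>n. complex_of_real (c n)) = (\<lambda>n. of_real (diffs c n))" by (auto simp: diffs_def)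
  thus ?thesis using termdiffs_strong_converges_everywhere[of "\<lambda>n. complex_of_real (c n)" z] ent_summable[OF assms]
    unfolding ent_def[abs_def] by simp
qed

lemma ent_deriv' [derivative_intros]:
  assumes "(f has_field_derivative D) (at z within A)" "fact_bounded c"
  shows "((\<lambda>z. ent c (f z)) has_field_derivative ent (diffs c) (f z) * D) (at z within A)"
  using DERIV_chain2[OF ent_deriv[OF assms(2)] assms(1)] .

lemma ent_cnj: assumes "fact_bounded c" shows "cnj (ent c z) = ent c (cnj z)"
proof -
  have "(\<lambda>n. cnj (of_real (c n) * z ^ n)) sums cnj (ent c z)" using ent_sums[OF assms] by (simp only: sums_cnj)
  moreover have "(\<lambda>n. cnj (of_real (c n) * z ^ n)) sums ent c (cnj z)" using ent_sums[OF assms, of "cnj z"] by simp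
  ultimately show ?thesis by (rule sums_unique2)
qed

lemma ent_0: "ent c 0 = of_real (c 0)"
  unfolding ent_def by (subst suminf_finite[of "{0}"]) auto

text \<open>Frobenius series at \<open>z = 0\<close> of two independent solutions \<open>z J(z)\<close> and
  \<open>K(z) - z J(z) ln z / 4\<close> of \<open>4 z w'' = - w\<close>.\<close>

definition Jco :: "nat \<Rightarrow> real" where
  "Jco j = (-1/4)^j / (fact j * fact (Suc j))"

fun Kco :: "nat \<Rightarrow> real" where
  "Kco 0 = 1"
| "Kco (Suc 0) = 0"
| "Kco (Suc (Suc j)) = (Jco (Suc j) * (1 + 2 * real (Suc j)) - Kco (Suc j)) / (4 * real (Suc j) * real (Suc (Suc j)))"

lemma fact_bounded_Jco: "fact_bounded Jco"
  unfolding fact_bounded_def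
proof
  fix n
  have "\<bar>Jco n\<bar> = (1/4)^n / (fact n * fact (Suc n))" by (simp add: Jco_def abs_mult power_abs)
  also have "\<dots> \<le> 1 / fact n"
  proof (rule frac_le)
    show "(1/4::real)^n \<le> 1" by (rule power_le_one) auto
    show "(fact n::real) \<le> fact n * fact (Suc n)" using fact_ge_1[of "Suc n", where 'a=real] by (simp del: fact_Suc)
  qed auto
  finally show "\<bar>Jco n\<bar> \<le> 1 / fact n" .
qed

text \<open>The recursion for \<open>Kco\<close> feeds in \<open>Jco\<close> with the factor
  \<open>1 + 2 * n\<close>. That factor is at most \<open>4 ^ n\<close> and is absorbed by the
  powers of \<open>1/4\<close> in \<open>Jco\<close>.\<close>

lemma Jco_small: "\<bar>Jco n\<bar> * (1 + 2 * real n) \<le> 1 / fact n"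
proof -
  have "(1 + 2 * real n) \<le> 4^n" by (induction n) auto
  hence "(1/4)^n * (1 + 2 * real n) \<le> (1/4)^n * 4^n" by (intro mult_left_mono) auto
  also have "\<dots> = 1" by (simp flip: power_mult_distrib)
  finally have *: "(1/4)^n * (1 + 2 * real n) \<le> 1" .
  have "\<bar>Jco n\<bar> * (1 + 2 * real n) = ((1/4)^n * (1 + 2 * real n)) / (fact n * fact (Suc n))"
    by (simp add: Jco_def abs_mult power_abs)
  also have "\<dots> \<le> 1 / fact n"
    by (rule frac_le) (use * fact_ge_1[of "Suc n", where 'a=real] in \<open>auto simp del: fact_Suc\<close>)
  finally show ?thesis .
qed

lemma fact_bounded_Kco: "fact_bounded Kco"
proof -
  have "\<bar>Kco n\<bar> \<le> 1 / fact n" for n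
  proof (induction n rule: Kco.induct)
    case (3 j)
    let ?n = "Suc j"
    have "\<bar>Jco ?n * (1 + 2 * real ?n) - Kco ?n\<bar> \<le> \<bar>Jco ?n\<bar> * (1 + 2 * real ?n) + \<bar>Kco ?n\<bar>"
      using abs_triangle_ineq4[of "Jco ?n * (1 + 2 * real ?n)" "Kco ?n"] by (simp add: abs_mult)
    also have "\<dots> \<le> 2 / fact ?n" using Jco_small[of ?n] 3 by simp
    finally have "\<bar>Kco (Suc ?n)\<bar> \<le> (2 / fact ?n) / (4 * real ?n * real (Suc ?n))"
      unfolding Kco.simps abs_divide by (intro frac_le) auto
    also have "\<dots> \<le> 1 / fact (Suc ?n)" by (simp add: divide_simps)
    finally show ?case .
  qed auto
  thus ?thesis by (simp add: fact_bounded_def)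
qed

abbreviation "J0 \<equiv> ent Jco"
abbreviation "J1 \<equiv> ent (diffs Jco)"
abbreviation "J2 \<equiv> ent (diffs (diffs Jco))"
abbreviation "K0 \<equiv> ent Kco"
abbreviation "K1 \<equiv> ent (diffs Kco)"
abbreviation "K2 \<equiv> ent (diffs (diffs Kco))"

lemmas fb = fact_bounded_Jco fact_bounded_Kco fact_bounded_diffs

lemma times_ent_sums:
  assumes "fact_bounded c"
  shows "(\<lambda>n. of_real (case n of 0 \<Rightarrow> 0 | Suc m \<Rightarrow> c m) * z ^ n) sums (z * ent c z)"
proof -
  have "(\<lambda>n. z * (of_real (c n) * z ^ n)) sums (z * ent c z)" by (intro sums_mult ent_sums assms)
  hence "(\<lambda>n. of_real (case Suc n of 0 \<Rightarrow> 0 | Suc m \<Rightarrow> c m) * z ^ Suc n) sums (z * ent c z)" by (simp add: mult_ac)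
  thus ?thesis by (subst (asm) sums_Suc_iff) simp
qed

text \<open>This is \<open>4 z w'' = - w\<close> for \<open>w = z J\<close>, divided by
  \<open>z\<close>.\<close>

lemma J_ode: "4 * (2 * J1 z + z * J2 z) = - J0 z"
proof -
  have "(\<lambda>n. 4 * (2 * (of_real (diffs Jco n) * z^n) + of_real (case n of 0 \<Rightarrow> 0 | Suc m \<Rightarrow> diffs (diffs Jco) m) * z ^ n))
      sums (4 * (2 * J1 z + z * J2 z))"
    by (intro sums_mult sums_add ent_sums times_ent_sums fb)
  moreover have "4 * (2 * (of_real (diffs Jco n) * z^n) + of_real (case n of 0 \<Rightarrow> 0 | Suc m \<Rightarrow> diffs (diffs Jco) m) * z ^ n)
     = - (of_real (Jco n) * z ^ n)" for n
  proof -
    have J: "Jco n = - 4 * real (Suc n) * real (Suc (Suc n)) * Jco (Suc n)" for n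
      by (simp add: Jco_def divide_simps) (simp add: algebra_simps)
    have "8 * diffs Jco n + 4 * (case n of 0 \<Rightarrow> 0 | Suc m \<Rightarrow> diffs (diffs Jco) m) = - Jco n"
      by (subst J[of n]) (cases n; simp add: diffs_def algebra_simps)
    hence "of_real (8 * diffs Jco n + 4 * (case n of 0 \<Rightarrow> 0 | Suc m \<Rightarrow> diffs (diffs Jco) m)) * z^n = of_real (- Jco n) * z^n"
      by (simp only:)
    thus ?thesis by (simp add: algebra_simps)
  qed
  ultimately have "(\<lambda>n. - (of_real (Jco n) * z ^ n)) sums (4 * (2 * J1 z + z * J2 z))" by simp
  moreover have "(\<lambda>n. - (of_real (Jco n) * z ^ n)) sums (- J0 z)" by (intro sums_minus ent_sums fb)
  ultimately show ?thesis by (rule sums_unique2)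
qed

text \<open>Inserting \<open>K - z J ln z / 4\<close> into \<open>4 z w'' = - w\<close>, the
  logarithmic terms cancel by \<open>J_ode\<close> and this inhomogeneous equation remains. It
  determines all coefficients of \<open>K\<close> except the one of index 1, since a multiple of
  \<open>z J\<close> may be added; \<open>Kco\<close> sets that one to 0.\<close>

lemma K_ode: "4 * (z * K2 z) + K0 z = J0 z + 2 * (z * J1 z)"
proof -
  have "(\<lambda>n. 4 * (of_real (case n of 0 \<Rightarrow> 0 | Suc m \<Rightarrow> diffs (diffs Kco) m) * z ^ n) + of_real (Kco n) * z ^ n)
      sums (4 * (z * K2 z) + K0 z)"
    by (intro sums_mult sums_add ent_sums times_ent_sums fb)
  moreover have "4 * (of_real (case n of 0 \<Rightarrow> 0 | Suc m \<Rightarrow> diffs (diffs Kco) m) * z ^ n) + of_real (Kco n) * z ^ n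
     = of_real (Jco n) * z ^ n + 2 * (of_real (case n of 0 \<Rightarrow> 0 | Suc m \<Rightarrow> diffs Jco m) * z ^ n)" for n
  proof -
    have "4 * (case n of 0 \<Rightarrow> 0 | Suc m \<Rightarrow> diffs (diffs Kco) m) + Kco n = Jco n + 2 * (case n of 0 \<Rightarrow> 0 | Suc m \<Rightarrow> diffs Jco m)"
    proof (cases n)
      case 0 thus ?thesis by (simp add: Jco_def)
    next
      case (Suc m)
      have "4 * real (Suc m) * real (Suc (Suc m)) * Kco (Suc (Suc m)) = Jco (Suc m) * (1 + 2 * real (Suc m)) - Kco (Suc m)"
        by (simp del: of_nat_Suc)
      thus ?thesis by (simp add: Suc diffs_def algebra_simps del: Kco.simps)
    qed
    hence "of_real (4 * (case n of 0 \<Rightarrow> 0 | Suc m \<Rightarrow> diffs (diffs Kco) m) + Kco n) * z^n = of_real (Jco n + 2 * (case n of 0 \<Rightarrow> 0 | Suc m \<Rightarrow> diffs Jco m)) * z^n"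
      by (simp only:)
    thus ?thesis by (simp add: algebra_simps)
  qed
  ultimately have "(\<lambda>n. of_real (Jco n) * z ^ n + 2 * (of_real (case n of 0 \<Rightarrow> 0 | Suc m \<Rightarrow> diffs Jco m) * z ^ n)) sums (4 * (z * K2 z) + K0 z)" by simp
  moreover have "(\<lambda>n. of_real (Jco n) * z ^ n + 2 * (of_real (case n of 0 \<Rightarrow> 0 | Suc m \<Rightarrow> diffs Jco m) * z ^ n)) sums (J0 z + 2 * (z * J1 z))"
    by (intro sums_mult sums_add ent_sums times_ent_sums fb)
  ultimately show ?thesis by (rule sums_unique2)
qed

text \<open>The Wronskian of the two Frobenius solutions, with the logarithms already cancelled so
  that it is entire. The two equations make it constant, and at \<open>z = 0\<close> it equals
  \<open>- J(0) K(0)\<close>.\<close>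

lemma wronskian: "z * J0 z * (K1 z - J0 z / 4) - (J0 z + z * J1 z) * K0 z = -1"
proof -
  define w where "w = (\<lambda>z. z * J0 z * (K1 z - J0 z / 4) - (J0 z + z * J1 z) * K0 z)"
  have "(w has_field_derivative 0) (at z)" for z
  proof -
    have "(w has_field_derivative
       (z * J0 z * (K2 z - J1 z / 4) + (J0 z + z * J1 z) * (K1 z - J0 z / 4)
        - ((J0 z + z * J1 z) * K1 z + (2 * J1 z + z * J2 z) * K0 z))) (at z)"
      unfolding w_def by (rule derivative_eq_intros refl fb | simp add: algebra_simps)+
    moreover have "z * J0 z * (K2 z - J1 z / 4) + (J0 z + z * J1 z) * (K1 z - J0 z / 4)
        - ((J0 z + z * J1 z) * K1 z + (2 * J1 z + z * J2 z) * K0 z) = 0"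
    proof -
      have k: "4 * (z * K2 z) = J0 z + 2 * (z * J1 z) - K0 z" using K_ode[of z] by (simp add: algebra_simps)
      have "4 * (z * J0 z * (K2 z - J1 z / 4) + (J0 z + z * J1 z) * (K1 z - J0 z / 4)
        - ((J0 z + z * J1 z) * K1 z + (2 * J1 z + z * J2 z) * K0 z))
        = J0 z * (4 * (z * K2 z)) - z * J0 z * J1 z - (J0 z + z * J1 z) * J0 z - (4 * (2 * J1 z + z * J2 z)) * K0 z"
        by (simp add: algebra_simps)
      also have "\<dots> = 0" unfolding k J_ode by (simp add: algebra_simps)
      finally show ?thesis by (simp only: mult_eq_0_iff) simp
    qed
    ultimately show ?thesis by simp
  qed
  then obtain k where "\<And>z. w z = k"
    using has_field_derivative_zero_constant[of UNIV w] by auto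
  hence "w z = w 0" by simp
  thus ?thesis unfolding w_def by (simp add: ent_0 Jco_def)
qed

text \<open>The Frobenius solutions at \<open>z = \<Lambda> t\<close>, the first divided by
  \<open>\<Lambda>\<close> and the second with \<open>ln t\<close> in place of \<open>ln z\<close>.
  The change of logarithm only adds a multiple of the first solution, and it makes both entire in
  \<open>\<Lambda>\<close>, the point \<open>\<Lambda> = 0\<close> included.\<close>

definition frob1 :: "complex \<Rightarrow> real \<Rightarrow> complex" where
  "frob1 \<Lambda> t = of_real t * J0 (\<Lambda> * of_real t)"
definition frob1' :: "complex \<Rightarrow> real \<Rightarrow> complex" where
  "frob1' \<Lambda> t = J0 (\<Lambda> * of_real t) + \<Lambda> * of_real t * J1 (\<Lambda> * of_real t)"
definition frob2 :: "complex \<Rightarrow> real \<Rightarrow> complex" where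
  "frob2 \<Lambda> t = K0 (\<Lambda> * of_real t) - \<Lambda> * of_real t / 4 * J0 (\<Lambda> * of_real t) * of_real (ln t)"
definition frob2' :: "complex \<Rightarrow> real \<Rightarrow> complex" where
  "frob2' \<Lambda> t = \<Lambda> * K1 (\<Lambda> * of_real t)
     - \<Lambda> / 4 * (J0 (\<Lambda> * of_real t) + \<Lambda> * of_real t * J1 (\<Lambda> * of_real t)) * of_real (ln t)
     - \<Lambda> / 4 * J0 (\<Lambda> * of_real t)"

lemma frob_wronskian: "frob1 \<Lambda> t * frob2' \<Lambda> t - frob1' \<Lambda> t * frob2 \<Lambda> t = -1"
proof -
  let ?z = "\<Lambda> * of_real t"
  have "frob1 \<Lambda> t * frob2' \<Lambda> t - frob1' \<Lambda> t * frob2 \<Lambda> t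
      = ?z * J0 ?z * (K1 ?z - J0 ?z / 4) - (J0 ?z + ?z * J1 ?z) * K0 ?z"
    unfolding frob1_def frob1'_def frob2_def frob2'_def by (simp add: field_simps)
  thus ?thesis using wronskian[of ?z] by simp
qed

lemma ent_vec [derivative_intros]:
  assumes "fact_bounded c"
  shows "((\<lambda>t. ent c (\<Lambda> * of_real t)) has_vector_derivative (\<Lambda> * ent (diffs c) (\<Lambda> * of_real t))) (at t)"
proof -
  have "((\<lambda>z. ent c (\<Lambda> * z)) has_field_derivative (ent (diffs c) (\<Lambda> * of_real t) * \<Lambda>)) (at (of_real t))"
    by (rule derivative_eq_intros refl assms | simp)+
  from has_vector_derivative_real_field[OF this] show ?thesis by (simp add: mult.commute[of \<Lambda> "ent (diffs c) _"])
qed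

lemma of_real_vec: "((\<lambda>t. of_real t :: complex) has_vector_derivative 1) (at t)"
  using has_vector_derivative_of_real[of "\<lambda>t. t" 1 "at t"] by simp

lemma ln_vec: "t > 0 \<Longrightarrow> ((\<lambda>t. of_real (ln t) :: complex) has_vector_derivative (1 / of_real t)) (at t)"
  using has_vector_derivative_of_real[where ?'a = complex, OF DERIV_ln_divide[of t]]
  by (simp add: of_real_divide)

lemma frob_deriv:
  assumes t: "t > 0"
  shows "(frob1 \<Lambda> has_vector_derivative frob1' \<Lambda> t) (at t)"
    "(frob1' \<Lambda> has_vector_derivative (- \<Lambda> / (4 * of_real t) * frob1 \<Lambda> t)) (at t)"
    "(frob2 \<Lambda> has_vector_derivative frob2' \<Lambda> t) (at t)"
    "(frob2' \<Lambda> has_vector_derivative (- \<Lambda> / (4 * of_real t) * frob2 \<Lambda> t)) (at t)"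
proof -
  let ?z = "\<Lambda> * of_real t"
  note m = has_vector_derivative_mult has_vector_derivative_add has_vector_derivative_diff
  note e = ent_vec[OF fb(1)] ent_vec[OF fb(2)] ent_vec[OF fb(3)[OF fb(1)]] ent_vec[OF fb(3)[OF fb(2)]]
  have L: "((\<lambda>t. \<Lambda> * of_real t) has_vector_derivative \<Lambda>) (at t)"
    using has_vector_derivative_mult_right[OF of_real_vec, of \<Lambda> t] by simp
  have L4: "((\<lambda>t. \<Lambda> * of_real t / 4) has_vector_derivative (\<Lambda>/4)) (at t)"
    using has_vector_derivative_mult_right[OF of_real_vec, of "\<Lambda>/4" t] by simp
  note l = ln_vec[OF t]
  have a: "((\<lambda>t. J0 (\<Lambda> * of_real t) + \<Lambda> * of_real t * J1 (\<Lambda> * of_real t)) has_vector_derivative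
     (\<Lambda> * J1 ?z + (?z * (\<Lambda> * J2 ?z) + \<Lambda> * J1 ?z))) (at t)"
    by (rule m e L)+
  have jo: "J0 ?z = - 4 * (2 * J1 ?z + ?z * J2 ?z)" using J_ode[of ?z] by simp
  have aeq: "(\<Lambda> * J1 ?z + (?z * (\<Lambda> * J2 ?z) + \<Lambda> * J1 ?z)) = - \<Lambda> / 4 * J0 ?z"
    unfolding jo by (simp add: algebra_simps)
  show "(frob1 \<Lambda> has_vector_derivative frob1' \<Lambda> t) (at t)"
  proof -
    have "((\<lambda>t. of_real t * J0 (\<Lambda> * of_real t)) has_vector_derivative (of_real t * (\<Lambda> * J1 ?z) + 1 * J0 ?z)) (at t)"
      by (rule m e of_real_vec)+
    thus ?thesis unfolding frob1_def[abs_def] frob1'_def by (simp add: algebra_simps)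
  qed
  show "(frob1' \<Lambda> has_vector_derivative (- \<Lambda> / (4 * of_real t) * frob1 \<Lambda> t)) (at t)"
    using a t unfolding frob1'_def[abs_def] frob1_def aeq by simp
  show "(frob2 \<Lambda> has_vector_derivative frob2' \<Lambda> t) (at t)"
  proof -
    have "((\<lambda>t. K0 (\<Lambda> * of_real t) - \<Lambda> * of_real t / 4 * J0 (\<Lambda> * of_real t) * of_real (ln t)) has_vector_derivative
      (\<Lambda> * K1 ?z - ((?z / 4 * J0 ?z) * (1 / of_real t) + (?z / 4 * (\<Lambda> * J1 ?z) + \<Lambda> / 4 * J0 ?z) * of_real (ln t)))) (at t)"
      by (rule m e L4 l)+
    thus ?thesis unfolding frob2_def[abs_def] frob2'_def using t by (simp add: algebra_simps)
  qed
  show "(frob2' \<Lambda> has_vector_derivative (- \<Lambda> / (4 * of_real t) * frob2 \<Lambda> t)) (at t)"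
  proof -
    have "(frob2' \<Lambda> has_vector_derivative
       (\<Lambda> * (\<Lambda> * K2 ?z) - (\<Lambda> / 4 * (J0 ?z + ?z * J1 ?z) * (1 / of_real t)
          + \<Lambda> / 4 * (- \<Lambda> / 4 * J0 ?z) * of_real (ln t)) - \<Lambda> / 4 * (\<Lambda> * J1 ?z))) (at t)"
      unfolding frob2'_def[abs_def]
      by (rule m(2,3) has_vector_derivative_mult_right e l has_vector_derivative_mult a[unfolded aeq])+
    moreover have "(\<Lambda> * (\<Lambda> * K2 ?z) - (\<Lambda> / 4 * (J0 ?z + ?z * J1 ?z) * (1 / of_real t)
          + \<Lambda> / 4 * (- \<Lambda> / 4 * J0 ?z) * of_real (ln t)) - \<Lambda> / 4 * (\<Lambda> * J1 ?z)) = - \<Lambda> / (4 * of_real t) * frob2 \<Lambda> t"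
    proof -
      have k: "K0 ?z = J0 ?z + 2 * (?z * J1 ?z) - 4 * (?z * K2 ?z)" using K_ode[of ?z] by (simp add: algebra_simps)
      show ?thesis unfolding frob2_def k using t by (simp add: field_simps)
    qed
    ultimately show ?thesis by simp
  qed
qed

text \<open>What contour integration, compactness and reality arguments require of a family in
  \<open>\<Lambda>\<close>. Later \<open>\<Lambda> = \<kappa>\<^sup>2\<close>, so entire dependence
  on \<open>\<Lambda>\<close> gives entire dependence on \<open>\<kappa>\<close> without choosing a
  square root.\<close>

definition spectral :: "(complex \<Rightarrow> real \<Rightarrow> complex) \<Rightarrow> bool" where
  "spectral F \<longleftrightarrow> continuous_on (UNIV \<times> {0<..}) (\<lambda>x. F (fst x) (snd x)) \<and>
     (\<forall>t>0. (\<lambda>\<Lambda>. F \<Lambda> t) holomorphic_on UNIV) \<and> (\<forall>\<Lambda>. \<forall>t>0. cnj (F \<Lambda> t) = F (cnj \<Lambda>) t)"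

lemma spectral_intros:
  "spectral F \<Longrightarrow> spectral G \<Longrightarrow> spectral (\<lambda>\<Lambda> t. F \<Lambda> t + G \<Lambda> t)"
  "spectral F \<Longrightarrow> spectral G \<Longrightarrow> spectral (\<lambda>\<Lambda> t. F \<Lambda> t - G \<Lambda> t)"
  "spectral F \<Longrightarrow> spectral G \<Longrightarrow> spectral (\<lambda>\<Lambda> t. F \<Lambda> t * G \<Lambda> t)"
  "spectral F \<Longrightarrow> spectral (\<lambda>\<Lambda> t. F \<Lambda> t / 4)"
  "spectral (\<lambda>\<Lambda> t. \<Lambda>)"
  "spectral (\<lambda>\<Lambda> t. of_real t)"
  "spectral (\<lambda>\<Lambda> t. of_real (ln t))"
  by (auto simp: spectral_def intro!: continuous_intros holomorphic_intros)

lemma spectral_ent: "fact_bounded c \<Longrightarrow> spectral (\<lambda>\<Lambda> t. ent c (\<Lambda> * of_real t))"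
  unfolding spectral_def
proof (intro conjI allI impI)
  assume c: "fact_bounded c"
  have h: "ent c holomorphic_on UNIV" using ent_deriv[OF c] by (auto simp: holomorphic_on_def field_differentiable_def intro: has_field_derivative_at_within)
  show "continuous_on (UNIV \<times> {0<..}) (\<lambda>x. ent c (fst x * of_real (snd x)))"
    by (rule continuous_on_compose2[OF holomorphic_on_imp_continuous_on[OF h]]) (auto intro!: continuous_intros)
  show "(\<lambda>\<Lambda>. ent c (\<Lambda> * of_real t)) holomorphic_on UNIV" for t :: real
    using holomorphic_on_compose_gen[of "\<lambda>\<Lambda>. \<Lambda> * of_real t" UNIV "ent c" UNIV, OF _ h]
    unfolding comp_def by (simp add: holomorphic_intros)
  show "cnj (ent c (\<Lambda> * of_real t)) = ent c (cnj \<Lambda> * of_real t)" for \<Lambda> t using ent_cnj[OF c] by simp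
qed

lemma spectral_fix: assumes "spectral F" "t1 > 0" shows "spectral (\<lambda>\<Lambda> t. F \<Lambda> t1)"
proof -
  have "continuous_on UNIV (\<lambda>\<Lambda>. F \<Lambda> t1)" using assms holomorphic_on_imp_continuous_on by (auto simp: spectral_def)
  hence "continuous_on (UNIV \<times> {0<..}) (\<lambda>x::complex \<times> real. F (fst x) t1)"
    by (rule continuous_on_compose2) (auto intro!: continuous_intros)
  thus ?thesis using assms by (auto simp: spectral_def)
qed

lemma spectral_frob: "spectral frob1" "spectral frob1'" "spectral frob2" "spectral frob2'"
  unfolding frob1_def[abs_def] frob1'_def[abs_def] frob2_def[abs_def] frob2'_def[abs_def]
  by (intro spectral_intros spectral_ent fb)+

text \<open>The Frobenius solutions are recombined to unit data at \<open>t1\<close>. Their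
  Wronskian is the constant -1, so no division occurs and the dependence on \<open>\<Lambda>\<close>
  stays entire. At \<open>\<Lambda> = 0\<close> the equation is \<open>w'' = 0\<close>, hence
  \<open>c\<close> is constant.\<close>

lemma fundamental_solutions:
  assumes t1: "t1 > 0"
  obtains c c' s s' :: "complex \<Rightarrow> real \<Rightarrow> complex"
  where "spectral c" "spectral c'" "spectral s" "spectral s'"
    and "\<And>\<Lambda> t. t > 0 \<Longrightarrow> (c \<Lambda> has_vector_derivative c' \<Lambda> t) (at t)"
    and "\<And>\<Lambda> t. t > 0 \<Longrightarrow> (c' \<Lambda> has_vector_derivative (- \<Lambda> / (4 * of_real t) * c \<Lambda> t)) (at t)"
    and "\<And>\<Lambda> t. t > 0 \<Longrightarrow> (s \<Lambda> has_vector_derivative s' \<Lambda> t) (at t)"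
    and "\<And>\<Lambda> t. t > 0 \<Longrightarrow> (s' \<Lambda> has_vector_derivative (- \<Lambda> / (4 * of_real t) * s \<Lambda> t)) (at t)"
    and "\<And>\<Lambda>. c \<Lambda> t1 = 1" "\<And>\<Lambda>. c' \<Lambda> t1 = 0" "\<And>\<Lambda>. s \<Lambda> t1 = 0" "\<And>\<Lambda>. s' \<Lambda> t1 = 1"
    and "\<And>t. c 0 t = 1"
proof (rule that)
  let ?c = "\<lambda>\<Lambda> t. frob1' \<Lambda> t1 * frob2 \<Lambda> t - frob2' \<Lambda> t1 * frob1 \<Lambda> t"
  let ?c' = "\<lambda>\<Lambda> t. frob1' \<Lambda> t1 * frob2' \<Lambda> t - frob2' \<Lambda> t1 * frob1' \<Lambda> t"
  let ?s = "\<lambda>\<Lambda> t. frob2 \<Lambda> t1 * frob1 \<Lambda> t - frob1 \<Lambda> t1 * frob2 \<Lambda> t"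
  let ?s' = "\<lambda>\<Lambda> t. frob2 \<Lambda> t1 * frob1' \<Lambda> t - frob1 \<Lambda> t1 * frob2' \<Lambda> t"
  show "spectral ?c" "spectral ?c'" "spectral ?s" "spectral ?s'"
    by (intro spectral_intros spectral_fix[OF _ t1] spectral_frob)+
  show "\<And>\<Lambda> t. t > 0 \<Longrightarrow> (?c \<Lambda> has_vector_derivative ?c' \<Lambda> t) (at t)"
    "\<And>\<Lambda> t. t > 0 \<Longrightarrow> (?s \<Lambda> has_vector_derivative ?s' \<Lambda> t) (at t)"
    by (intro has_vector_derivative_diff has_vector_derivative_mult_right frob_deriv; assumption)+
  show "(?c' \<Lambda> has_vector_derivative (- \<Lambda> / (4 * of_real t) * ?c \<Lambda> t)) (at t)" if "t > 0" for \<Lambda> t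
    using has_vector_derivative_diff[OF has_vector_derivative_mult_right[OF frob_deriv(4)[OF that]]
        has_vector_derivative_mult_right[OF frob_deriv(2)[OF that]], of "frob1' \<Lambda> t1" \<Lambda> "frob2' \<Lambda> t1" \<Lambda>]
    by (simp add: algebra_simps)
  show "(?s' \<Lambda> has_vector_derivative (- \<Lambda> / (4 * of_real t) * ?s \<Lambda> t)) (at t)" if "t > 0" for \<Lambda> t
    using has_vector_derivative_diff[OF has_vector_derivative_mult_right[OF frob_deriv(2)[OF that]]
        has_vector_derivative_mult_right[OF frob_deriv(4)[OF that]], of "frob2 \<Lambda> t1" \<Lambda> "frob1 \<Lambda> t1" \<Lambda>]
    by (simp add: algebra_simps)
  show "?c \<Lambda> t1 = 1" "?s' \<Lambda> t1 = 1" "?c' \<Lambda> t1 = 0" "?s \<Lambda> t1 = 0" for \<Lambda>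
    using frob_wronskian[of \<Lambda> t1] by (auto simp: algebra_simps add_eq_0_iff eq_neg_iff_add_eq_0)
  show "?c 0 t = 1" for t by (simp add: frob1_def frob1'_def frob2_def frob2'_def ent_0 Jco_def)
qed

section \<open>Mean value, Volterra and contour estimates\<close>

lemma norm_diff_le_of_vector_derivative:
  fixes F :: "real \<Rightarrow> 'a::real_normed_vector"
  assumes "\<And>x. x \<in> {a..b} \<Longrightarrow> (F has_vector_derivative F' x) (at x within {a..b})"
    and "\<And>x. x \<in> {a..b} \<Longrightarrow> norm (F' x) \<le> B" and "x \<in> {a..b}" "y \<in> {a..b}"
  shows "norm (F y - F x) \<le> B * \<bar>y - x\<bar>"
proof -
  have "norm (F y - F x) \<le> B * norm (y - x)"
  proof (rule differentiable_bound[of "{a..b}" F "\<lambda>x h. h *\<^sub>R F' x"])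
    show "onorm (\<lambda>h. h *\<^sub>R F' z) \<le> B" if "z \<in> {a..b}" for z
      by (rule onorm_bound) (use assms(2)[OF that] order_trans[OF norm_ge_zero assms(2)[OF that]] in \<open>auto simp: mult.commute[of B] mult_left_mono\<close>)
  qed (use assms in \<open>auto simp: has_vector_derivative_def\<close>)
  thus ?thesis by simp
qed

text \<open>A Volterra estimate for \<open>G'' = 2 i \<kappa> G' + V G\<close>: since \<open>exp (2 i \<kappa> x)\<close> is bounded
  for \<open>Im \<kappa> \<ge> 0\<close>, \<open>G\<close> stays close to its initial value when \<open>\<kappa>\<close> is large.\<close>

lemma volterra_bound:
  fixes G H :: "real \<Rightarrow> complex" and V :: "real \<Rightarrow> real"
  assumes ab: "a \<le> b" and \<kappa>: "Im \<kappa> \<ge> 0" "\<kappa> \<noteq> 0"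
    and G': "\<And>x. x \<in> {a..b} \<Longrightarrow> (G has_vector_derivative H x) (at x within {a..b})"
    and H': "\<And>x. x \<in> {a..b} \<Longrightarrow> (H has_vector_derivative (2 * \<i> * \<kappa> * H x + of_real (V x) * G x)) (at x within {a..b})"
    and V: "\<And>x. x \<in> {a..b} \<Longrightarrow> \<bar>V x\<bar> \<le> v"
    and init: "norm (G a) = 1" "norm (H a) \<le> h"
    and big: "4 * (v * (b - a) + h) \<le> norm \<kappa>" and x: "x \<in> {a..b}"
  shows "norm (G x - G a) \<le> 1/2"
proof -
  have contG: "continuous_on {a..b} G"
    using G' has_vector_derivative_continuous continuous_on_eq_continuous_within by blast
  have "continuous_on {a..b} (\<lambda>x. norm (G x))" using contG by (intro continuous_intros)
  then obtain m where m: "m \<in> {a..b}" "\<And>y. y \<in> {a..b} \<Longrightarrow> norm (G y) \<le> norm (G m)"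
    using continuous_attains_sup[of "{a..b}" "\<lambda>x. norm (G x)"] ab by auto
  \<comment> \<open>All estimates below are expressed by the maximum \<open>M\<close> of the norm of
    \<open>G\<close>; \<open>M\<close> itself is bounded at the end by absorption.\<close>
  define M where "M = norm (G m)"
  have GM: "norm (G y) \<le> M" if "y \<in> {a..b}" for y using m that by (simp add: M_def)
  have M0: "M \<ge> 0" by (simp add: M_def)
  have v0: "v \<ge> 0" using V[of a] ab by auto
  have VG: "norm (of_real (V y) * G y) \<le> v * M" if "y \<in> {a..b}" for y
    using V[OF that] GM[OF that] M0 by (auto simp: norm_mult intro!: mult_mono)
  have Hb: "norm (H y) \<le> h + v * M * (b - a)" if y: "y \<in> {a..b}" for y
  proof -
    \<comment> \<open>The integrating factor removes the term \<open>2 i \<kappa> H\<close>.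
      Referring it to the endpoint \<open>y\<close> keeps its norm at most 1, since
      \<open>r \<le> y\<close> and \<open>Im \<kappa> \<ge> 0\<close>.\<close>
    define F where "F = (\<lambda>r. exp (2 * \<i> * \<kappa> * of_real (y - r)) * H r)"
    define F' where "F' = (\<lambda>r. exp (2 * \<i> * \<kappa> * of_real (y - r)) * (of_real (V r) * G r))"
    have E: "((\<lambda>r. exp (2 * \<i> * \<kappa> * of_real (y - r))) has_vector_derivative
        (- (2 * \<i> * \<kappa>) * exp (2 * \<i> * \<kappa> * of_real (y - r)))) (at r within A)" for r A
    proof -
      have "((\<lambda>z. exp (2 * \<i> * \<kappa> * (of_real y - z))) has_field_derivative
          (- (2 * \<i> * \<kappa>) * exp (2 * \<i> * \<kappa> * (of_real y - of_real r)))) (at (of_real r))"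
        by (rule derivative_eq_intros refl | simp)+
      from has_vector_derivative_real_field[OF this] show ?thesis by simp
    qed
    have "norm (F y - F a) \<le> (v * M) * \<bar>y - a\<bar>"
    proof (rule norm_diff_le_of_vector_derivative[where b = y and F' = F'])
      fix r assume r: "r \<in> {a..y}"
      have rb: "r \<in> {a..b}" using r y by auto
      have "(F has_vector_derivative (exp (2 * \<i> * \<kappa> * of_real (y - r)) * (2 * \<i> * \<kappa> * H r + of_real (V r) * G r)
          + (- (2 * \<i> * \<kappa>) * exp (2 * \<i> * \<kappa> * of_real (y - r))) * H r)) (at r within {a..y})"
        unfolding F_def
        by (rule has_vector_derivative_mult[OF E has_vector_derivative_within_subset[OF H'[OF rb]]]) (use y in auto)
      thus "(F has_vector_derivative F' r) (at r within {a..y})" unfolding F'_def by (simp add: algebra_simps)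
      have "norm (exp (2 * \<i> * \<kappa> * of_real (y - r))) \<le> 1" using r \<kappa> by (simp add: norm_exp mult_nonneg_nonneg)
      hence "norm (exp (2 * \<i> * \<kappa> * of_real (y - r))) * norm (of_real (V r) * G r) \<le> 1 * (v * M)"
        by (intro mult_mono VG rb) auto
      thus "norm (F' r) \<le> v * M" unfolding F'_def by (simp add: norm_mult)
    qed (use y in auto)
    also have "\<dots> \<le> v * M * (b - a)" using y v0 M0 by (intro mult_left_mono) auto
    finally have 1: "norm (F y - F a) \<le> v * M * (b - a)" .
    have "norm (exp (2 * \<i> * \<kappa> * of_real (y - a))) \<le> 1" using y \<kappa> by (simp add: norm_exp mult_nonneg_nonneg)
    hence "norm (F a) \<le> 1 * h" unfolding F_def norm_mult[of "exp _"] using init(2) by (intro mult_mono) auto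
    moreover have "F y = H y" by (simp add: F_def)
    ultimately show ?thesis using 1 norm_triangle_ineq[of "F y - F a" "F a"] by auto
  qed
  have main: "norm \<kappa> * norm (G y - G a) \<le> v * M * (b - a) + h" if y: "y \<in> {a..b}" for y
  proof -
    \<comment> \<open>\<open>H - 2 i \<kappa> G\<close> has derivative \<open>V G\<close>, free of
      \<open>\<kappa>\<close>. Together with the bound on \<open>H\<close> this isolates
      \<open>2 i \<kappa> (G y - G a)\<close>, and dividing by \<open>\<kappa>\<close> yields the
      smallness.\<close>
    have "norm ((H y - 2 * \<i> * \<kappa> * G y) - (H a - 2 * \<i> * \<kappa> * G a)) \<le> (v * M) * \<bar>y - a\<bar>"
    proof (rule norm_diff_le_of_vector_derivative[where b = b and F' = "\<lambda>y. of_real (V y) * G y"])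
      fix r assume r: "r \<in> {a..b}"
      have "((\<lambda>y. H y - 2 * \<i> * \<kappa> * G y) has_vector_derivative
         ((2 * \<i> * \<kappa> * H r + of_real (V r) * G r) - 2 * \<i> * \<kappa> * H r)) (at r within {a..b})"
        by (intro has_vector_derivative_diff has_vector_derivative_mult_right H' G' r)
      thus "((\<lambda>y. H y - 2 * \<i> * \<kappa> * G y) has_vector_derivative of_real (V r) * G r) (at r within {a..b})" by simp
    qed (use y VG in auto)
    also have "\<dots> \<le> v * M * (b - a)" using y v0 M0 by (intro mult_left_mono) auto
    finally have 1: "norm ((H y - 2 * \<i> * \<kappa> * G y) - (H a - 2 * \<i> * \<kappa> * G a)) \<le> v * M * (b - a)" .
    have "2 * norm \<kappa> * norm (G y - G a) = norm (2 * \<i> * \<kappa> * (G y - G a))" by (simp add: norm_mult)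
    also have "2 * \<i> * \<kappa> * (G y - G a) = H y - H a - ((H y - 2 * \<i> * \<kappa> * G y) - (H a - 2 * \<i> * \<kappa> * G a))"
      by (simp add: algebra_simps)
    also have "norm \<dots> \<le> norm (H y) + norm (H a) + v * M * (b - a)"
      using 1 norm_triangle_ineq4[of "H y - H a" "(H y - 2 * \<i> * \<kappa> * G y) - (H a - 2 * \<i> * \<kappa> * G a)"]
        norm_triangle_ineq4[of "H y" "H a"] by linarith
    also have "\<dots> \<le> (h + v * M * (b - a)) + h + v * M * (b - a)" using Hb[OF y] init by linarith
    finally show ?thesis by linarith
  qed
  have \<kappa>0: "norm \<kappa> > 0" using \<kappa> by simp
  have "M \<le> 1 + norm (G m - G a)" unfolding M_def using norm_triangle_ineq2[of "G m" "G a"] init by simp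
  moreover have "norm \<kappa> * norm (G m - G a) \<le> norm \<kappa> * ((M + 1) / 4)"
  proof -
    have "0 \<le> h" using init(2) norm_ge_zero order_trans by blast
    have "v * M * (b - a) + h \<le> (v * (b - a) + h) * (M + 1)"
    proof -
      have "(v * (b - a) + h) * (M + 1) = (v * M * (b - a) + h) + (v * (b - a) + h * M)" by (simp add: algebra_simps)
      moreover have "v * (b - a) \<ge> 0" "h * M \<ge> 0" using v0 M0 ab \<open>0 \<le> h\<close> by auto
      ultimately show ?thesis by linarith
    qed
    also have "\<dots> \<le> (norm \<kappa> / 4) * (M + 1)" using big M0 by (intro mult_right_mono) auto
    finally show ?thesis using main[OF m(1)] by simp
  qed
  hence "norm (G m - G a) \<le> (M + 1) / 4" using \<kappa>0 by (simp only: mult_le_cancel_left_pos)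
  \<comment> \<open>Absorption: \<open>M \<le> 1 + (M + 1) / 4\<close>.\<close>
  ultimately have M2: "M \<le> 5/3" by (simp add: field_simps)
  have "v * M * (b - a) + h \<le> (v * (b - a) + h) * 2"
  proof -
    have "0 \<le> h" using init(2) norm_ge_zero order_trans by blast
    moreover have "v * (b - a) * M \<le> v * (b - a) * 2" using M2 v0 ab by (intro mult_left_mono) auto
    ultimately show ?thesis by (simp add: algebra_simps)
  qed
  also have "\<dots> \<le> norm \<kappa> * (1/2)" using big by simp
  finally have "norm \<kappa> * norm (G x - G a) \<le> norm \<kappa> * (1/2)" using main[OF x] by simp
  thus ?thesis using \<kappa>0 by (simp only: mult_le_cancel_left_pos)
qed

text \<open>Cauchy's theorem on the closed path made of the diameter and the upper arc. Both lie in
  the closed half plane, which is convex and on which \<open>F\<close> is holomorphic up to the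
  boundary line.\<close>

lemma half_disc_integral:
  assumes hol: "F holomorphic_on {z. Im z \<ge> 0}" and R: "R > 0"
  shows "((\<lambda>x. F (of_real x)) has_integral
           - integral {0..pi} (\<lambda>\<theta>. F (of_real R * cis \<theta>) * of_real R * \<i> * cis \<theta>)) {-R..R}"
    "(\<lambda>\<theta>. F (of_real R * cis \<theta>) * of_real R * \<i> * cis \<theta>) integrable_on {0..pi}"
proof -
  define L where "L = linepath (- of_real R) (of_real R :: complex)"
  define P where "P = part_circlepath 0 R 0 pi"
  have conv: "convex {z. Im z \<ge> 0}" by (simp add: convex_halfspace_Im_ge)
  have contF: "continuous_on {z. Im z \<ge> 0} F" using hol by (rule holomorphic_on_imp_continuous_on)
  have pL: "path_image L \<subseteq> {z. Im z \<ge> 0}"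
    unfolding L_def path_image_linepath using conv by (intro closed_segment_subset) auto
  have pP: "path_image P \<subseteq> {z. Im z \<ge> 0}"
  proof -
    have "path_image P = {0 + of_real R * cis \<theta> |\<theta>. \<theta> \<in> {0..pi}}"
      unfolding P_def by (subst path_image_part_circlepath) (auto simp: cis_conv_exp mult.commute)
    thus ?thesis using R by (auto simp: sin_ge_zero)
  qed
  have vL: "valid_path L" and vP: "valid_path P" by (auto simp: L_def P_def)
  have ends: "pathfinish L = pathstart P" "pathfinish P = pathstart L"
    by (auto simp: L_def P_def)
  have iL: "F contour_integrable_on L" unfolding L_def
    by (rule contour_integrable_continuous_linepath) (use contF pL in \<open>auto simp: L_def intro: continuous_on_subset\<close>)
  have iP: "F contour_integrable_on P" unfolding P_def
    by (rule contour_integrable_continuous_part_circlepath) (use contF pP in \<open>auto simp: P_def intro: continuous_on_subset\<close>)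
  have "(F has_contour_integral 0) (L +++ P)"
    by (rule Cauchy_theorem_convex_simple[OF hol conv])
       (use vL vP ends pL pP in \<open>auto simp: valid_path_join path_image_join\<close>)
  hence "contour_integral L F + contour_integral P F = 0"
    using contour_integral_join[OF iL iP vL vP] contour_integral_unique by metis
  moreover have "contour_integral P F = integral {0..pi} (\<lambda>\<theta>. F (of_real R * cis \<theta>) * of_real R * \<i> * cis \<theta>)"
    unfolding P_def by (subst contour_integral_part_circlepath_eq) auto
  ultimately have "contour_integral L F = - integral {0..pi} (\<lambda>\<theta>. F (of_real R * cis \<theta>) * of_real R * \<i> * cis \<theta>)"
    by (simp add: add_eq_0_iff)
  hence "(F has_contour_integral - integral {0..pi} (\<lambda>\<theta>. F (of_real R * cis \<theta>) * of_real R * \<i> * cis \<theta>)) L"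
    using has_contour_integral_integral[OF iL] by simp
  thus "((\<lambda>x. F (of_real x)) has_integral
           - integral {0..pi} (\<lambda>\<theta>. F (of_real R * cis \<theta>) * of_real R * \<i> * cis \<theta>)) {-R..R}"
    unfolding L_def by (subst (asm) has_contour_integral_linepath_Reals_iff) (use R in auto)
  show "(\<lambda>\<theta>. F (of_real R * cis \<theta>) * of_real R * \<i> * cis \<theta>) integrable_on {0..pi}"
    using iP unfolding P_def by (subst (asm) contour_integrable_part_circlepath_iff) auto
qed

text \<open>The algebra behind the equation for the amplitude in \<open>g_asymptotics\<close>:
  \<open>X\<close> and \<open>Y\<close> stand for \<open>2 x\<close> and \<open>1 / (2 x)\<close>,
  \<open>E\<close> and \<open>r\<close> for the exponential and the power factor. With the two
  relations as hypotheses it is a purely polynomial identity.\<close>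

lemma amplitude_identity:
  fixes X Y i k E r g g' :: complex
  assumes "X * Y = 1" "i * i = -1"
  shows "E * r * (i * k * (X * g') - (Y * (X * g') + (- 2 * Y\<^sup>2) * g) + (X * (X * (- k\<^sup>2 * Y\<^sup>2 * g)) + 2 * g'))
     + (E * (- Y * r) + i * k * E * r) * (i * k * g - Y * g + X * g')
     = 2 * i * k * (E * r * (i * k * g - Y * g + X * g')) + 3 * Y\<^sup>2 * (E * r * g)"
  using assms by algebra

section \<open>Outgoing modes for complex frequency\<close>

locale wave_modes =
  fixes t1 T :: real and c c' s s' :: "complex \<Rightarrow> real \<Rightarrow> complex"
  assumes t1: "0 < t1" and t1T: "t1 < T"
    and spec: "spectral c" "spectral c'" "spectral s" "spectral s'"
    and c_deriv: "\<And>\<Lambda> t. t > 0 \<Longrightarrow> (c \<Lambda> has_vector_derivative c' \<Lambda> t) (at t)"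
    and c'_deriv: "\<And>\<Lambda> t. t > 0 \<Longrightarrow> (c' \<Lambda> has_vector_derivative (- \<Lambda> / (4 * of_real t) * c \<Lambda> t)) (at t)"
    and s_deriv: "\<And>\<Lambda> t. t > 0 \<Longrightarrow> (s \<Lambda> has_vector_derivative s' \<Lambda> t) (at t)"
    and s'_deriv: "\<And>\<Lambda> t. t > 0 \<Longrightarrow> (s' \<Lambda> has_vector_derivative (- \<Lambda> / (4 * of_real t) * s \<Lambda> t)) (at t)"
    and init: "\<And>\<Lambda>. c \<Lambda> t1 = 1" "\<And>\<Lambda>. c' \<Lambda> t1 = 0" "\<And>\<Lambda>. s \<Lambda> t1 = 0" "\<And>\<Lambda>. s' \<Lambda> t1 = 1"
    and c_0: "\<And>t. c 0 t = 1"
begin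

definition bt :: real where "bt = 1 / (2 * sqrt t1)"

text \<open>The outgoing initial condition \<open>g' = - i \<kappa> g / (2 sqrt t)\<close> at \<open>t1\<close> selects the WKB branch \<open>exp (- i \<kappa> sqrt t)\<close>.\<close>

definition g :: "complex \<Rightarrow> real \<Rightarrow> complex" where
  "g \<kappa> t = c (\<kappa>\<^sup>2) t - \<i> * \<kappa> * of_real bt * s (\<kappa>\<^sup>2) t"
definition g' :: "complex \<Rightarrow> real \<Rightarrow> complex" where
  "g' \<kappa> t = c' (\<kappa>\<^sup>2) t - \<i> * \<kappa> * of_real bt * s' (\<kappa>\<^sup>2) t"

lemma bt_pos: "bt > 0" using t1 by (simp add: bt_def)

lemma g_deriv: "t > 0 \<Longrightarrow> (g \<kappa> has_vector_derivative g' \<kappa> t) (at t)"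
  unfolding g_def[abs_def] g'_def
  by (intro has_vector_derivative_diff has_vector_derivative_mult_right c_deriv s_deriv)

lemma g'_deriv: "t > 0 \<Longrightarrow> (g' \<kappa> has_vector_derivative (- \<kappa>\<^sup>2 / (4 * of_real t) * g \<kappa> t)) (at t)"
proof -
  assume "t > 0"
  hence "(g' \<kappa> has_vector_derivative (- \<kappa>\<^sup>2 / (4 * of_real t) * c (\<kappa>\<^sup>2) t
      - \<i> * \<kappa> * of_real bt * (- \<kappa>\<^sup>2 / (4 * of_real t) * s (\<kappa>\<^sup>2) t))) (at t)"
    unfolding g'_def[abs_def]
    by (intro has_vector_derivative_diff has_vector_derivative_mult_right c'_deriv s'_deriv)
  thus ?thesis unfolding g_def by (simp add: algebra_simps)
qed

lemma g_init: "g \<kappa> t1 = 1" "g' \<kappa> t1 = - \<i> * \<kappa> * of_real bt"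
  by (simp_all add: g_def g'_def init)

lemma g_0: "g 0 t = 1" by (simp add: g_def c_0)

text \<open>The energy flux \<open>Im (cnj g * g' / \<kappa>)\<close> is negative at \<open>t1\<close> and nonincreasing.\<close>

lemma g_T_nonzero:
  assumes "Im \<kappa> \<ge> 0"
  shows "g \<kappa> T \<noteq> 0"
proof (cases "\<kappa> = 0")
  case True thus ?thesis by (simp add: g_0)
next
  case False
  define X where "X t = Im (cnj (g \<kappa> t) * g' \<kappa> t / \<kappa>)" for t
  have D: "\<exists>y. (X has_real_derivative y) (at t) \<and> y \<le> 0" if t: "t1 \<le> t" for t
  proof (intro exI conjI)
    have t0: "t > 0" using t t1 by simp
    let ?y = "Im ((cnj (g \<kappa> t) * (- \<kappa>\<^sup>2 / (4 * of_real t) * g \<kappa> t) + cnj (g' \<kappa> t) * g' \<kappa> t) / \<kappa>)"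
    have "((\<lambda>t. cnj (g \<kappa> t) * g' \<kappa> t / \<kappa>) has_vector_derivative
       ((cnj (g \<kappa> t) * (- \<kappa>\<^sup>2 / (4 * of_real t) * g \<kappa> t) + cnj (g' \<kappa> t) * g' \<kappa> t) / \<kappa>)) (at t)"
      by (intro has_vector_derivative_divide has_vector_derivative_mult has_vector_derivative_cnj g_deriv g'_deriv t0)
    thus "(X has_real_derivative ?y) (at t)"
      unfolding X_def[abs_def] has_real_derivative_iff_has_vector_derivative by (rule bounded_linear.has_vector_derivative[OF bounded_linear_Im])
    \<comment> \<open>Division by \<open>\<kappa>\<close> leaves a nonpositive multiple of
      \<open>\<kappa>\<close> and a nonnegative multiple of \<open>inverse \<kappa>\<close>; both
      have imaginary part at most 0 when \<open>Im \<kappa> \<ge> 0\<close>.\<close>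
    have "(cnj (g \<kappa> t) * (- \<kappa>\<^sup>2 / (4 * of_real t) * g \<kappa> t) + cnj (g' \<kappa> t) * g' \<kappa> t) / \<kappa>
       = - of_real ((cmod (g \<kappa> t))\<^sup>2 / (4 * t)) * \<kappa> + of_real ((cmod (g' \<kappa> t))\<^sup>2) * inverse \<kappa>"
      unfolding of_real_divide complex_norm_square using False by (simp add: field_simps power2_eq_square)
    have gen: "Im (- of_real A * k + of_real B * w) = - A * Im k + B * Im w" for A B k w by simp
    from \<open>_ = - of_real _ * \<kappa> + _\<close> have "?y = - ((cmod (g \<kappa> t))\<^sup>2 / (4 * t)) * Im \<kappa> + (cmod (g' \<kappa> t))\<^sup>2 * Im (inverse \<kappa>)"
      using gen by (simp only:)
    moreover have "Im (inverse \<kappa>) \<le> 0" using assms by (simp add: divide_nonpos_nonneg)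
    hence "(cmod (g' \<kappa> t))\<^sup>2 * Im (inverse \<kappa>) \<le> 0" by (intro mult_nonneg_nonpos) auto
    moreover have "(cmod (g \<kappa> t))\<^sup>2 / (4 * t) * Im \<kappa> \<ge> 0" using assms t0 by auto
    ultimately show "?y \<le> 0" by linarith
  qed
  have "X T \<le> X t1" by (rule DERIV_nonpos_imp_nonincreasing) (use t1T D in auto)
  \<comment> \<open>The outgoing condition gives \<open>g' / \<kappa> = - i bt\<close> at
    \<open>t1\<close>, whatever \<open>\<kappa>\<close> is. A zero of \<open>g\<close> at
    \<open>T\<close> would make the flux vanish there, against monotonicity.\<close>
  moreover have "X t1 = - bt" using False by (simp add: X_def g_init)
  ultimately have "X T < 0" using bt_pos by simp
  thus ?thesis by (auto simp: X_def)
qed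

definition f :: "complex \<Rightarrow> real \<Rightarrow> complex" where "f \<kappa> t = g \<kappa> t / g \<kappa> T"
definition f' :: "complex \<Rightarrow> real \<Rightarrow> complex" where "f' \<kappa> t = g' \<kappa> t / g \<kappa> T"

lemma f_deriv: "t > 0 \<Longrightarrow> (f \<kappa> has_vector_derivative f' \<kappa> t) (at t)"
  unfolding f_def[abs_def] f'_def by (intro has_vector_derivative_divide g_deriv)

lemma f'_deriv: "t > 0 \<Longrightarrow> (f' \<kappa> has_vector_derivative (- \<kappa>\<^sup>2 / (4 * of_real t) * f \<kappa> t)) (at t)"
  using has_vector_derivative_divide[OF g'_deriv, of t \<kappa> "g \<kappa> T"]
  unfolding f'_def[abs_def] f_def by simp

lemma f_T: "Im \<kappa> \<ge> 0 \<Longrightarrow> f \<kappa> T = 1" by (simp add: f_def g_T_nonzero)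
lemma f_0: "f 0 t = 1" by (simp add: f_def g_0)

lemma spectral_compose:
  assumes "spectral F" shows "continuous_on (UNIV \<times> {0<..}) (\<lambda>x. F ((fst x)\<^sup>2) (snd x))"
proof -
  have "continuous_on (UNIV \<times> {0<..}) (\<lambda>x::complex\<times>real. ((fst x)\<^sup>2, snd x))" by (intro continuous_intros)
  hence "continuous_on (UNIV \<times> {0<..}) (\<lambda>x::complex\<times>real. (\<lambda>x. F (fst x) (snd x)) ((fst x)\<^sup>2, snd x))"
    by (rule continuous_on_compose2[of "UNIV \<times> {0<..}" "\<lambda>x. F (fst x) (snd x)", rotated])
       (use assms in \<open>auto simp: spectral_def\<close>)
  thus ?thesis by simp
qed

lemma g_cont: "continuous_on (UNIV \<times> {0<..}) (\<lambda>x. g (fst x) (snd x))"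
  unfolding g_def using spec by (intro continuous_intros spectral_compose)
lemma g'_cont: "continuous_on (UNIV \<times> {0<..}) (\<lambda>x. g' (fst x) (snd x))"
  unfolding g'_def using spec by (intro continuous_intros spectral_compose)

lemma g_T_cont: "continuous_on A (\<lambda>\<kappa>. g \<kappa> T)"
proof -
  have "continuous_on UNIV (\<lambda>\<kappa>. (\<lambda>x. g (fst x) (snd x)) (\<kappa>, T))"
    by (rule continuous_on_compose2[OF g_cont]) (use t1 t1T in \<open>auto intro!: continuous_intros\<close>)
  thus ?thesis by (auto intro: continuous_on_subset)
qed

lemma f_cont: "continuous_on ({\<kappa>. Im \<kappa> \<ge> 0} \<times> {0<..}) (\<lambda>x. f (fst x) (snd x))"
  and f'_cont: "continuous_on ({\<kappa>. Im \<kappa> \<ge> 0} \<times> {0<..}) (\<lambda>x. f' (fst x) (snd x))"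
proof -
  have T: "continuous_on ({\<kappa>. Im \<kappa> \<ge> 0} \<times> {0<..}) (\<lambda>x::complex\<times>real. g (fst x) T)"
    by (rule continuous_on_compose2[OF g_T_cont[of UNIV]]) (auto intro!: continuous_intros)
  show "continuous_on ({\<kappa>. Im \<kappa> \<ge> 0} \<times> {0<..}) (\<lambda>x. f (fst x) (snd x))"
    unfolding f_def by (intro continuous_on_divide continuous_on_subset[OF g_cont] T) (auto simp: g_T_nonzero)
  show "continuous_on ({\<kappa>. Im \<kappa> \<ge> 0} \<times> {0<..}) (\<lambda>x. f' (fst x) (snd x))"
    unfolding f'_def by (intro continuous_on_divide continuous_on_subset[OF g'_cont] T) (auto simp: g_T_nonzero)
qed

lemma g_holomorphic: "t > 0 \<Longrightarrow> (\<lambda>\<kappa>. g \<kappa> t) holomorphic_on A"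
proof -
  assume t: "t > 0"
  have "(\<lambda>\<kappa>. F (\<kappa>\<^sup>2) t) holomorphic_on A" if "spectral F" for F
  proof -
    have h: "(\<lambda>\<Lambda>. F \<Lambda> t) holomorphic_on UNIV" using that t by (auto simp: spectral_def)
    have "((\<lambda>\<Lambda>. F \<Lambda> t) \<circ> (\<lambda>\<kappa>. \<kappa>\<^sup>2)) holomorphic_on A"
      by (rule holomorphic_on_compose_gen[OF _ h]) (auto intro!: holomorphic_intros)
    thus ?thesis by (simp add: comp_def)
  qed
  thus ?thesis unfolding g_def using spec by (intro holomorphic_intros) auto
qed

lemma open_nonzero: "open {\<kappa>. g \<kappa> T \<noteq> 0}"
  using g_T_cont[of UNIV] by (rule open_Collect_neq) (intro continuous_intros)

lemma f_holomorphic: assumes "t > 0" shows "(\<lambda>\<kappa>. f \<kappa> t) holomorphic_on {\<kappa>. g \<kappa> T \<noteq> 0}"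
  unfolding f_def using assms t1 t1T by (intro holomorphic_on_divide g_holomorphic) auto

text \<open>A Liouville-Green transformation. With \<open>x = sqrt t\<close>, the function
  \<open>w = g(x\<^sup>2) / sqrt x\<close> solves
  \<open>w'' + (\<kappa>\<^sup>2 - 3/(4 x\<^sup>2)) w = 0\<close>; splitting off the outgoing wave
  \<open>exp (- i \<kappa> x)\<close> leaves an amplitude \<open>G\<close> with
  \<open>G'' = 2 i \<kappa> G' + 3/(4 x\<^sup>2) G\<close>. The Volterra estimate keeps its norm
  between 1/2 and 3/2. The lower bound matters as much as the upper one, because \<open>g\<close> at
  \<open>T\<close> becomes a denominator.\<close>

lemma g_asymptotics:
  obtains K where "K > 0" "\<And>\<kappa> t. Im \<kappa> \<ge> 0 \<Longrightarrow> K \<le> norm \<kappa> \<Longrightarrow> t \<in> {t1..T+1} \<Longrightarrow>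
      norm (g \<kappa> t) \<le> 3/2 * exp (Im \<kappa> * (sqrt t - sqrt t1)) * (sqrt (sqrt t) / sqrt (sqrt t1)) \<and>
      norm (g \<kappa> t) \<ge> 1/2 * exp (Im \<kappa> * (sqrt t - sqrt t1)) * (sqrt (sqrt t) / sqrt (sqrt t1))"
proof -
  define a where "a = sqrt t1"
  define b where "b = sqrt (T + 1)"
  have a0: "a > 0" using t1 by (simp add: a_def)
  have ab: "a \<le> b" using t1T by (simp add: a_def b_def)
  \<comment> \<open>\<open>v\<close> bounds the potential \<open>3 / (4 x\<^sup>2)\<close> for
    \<open>x \<ge> a\<close>. The value \<open>h\<close> is the norm of the derivative of
    \<open>G\<close> at \<open>a\<close>, the part that the outgoing condition does not cancel
    because of the factor \<open>1 / sqrt x\<close>. \<open>K\<close> is the threshold of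
    \<open>volterra_bound\<close>.\<close>
  define v where "v = 3 / (4 * a\<^sup>2)"
  define h where "h = 1 / (2 * a)"
  define K where "K = 4 * (v * (b - a) + h)"
  have K0: "K > 0" using a0 ab by (auto simp: K_def v_def h_def intro!: add_nonneg_pos)
  show thesis
  proof (rule that[OF K0])
    fix \<kappa> t assume \<kappa>: "Im \<kappa> \<ge> 0" "K \<le> norm \<kappa>" and t: "t \<in> {t1..T+1}"
    define e where "e = (\<lambda>x::real. exp (\<i> * \<kappa> * of_real (x - a)))"
    define r where "r = (\<lambda>x::real. complex_of_real (sqrt a / sqrt x))"
    define G where "G = (\<lambda>x. e x * r x * g \<kappa> (x\<^sup>2))"
    define H where "H = (\<lambda>x. e x * r x * (\<i> * \<kappa> * g \<kappa> (x\<^sup>2) - of_real (1 / (2 * x)) * g \<kappa> (x\<^sup>2) + of_real (2 * x) * g' \<kappa> (x\<^sup>2)))"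
    have e': "(e has_vector_derivative (\<i> * \<kappa> * e x)) (at x)" for x
    proof -
      have "((\<lambda>z. exp (\<i> * \<kappa> * (z - of_real a))) has_field_derivative (\<i> * \<kappa> * exp (\<i> * \<kappa> * (of_real x - of_real a)))) (at (of_real x))"
        by (rule derivative_eq_intros refl | simp)+
      from has_vector_derivative_real_field[OF this] show ?thesis by (simp add: e_def)
    qed
    have r': "(r has_vector_derivative (- of_real (1 / (2 * x)) * r x)) (at x)" if "x > 0" for x
    proof -
      have "((\<lambda>x. sqrt a / sqrt x) has_real_derivative (- (1 / (2 * x)) * (sqrt a / sqrt x))) (at x)"
      proof -
        have "((\<lambda>x. sqrt a / sqrt x) has_real_derivative
            ((0 * sqrt x - sqrt a * (inverse (sqrt x) / 2)) / (sqrt x * sqrt x))) (at x)"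
          by (rule DERIV_divide[OF DERIV_const DERIV_real_sqrt]) (use that in auto)
        moreover have "(0 * sqrt x - sqrt a * (inverse (sqrt x) / 2)) / (sqrt x * sqrt x) = - (1 / (2 * x)) * (sqrt a / sqrt x)"
        proof -
          have xx: "sqrt x * sqrt x = x" using that by simp
          show ?thesis unfolding xx by (simp add: inverse_eq_divide mult.commute)
        qed
        ultimately show ?thesis by simp
      qed
      from has_vector_derivative_of_real[where ?'a = complex, OF this] show ?thesis by (simp add: r_def)
    qed
    have gx: "((\<lambda>x. g \<kappa> (x\<^sup>2)) has_vector_derivative (of_real (2 * x) * g' \<kappa> (x\<^sup>2))) (at x)"
      "((\<lambda>x. g' \<kappa> (x\<^sup>2)) has_vector_derivative (of_real (2 * x) * (- \<kappa>\<^sup>2 / (4 * of_real (x\<^sup>2)) * g \<kappa> (x\<^sup>2)))) (at x)"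
      if "x > 0" for x
    proof -
      have sq: "((\<lambda>x::real. x\<^sup>2) has_vector_derivative (2 * x)) (at x)"
        unfolding has_real_derivative_iff_has_vector_derivative[symmetric] by (rule derivative_eq_intros refl | simp)+
      show "((\<lambda>x. g \<kappa> (x\<^sup>2)) has_vector_derivative (of_real (2 * x) * g' \<kappa> (x\<^sup>2))) (at x)"
        using vector_diff_chain_at[OF sq g_deriv] that by (simp add: comp_def scaleR_conv_of_real)
      show "((\<lambda>x. g' \<kappa> (x\<^sup>2)) has_vector_derivative (of_real (2 * x) * (- \<kappa>\<^sup>2 / (4 * of_real (x\<^sup>2)) * g \<kappa> (x\<^sup>2)))) (at x)"
        using vector_diff_chain_at[OF sq g'_deriv] that by (simp add: comp_def scaleR_conv_of_real)
    qed
    have G': "(G has_vector_derivative H x) (at x)" if x: "x > 0" for x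
    proof -
      have "(G has_vector_derivative (e x * r x * (of_real (2 * x) * g' \<kappa> (x\<^sup>2)) +
         (e x * (- of_real (1 / (2 * x)) * r x) + \<i> * \<kappa> * e x * r x) * g \<kappa> (x\<^sup>2))) (at x)"
        unfolding G_def by (intro has_vector_derivative_mult e' r' gx x)
      thus ?thesis unfolding H_def by (simp add: algebra_simps)
    qed
    have H': "(H has_vector_derivative (2 * \<i> * \<kappa> * H x + of_real (3 / (4 * x\<^sup>2)) * G x)) (at x)" if x: "x > 0" for x
    proof -
      have i': "((\<lambda>x. complex_of_real (1 / (2 * x))) has_vector_derivative of_real (- 1 / (2 * x\<^sup>2))) (at x)"
      proof (rule has_vector_derivative_of_real)
        have "((\<lambda>x. 1 / (2 * x)) has_real_derivative ((0 * (2 * x) - 1 * 2) / ((2 * x) * (2 * x)))) (at x)"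
          by (rule DERIV_divide[OF DERIV_const DERIV_cmult_Id]) (use x in auto)
        moreover have "(0 * (2 * x) - 1 * 2) / ((2 * x) * (2 * x)) = - 1 / (2 * x\<^sup>2)" by (simp add: power2_eq_square)
        ultimately show "((\<lambda>x. 1 / (2 * x)) has_real_derivative - 1 / (2 * x\<^sup>2)) (at x)" by simp
      qed
      have d': "((\<lambda>x. complex_of_real (2 * x)) has_vector_derivative of_real 2) (at x)"
        by (rule has_vector_derivative_of_real[OF DERIV_cmult_Id])
      have "(H has_vector_derivative (e x * r x *
            (\<i> * \<kappa> * (of_real (2 * x) * g' \<kappa> (x\<^sup>2))
             - (of_real (1 / (2 * x)) * (of_real (2 * x) * g' \<kappa> (x\<^sup>2)) + of_real (- 1 / (2 * x\<^sup>2)) * g \<kappa> (x\<^sup>2))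
             + (of_real (2 * x) * (of_real (2 * x) * (- \<kappa>\<^sup>2 / (4 * of_real (x\<^sup>2)) * g \<kappa> (x\<^sup>2))) + of_real 2 * g' \<kappa> (x\<^sup>2)))
           + (e x * (- of_real (1 / (2 * x)) * r x) + \<i> * \<kappa> * e x * r x) *
            (\<i> * \<kappa> * g \<kappa> (x\<^sup>2) - of_real (1 / (2 * x)) * g \<kappa> (x\<^sup>2) + of_real (2 * x) * g' \<kappa> (x\<^sup>2)))) (at x)"
        unfolding H_def
        by (rule has_vector_derivative_mult[OF has_vector_derivative_mult[OF e' r'[OF x]]
            has_vector_derivative_add[OF has_vector_derivative_diff[OF has_vector_derivative_mult_right[OF gx(1)[OF x]]
              has_vector_derivative_mult[OF i' gx(1)[OF x]]] has_vector_derivative_mult[OF d' gx(2)[OF x]]]])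
      moreover have "(e x * r x *
            (\<i> * \<kappa> * (of_real (2 * x) * g' \<kappa> (x\<^sup>2))
             - (of_real (1 / (2 * x)) * (of_real (2 * x) * g' \<kappa> (x\<^sup>2)) + of_real (- 1 / (2 * x\<^sup>2)) * g \<kappa> (x\<^sup>2))
             + (of_real (2 * x) * (of_real (2 * x) * (- \<kappa>\<^sup>2 / (4 * of_real (x\<^sup>2)) * g \<kappa> (x\<^sup>2))) + of_real 2 * g' \<kappa> (x\<^sup>2)))
           + (e x * (- of_real (1 / (2 * x)) * r x) + \<i> * \<kappa> * e x * r x) *
            (\<i> * \<kappa> * g \<kappa> (x\<^sup>2) - of_real (1 / (2 * x)) * g \<kappa> (x\<^sup>2) + of_real (2 * x) * g' \<kappa> (x\<^sup>2)))
         = 2 * \<i> * \<kappa> * H x + of_real (3 / (4 * x\<^sup>2)) * G x"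
      proof -
        define X where "X = complex_of_real (2 * x)"
        define Y where "Y = complex_of_real (1 / (2 * x))"
        have XY: "X * Y = 1" unfolding X_def Y_def of_real_mult[symmetric] using x by simp
        have 1: "complex_of_real (- 1 / (2 * x\<^sup>2)) = - 2 * Y\<^sup>2" "complex_of_real (3 / (4 * x\<^sup>2)) = 3 * Y\<^sup>2"
          "- \<kappa>\<^sup>2 / (4 * of_real (x\<^sup>2)) = - \<kappa>\<^sup>2 * Y\<^sup>2" "complex_of_real 2 = 2"
          using x by (simp_all add: Y_def power2_eq_square)
        have "\<i> * \<i> = - 1" by simp
        thus ?thesis unfolding H_def G_def 1 X_def[symmetric] Y_def[symmetric]
          by (rule amplitude_identity[OF XY])
      qed
      ultimately show ?thesis by (simp only:)
    qed
    have st: "sqrt t \<in> {a..b}" using t by (auto simp: a_def b_def)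
    have "norm (G (sqrt t) - G a) \<le> 1/2"
    proof (rule volterra_bound[where H = H and V = "\<lambda>x. 3 / (4 * x\<^sup>2)" and v = v and h = h and \<kappa> = \<kappa> and b = b])
      show "\<kappa> \<noteq> 0" using \<kappa> K0 by auto
      show "\<And>x. x \<in> {a..b} \<Longrightarrow> (G has_vector_derivative H x) (at x within {a..b})"
        using G' a0 by (auto intro: has_vector_derivative_at_within)
      show "\<And>x. x \<in> {a..b} \<Longrightarrow> (H has_vector_derivative 2 * \<i> * \<kappa> * H x + of_real (3 / (4 * x\<^sup>2)) * G x) (at x within {a..b})"
        using H' a0 by (auto intro: has_vector_derivative_at_within)
      show "\<bar>3 / (4 * x\<^sup>2)\<bar> \<le> v" if "x \<in> {a..b}" for x
        using that a0 unfolding v_def by (auto intro!: divide_left_mono power_mono)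
      have aa: "a\<^sup>2 = t1" using t1 by (simp add: a_def)
      show "norm (G a) = 1" using a0 by (simp add: G_def e_def r_def aa g_init)
      have "\<i> * \<kappa> * 1 - of_real (1 / (2 * a)) * 1 + of_real (2 * a) * (- \<i> * \<kappa> * of_real bt) = - of_real (1 / (2 * a))"
        using a0 by (simp add: bt_def a_def field_simps)
      hence "H a = - of_real (1 / (2 * a))" using a0 by (simp add: H_def e_def r_def aa g_init del: of_real_divide)
      thus "norm (H a) \<le> h" using a0 by (simp add: h_def norm_divide)
      show "4 * (v * (b - a) + h) \<le> cmod \<kappa>" using \<kappa> by (simp add: K_def)
    qed (use ab \<kappa> st in auto)
    moreover have "norm (G a) = 1"
    proof -
      have aa: "a\<^sup>2 = t1" using t1 by (simp add: a_def)
      show ?thesis using a0 by (simp add: G_def e_def r_def aa g_init)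
    qed
    ultimately have Gb: "norm (G (sqrt t)) \<le> 3/2" "norm (G (sqrt t)) \<ge> 1/2"
      using norm_triangle_ineq2[of "G (sqrt t)" "G a"] norm_triangle_ineq3[of "G (sqrt t)" "G a"] by linarith+
    have tp: "t > 0" using t t1 by auto
    have "norm (G (sqrt t)) = exp (- (Im \<kappa> * (sqrt t - a))) * (sqrt a / sqrt (sqrt t)) * norm (g \<kappa> t)"
      using tp a0 by (simp add: G_def e_def r_def norm_mult norm_divide norm_exp algebra_simps)
    hence "norm (g \<kappa> t) = norm (G (sqrt t)) * exp (Im \<kappa> * (sqrt t - sqrt t1)) * (sqrt (sqrt t) / sqrt (sqrt t1))"
    proof -
      define z where "z = Im \<kappa> * (sqrt t - a)"
      assume *: "norm (G (sqrt t)) = exp (- (Im \<kappa> * (sqrt t - a))) * (sqrt a / sqrt (sqrt t)) * norm (g \<kappa> t)"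
      have "norm (G (sqrt t)) * exp z * (sqrt (sqrt t) / sqrt a)
          = (exp (- z) * exp z) * ((sqrt a / sqrt (sqrt t)) * (sqrt (sqrt t) / sqrt a)) * norm (g \<kappa> t)"
        unfolding * z_def by (simp only: mult_ac)
      also have "\<dots> = norm (g \<kappa> t)" using tp a0 by (simp add: exp_minus)
      finally show ?thesis by (simp add: z_def a_def)
    qed
    moreover have "exp (Im \<kappa> * (sqrt t - sqrt t1)) \<ge> 0" "sqrt (sqrt t) / sqrt (sqrt t1) \<ge> 0" using tp t1 by auto
    ultimately show "norm (g \<kappa> t) \<le> 3/2 * exp (Im \<kappa> * (sqrt t - sqrt t1)) * (sqrt (sqrt t) / sqrt (sqrt t1)) \<and>
      norm (g \<kappa> t) \<ge> 1/2 * exp (Im \<kappa> * (sqrt t - sqrt t1)) * (sqrt (sqrt t) / sqrt (sqrt t1))"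
      using Gb by (simp only:) (intro conjI mult_right_mono; simp)
  qed
qed

text \<open>Dividing the two-sided bounds at \<open>t\<close> and at \<open>T\<close> gives the
  factor 3 and an exponential in \<open>sqrt T - sqrt t\<close>; compactness covers the remaining
  small \<open>\<kappa>\<close>. Beyond \<open>T\<close> that exponential grows with
  \<open>Im \<kappa>\<close>, so the range up to \<open>T + 1\<close>, needed for a neighbourhood of
  the slab, is treated for real frequencies only.\<close>

lemma f_bounds:
  obtains C K where "C \<ge> 0" "K > 0"
    and "\<And>\<kappa> t. Im \<kappa> \<ge> 0 \<Longrightarrow> t \<in> {t1..T} \<Longrightarrow> norm (f \<kappa> t) \<le> C"
    and "\<And>x t. t \<in> {t1..T+1} \<Longrightarrow> norm (f (of_real x) t) \<le> C"
    and "\<And>\<kappa> t. Im \<kappa> \<ge> 0 \<Longrightarrow> K \<le> norm \<kappa> \<Longrightarrow> t \<in> {t1..T} \<Longrightarrow>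
          norm (f \<kappa> t) \<le> C * exp (- (Im \<kappa> * (sqrt T - sqrt t)))"
proof -
  obtain K where K: "K > 0" and ga: "\<And>\<kappa> t. Im \<kappa> \<ge> 0 \<Longrightarrow> K \<le> norm \<kappa> \<Longrightarrow> t \<in> {t1..T+1} \<Longrightarrow>
      norm (g \<kappa> t) \<le> 3/2 * exp (Im \<kappa> * (sqrt t - sqrt t1)) * (sqrt (sqrt t) / sqrt (sqrt t1)) \<and>
      norm (g \<kappa> t) \<ge> 1/2 * exp (Im \<kappa> * (sqrt t - sqrt t1)) * (sqrt (sqrt t) / sqrt (sqrt t1))"
    using g_asymptotics by blast
  define D where "D = 3 * (sqrt (sqrt (T+1)) / sqrt (sqrt T))"
  have T0: "T > 0" using t1 t1T by simp
  have D0: "D \<ge> 0" using T0 by (simp add: D_def)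
  have big: "norm (f \<kappa> t) \<le> D * exp (- (Im \<kappa> * (sqrt T - sqrt t)))"
    if \<kappa>: "Im \<kappa> \<ge> 0" "K \<le> norm \<kappa>" and t: "t \<in> {t1..T+1}" for \<kappa> t
  proof -
    define q where "q = sqrt (sqrt t1)"
    have q0: "q > 0" using t1 by (simp add: q_def)
    have "norm (f \<kappa> t) = norm (g \<kappa> t) / norm (g \<kappa> T)" by (simp add: f_def norm_divide)
    also have "\<dots> \<le> (3/2 * exp (Im \<kappa> * (sqrt t - sqrt t1)) * (sqrt (sqrt t) / q)) /
        (1/2 * exp (Im \<kappa> * (sqrt T - sqrt t1)) * (sqrt (sqrt T) / q))"
      unfolding q_def using ga[OF \<kappa> t] ga[OF \<kappa>, of T] t1T t1 T0 t by (intro frac_le) auto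
    also have "\<dots> = 3 * (exp (Im \<kappa> * (sqrt t - sqrt t1)) / exp (Im \<kappa> * (sqrt T - sqrt t1))) * (sqrt (sqrt t) / sqrt (sqrt T))"
      using q0 T0 by (simp add: field_simps)
    also have "exp (Im \<kappa> * (sqrt t - sqrt t1)) / exp (Im \<kappa> * (sqrt T - sqrt t1)) = exp (- (Im \<kappa> * (sqrt T - sqrt t)))"
      by (simp add: exp_diff[symmetric] algebra_simps)
    also have "3 * exp (- (Im \<kappa> * (sqrt T - sqrt t))) * (sqrt (sqrt t) / sqrt (sqrt T))
       \<le> 3 * exp (- (Im \<kappa> * (sqrt T - sqrt t))) * (sqrt (sqrt (T+1)) / sqrt (sqrt T))"
      using t T0 by (intro mult_left_mono divide_right_mono) auto
    finally show ?thesis by (simp add: D_def mult_ac)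
  qed
  define S where "S = ({\<kappa>. Im \<kappa> \<ge> 0} \<inter> cball 0 K) \<times> {t1..T+1}"
  have "compact S" unfolding S_def
    by (intro compact_Times closed_Int_compact closed_halfspace_Im_ge) auto
  moreover have "continuous_on S (\<lambda>x. f (fst x) (snd x))"
    by (rule continuous_on_subset[OF f_cont]) (use t1 in \<open>auto simp: S_def\<close>)
  ultimately have "bounded ((\<lambda>x. f (fst x) (snd x)) ` S)"
    by (intro compact_imp_bounded compact_continuous_image)
  then obtain B where B: "\<And>x. x \<in> S \<Longrightarrow> norm (f (fst x) (snd x)) \<le> B" unfolding bounded_iff by auto
  have small: "norm (f \<kappa> t) \<le> B" if "Im \<kappa> \<ge> 0" "norm \<kappa> \<le> K" "t \<in> {t1..T+1}" for \<kappa> t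
    using B[of "(\<kappa>, t)"] that by (auto simp: S_def)
  show thesis
  proof (rule that[of "max D B" K])
    show "max D B \<ge> 0" using D0 by simp
    show "norm (f \<kappa> t) \<le> max D B * exp (- (Im \<kappa> * (sqrt T - sqrt t)))" if "Im \<kappa> \<ge> 0" "K \<le> norm \<kappa>" "t \<in> {t1..T}" for \<kappa> t
    proof -
      have "D * exp (- (Im \<kappa> * (sqrt T - sqrt t))) \<le> max D B * exp (- (Im \<kappa> * (sqrt T - sqrt t)))"
        by (intro mult_right_mono) auto
      from order_trans[OF big[OF that(1,2)] this] show ?thesis using that(3) by simp
    qed
    show "norm (f \<kappa> t) \<le> max D B" if "Im \<kappa> \<ge> 0" "t \<in> {t1..T}" for \<kappa> t
    proof (cases "norm \<kappa> \<le> K")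
      case True thus ?thesis using small[of \<kappa> t] that by auto
    next
      case False
      have "norm (f \<kappa> t) \<le> D * exp (- (Im \<kappa> * (sqrt T - sqrt t)))" using big[of \<kappa> t] False that by auto
      also have "\<dots> \<le> D * 1" using D0 that by (intro mult_left_mono) auto
      finally show ?thesis by simp
    qed
    show "norm (f (of_real x) t) \<le> max D B" if "t \<in> {t1..T+1}" for x t
      using small[of "of_real x" t] big[of "of_real x" t] that by (cases "\<bar>x\<bar> \<le> K") auto
  qed (use K in auto)
qed

text \<open>\<open>St \<kappa> t\<close> is \<open>Im (f \<kappa> t) / \<kappa>\<close>, written so that it makes sense at \<open>\<kappa> = 0\<close>.\<close>

definition St :: "real \<Rightarrow> real \<Rightarrow> real" where
  "St \<kappa> t = bt * (Re (c ((of_real \<kappa>)\<^sup>2) t) * Re (s ((of_real \<kappa>)\<^sup>2) T) - Re (s ((of_real \<kappa>)\<^sup>2) t) * Re (c ((of_real \<kappa>)\<^sup>2) T))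
     / (cmod (g (of_real \<kappa>) T))\<^sup>2"
definition St' :: "real \<Rightarrow> real \<Rightarrow> real" where
  "St' \<kappa> t = bt * (Re (c' ((of_real \<kappa>)\<^sup>2) t) * Re (s ((of_real \<kappa>)\<^sup>2) T) - Re (s' ((of_real \<kappa>)\<^sup>2) t) * Re (c ((of_real \<kappa>)\<^sup>2) T))
     / (cmod (g (of_real \<kappa>) T))\<^sup>2"

lemma has_real_derivative_Re:
  "(F has_vector_derivative D) (at t) \<Longrightarrow> ((\<lambda>t. Re (F t)) has_real_derivative Re D) (at t)"
  unfolding has_real_derivative_iff_has_vector_derivative
  by (rule bounded_linear.has_vector_derivative[OF bounded_linear_Re])

lemma St_deriv: assumes "t > 0" shows "(St \<kappa> has_real_derivative St' \<kappa> t) (at t)"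
proof -
  have "((\<lambda>t. Re (c ((of_real \<kappa>)\<^sup>2) t)) has_real_derivative Re (c' ((of_real \<kappa>)\<^sup>2) t)) (at t)"
    "((\<lambda>t. Re (s ((of_real \<kappa>)\<^sup>2) t)) has_real_derivative Re (s' ((of_real \<kappa>)\<^sup>2) t)) (at t)"
    by (intro has_real_derivative_Re c_deriv s_deriv assms)+
  thus ?thesis unfolding St_def[abs_def] St'_def
    by (intro DERIV_cdivide DERIV_cmult DERIV_diff DERIV_cmult_right)
qed

lemma St'_deriv: assumes "t > 0" shows "(St' \<kappa> has_real_derivative (- \<kappa>\<^sup>2 / (4 * t) * St \<kappa> t)) (at t)"
proof -
  have e: "- (complex_of_real \<kappa>)\<^sup>2 / (4 * of_real t) = of_real (- \<kappa>\<^sup>2 / (4 * t))" by simp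
  have R: "Re (of_real a * z) = a * Re z" for a z by simp
  have "((\<lambda>t. Re (c' ((of_real \<kappa>)\<^sup>2) t)) has_real_derivative Re (- (of_real \<kappa>)\<^sup>2 / (4 * of_real t) * c ((of_real \<kappa>)\<^sup>2) t)) (at t)"
    "((\<lambda>t. Re (s' ((of_real \<kappa>)\<^sup>2) t)) has_real_derivative Re (- (of_real \<kappa>)\<^sup>2 / (4 * of_real t) * s ((of_real \<kappa>)\<^sup>2) t)) (at t)"
    by (intro has_real_derivative_Re c'_deriv s'_deriv assms)+
  hence "(St' \<kappa> has_real_derivative
     (bt * ((- \<kappa>\<^sup>2 / (4 * t) * Re (c ((of_real \<kappa>)\<^sup>2) t)) * Re (s ((of_real \<kappa>)\<^sup>2) T)
       - (- \<kappa>\<^sup>2 / (4 * t) * Re (s ((of_real \<kappa>)\<^sup>2) t)) * Re (c ((of_real \<kappa>)\<^sup>2) T)) / (cmod (g (of_real \<kappa>) T))\<^sup>2)) (at t)"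
    unfolding St'_def[abs_def] e R by (intro DERIV_cdivide DERIV_cmult DERIV_diff DERIV_cmult_right)
  moreover have "bt * ((k * a) * b - (k * a') * b') / d = k * (bt * (a * b - a' * b') / d)" for k a b a' b' d :: real
    by (simp add: algebra_simps)
  ultimately show ?thesis unfolding St_def by (simp only:)
qed

lemma St_T: "St \<kappa> T = 0" by (simp add: St_def)

lemma cont_compose_real:
  assumes "continuous_on (UNIV \<times> {0<..}) (\<lambda>x::complex\<times>real. F (fst x) (snd x) :: complex)"
  shows "continuous_on (UNIV \<times> {0<..}) (\<lambda>x::real\<times>real. F (of_real (fst x)) (snd x))"
proof -
  have "continuous_on (UNIV \<times> {0<..}) (\<lambda>x::real\<times>real. (\<lambda>x. F (fst x) (snd x)) (complex_of_real (fst x), snd x))"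
    by (rule continuous_on_compose2[OF assms]) (auto intro!: continuous_intros)
  thus ?thesis by simp
qed

lemma St_cont: "continuous_on (UNIV \<times> {0<..}) (\<lambda>x. St (fst x) (snd x))"
  and St'_cont: "continuous_on (UNIV \<times> {0<..}) (\<lambda>x. St' (fst x) (snd x))"
proof -
  have T0: "T > 0" using t1 t1T by simp
  have a: "continuous_on (UNIV \<times> {0<..}) (\<lambda>x::real\<times>real. F ((of_real (fst x))\<^sup>2) (snd x))" if "spectral F" for F
    using cont_compose_real[of "\<lambda>\<kappa> t. F (\<kappa>\<^sup>2) t"] spectral_compose[OF that] by simp
  have b: "continuous_on (UNIV \<times> {0<..}) (\<lambda>x::real\<times>real. F ((of_real (fst x))\<^sup>2) T)" if "spectral F" for F
  proof -
    have "continuous_on (UNIV \<times> {0<..}) (\<lambda>x::real\<times>real. (\<lambda>x. F ((of_real (fst x))\<^sup>2) (snd x)) (fst x, T))"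
      by (rule continuous_on_compose2[OF a[OF that]]) (use T0 in \<open>auto intro!: continuous_intros\<close>)
    thus ?thesis by simp
  qed
  have d: "continuous_on (UNIV \<times> {0<..}) (\<lambda>x::real\<times>real. g (of_real (fst x)) T)"
    by (rule continuous_on_compose2[OF g_T_cont[of UNIV]]) (auto intro!: continuous_intros)
  show "continuous_on (UNIV \<times> {0<..}) (\<lambda>x. St (fst x) (snd x))"
    unfolding St_def by (intro continuous_intros a b d spec) (simp add: g_T_nonzero)
  show "continuous_on (UNIV \<times> {0<..}) (\<lambda>x. St' (fst x) (snd x))"
    unfolding St'_def by (intro continuous_intros a b d spec) (simp add: g_T_nonzero)
qed

lemma spectral_real: assumes "spectral F" "t > 0" shows "F ((of_real x)\<^sup>2) t = of_real (Re (F ((of_real x)\<^sup>2) t))"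
proof -
  have "cnj (F ((of_real x)\<^sup>2) t) = F ((of_real x)\<^sup>2) t" using assms by (auto simp: spectral_def)
  thus ?thesis by (metis Reals_cnj_iff complex_is_Real_iff of_real_Re)
qed

lemma g_neg: assumes "t > 0" shows "g (of_real (- x)) t = cnj (g (of_real x) t)"
proof -
  have "cnj (F ((of_real x)\<^sup>2) t) = F ((of_real x)\<^sup>2) t" if "spectral F" for F
    using that assms by (auto simp: spectral_def)
  thus ?thesis using spec by (simp add: g_def)
qed

text \<open>For real frequencies the only non-real coefficient of \<open>g\<close> is
  \<open>- i \<kappa> bt\<close>, which is odd in \<open>\<kappa>\<close>. Hence \<open>Re f\<close>
  is even and \<open>Im f\<close> odd, so half-line integrals of \<open>Re f\<close> and of
  \<open>Im f / \<kappa>\<close> are half of those over the line.\<close>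

lemma f_neg: assumes "t > 0" shows "f (of_real (- x)) t = cnj (f (of_real x) t)"
  unfolding f_def using g_neg[OF assms, of x] g_neg[of T x] t1 t1T by simp

text \<open>On the real axis \<open>g\<close> has real part \<open>c\<close> and imaginary part
  \<open>- x * bt * s\<close>, so the imaginary part of \<open>g(t) cnj(g(T))\<close> carries an
  explicit factor \<open>x\<close>.\<close>

lemma Im_f: assumes t: "t > 0" shows "Im (f (of_real x) t) = x * St x t"
proof -
  have T0: "T > 0" using t1 t1T by simp
  define a b a' b' where "a = Re (c ((of_real x)\<^sup>2) t)" "b = Re (s ((of_real x)\<^sup>2) t)"
    "a' = Re (c ((of_real x)\<^sup>2) T)" "b' = Re (s ((of_real x)\<^sup>2) T)"
  note ab = this
  have g: "g (of_real x) t = Complex a (- x * bt * b)" "g (of_real x) T = Complex a' (- x * bt * b')"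
    unfolding g_def ab using spectral_real[OF spec(1) t, of x] spectral_real[OF spec(3) t, of x]
      spectral_real[OF spec(1) T0, of x] spectral_real[OF spec(3) T0, of x]
    by (auto simp: complex_eq_iff)
  have "Im (f (of_real x) t) = (x * bt * (a * b' - b * a')) / (cmod (g (of_real x) T))\<^sup>2"
    unfolding f_def g by (simp add: Im_divide cmod_power2 algebra_simps)
  thus ?thesis unfolding St_def ab by simp
qed

text \<open>The error term common to both contour integrals below. Only the angle is integrated, so
  the factor \<open>R\<close> of the arc length appears separately where it does not cancel.\<close>

definition arc :: "real \<Rightarrow> real \<Rightarrow> real" where
  "arc t R = integral {0..pi} (\<lambda>\<theta>. norm (f (of_real R * cis \<theta>) t))"

lemma f_arc_cont: assumes "t > 0" "R > 0" shows "continuous_on {0..pi} (\<lambda>\<theta>. f (of_real R * cis \<theta>) t)"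
proof -
  have "continuous_on {0..pi} (\<lambda>\<theta>. (\<lambda>x. f (fst x) (snd x)) (of_real R * cis \<theta>, t))"
  proof (rule continuous_on_compose2[OF f_cont])
    show "continuous_on {0..pi} (\<lambda>\<theta>. (of_real R * cis \<theta>, t))"
      unfolding cis_conv_exp by (intro continuous_intros)
  qed (use assms in \<open>auto simp: sin_ge_zero\<close>)
  thus ?thesis by simp
qed

lemma arc_bounded: obtains C where "\<And>t R. t \<in> {t1..T} \<Longrightarrow> R > 0 \<Longrightarrow> arc t R \<le> C" "\<And>t R. 0 \<le> arc t R"
proof -
  obtain C K where C: "C \<ge> 0" "\<And>\<kappa> t. Im \<kappa> \<ge> 0 \<Longrightarrow> t \<in> {t1..T} \<Longrightarrow> norm (f \<kappa> t) \<le> C"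
    using f_bounds by metis
  show thesis
  proof (rule that)
    fix t R :: real assume t: "t \<in> {t1..T}" and R: "R > 0"
    have "arc t R \<le> integral {0..pi} (\<lambda>_. C)"
      unfolding arc_def
    proof (rule integral_le)
      show "(\<lambda>\<theta>. norm (f (of_real R * cis \<theta>) t)) integrable_on {0..pi}"
        using t t1 R by (intro integrable_continuous_real continuous_intros f_arc_cont) auto
      show "norm (f (of_real R * cis \<theta>) t) \<le> C" if "\<theta> \<in> {0..pi}" for \<theta>
        using R that by (intro C t) (auto simp: sin_ge_zero)
    qed auto
    thus "arc t R \<le> pi * C" by simp
  next
    \<comment> \<open>A non-integrable integrand has integral 0 by convention, so the sign holds for
      all \<open>t\<close> and \<open>R\<close>.\<close>
    show "0 \<le> arc t R" for t R unfolding arc_def by (cases "(\<lambda>\<theta>. norm (f (of_real R * cis \<theta>) t)) integrable_on {0..pi}")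
       (auto intro: integral_nonneg simp: not_integrable_integral)
  qed
qed

text \<open>Inside the arc \<open>Im \<kappa> = R sin \<theta>\<close> tends to infinity and
  \<open>f\<close> decays at the rate \<open>sqrt T - sqrt t\<close>, which is positive only for
  \<open>t < T\<close>. The two endpoints are negligible, and the uniform bound provides the
  majorant.\<close>

lemma arc_tendsto_0:
  assumes t: "t1 \<le> t" "t < T" and X: "filterlim X at_top sequentially"
  shows "(\<lambda>i. arc t (X i)) \<longlonglongrightarrow> 0"
proof -
  obtain C K where C: "C \<ge> 0" "K > 0" "\<And>\<kappa> t. Im \<kappa> \<ge> 0 \<Longrightarrow> K \<le> norm \<kappa> \<Longrightarrow> t \<in> {t1..T} \<Longrightarrow>
          norm (f \<kappa> t) \<le> C * exp (- (Im \<kappa> * (sqrt T - sqrt t)))"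
    using f_bounds by metis
  define \<tau> where "\<tau> = sqrt T - sqrt t"
  have \<tau>: "\<tau> > 0" using t by (simp add: \<tau>_def)
  \<comment> \<open>The maximum with \<open>K\<close> keeps the comparison function below
    \<open>C\<close> for every radius, so dominated convergence covers the whole sequence and not
    only its tail.\<close>
  define h where "h R \<theta> = C * exp (- (max K R * sin \<theta> * \<tau>))" for R \<theta>
  define lim where "lim \<theta> = (if \<theta> \<in> {0, pi} then C else 0)" for \<theta>
  have hc: "h R integrable_on {0..pi}" for R
    unfolding h_def by (intro integrable_continuous_real continuous_intros)
  have conv: "(\<lambda>i. integral {0..pi} (h (X i))) \<longlonglongrightarrow> integral {0..pi} lim"
  proof (rule dominated_convergence(2)[where h = "\<lambda>_. C"])
    show "norm (h (X k) \<theta>) \<le> C" if "\<theta> \<in> {0..pi}" for k \<theta>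
    proof -
      have "exp (- (max K (X k) * sin \<theta> * \<tau>)) \<le> 1"
        using C(2) \<tau> that by (auto intro!: mult_nonneg_nonneg sin_ge_zero simp: le_max_iff_disj)
      thus ?thesis using C(1) by (auto simp: h_def mult_left_le)
    qed
    show "(\<lambda>k. h (X k) \<theta>) \<longlonglongrightarrow> lim \<theta>" if \<theta>: "\<theta> \<in> {0..pi}" for \<theta>
    proof (cases "\<theta> \<in> {0, pi}")
      case True thus ?thesis by (auto simp: h_def lim_def)
    next
      case False
      hence s: "sin \<theta> > 0" using \<theta> by (intro sin_gt_zero) auto
      have "filterlim (\<lambda>k. max K (X k)) at_top sequentially"
        by (rule filterlim_at_top_mono[OF X]) auto
      hence "filterlim (\<lambda>k. (sin \<theta> * \<tau>) * max K (X k)) at_top sequentially"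
        using s \<tau> by (intro filterlim_tendsto_pos_mult_at_top[OF tendsto_const]) auto
      hence "filterlim (\<lambda>k. - ((sin \<theta> * \<tau>) * max K (X k))) at_bot sequentially"
        by (simp add: filterlim_uminus_at_bot)
      hence "(\<lambda>k. exp (- ((sin \<theta> * \<tau>) * max K (X k)))) \<longlonglongrightarrow> 0"
        by (rule filterlim_compose[OF exp_at_bot])
      hence "(\<lambda>k. C * exp (- ((sin \<theta> * \<tau>) * max K (X k)))) \<longlonglongrightarrow> C * 0" by (intro tendsto_intros)
      thus ?thesis using False by (simp add: h_def lim_def mult_ac)
    qed
  qed (use hc in auto)
  have "(lim has_integral 0) {0..pi}"
    by (rule has_integral_spike_finite[of "{0,pi}" _ _ "\<lambda>_. 0"]) (auto simp: lim_def)
  hence "integral {0..pi} lim = 0" by (rule integral_unique)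
  hence conv0: "(\<lambda>i. integral {0..pi} (h (X i))) \<longlonglongrightarrow> 0" using conv by simp
  show ?thesis
  proof (rule tendsto_sandwich[OF _ _ tendsto_const conv0])
    show "\<forall>\<^sub>F i in sequentially. 0 \<le> arc t (X i)" using arc_bounded by (metis (no_types) always_eventually)
    have "\<forall>\<^sub>F i in sequentially. K \<le> X i" using X by (simp add: filterlim_at_top)
    thus "\<forall>\<^sub>F i in sequentially. arc t (X i) \<le> integral {0..pi} (h (X i))"
    proof eventually_elim
      case (elim i)
      have X0: "X i > 0" using elim C(2) by simp
      show ?case unfolding arc_def
      proof (rule integral_le)
        show "(\<lambda>\<theta>. norm (f (of_real (X i) * cis \<theta>) t)) integrable_on {0..pi}"
          using t t1 X0 by (intro integrable_continuous_real continuous_intros f_arc_cont) auto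
        show "norm (f (of_real (X i) * cis \<theta>) t) \<le> h (X i) \<theta>" if "\<theta> \<in> {0..pi}" for \<theta>
          using C(3)[of "of_real (X i) * cis \<theta>" t] X0 that t elim
          by (auto simp: sin_ge_zero norm_mult h_def \<tau>_def max_def)
      qed (use hc in auto)
    qed
  qed
qed

lemma integral_even:
  fixes h :: "real \<Rightarrow> real"
  assumes "(h has_integral I) {-R..R}" "\<And>x. h (- x) = h x" "R > 0"
  shows "2 * integral {0..R} h = I"
proof -
  have i: "h integrable_on {-R..R}" using assms by blast
  have "integral {-R..0} h + integral {0..R} h = I"
    using Henstock_Kurzweil_Integration.integral_combine[OF _ _ i, of 0] assms by (auto simp: integral_unique)
  moreover have "integral {-R..-0} (\<lambda>x. h (- x)) = integral {0..R} h" by (rule Henstock_Kurzweil_Integration.integral_reflect_real)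
  ultimately show ?thesis using assms(2) by simp
qed

lemma halfplane_subset: "{z. Im z \<ge> 0} \<subseteq> {\<kappa>. g \<kappa> T \<noteq> 0}" using g_T_nonzero by auto

text \<open>Cauchy's theorem for \<open>f\<close> itself. Divided by \<open>R\<close>, it says that
  \<open>Re f\<close> has mean zero on the half line for \<open>t < T\<close>: exactly the input of
  \<open>riemann_lebesgue\<close>, obtained without an asymptotic expansion.\<close>

lemma integral_Re_f:
  assumes t: "t \<in> {t1..T}" and R: "R > 0"
  shows "\<bar>2 * integral {0..R} (\<lambda>x. Re (f (of_real x) t))\<bar> \<le> R * arc t R"
proof -
  have t0: "t > 0" using t t1 by auto
  let ?F = "\<lambda>\<kappa>. f \<kappa> t"
  let ?I = "integral {0..pi} (\<lambda>\<theta>. ?F (of_real R * cis \<theta>) * of_real R * \<i> * cis \<theta>)"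
  have hol: "?F holomorphic_on {z. Im z \<ge> 0}"
    using f_holomorphic[OF t0] halfplane_subset by (rule holomorphic_on_subset)
  have "((\<lambda>x. Re (?F (of_real x))) has_integral Re (- ?I)) {-R..R}"
    using half_disc_integral(1)[OF hol R] by (rule has_integral_Re)
  hence "2 * integral {0..R} (\<lambda>x. Re (?F (of_real x))) = Re (- ?I)"
    by (rule integral_even) (use f_neg[OF t0] R in auto)
  moreover have "norm ?I \<le> integral {0..pi} (\<lambda>\<theta>. R * norm (?F (of_real R * cis \<theta>)))"
    using R t0 by (intro integral_norm_bound_integral half_disc_integral(2)[OF hol R] integrable_continuous_real continuous_intros f_arc_cont)
       (auto simp: norm_mult)
  ultimately show ?thesis using abs_Re_le_cmod[of ?I] by (simp add: arc_def)
qed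

text \<open>Cauchy's theorem for \<open>(f - 1) / \<kappa>\<close>, whose singularity at 0 is
  removable because \<open>f 0 t = 1\<close>. On the arc the term \<open>- 1 / \<kappa>\<close>
  contributes \<open>- i pi\<close>, which accounts for the value \<open>pi\<close> on the line,
  while \<open>f / \<kappa>\<close> contributes at most \<open>arc t R\<close>.\<close>

lemma integral_St:
  assumes t: "t \<in> {t1..T}" and R: "R > 0"
  shows "\<bar>2 * integral {0..R} (\<lambda>x. St x t) - pi\<bar> \<le> arc t R"
proof -
  have t0: "t > 0" using t t1 by auto
  define F where "F = (\<lambda>\<kappa>. if \<kappa> = 0 then deriv (\<lambda>\<kappa>. f \<kappa> t) 0 else (f \<kappa> t - f 0 t) / (\<kappa> - 0))"
  let ?I = "integral {0..pi} (\<lambda>\<theta>. F (of_real R * cis \<theta>) * of_real R * \<i> * cis \<theta>)"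
  have "F holomorphic_on {\<kappa>. g \<kappa> T \<noteq> 0}"
    unfolding F_def by (rule pole_lemma[OF f_holomorphic[OF t0]]) (use open_nonzero in \<open>auto simp: interior_open g_0\<close>)
  hence hol: "F holomorphic_on {z. Im z \<ge> 0}" using halfplane_subset by (rule holomorphic_on_subset)
  have "((\<lambda>x. Im (F (of_real x))) has_integral Im (- ?I)) {-R..R}"
    using half_disc_integral(1)[OF hol R] by (rule has_integral_Im)
  \<comment> \<open>Subtracting the real number 1 from \<open>f\<close> does not change the
    imaginary part on the real axis, so the two integrands agree away from
    \<open>x = 0\<close>.\<close>
  hence "((\<lambda>x. St x t) has_integral Im (- ?I)) {-R..R}"
    by (rule has_integral_spike_finite[of "{0}", rotated 2]) (auto simp: F_def f_0 Im_f[OF t0])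
  hence 1: "2 * integral {0..R} (\<lambda>x. St x t) = Im (- ?I)"
  proof (rule integral_even)
    show "St (- x) t = St x t" for x
      using g_neg[of T x] t1 t1T by (simp add: St_def)
  qed fact
  have eq: "F (of_real R * cis \<theta>) * of_real R * \<i> * cis \<theta> = \<i> * f (of_real R * cis \<theta>) t - \<i>" for \<theta>
    using R by (simp add: F_def f_0 field_simps)
  have fi: "(\<lambda>\<theta>. f (of_real R * cis \<theta>) t) integrable_on {0..pi}"
    using R t0 by (intro integrable_continuous_real f_arc_cont)
  have "?I = \<i> * integral {0..pi} (\<lambda>\<theta>. f (of_real R * cis \<theta>) t) - \<i> * of_real pi"
  proof (rule integral_unique)
    have "((\<lambda>\<theta>. \<i> * f (of_real R * cis \<theta>) t - \<i>) has_integral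
        (\<i> * integral {0..pi} (\<lambda>\<theta>. f (of_real R * cis \<theta>) t) - (pi - 0) *\<^sub>R \<i>)) {0..pi}"
      using fi has_integral_const_real[of \<i> 0 pi] by (intro has_integral_diff has_integral_mult_right integrable_integral) auto
    thus "((\<lambda>\<theta>. F (of_real R * cis \<theta>) * of_real R * \<i> * cis \<theta>) has_integral
        (\<i> * integral {0..pi} (\<lambda>\<theta>. f (of_real R * cis \<theta>) t) - \<i> * of_real pi)) {0..pi}"
      unfolding eq by (simp add: scaleR_conv_of_real mult.commute)
  qed
  hence "Im (- ?I) - pi = - Re (integral {0..pi} (\<lambda>\<theta>. f (of_real R * cis \<theta>) t))" by simp
  moreover have "norm (integral {0..pi} (\<lambda>\<theta>. f (of_real R * cis \<theta>) t)) \<le> arc t R"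
    unfolding arc_def using R t0
    by (intro integral_norm_bound_integral fi integrable_continuous_real continuous_intros f_arc_cont) auto
  ultimately show ?thesis unfolding 1 using abs_Re_le_cmod[of "integral {0..pi} (\<lambda>\<theta>. f (of_real R * cis \<theta>) t)"] by simp
qed

text \<open>The second derivative of \<open>f\<close> in time is
  \<open>- \<kappa>\<^sup>2 f / (4 t)\<close>; it is integrated from \<open>t1\<close>, where the
  outgoing condition gives \<open>f' = - i \<kappa> bt f\<close>. Polynomial growth in the frequency
  is harmless, as the moments of the transform absorb it.\<close>

lemma f'_bound:
  obtains C where "\<And>x t. t \<in> {t1..T+1} \<Longrightarrow> norm (f' (of_real x) t) \<le> C * (1 + x\<^sup>2)" "C \<ge> 0"
proof -
  obtain C K where C: "C \<ge> 0" "\<And>x t. t \<in> {t1..T+1} \<Longrightarrow> norm (f (of_real x) t) \<le> C"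
    using f_bounds by metis
  define l where "l = T + 1 - t1"
  have l0: "l > 0" using t1T by (simp add: l_def)
  show thesis
  proof (rule that[of "bt * C + C / (4 * t1) * l"])
    fix x t :: real assume t: "t \<in> {t1..T+1}"
    have "norm (f' (of_real x) t - f' (of_real x) t1) \<le> (x\<^sup>2 * C / (4 * t1)) * \<bar>t - t1\<bar>"
    proof (rule norm_diff_le_of_vector_derivative[where b = "T+1"])
      fix r assume r: "r \<in> {t1..T+1}"
      show "(f' (of_real x) has_vector_derivative (- (of_real x)\<^sup>2 / (4 * of_real r) * f (of_real x) r)) (at r within {t1..T+1})"
        using f'_deriv[of r "of_real x"] r t1 by (auto intro: has_vector_derivative_at_within)
      have "norm (- (of_real x)\<^sup>2 / (4 * of_real r) * f (of_real x) r) = x\<^sup>2 * norm (f (of_real x) r) / (4 * r)"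
        using r t1 by (simp add: norm_mult norm_divide norm_power)
      also have "\<dots> \<le> x\<^sup>2 * C / (4 * t1)" using r t1 C by (intro frac_le mult_mono) auto
      finally show "norm (- (of_real x)\<^sup>2 / (4 * of_real r) * f (of_real x) r) \<le> x\<^sup>2 * C / (4 * t1)" .
    qed (use t t1T in auto)
    also have "\<dots> \<le> (x\<^sup>2 * C / (4 * t1)) * l" using t t1 C(1) by (intro mult_left_mono) (auto simp: l_def)
    finally have a: "norm (f' (of_real x) t - f' (of_real x) t1) \<le> (C / (4 * t1) * l) * x\<^sup>2" by (simp add: mult_ac)
    have "norm (f' (of_real x) t1) = \<bar>x\<bar> * bt * norm (f (of_real x) t1)"
      using bt_pos by (simp add: f'_def f_def g_init norm_mult norm_divide)
    also have "\<dots> \<le> (1 + x\<^sup>2) * bt * C"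
    proof (intro mult_mono C)
      show "\<bar>x\<bar> \<le> 1 + x\<^sup>2"
        using zero_le_power2[of "\<bar>x\<bar> - 1"] by (simp add: power2_eq_square algebra_simps)
    qed (use t1T bt_pos in auto)
    finally have b: "norm (f' (of_real x) t1) \<le> (bt * C) * (1 + x\<^sup>2)" by (simp add: mult_ac)
    have "(C / (4 * t1) * l) * x\<^sup>2 \<le> (C / (4 * t1) * l) * (1 + x\<^sup>2)" using C t1 l0 by (intro mult_left_mono) auto
    thus "norm (f' (of_real x) t) \<le> (bt * C + C / (4 * t1) * l) * (1 + x\<^sup>2)"
      using a b norm_triangle_ineq[of "f' (of_real x) t - f' (of_real x) t1" "f' (of_real x) t1"]
      by (simp add: distrib_right)
  next
    show "0 \<le> bt * C + C / (4 * t1) * l" using C bt_pos t1 l0 by auto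
  qed
qed

text \<open>Joint continuity on a compact set treats small \<open>x\<close>; for larger
  \<open>x\<close> the bound on \<open>f\<close> is divided by \<open>x\<close>.\<close>

lemma St_bounded:
  obtains C where "\<And>x t. t \<in> {t1..T} \<Longrightarrow> \<bar>St x t\<bar> \<le> C" "C \<ge> 0"
proof -
  obtain C K where C: "C \<ge> 0" "\<And>x t. t \<in> {t1..T+1} \<Longrightarrow> norm (f (of_real x) t) \<le> C"
    using f_bounds by metis
  have "compact ({-1..1} \<times> {t1..T} :: (real\<times>real) set)" by (intro compact_Times) auto
  moreover have "continuous_on ({-1..1} \<times> {t1..T}) (\<lambda>x. St (fst x) (snd x))"
    by (rule continuous_on_subset[OF St_cont]) (use t1 in auto)
  ultimately have "bounded ((\<lambda>x. St (fst x) (snd x)) ` ({-1..1} \<times> {t1..T}))"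
    by (intro compact_imp_bounded compact_continuous_image)
  then obtain B where B: "\<And>x. x \<in> {-1..1} \<times> {t1..T} \<Longrightarrow> norm (St (fst x) (snd x)) \<le> B" unfolding bounded_iff by blast
  show thesis
  proof (rule that[of "max C B"])
    fix x t :: real assume t: "t \<in> {t1..T}"
    show "\<bar>St x t\<bar> \<le> max C B"
    proof (cases "\<bar>x\<bar> \<le> 1")
      case True
      hence "x \<in> {-1..1}" by auto
      thus ?thesis using B[of "(x,t)"] t by auto
    next
      case False
      have "\<bar>x\<bar> * \<bar>St x t\<bar> = \<bar>Im (f (of_real x) t)\<bar>" using Im_f[of t x] t t1 by (simp add: abs_mult)
      also have "\<dots> \<le> C" using abs_Im_le_cmod C(2)[of t x] t order_trans by fastforce
      finally have "\<bar>x\<bar> * \<bar>St x t\<bar> \<le> C" .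
      moreover have "1 * \<bar>St x t\<bar> \<le> \<bar>x\<bar> * \<bar>St x t\<bar>" using False by (intro mult_right_mono) auto
      ultimately show ?thesis by simp
    qed
  qed (use C in auto)
qed

end

section \<open>The radial factor\<close>

text \<open>\<open>bess N 0 (z |y|\<^sup>2 / (2N))\<close> is the radial solution of \<open>\<Delta>\<^sub>y Y = (z/N) Y\<close> on \<open>R\<^sup>N\<close> with \<open>Y(0) = 1\<close>,
  and \<open>bess N l\<close> is the \<open>l\<close>-th derivative of \<open>bess N 0\<close>.\<close>

definition bco :: "nat \<Rightarrow> nat \<Rightarrow> nat \<Rightarrow> real" where
  "bco N l j = 1 / (fact j * (\<Prod>i<j+l. real N + 2 * real i))"

definition bess :: "nat \<Rightarrow> nat \<Rightarrow> real \<Rightarrow> real" where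
  "bess N l w = (\<Sum>j. bco N l j * w ^ j)"

context
  fixes N :: nat
  assumes N: "N \<ge> 1"
begin

lemma bco_nonneg: "bco N l j \<ge> 0" by (auto simp: bco_def intro!: divide_nonneg_nonneg mult_nonneg_nonneg prod_nonneg)

text \<open>For \<open>N \<ge> 1\<close> the product is at least \<open>fact j\<close>. Coefficients
  below \<open>1 / (fact j)\<^sup>2\<close> mean that the function grows no faster than an
  exponential of the square root.\<close>

lemma bco_le1: "bco N l j \<le> 1 / (fact j * fact j)"
proof -
  have "(\<Prod>i<m. real N + 2 * real i) \<ge> fact m" for m
  proof (induction m)
    case (Suc m)
    have "fact m * real (Suc m) \<le> (\<Prod>i<m. real N + 2 * real i) * (real N + 2 * real m)"
      using Suc N by (intro mult_mono) (auto intro: prod_nonneg)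
    thus ?case by (simp add: mult.commute)
  qed simp
  moreover have "fact j \<le> (fact (j+l) :: real)" by (rule fact_mono) simp
  ultimately have "(\<Prod>i<j+l. real N + 2 * real i) \<ge> fact j" by (meson order_trans)
  thus ?thesis unfolding bco_def by (intro divide_left_mono mult_left_mono mult_pos_pos) (auto intro!: prod_pos add_pos_nonneg simp: N[unfolded One_nat_def Suc_le_eq])
qed

text \<open>Complements \<open>bco_le1\<close>: this is the bound that remains uniform in
  \<open>N\<close> when the argument is proportional to \<open>N\<close>.\<close>

lemma bco_leN: "bco N l j \<le> 1 / (fact j * real N ^ (j+l))"
proof -
  have "(\<Prod>i<j+l. real N) \<le> (\<Prod>i<j+l. real N + 2 * real i)" by (intro prod_mono) auto
  hence "real N ^ (j+l) \<le> (\<Prod>i<j+l. real N + 2 * real i)" by simp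
  thus ?thesis unfolding bco_def using N by (intro divide_left_mono mult_left_mono mult_pos_pos) (auto intro!: prod_pos add_pos_nonneg)
qed

text \<open>A term of size \<open>\<bar>w\<bar> ^ j / (fact j)\<^sup>2\<close> splits into
  \<open>(1/\<epsilon>) ^ j / fact j\<close> and
  \<open>(\<epsilon> * \<bar>w\<bar>) ^ j / fact j\<close>. Arbitrarily small exponential rates are
  available, so the damping \<open>exp (- T q)\<close> can beat the radial factor for every
  \<open>y\<close>.\<close>

lemma bess_term_bound:
  assumes "\<epsilon> > 0"
  shows "\<bar>bco N l j * w ^ j\<bar> \<le> exp (1/\<epsilon>) * ((\<epsilon> * \<bar>w\<bar>) ^ j /\<^sub>R fact j)"
proof -
  have "(1/\<epsilon>) ^ j / fact j \<le> exp (1/\<epsilon>)"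
  proof -
    have "(\<Sum>i\<in>{j}. (1/\<epsilon>) ^ i /\<^sub>R fact i) \<le> (\<Sum>i. (1/\<epsilon>) ^ i /\<^sub>R fact i)"
      by (rule sum_le_suminf[OF summable_exp_generic]) (use assms in auto)
    thus ?thesis by (simp add: exp_def divide_inverse mult.commute)
  qed
  hence "((1/\<epsilon>) ^ j / fact j) * ((\<epsilon> * \<bar>w\<bar>) ^ j / fact j) \<le> exp (1/\<epsilon>) * ((\<epsilon> * \<bar>w\<bar>) ^ j / fact j)"
    using assms by (intro mult_right_mono) auto
  moreover have "((1/\<epsilon>) ^ j / fact j) * ((\<epsilon> * \<bar>w\<bar>) ^ j / fact j) = 1 / (fact j * fact j) * \<bar>w\<bar> ^ j"
    using assms by (simp add: power_mult_distrib power_one_over field_simps)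
  moreover have "bco N l j * \<bar>w\<bar> ^ j \<le> 1 / (fact j * fact j) * \<bar>w\<bar> ^ j" by (intro mult_right_mono bco_le1) auto
  ultimately have "bco N l j * \<bar>w\<bar> ^ j \<le> exp (1/\<epsilon>) * ((\<epsilon> * \<bar>w\<bar>) ^ j / fact j)" by linarith
  moreover have "\<bar>bco N l j * w ^ j\<bar> = bco N l j * \<bar>w\<bar> ^ j" using bco_nonneg[of l j] by (simp add: abs_mult power_abs)
  moreover have "(\<epsilon> * \<bar>w\<bar>) ^ j /\<^sub>R fact j = (\<epsilon> * \<bar>w\<bar>) ^ j / fact j" by (simp add: divide_inverse mult.commute)
  ultimately show ?thesis by (simp only:)
qed

lemma bess_summable: "summable (\<lambda>j. bco N l j * w ^ j)"
proof (rule summable_comparison_test')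
  show "summable (\<lambda>j. exp (1/1) * ((1 * \<bar>w\<bar>) ^ j /\<^sub>R fact j))" by (intro summable_mult summable_exp_generic)
  show "norm (bco N l j * w ^ j) \<le> exp (1/1) * ((1 * \<bar>w\<bar>) ^ j /\<^sub>R fact j)" for j
    using bess_term_bound[of 1 l j w] by simp
qed

lemma bess_bound: assumes "\<epsilon> > 0" shows "\<bar>bess N l w\<bar> \<le> exp (1/\<epsilon>) * exp (\<epsilon> * \<bar>w\<bar>)"
proof -
  have s: "summable (\<lambda>j. exp (1/\<epsilon>) * ((\<epsilon> * \<bar>w\<bar>) ^ j /\<^sub>R fact j))" by (intro summable_mult summable_exp_generic)
  have "norm (bess N l w) \<le> (\<Sum>j. exp (1/\<epsilon>) * ((\<epsilon> * \<bar>w\<bar>) ^ j /\<^sub>R fact j))"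
    unfolding bess_def by (rule norm_suminf_le[OF _ s]) (use bess_term_bound[OF assms] in simp)
  also have "\<dots> = exp (1/\<epsilon>) * exp (\<epsilon> * \<bar>w\<bar>)" unfolding exp_def by (rule suminf_mult[OF summable_exp_generic])
  finally show ?thesis by simp
qed

lemma bess_boundN: "\<bar>bess N l w\<bar> \<le> exp (\<bar>w\<bar> / N) / real N ^ l"
proof -
  have s: "summable (\<lambda>j. (1 / real N ^ l) * ((\<bar>w\<bar> / N) ^ j /\<^sub>R fact j))" by (intro summable_mult summable_exp_generic)
  have "norm (bess N l w) \<le> (\<Sum>j. (1 / real N ^ l) * ((\<bar>w\<bar> / N) ^ j /\<^sub>R fact j))"
    unfolding bess_def
  proof (rule norm_suminf_le[OF _ s])
    fix j
    have "bco N l j * \<bar>w\<bar> ^ j \<le> 1 / (fact j * real N ^ (j+l)) * \<bar>w\<bar> ^ j" by (intro mult_right_mono bco_leN) auto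
    also have "\<dots> = (1 / real N ^ l) * ((\<bar>w\<bar> / N) ^ j /\<^sub>R fact j)" by (simp add: power_add divide_inverse power_mult_distrib power_inverse mult_ac)
    finally show "norm (bco N l j * w ^ j) \<le> (1 / real N ^ l) * ((\<bar>w\<bar> / N) ^ j /\<^sub>R fact j)"
      using bco_nonneg[of l j] by (simp add: abs_mult power_abs)
  qed
  also have "\<dots> = (1 / real N ^ l) * exp (\<bar>w\<bar> / N)" unfolding exp_def by (rule suminf_mult[OF summable_exp_generic])
  finally show ?thesis by simp
qed

lemma bess_deriv: "(bess N l has_real_derivative bess N (Suc l) w) (at w)"
proof -
  have "diffs (bco N l) = bco N (Suc l)"
    by (auto simp: diffs_def bco_def fun_eq_iff divide_simps)
  thus ?thesis using termdiffs_strong_converges_everywhere[of "bco N l" w] bess_summable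
    unfolding bess_def[abs_def] by simp
qed

text \<open>The radial equation in a variable \<open>w\<close> proportional to the squared length of
  \<open>y\<close>: each of the \<open>N\<close> coordinates contributes a term with
  \<open>bess N 1\<close>, and the squared gradient of \<open>w\<close> produces the term with
  \<open>bess N 2\<close>.\<close>

lemma bess_ode: "2 * (w * bess N 2 w) + real N * bess N 1 w = bess N 0 w"
proof -
  have s2: "(\<lambda>j. (case j of 0 \<Rightarrow> 0 | Suc m \<Rightarrow> bco N 2 m) * w ^ j) sums (w * bess N 2 w)"
  proof -
    have "(\<lambda>n. w * (bco N 2 n * w ^ n)) sums (w * bess N 2 w)"
      unfolding bess_def by (intro sums_mult summable_sums bess_summable)
    hence "(\<lambda>n. (case Suc n of 0 \<Rightarrow> 0 | Suc m \<Rightarrow> bco N 2 m) * w ^ Suc n) sums (w * bess N 2 w)" by (simp add: mult_ac)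
    thus ?thesis by (subst (asm) sums_Suc_iff) simp
  qed
  have s1: "(\<lambda>j. bco N 1 j * w ^ j) sums bess N 1 w" unfolding bess_def by (intro summable_sums bess_summable)
  have "(\<lambda>j. 2 * ((case j of 0 \<Rightarrow> 0 | Suc m \<Rightarrow> bco N 2 m) * w ^ j) + real N * (bco N 1 j * w ^ j)) sums (2 * (w * bess N 2 w) + real N * bess N 1 w)"
    by (intro sums_add sums_mult s1 s2)
  moreover have "2 * ((case j of 0 \<Rightarrow> 0 | Suc m \<Rightarrow> bco N 2 m) * w ^ j) + real N * (bco N 1 j * w ^ j) = bco N 0 j * w ^ j" for j
  proof -
    define P where "P = (\<Prod>i<j. real N + 2 * real i)"
    have P0: "P > 0" unfolding P_def using N by (intro prod_pos) (auto intro!: add_pos_nonneg)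
    have a: "real N + 2 * real j > 0" using N by (intro add_pos_nonneg) auto
    have 1: "bco N 1 j = 1 / (fact j * (P * (real N + 2 * real j)))" by (simp add: bco_def P_def)
    have 2: "(case j of 0 \<Rightarrow> 0 | Suc m \<Rightarrow> bco N 2 m) = real j / (fact j * (P * (real N + 2 * real j)))"
      by (cases j) (auto simp: bco_def P_def numeral_2_eq_2 divide_simps)
    have 0: "bco N 0 j = 1 / (fact j * P)" by (simp add: bco_def P_def)
    have "2 * (case j of 0 \<Rightarrow> 0 | Suc m \<Rightarrow> bco N 2 m) + real N * bco N 1 j = (real N + 2 * real j) / (fact j * (P * (real N + 2 * real j)))"
      unfolding 1 2 by (simp add: add_divide_distrib)
    also have "\<dots> = bco N 0 j" unfolding 0 using a by simp
    finally have "(2 * (case j of 0 \<Rightarrow> 0 | Suc m \<Rightarrow> bco N 2 m) + real N * bco N 1 j) * w ^ j = bco N 0 j * w ^ j" by simp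
    thus ?thesis by (simp add: algebra_simps)
  qed
  ultimately have "(\<lambda>j. bco N 0 j * w ^ j) sums (2 * (w * bess N 2 w) + real N * bess N 1 w)" by simp
  moreover have "(\<lambda>j. bco N 0 j * w ^ j) sums bess N 0 w" unfolding bess_def by (intro summable_sums bess_summable)
  ultimately show ?thesis by (rule sums_unique2)
qed

text \<open>By the differential equation, \<open>exp (- w) * bess N 0 (N w)\<close> decreases at rate at most \<open>2 w / N\<close>.\<close>

lemma bess_exp: fixes w :: real assumes "w \<ge> 0" shows "\<bar>bess N 0 (N * w) - exp w\<bar> \<le> exp w * (w\<^sup>2 / N)"
proof -
  \<comment> \<open>The added \<open>w\<^sup>2 / N\<close> compensates the largest possible
    decrease, so \<open>F\<close> is nondecreasing; it starts at 1.\<close>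
  define F where "F w = exp (- w) * bess N 0 (N * w) + w\<^sup>2 / N" for w :: real
  have N0: "real N > 0" using N by simp
  have "F 0 \<le> F w"
  proof (rule DERIV_nonneg_imp_nondecreasing[OF assms])
    fix x assume x: "0 \<le> x" "x \<le> w"
    have "((\<lambda>x. bess N 0 (real N * x)) has_real_derivative bess N (Suc 0) (real N * x) * real N) (at x)"
      by (rule DERIV_chain2[OF bess_deriv]) (rule derivative_eq_intros refl | simp)+
    hence D: "(F has_real_derivative (exp (- x) * (bess N (Suc 0) (N * x) * real N) + (exp (- x) * (- 1)) * bess N 0 (N * x) + 2 * x / N)) (at x)"
    proof -
      assume b: "((\<lambda>x. bess N 0 (real N * x)) has_real_derivative bess N (Suc 0) (real N * x) * real N) (at x)"
      have e: "((\<lambda>x. exp (- x)) has_real_derivative (exp (- x) * (- 1))) (at x)"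
        by (rule DERIV_fun_exp[OF DERIV_minus[OF DERIV_ident]])
      have s: "((\<lambda>x. x\<^sup>2 / N) has_real_derivative (2 * x / N)) (at x)"
        using DERIV_cdivide[OF DERIV_power[OF DERIV_ident, of 2 x UNIV], of "real N"] by simp
      show ?thesis unfolding F_def by (rule DERIV_add[OF DERIV_mult'[OF e b] s])
    qed
    have "bess N (Suc 0) (N * x) * real N - bess N 0 (N * x) = - 2 * ((N * x) * bess N 2 (N * x))"
      using bess_ode[of "N * x"] by (simp add: algebra_simps)
    note r = this
    have "exp (- x) * (bess N (Suc 0) (N * x) * real N) + (exp (- x) * (- 1)) * bess N 0 (N * x) + 2 * x / N
       = exp (- x) * (bess N (Suc 0) (N * x) * real N - bess N 0 (N * x)) + 2 * x / N" by (simp add: right_diff_distrib)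
    also have "\<dots> = 2 * x / N - 2 * (exp (- x) * (N * x) * bess N 2 (N * x))" unfolding r by simp
    finally have eq: "exp (- x) * (bess N (Suc 0) (N * x) * real N) + (exp (- x) * (- 1)) * bess N 0 (N * x) + 2 * x / N
       = 2 * x / N - 2 * (exp (- x) * (N * x) * bess N 2 (N * x))" .
    have "bess N 2 (N * x) \<le> exp x / N\<^sup>2" using bess_boundN[of 2 "N * x"] N0 x by (simp add: abs_mult)
    hence "exp (- x) * (N * x) * bess N 2 (N * x) \<le> exp (- x) * (N * x) * (exp x / N\<^sup>2)"
      using x N0 by (intro mult_left_mono) auto
    also have "\<dots> = (exp (- x) * exp x) * (x / N)" using N0 by (simp add: power2_eq_square)
    also have "\<dots> = x / N" by (simp flip: exp_add)
    finally show "\<exists>y. (F has_real_derivative y) (at x) \<and> 0 \<le> y" using D unfolding eq by (intro exI conjI) auto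
  qed
  moreover have "F 0 = 1"
  proof -
    have "bess N 0 0 = 1" unfolding bess_def by (subst suminf_finite[of "{0}"]) (auto simp: bco_def)
    thus ?thesis by (simp add: F_def)
  qed
  ultimately have "1 - w\<^sup>2 / N \<le> exp (- w) * bess N 0 (N * w)" by (simp add: F_def)
  hence "exp w * (1 - w\<^sup>2 / N) \<le> exp w * (exp (- w) * bess N 0 (N * w))" by (intro mult_left_mono) auto
  also have "\<dots> = bess N 0 (N * w)" by (simp add: exp_minus)
  finally have "exp w - exp w * (w\<^sup>2 / N) \<le> bess N 0 (N * w)" by (simp add: algebra_simps)
  moreover have "bess N 0 (N * w) \<le> exp w" using bess_boundN[of 0 "N * w"] N0 assms by (simp add: abs_mult)
  moreover have "exp w * (w\<^sup>2 / N) \<ge> 0" using N0 by simp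
  ultimately show ?thesis by linarith
qed

text \<open>The mean value inequality between the arguments \<open>t (N q - k)\<close> and
  \<open>N t q\<close>, on an interval where \<open>bess_boundN\<close> bounds the slope, followed
  by \<open>bess_exp\<close>. In the application \<open>k\<close> is half the squared frequency of
  the packet and \<open>K\<close> half the squared cutoff.\<close>

lemma bess_close:
  fixes t q k K :: real
  assumes t: "0 \<le> t" and q: "0 \<le> q" and k: "0 \<le> k" "k \<le> K"
  shows "\<bar>bess N 0 (t * (N * q - k)) - exp (t * q)\<bar> \<le> exp (t * q) * ((t * q)\<^sup>2 / N + t * K / N * exp (t * K / N))"
proof -
  have N0: "real N > 0" using N by simp
  have "norm (bess N 0 (t * (N * q - k)) - bess N 0 (N * (t * q))) \<le> (exp (t * q + t * K / N) / N) * norm (t * (N * q - k) - N * (t * q))"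
  proof (rule field_differentiable_bound[where S = "{- (N * (t * q + t * K / N)) .. N * (t * q + t * K / N)}" and f' = "bess N (Suc 0)"])
    show "(bess N 0 has_real_derivative bess N (Suc 0) z) (at z within S)" for z S
      using bess_deriv by (rule has_field_derivative_at_within)
    show "norm (bess N (Suc 0) z) \<le> exp (t * q + t * K / N) / N" if z: "z \<in> {- (N * (t * q + t * K / N)) .. N * (t * q + t * K / N)}" for z
    proof -
      have "\<bar>z\<bar> / N \<le> t * q + t * K / N" using z N0 by (simp add: divide_le_eq mult.commute abs_le_iff)
      hence "exp (\<bar>z\<bar> / N) / N \<le> exp (t * q + t * K / N) / N" by (intro divide_right_mono) auto
      thus ?thesis using bess_boundN[of "Suc 0" z] by simp
    qed
    have e: "N * (t * q + t * K / N) = N * (t * q) + t * K" using N0 by (simp add: algebra_simps)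
    have "t * k \<le> t * K" "0 \<le> t * k" "0 \<le> N * (t * q)" "0 \<le> t * K" using k t q by (auto intro!: mult_left_mono mult_nonneg_nonneg)
    thus "t * (N * q - k) \<in> {- (N * (t * q + t * K / N)) .. N * (t * q + t * K / N)}"
      "N * (t * q) \<in> {- (N * (t * q + t * K / N)) .. N * (t * q + t * K / N)}"
      unfolding e by (auto simp: algebra_simps)
  qed simp
  also have "norm (t * (N * q - k) - N * (t * q)) = t * k" using t k by (simp add: algebra_simps abs_mult)
  also have "exp (t * q + t * K / N) / N * (t * k) \<le> exp (t * q + t * K / N) / N * (t * K)"
    using t k by (intro mult_left_mono) auto
  also have "\<dots> = exp (t * q) * (t * K / N * exp (t * K / N))" by (simp add: exp_add)
  finally have "\<bar>bess N 0 (t * (N * q - k)) - bess N 0 (N * (t * q))\<bar> \<le> exp (t * q) * (t * K / N * exp (t * K / N))" by simp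
  moreover have "\<bar>bess N 0 (N * (t * q)) - exp (t * q)\<bar> \<le> exp (t * q) * ((t * q)\<^sup>2 / N)" using t q by (intro bess_exp) auto
  ultimately show ?thesis by (simp add: distrib_left)
qed

end

section \<open>Integrands depending on time\<close>

context param_family
begin

lemma fam0I:
  assumes "\<And>p. p \<in> V \<Longrightarrow> (\<lambda>w. \<Phi> w p) \<in> borel_measurable M"
    and "\<And>w. w \<in> space M \<Longrightarrow> continuous_on V (\<Phi> w)"
    and "\<And>w p. w \<in> space M \<Longrightarrow> p \<in> V \<Longrightarrow> \<bar>\<Phi> w p\<bar> \<le> C * Q w ^ m"
  shows "fam0 \<Phi>"
  unfolding fam0_def
proof (intro conjI ballI)
  show "\<exists>U C m. open U \<and> p \<in> U \<and> (\<forall>w\<in>space M. \<forall>p'\<in>V \<inter> U. \<bar>\<Phi> w p'\<bar> \<le> C * Q w ^ m)" for p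
    by (intro exI[of _ UNIV] exI[of _ C] exI[of _ m]) (use assms in auto)
qed (use assms in auto)

text \<open>\<open>e l\<close> is the \<open>l\<close>-th derivative of \<open>1 / (4 x)\<close>.
  Positivity of the time coordinate is enough, because the bounds in \<open>fam0\<close> are
  local.\<close>

lemma fam_inverse_time:
  assumes "\<And>p. p \<in> V \<Longrightarrow> p 0 > 0"
  shows "fam k (\<lambda>w p. 1 / (4 * p 0))"
proof -
  define e where "e = (\<lambda>(l::nat) (w::'w) x. (-1) ^ l * fact l / (4 * x ^ Suc l) :: real)"
  have "fam k (\<lambda>w p. e 0 w (p 0))"
  proof (rule fam_compose[where \<theta> = "\<lambda>w p. p 0" and e = e])
    show "fam k (\<lambda>w p. p 0)" for k by (rule fam_coord)
    show "fam0 (\<lambda>w p. e l w (p 0))" for l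
      unfolding e_def using assms by (intro fam0_indep continuous_intros continuous_on_coord) (auto dest!: assms)
    show "(e l w has_real_derivative e (Suc l) w (p 0)) (at (p 0))" if "p \<in> V" for l w p
    proof -
      have x: "p 0 > 0" by (rule assms[OF that])
      have pw: "((\<lambda>x. x ^ Suc l) has_real_derivative (real (Suc l) * p 0 ^ l)) (at (p 0))"
        using DERIV_pow[of "Suc l" "p 0" UNIV] by (simp del: power_Suc of_nat_Suc)
      have "((\<lambda>x. (-1) ^ l * fact l / (4 * x ^ Suc l)) has_real_derivative
         ((0 * (4 * p 0 ^ Suc l) - (-1) ^ l * fact l * (4 * (real (Suc l) * p 0 ^ l))) / ((4 * p 0 ^ Suc l) * (4 * p 0 ^ Suc l)))) (at (p 0))"
        by (intro DERIV_divide DERIV_const DERIV_cmult pw) (use x in auto)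
      moreover have "(0 * (4 * p 0 ^ Suc l) - (-1) ^ l * fact l * (4 * (real (Suc l) * p 0 ^ l))) / ((4 * p 0 ^ Suc l) * (4 * p 0 ^ Suc l))
         = e (Suc l) w (p 0)" using x by (simp add: e_def divide_simps)
      ultimately show ?thesis by (simp add: e_def)
    qed
  qed
  thus ?thesis by (simp add: e_def)
qed

text \<open>The equation \<open>4 t A'' = - \<lambda> A\<close> expresses all further derivatives through \<open>A\<close> and \<open>A'\<close>, so bounds on these two suffice.\<close>

lemma fam_time:
  assumes pos: "\<And>p. p \<in> V \<Longrightarrow> p 0 > 0"
    and A: "fam0 (\<lambda>w p. A w (p 0))" "fam0 (\<lambda>w p. A' w (p 0))"
    and d: "\<And>w p. w \<in> space M \<Longrightarrow> p \<in> V \<Longrightarrow> (A w has_real_derivative A' w (p 0)) (at (p 0))"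
    and d': "\<And>w p. w \<in> space M \<Longrightarrow> p \<in> V \<Longrightarrow> (A' w has_real_derivative (- lam w / (4 * p 0) * A w (p 0))) (at (p 0))"
    and lam: "\<And>k. fam k (\<lambda>w p. lam w)"
  shows "fam k (\<lambda>w p. A w (p 0)) \<and> fam k (\<lambda>w p. A' w (p 0))"
proof (induction k)
  case 0 thus ?case using A by simp
next
  case (Suc k)
  have z: "fam k (\<lambda>w p. 0)" by (rule fam_const)
  have it: "fam k (\<lambda>w p. 1 / (4 * p 0))" by (rule fam_inverse_time) (rule pos)
  have "fam k (\<lambda>w p. (-1) * (lam w * (1 / (4 * p 0) * A w (p 0))))"
    by (intro fam_mult fam_const lam it conjunct1[OF Suc])
  hence f2: "fam k (\<lambda>w p. - lam w / (4 * p 0) * A w (p 0))" by simp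
  have 1: "\<exists>\<Psi>. fam k \<Psi> \<and> (\<forall>w\<in>space M. \<forall>p\<in>V. ((\<lambda>s. F w ((p(j := s)) 0)) has_real_derivative \<Psi> w p) (at (p j)))"
    if F: "\<And>w p. w \<in> space M \<Longrightarrow> p \<in> V \<Longrightarrow> (F w has_real_derivative F' w p) (at (p 0))" "fam k F'" for F F' j
  proof (cases "j = 0")
    case True
    thus ?thesis using F by (intro exI[of _ F']) simp
  next
    case False
    thus ?thesis using z by (intro exI[of _ "\<lambda>w p. 0"]) simp
  qed
  show ?case unfolding fam.simps
    using A 1[of A "\<lambda>w p. A' w (p 0)"] 1[of A' "\<lambda>w p. - lam w / (4 * p 0) * A w (p 0)"] d d' f2 Suc by blast
qed

end

section \<open>The heat solution\<close>

locale test_fn =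
  fixes n :: nat and h :: "(nat \<Rightarrow> real) \<Rightarrow> real"
  assumes n: "n \<ge> 1" and h: "C0_inf n h"
begin

definition fa :: "(nat \<Rightarrow> real) \<Rightarrow> real" where "fa \<xi> = FT n h 0 \<xi> / (2 * pi) ^ n"
definition fb :: "(nat \<Rightarrow> real) \<Rightarrow> real" where "fb \<xi> = FT n h (- pi/2) \<xi> / (2 * pi) ^ n"
definition rho :: "(nat \<Rightarrow> real) \<Rightarrow> real" where "rho \<xi> = \<bar>fa \<xi>\<bar> + \<bar>fb \<xi>\<bar>"

lemma fa_measurable [measurable]: "fa \<in> borel_measurable (leb n)"
  and fb_measurable [measurable]: "fb \<in> borel_measurable (leb n)"
  unfolding fa_def[abs_def] fb_def[abs_def]
  by (intro borel_measurable_divide borel_measurable_const measurable_of_continuous FT_cont h FT_emb)+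

lemma rho_measurable [measurable]: "rho \<in> borel_measurable (leb n)" unfolding rho_def[abs_def] by measurable

lemma rho_nonneg: "rho \<xi> \<ge> 0" by (simp add: rho_def)

lemma rho_moments: "integrable (leb n) (\<lambda>\<xi>. (1 + nsq n \<xi>) ^ m * rho \<xi>)"
proof -
  obtain C where C: "\<And>\<alpha> \<xi>. (1 + nsq n \<xi>) ^ (n + m) * \<bar>FT n h \<alpha> \<xi>\<bar> \<le> C" using FT_decay[OF h n] by blast
  show ?thesis
  proof (rule integrable_decay)
    show "(\<lambda>\<xi>. (1 + nsq n \<xi>) ^ m * rho \<xi>) \<in> borel_measurable (leb n)" by measurable
    fix \<xi>
    have p: "(2 * pi) ^ n > 0" by simp
    have "(1 + nsq n \<xi>) ^ n * \<bar>(1 + nsq n \<xi>) ^ m * rho \<xi>\<bar> = (1 + nsq n \<xi>) ^ (n + m) * rho \<xi>"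
      using nsq_nonneg[of n \<xi>] rho_nonneg by (simp add: abs_mult power_add mult_ac)
    also have "\<dots> = ((1 + nsq n \<xi>) ^ (n + m) * \<bar>FT n h 0 \<xi>\<bar> + (1 + nsq n \<xi>) ^ (n + m) * \<bar>FT n h (- pi/2) \<xi>\<bar>) / (2 * pi) ^ n"
      by (simp add: rho_def fa_def fb_def field_simps)
    also have "\<dots> \<le> (C + C) / (2 * pi) ^ n" using C p by (intro divide_right_mono add_mono) auto
    finally show "(1 + nsq n \<xi>) ^ n * \<bar>(1 + nsq n \<xi>) ^ m * rho \<xi>\<bar> \<le> (C + C) / (2 * pi) ^ n" .
  qed
qed

definition Gn :: "(nat \<Rightarrow> real) \<Rightarrow> (nat \<Rightarrow> real) \<Rightarrow> real" where
  "Gn x \<xi> = fa \<xi> * cos (dot n \<xi> x) + fb \<xi> * sin (dot n \<xi> x)"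

lemma Gn_eq: "Gn x \<xi> = Gx n h x \<xi> / (2 * pi) ^ n"
  unfolding Gn_def Gx_def FT_shift[OF h] fa_def fb_def by (simp add: add_divide_distrib mult.commute)

lemma Gn_inversion: "x \<in> Rsp n \<Longrightarrow> (\<integral>\<xi>. Gn x \<xi> \<partial>leb n) = h x"
  unfolding Gn_eq by (rule fourier_inversion[OF h n, symmetric])

lemma Gn_cont: "continuous_on UNIV (Gn x)" and Gn_emb: "Gn x (emb n \<xi>) = Gn x \<xi>"
  unfolding Gn_eq[abs_def] using Gx_cont[OF h] Gx_emb by (auto intro!: continuous_intros)

lemma Gn_measurable [measurable]: "Gn x \<in> borel_measurable (leb n)"
  using Gn_cont Gn_emb by (rule measurable_of_continuous)

lemma Gn_le_rho: "\<bar>Gn x \<xi>\<bar> \<le> rho \<xi>"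
proof -
  have "\<bar>fa \<xi> * cos (dot n \<xi> x)\<bar> \<le> \<bar>fa \<xi>\<bar>" "\<bar>fb \<xi> * sin (dot n \<xi> x)\<bar> \<le> \<bar>fb \<xi>\<bar>"
    by (auto simp: abs_mult mult_left_le)
  thus ?thesis unfolding Gn_def rho_def
    using abs_triangle_ineq[of "fa \<xi> * cos (dot n \<xi> x)" "fb \<xi> * sin (dot n \<xi> x)"] by linarith
qed

text \<open>The decay of the transforms is moved into the measure. The remaining coefficients
  \<open>ca\<close> and \<open>cb\<close> are bounded by 1, and all powers of
  \<open>1 + nsq n \<xi>\<close> become integrable, as \<open>param_family\<close> requires.\<close>

definition mu :: "(nat \<Rightarrow> real) measure" where "mu = density (leb n) (\<lambda>\<xi>. ennreal (rho \<xi>))"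

lemma sets_mu [measurable_cong, simp]: "sets mu = sets (leb n)" by (simp add: mu_def)
lemma space_mu [simp]: "space mu = space (leb n)" by (simp add: mu_def)

lemma mu_integrable: "F \<in> borel_measurable (leb n) \<Longrightarrow> integrable mu F \<longleftrightarrow> integrable (leb n) (\<lambda>\<xi>. rho \<xi> * F \<xi>)"
  for F :: "(nat \<Rightarrow> real) \<Rightarrow> real"
  unfolding mu_def using rho_nonneg by (subst integrable_density) auto

lemma mu_integral: "F \<in> borel_measurable (leb n) \<Longrightarrow> (\<integral>\<xi>. F \<xi> \<partial>mu) = (\<integral>\<xi>. rho \<xi> * F \<xi> \<partial>leb n)"
  for F :: "(nat \<Rightarrow> real) \<Rightarrow> real"
  unfolding mu_def using rho_nonneg by (subst integral_density) auto

lemma mu_finite: "finite_measure mu"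
proof
  have "(\<integral>\<^sup>+\<xi>. ennreal (rho \<xi>) \<partial>leb n) = ennreal (\<integral>\<xi>. rho \<xi> \<partial>leb n)"
    using rho_moments[of 0] rho_nonneg by (intro nn_integral_eq_integral) auto
  thus "emeasure mu (space mu) \<noteq> \<infinity>" unfolding mu_def by (subst emeasure_density) (auto simp: mu_def)
qed

text \<open>The second factor carries the rescaled variable \<open>r = \<kappa> / N\<^bsup>1/4\<^esup>\<close>.\<close>

definition PM :: "((nat \<Rightarrow> real) \<times> real) measure" where "PM = mu \<Otimes>\<^sub>M unit_leb"

lemma space_PM: "space PM = space (leb n) \<times> {0..1}" by (simp add: PM_def space_pair_measure)

lemma measurable_fst_PM: "F \<in> borel_measurable (leb n) \<Longrightarrow> (\<lambda>w. F (fst w)) \<in> borel_measurable PM"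
proof -
  assume "F \<in> borel_measurable (leb n)"
  hence "F \<in> borel_measurable mu" by (simp cong: measurable_cong_sets)
  thus ?thesis unfolding PM_def by (rule measurable_compose[OF measurable_fst])
qed

lemma measurable_snd_PM: "(\<lambda>w. snd w) \<in> borel_measurable PM"
proof -
  have "(\<lambda>r::real. r) \<in> borel_measurable unit_leb" by (intro measurable_restrict_space1) simp
  thus ?thesis unfolding PM_def by (rule measurable_compose[OF measurable_snd])
qed

lemma PM_pair: "pair_sigma_finite mu unit_leb"
proof -
  interpret a: finite_measure mu by (rule mu_finite)
  interpret b: prob_space unit_leb by (rule unit_leb_prob)
  show ?thesis ..
qed

lemma PM_integral:
  fixes F :: "(nat \<Rightarrow> real) \<times> real \<Rightarrow> real"
  assumes "integrable PM F"
  shows "(\<integral>w. F w \<partial>PM) = (\<integral>\<xi>. rho \<xi> * (\<integral>r. F (\<xi>, r) \<partial>unit_leb) \<partial>leb n)"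
proof -
  interpret P: pair_sigma_finite mu unit_leb by (rule PM_pair)
  have F: "integrable (mu \<Otimes>\<^sub>M unit_leb) F" using assms by (simp add: PM_def)
  have m: "(\<lambda>\<xi>. \<integral>r. F (\<xi>, r) \<partial>unit_leb) \<in> borel_measurable mu"
    using P.integrable_fst'[OF F] by simp
  have "(\<integral>w. F w \<partial>PM) = (\<integral>\<xi>. (\<integral>r. F (\<xi>, r) \<partial>unit_leb) \<partial>mu)"
    unfolding PM_def using P.integral_fst'[OF F] by simp
  also have "\<dots> = (\<integral>\<xi>. rho \<xi> * (\<integral>r. F (\<xi>, r) \<partial>unit_leb) \<partial>leb n)"
    using m by (intro mu_integral) (simp cong: measurable_cong_sets)
  finally show ?thesis .
qed

definition Q :: "(nat \<Rightarrow> real) \<times> real \<Rightarrow> real" where "Q w = 1 + nsq n (fst w)"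

lemma Q_moments: "integrable PM (\<lambda>w. Q w ^ m)"
proof -
  interpret P: pair_sigma_finite mu unit_leb by (rule PM_pair)
  interpret b: prob_space unit_leb by (rule unit_leb_prob)
  have p1: "b.prob {0..1} = 1" using b.prob_space by simp
  have i: "integrable mu (\<lambda>\<xi>. (1 + nsq n \<xi>) ^ m)"
    using rho_moments[of m] by (subst mu_integrable) (auto simp: mult.commute)
  show ?thesis unfolding PM_def
  proof (rule P.Fubini_integrable)
    show "(\<lambda>w. Q w ^ m) \<in> borel_measurable (mu \<Otimes>\<^sub>M unit_leb)"
      unfolding Q_def PM_def[symmetric] by (intro measurable_fst_PM) measurable
    show "integrable mu (\<lambda>\<xi>. \<integral>r. norm (Q (\<xi>, r) ^ m) \<partial>unit_leb)"
      using integrable_norm[OF i] by (simp add: Q_def p1)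
  qed (auto simp: Q_def)
qed

lemma Q_ge_1: "1 \<le> Q w" using nsq_nonneg by (simp add: Q_def)

definition ca :: "(nat \<Rightarrow> real) \<Rightarrow> real" where "ca \<xi> = fa \<xi> / rho \<xi>"
definition cb :: "(nat \<Rightarrow> real) \<Rightarrow> real" where "cb \<xi> = fb \<xi> / rho \<xi>"

lemma ca_le: "\<bar>ca \<xi>\<bar> \<le> 1" and cb_le: "\<bar>cb \<xi>\<bar> \<le> 1"
  unfolding ca_def cb_def rho_def by (auto simp: divide_le_eq)

text \<open>Where \<open>rho\<close> vanishes, both transforms vanish too and the quotients are 0 by
  convention, so the identities hold without exception.\<close>

lemma rho_ca: "rho \<xi> * ca \<xi> = fa \<xi>" "rho \<xi> * cb \<xi> = fb \<xi>"
  unfolding ca_def cb_def by (cases "rho \<xi> = 0"; auto simp: rho_def)+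

lemma ca_measurable [measurable]: "ca \<in> borel_measurable (leb n)" "cb \<in> borel_measurable (leb n)"
  unfolding ca_def[abs_def] cb_def[abs_def] by measurable

text \<open>The \<open>l\<close>-th derivative of a plane wave in its phase, encoded as a shift by
  \<open>l * pi / 2\<close>. Two derivatives reverse the sign, which turns the Laplacian in
  \<open>x\<close> into multiplication by \<open>- nsq n \<xi>\<close>.\<close>

definition tr :: "nat \<Rightarrow> (nat \<Rightarrow> real) \<times> real \<Rightarrow> real \<Rightarrow> real" where
  "tr l w x = ca (fst w) * cos (x + real l * pi / 2) + cb (fst w) * sin (x + real l * pi / 2)"

lemma tr_deriv: "(tr l w has_real_derivative tr (Suc l) w x) (at x)"
proof -
  have a: "x + real (Suc l) * pi / 2 = (x + real l * pi / 2) + pi/2" by (simp add: field_simps)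
  have c: "((\<lambda>x. cos (x + real l * pi / 2)) has_real_derivative (- sin (x + real l * pi / 2))) (at x)"
    by (rule derivative_eq_intros refl | simp)+
  have s: "((\<lambda>x. sin (x + real l * pi / 2)) has_real_derivative (cos (x + real l * pi / 2))) (at x)"
    by (rule derivative_eq_intros refl | simp)+
  show ?thesis unfolding tr_def[abs_def] a
    using DERIV_add[OF DERIV_cmult[OF c, of "ca (fst w)"] DERIV_cmult[OF s, of "cb (fst w)"]]
    by (simp add: cos_add[of _ "pi/2"] sin_add[of _ "pi/2"])
qed

lemma tr_2: "tr 2 w x = - tr 0 w x" by (simp add: tr_def)

lemma tr_le: "\<bar>tr l w x\<bar> \<le> 2"
proof -
  have "\<bar>ca (fst w) * cos (x + real l * pi / 2)\<bar> \<le> 1 * 1" unfolding abs_mult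
    by (intro mult_mono ca_le) auto
  moreover have "\<bar>cb (fst w) * sin (x + real l * pi / 2)\<bar> \<le> 1 * 1" unfolding abs_mult
    by (intro mult_mono cb_le) auto
  ultimately show ?thesis unfolding tr_def using abs_triangle_ineq[of "ca (fst w) * cos (x + real l * pi / 2)" "cb (fst w) * sin (x + real l * pi / 2)"] by linarith
qed

lemma rho_tr: "rho \<xi> * tr 0 (\<xi>, r) (dot n \<xi> x) = Gn x \<xi>"
proof -
  have "rho \<xi> * tr 0 (\<xi>, r) (dot n \<xi> x) = (rho \<xi> * ca \<xi>) * cos (dot n \<xi> x) + (rho \<xi> * cb \<xi>) * sin (dot n \<xi> x)"
    by (simp add: tr_def algebra_simps)
  thus ?thesis unfolding rho_ca Gn_def by simp
qed

definition th :: "(nat \<Rightarrow> real) \<times> real \<Rightarrow> (nat \<Rightarrow> real) \<Rightarrow> real" where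
  "th w p = (\<Sum>i<n. fst w i * p (Suc i))"

lemma th_xof: "th w p = dot n (fst w) (xof n p)"
  unfolding th_def dot_def by (rule sum.cong) (auto simp: xof_def)

lemma th_measurable: "(\<lambda>w. th w p) \<in> borel_measurable PM"
  unfolding th_def by (intro borel_measurable_sum borel_measurable_times measurable_fst_PM[where F = "\<lambda>\<xi>. \<xi> i" for i] leb_coord) auto

lemma tr_measurable:
  assumes "X \<in> borel_measurable PM" shows "(\<lambda>w. tr l w (X w)) \<in> borel_measurable PM"
proof -
  have "(\<lambda>w. ca (fst w)) \<in> borel_measurable PM" "(\<lambda>w. cb (fst w)) \<in> borel_measurable PM"
    by (intro measurable_fst_PM ca_measurable)+
  thus ?thesis unfolding tr_def using assms by measurable
qed

lemma th_upd:
  "th w (p(j := s)) = th w p + (if 1 \<le> j \<and> j \<le> n then fst w (j - 1) * (s - p j) else 0)"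
proof (cases "1 \<le> j \<and> j \<le> n")
  case True
  then obtain i where i: "j = Suc i" "i < n" by (cases j) auto
  have "th w (p(j := s)) = (\<Sum>l<n. fst w l * p (Suc l) + (if l = i then fst w i * (s - p j) else 0))"
    unfolding th_def i by (rule sum.cong) (auto simp: algebra_simps)
  also have "\<dots> = th w p + fst w i * (s - p j)" unfolding th_def using i by (simp add: sum.distrib)
  finally show ?thesis using True i by simp
next
  case False
  thus ?thesis unfolding th_def by (auto intro!: sum.cong)
qed

end

text \<open>Dimension and domain are parameters because the heat solution uses all of
  \<open>Rsp (Suc n)\<close> and the wave solutions a time strip in
  \<open>Rsp (Suc (n + N))\<close>.\<close>

locale test_fn_domain = test_fn +
  fixes d :: nat and V :: "(nat \<Rightarrow> real) set"
  assumes V_op: "openin (top_of_set (Rsp d)) V"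
begin

sublocale param_family PM Q d V
proof
  show "Q \<in> borel_measurable PM" unfolding Q_def by (intro measurable_fst_PM) measurable
qed (use V_op Q_moments Q_ge_1 in auto)

lemma fam_xi: "i < n \<Longrightarrow> fam k (\<lambda>w p. fst w i)"
proof (rule fam_coeff[of _ 1 1])
  assume i: "i < n"
  show "(\<lambda>w. fst w i) \<in> borel_measurable PM" using i by (intro measurable_fst_PM[where F = "\<lambda>\<xi>. \<xi> i"] leb_coord)
  fix w :: "(nat \<Rightarrow> real) \<times> real"
  have "\<bar>fst w i\<bar> \<le> 1 + (fst w i)\<^sup>2"
    using zero_le_power2[of "\<bar>fst w i\<bar> - 1"] by (simp add: power2_eq_square algebra_simps)
  thus "\<bar>fst w i\<bar> \<le> 1 * Q w ^ 1" using coord_le_nsq[OF i, of "fst w"] by (simp add: Q_def)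
qed

lemma fam_q: "fam k (\<lambda>w p. nsq n (fst w))"
  by (rule fam_coeff[of _ 1 1]) (auto simp: Q_def nsq_nonneg intro!: measurable_fst_PM)

lemma fam_th: "fam k th"
  unfolding th_def[abs_def] by (intro fam_sum fam_mult fam_xi fam_coord) auto

lemma fam_tr: "fam k (\<lambda>w p. tr l w (th w p))"
proof (rule fam_compose[OF fam_th])
  show "fam0 (\<lambda>w p. tr l w (th w p))" for l
  proof (rule fam0I[of _ 2 0])
    show "continuous_on V (\<lambda>p. tr l w (th w p))" for w
      unfolding tr_def th_def by (intro continuous_intros continuous_on_coord)
  qed (use tr_le in \<open>auto intro!: tr_measurable th_measurable\<close>)
qed (rule tr_deriv)

lemma tr_th_deriv:
  "((\<lambda>s. tr l w (th w (p(j := s)))) has_real_derivative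
     (if 1 \<le> j \<and> j \<le> n then tr (Suc l) w (th w p) * fst w (j - 1) else 0)) (at (p j))"
proof (cases "1 \<le> j \<and> j \<le> n")
  case True
  have i: "((\<lambda>s. th w p + fst w (j - 1) * (s - p j)) has_real_derivative fst w (j - 1)) (at (p j))"
    by (rule derivative_eq_intros refl | simp)+
  have "((\<lambda>s. tr l w (th w p + fst w (j - 1) * (s - p j))) has_real_derivative
      tr (Suc l) w (th w p + fst w (j - 1) * (p j - p j)) * fst w (j - 1)) (at (p j))"
    by (rule DERIV_chain2[OF tr_deriv i])
  thus ?thesis using True by (simp add: th_upd)
qed (auto simp: th_upd)

end

context test_fn
begin

definition heat :: "real \<Rightarrow> real \<Rightarrow> (nat \<Rightarrow> real) \<Rightarrow> real" where
  "heat T t x = (\<integral>\<xi>. Gn x \<xi> * exp (- ((T - t) * nsq n \<xi>)) \<partial>leb n)"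

lemma heat_T: "x \<in> Rsp n \<Longrightarrow> heat T T x = h x"
  by (simp add: heat_def Gn_inversion)

text \<open>For \<open>t > T\<close> the factor \<open>exp (- (T - t) q)\<close> is unbounded in
  \<open>q\<close>, so the formula for \<open>heat\<close> cannot serve as the extension beyond the
  slab. With \<open>\<phi> 0 ((T - t) q)\<close> in its place the integrand is bounded for all
  \<open>t\<close>, smooth, and unchanged for \<open>t \<le> T\<close>.\<close>

lemma heat_backward: "t0 < T \<Longrightarrow> backward_heat_smooth n t0 T h (heat T)"
proof -
  assume tT: "t0 < T"
  interpret D: test_fn_domain n h "Suc n" "Rsp (Suc n)"
    by standard (simp add: n h)
  obtain \<phi> :: "nat \<Rightarrow> real \<Rightarrow> real"
    where \<phi>': "\<And>m s. (\<phi> m has_real_derivative \<phi> (Suc m) s) (at s)"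
    and \<phi>b: "\<And>m. \<exists>C. \<forall>s. \<bar>\<phi> m s\<bar> \<le> C" and \<phi>e: "\<And>m s. 0 \<le> s \<Longrightarrow> \<phi> m s = (-1)^m * exp (-s)"
    using smooth_bounded_extension_of_exp by blast
  define \<tau> where "\<tau> w p = (T + (-1) * p 0) * nsq n (fst w)" for w :: "(nat \<Rightarrow> real) \<times> real" and p :: "nat \<Rightarrow> real"
  \<comment> \<open>The second component of \<open>w\<close> is a dummy here; it runs over a
    probability space and integrates out, so the product measure of the wave construction can be
    reused.\<close>
  define g where "g p = (\<integral>w. tr 0 w (th w p) * \<phi> 0 (\<tau> w p) \<partial>PM)" for p
  have \<phi>c: "continuous_on A (\<phi> m)" for m A
    using \<phi>' by (meson DERIV_isCont continuous_at_imp_continuous_on)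
  have f\<tau>: "D.fam k \<tau>" for k
    unfolding \<tau>_def[abs_def] by (intro D.fam_mult D.fam_add D.fam_const D.fam_coord D.fam_q)
  have f\<phi>: "D.fam k (\<lambda>w p. \<phi> l (\<tau> w p))" for k l
  proof (rule D.fam_compose[OF f\<tau>, where e = "\<lambda>l w. \<phi> l"])
    fix l
    obtain C where C: "\<And>s. \<bar>\<phi> l s\<bar> \<le> C" using \<phi>b by blast
    show "D.fam0 (\<lambda>w p. \<phi> l (\<tau> w p))"
    proof (rule D.fam0I[of _ C 0])
      show "(\<lambda>w. \<phi> l (\<tau> w p)) \<in> borel_measurable PM" for p
        unfolding \<tau>_def by (intro measurable_compose[OF _ borel_measurable_continuous_onI[OF \<phi>c]] borel_measurable_times borel_measurable_const measurable_fst_PM) measurable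
      show "continuous_on (Rsp (Suc n)) (\<lambda>p. \<phi> l (\<tau> w p))" for w
        unfolding \<tau>_def by (rule continuous_on_compose2[OF \<phi>c[of UNIV]]) (auto intro!: continuous_intros continuous_on_coord)
    qed (use C in auto)
  qed (rule \<phi>')
  have fam: "D.fam k (\<lambda>w p. tr l w (th w p) * \<phi> m (\<tau> w p))" for k l m
    by (intro D.fam_mult D.fam_tr f\<phi>)
  have C: "Ck_on k (Suc n) (Rsp (Suc n)) g" for k
    unfolding g_def[abs_def] by (rule D.Ck_on_integral[OF fam])
  have geq: "g p = heat T (p 0) (xof n p)" if p: "p \<in> slab (Suc n) t0 T" for p
  proof -
    have pR: "p \<in> Rsp (Suc n)" using p by (simp add: slab_def)
    have i: "integrable PM (\<lambda>w. tr 0 w (th w p) * \<phi> 0 (\<tau> w p))"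
      by (rule D.fam0_integrable[OF D.fam_fam0[OF fam[of 0]] pR])
    have e: "\<phi> 0 (\<tau> (\<xi>, r) p) = exp (- ((T - p 0) * nsq n \<xi>))" for \<xi> r
      using p nsq_nonneg[of n \<xi>] by (subst \<phi>e) (auto simp: \<tau>_def slab_def)
    interpret b: prob_space unit_leb by (rule unit_leb_prob)
    have p1: "b.prob {0..1} = 1" using b.prob_space by simp
    have "g p = (\<integral>\<xi>. rho \<xi> * (\<integral>r. tr 0 (\<xi>, r) (th (\<xi>, r) p) * \<phi> 0 (\<tau> (\<xi>, r) p) \<partial>unit_leb) \<partial>leb n)"
      unfolding g_def by (rule PM_integral[OF i])
    also have "\<dots> = heat T (p 0) (xof n p)"
      unfolding heat_def
    proof (rule Bochner_Integration.integral_cong[OF refl])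
      fix \<xi>
      have "(\<integral>r. tr 0 (\<xi>, r) (th (\<xi>, r) p) * \<phi> 0 (\<tau> (\<xi>, r) p) \<partial>unit_leb) = (\<integral>r. tr 0 (\<xi>, 0) (dot n \<xi> (xof n p)) * exp (- ((T - p 0) * nsq n \<xi>)) \<partial>unit_leb)"
        unfolding e th_xof by (simp add: tr_def)
      also have "\<dots> = tr 0 (\<xi>, 0) (dot n \<xi> (xof n p)) * exp (- ((T - p 0) * nsq n \<xi>))" by (simp add: p1)
      finally show "rho \<xi> * (\<integral>r. tr 0 (\<xi>, r) (th (\<xi>, r) p) * \<phi> 0 (\<tau> (\<xi>, r) p) \<partial>unit_leb)
          = Gn (xof n p) \<xi> * exp (- ((T - p 0) * nsq n \<xi>))"
        using rho_tr[of \<xi> 0 "xof n p"] by simp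
    qed
    finally show ?thesis .
  qed
  have pde: "pd 0 g p + (\<Sum>k\<in>{1..n}. pd k (pd k g) p) = 0" if p: "p \<in> slab (Suc n) t0 T" for p
  proof -
    have pR: "p \<in> Rsp (Suc n)" using p by (simp add: slab_def)
    have t: "pd 0 g p = (\<integral>w. tr 0 w (th w p) * \<phi> 1 (\<tau> w p) * (- nsq n (fst w)) \<partial>PM)"
      unfolding g_def
    proof (rule D.pd_integral[OF D.fam_fam0[OF fam[of 0]] _ _ pR])
      have "D.fam 0 (\<lambda>w p. tr 0 w (th w p) * \<phi> 1 (\<tau> w p) * ((-1) * nsq n (fst w)))"
        by (intro D.fam_mult[OF fam] D.fam_mult D.fam_const D.fam_q)
      thus "D.fam0 (\<lambda>w p. tr 0 w (th w p) * \<phi> 1 (\<tau> w p) * (- nsq n (fst w)))" by simp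
      fix w :: "(nat \<Rightarrow> real) \<times> real" and p :: "nat \<Rightarrow> real"
      have i: "((\<lambda>s. (T + (-1) * s) * nsq n (fst w)) has_real_derivative (- nsq n (fst w))) (at (p 0))"
        by (rule derivative_eq_intros refl | simp)+
      have "((\<lambda>s. \<phi> 0 (\<tau> w (p(0 := s)))) has_real_derivative \<phi> 1 (\<tau> w p) * (- nsq n (fst w))) (at (p 0))"
        unfolding \<tau>_def using DERIV_chain2[OF \<phi>' i, of 0] by simp
      from DERIV_mult'[OF D.tr_th_deriv[of 0 w p 0] this]
      show "((\<lambda>s. tr 0 w (th w (p(0 := s))) * \<phi> 0 (\<tau> w (p(0 := s)))) has_real_derivative
         tr 0 w (th w p) * \<phi> 1 (\<tau> w p) * (- nsq n (fst w))) (at (p 0))" by (simp add: mult.assoc)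
    qed simp
    have x: "pd k (pd k g) p = (\<integral>w. - (tr 0 w (th w p) * \<phi> 0 (\<tau> w p) * (fst w (k-1))\<^sup>2) \<partial>PM)" if k: "k \<in> {1..n}" for k
      unfolding g_def
    proof (rule D.pd_pd_integral[OF D.fam_fam0[OF fam[of 0]] _ _ _ pR])
      have xi: "D.fam 0 (\<lambda>w p. fst w (k-1))" using k by (intro D.fam_xi) auto
      show "D.fam0 (\<lambda>w p. tr 1 w (th w p) * \<phi> 0 (\<tau> w p) * fst w (k-1))"
        using D.fam_mult[OF fam[of 0] xi] by simp
      have "D.fam 0 (\<lambda>w p. (-1) * (tr 0 w (th w p) * \<phi> 0 (\<tau> w p) * (fst w (k-1) * fst w (k-1))))"
        by (intro D.fam_mult[OF D.fam_const] D.fam_mult[OF fam] D.fam_mult xi)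
      thus "D.fam0 (\<lambda>w p. - (tr 0 w (th w p) * \<phi> 0 (\<tau> w p) * (fst w (k-1))\<^sup>2))" by (simp add: power2_eq_square)
      have k0: "k \<noteq> 0" using k by auto
      have \<tau>k: "\<tau> w (p(k := s)) = \<tau> w p" for w p s using k0 by (simp add: \<tau>_def)
      fix w :: "(nat \<Rightarrow> real) \<times> real" and p :: "nat \<Rightarrow> real"
      show "((\<lambda>s. tr 0 w (th w (p(k := s))) * \<phi> 0 (\<tau> w (p(k := s)))) has_real_derivative
         tr 1 w (th w p) * \<phi> 0 (\<tau> w p) * fst w (k-1)) (at (p k))"
        using DERIV_cmult_right[OF D.tr_th_deriv[of 0 w p k], of "\<phi> 0 (\<tau> w p)"] k unfolding \<tau>k by (simp add: mult_ac)
      show "((\<lambda>s. tr 1 w (th w (p(k := s))) * \<phi> 0 (\<tau> w (p(k := s))) * fst w (k-1)) has_real_derivative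
         - (tr 0 w (th w p) * \<phi> 0 (\<tau> w p) * (fst w (k-1))\<^sup>2)) (at (p k))"
        using DERIV_cmult_right[OF D.tr_th_deriv[of 1 w p k], of "\<phi> 0 (\<tau> w p) * fst w (k-1)"] k unfolding \<tau>k
        by (simp add: mult_ac numeral_2_eq_2[symmetric] tr_2 power2_eq_square)
    qed (use k in auto)
    have i1: "integrable PM (\<lambda>w. - (tr 0 w (th w p) * \<phi> 0 (\<tau> w p) * (fst w (k-1))\<^sup>2))" if k: "k \<in> {1..n}" for k
    proof -
      have xi: "D.fam 0 (\<lambda>w p. fst w (k-1))" using k by (intro D.fam_xi) auto
      have "D.fam 0 (\<lambda>w p. (-1) * (tr 0 w (th w p) * \<phi> 0 (\<tau> w p) * (fst w (k-1) * fst w (k-1))))"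
        by (intro D.fam_mult[OF D.fam_const] D.fam_mult[OF fam] D.fam_mult xi)
      from D.fam0_integrable[OF D.fam_fam0[OF this] pR] show ?thesis by (simp add: power2_eq_square)
    qed
    have i0: "integrable PM (\<lambda>w. tr 0 w (th w p) * \<phi> 1 (\<tau> w p) * (- nsq n (fst w)))"
    proof -
      have "D.fam 0 (\<lambda>w p. tr 0 w (th w p) * \<phi> 1 (\<tau> w p) * ((-1) * nsq n (fst w)))"
        by (intro D.fam_mult[OF fam] D.fam_mult D.fam_const D.fam_q)
      from D.fam0_integrable[OF D.fam_fam0[OF this] pR] show ?thesis by simp
    qed
    have sx: "(\<Sum>k\<in>{1..n}. pd k (pd k g) p) = (\<integral>w. (\<Sum>k\<in>{1..n}. - (tr 0 w (th w p) * \<phi> 0 (\<tau> w p) * (fst w (k-1))\<^sup>2)) \<partial>PM)"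
      by (rule trans[OF sum.cong[OF refl x] Bochner_Integration.integral_sum[symmetric]]) (use i1 in auto)
    have "pd 0 g p + (\<Sum>k\<in>{1..n}. pd k (pd k g) p) =
       (\<integral>w. tr 0 w (th w p) * \<phi> 1 (\<tau> w p) * (- nsq n (fst w)) + (\<Sum>k\<in>{1..n}. - (tr 0 w (th w p) * \<phi> 0 (\<tau> w p) * (fst w (k-1))\<^sup>2)) \<partial>PM)"
      unfolding t sx by (rule Bochner_Integration.integral_add[symmetric, OF i0 Bochner_Integration.integrable_sum[OF i1]])
    also have "\<dots> = (\<integral>w. 0 \<partial>PM)"
    proof (rule Bochner_Integration.integral_cong[OF refl])
      fix w
      \<comment> \<open>On the slab the argument is nonnegative and
        \<open>\<phi> 1 = - \<phi> 0\<close> there, which closes the equation. Off the slab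
        \<open>g\<close> need not satisfy it.\<close>
      have 0: "0 \<le> \<tau> w p" using p nsq_nonneg by (auto simp: \<tau>_def slab_def)
      have "(\<Sum>k\<in>{1..n}. (fst w (k-1))\<^sup>2) = nsq n (fst w)"
        unfolding nsq_def by (rule sum.reindex_bij_witness[of _ Suc "\<lambda>k. k - 1"]) auto
      hence "(\<Sum>k\<in>{1..n}. - (tr 0 w (th w p) * \<phi> 0 (\<tau> w p) * (fst w (k-1))\<^sup>2)) = - (tr 0 w (th w p) * \<phi> 0 (\<tau> w p) * nsq n (fst w))"
        by (simp add: sum_negf sum_distrib_left[symmetric])
      thus "tr 0 w (th w p) * \<phi> 1 (\<tau> w p) * (- nsq n (fst w)) + (\<Sum>k\<in>{1..n}. - (tr 0 w (th w p) * \<phi> 0 (\<tau> w p) * (fst w (k-1))\<^sup>2)) = 0"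
        using \<phi>e[OF 0, of 0] \<phi>e[OF 0, of 1] by simp
    qed
    finally show ?thesis by simp
  qed
  show ?thesis
    unfolding backward_heat_smooth_def
  proof (intro conjI exI[of _ "Rsp (Suc n)"] exI[of _ g] allI ballI)
    show "Ck_ext 0 (Suc n) t0 T (\<lambda>p. heat T (p 0) (xof n p)) (Rsp (Suc n)) g"
      unfolding Ck_ext_def using C geq by (auto simp: slab_def)
  qed (use C pde heat_T in auto)
qed

end

section \<open>The wave solutions and their limit\<close>

locale wave_construction = wave_modes t1 T c c' s s' + test_fn n h
  for t1 T :: real and c c' s s' :: "complex \<Rightarrow> real \<Rightarrow> complex" and n :: nat and h :: "(nat \<Rightarrow> real) \<Rightarrow> real"
begin

definition cut :: "nat \<Rightarrow> real" where "cut N = sqrt (sqrt (real N))"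

text \<open>The values of \<open>\<kappa>\<^sup>2\<close> for the two time modes. With
  \<open>lam1\<close>, the coefficient \<open>2 t / N\<close> turns \<open>- lam1 / (4 t)\<close>
  into \<open>- nsq n \<xi>\<close>, so this mode needs no dependence on \<open>y\<close>. With
  \<open>lam2\<close> the remainder \<open>nsq n \<xi> - lam2 / (2 N)\<close> is left to the radial
  factor.\<close>

definition lam1 :: "nat \<Rightarrow> (nat \<Rightarrow> real) \<times> real \<Rightarrow> real" where "lam1 N w = 2 * real N * nsq n (fst w)"
definition lam2 :: "nat \<Rightarrow> (nat \<Rightarrow> real) \<times> real \<Rightarrow> real" where "lam2 N w = (cut N * snd w)\<^sup>2"

definition Dm :: "nat \<Rightarrow> (nat \<Rightarrow> real) \<times> real \<Rightarrow> real \<Rightarrow> real" where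
  "Dm N w t = Re (f (of_real (sqrt (lam1 N w))) t)"
definition Dm' :: "nat \<Rightarrow> (nat \<Rightarrow> real) \<times> real \<Rightarrow> real \<Rightarrow> real" where
  "Dm' N w t = Re (f' (of_real (sqrt (lam1 N w))) t)"
text \<open>The factor \<open>cut N\<close> is the Jacobian of \<open>\<kappa> = cut N * r\<close>
  with \<open>r\<close> in the unit interval, and \<open>2 / pi\<close> normalises the limit of the
  packet to 1.\<close>

definition Sm :: "nat \<Rightarrow> (nat \<Rightarrow> real) \<times> real \<Rightarrow> real \<Rightarrow> real" where
  "Sm N w t = 2 / pi * cut N * St (cut N * snd w) t"
definition Sm' :: "nat \<Rightarrow> (nat \<Rightarrow> real) \<times> real \<Rightarrow> real \<Rightarrow> real" where
  "Sm' N w t = 2 / pi * cut N * St' (cut N * snd w) t"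

definition zz :: "nat \<Rightarrow> (nat \<Rightarrow> real) \<times> real \<Rightarrow> real" where
  "zz N w = real N * nsq n (fst w) - lam2 N w / 2"

text \<open>The damping is kept together with the Bessel factor because the product is bounded in
  \<open>\<xi>\<close>, locally uniformly in \<open>y\<close>.\<close>

definition Ym :: "nat \<Rightarrow> nat \<Rightarrow> (nat \<Rightarrow> real) \<times> real \<Rightarrow> real \<Rightarrow> real" where
  "Ym N l w x = exp (- (T * nsq n (fst w))) * bess N l x"

definition vN :: "nat \<Rightarrow> real \<Rightarrow> (nat \<Rightarrow> real) \<Rightarrow> (nat \<Rightarrow> real) \<Rightarrow> real" where
  "vN N t x y = (\<integral>w. tr 0 w (dot n (fst w) x) * (Dm N w t + Sm N w t * Ym N 0 w (zz N w * (nsq N y / (2 * real N)))) \<partial>PM)"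

lemma f_real_cont: "t > 0 \<Longrightarrow> continuous_on UNIV (\<lambda>x. f (of_real x) t)"
  and f'_real_cont: "t > 0 \<Longrightarrow> continuous_on UNIV (\<lambda>x. f' (of_real x) t)"
proof -
  assume t: "t > 0"
  have "continuous_on UNIV (\<lambda>x. (\<lambda>x. f (fst x) (snd x)) (complex_of_real x, t))"
    by (rule continuous_on_compose2[OF f_cont]) (use t in \<open>auto intro!: continuous_intros\<close>)
  thus "continuous_on UNIV (\<lambda>x. f (of_real x) t)" by simp
  have "continuous_on UNIV (\<lambda>x. (\<lambda>x. f' (fst x) (snd x)) (complex_of_real x, t))"
    by (rule continuous_on_compose2[OF f'_cont]) (use t in \<open>auto intro!: continuous_intros\<close>)
  thus "continuous_on UNIV (\<lambda>x. f' (of_real x) t)" by simp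
qed

lemma St_x_cont: "t > 0 \<Longrightarrow> continuous_on UNIV (\<lambda>x. St x t)"
  and St'_x_cont: "t > 0 \<Longrightarrow> continuous_on UNIV (\<lambda>x. St' x t)"
proof -
  assume t: "t > 0"
  have "continuous_on UNIV (\<lambda>x. (\<lambda>x. St (fst x) (snd x)) (x, t))"
    by (rule continuous_on_compose2[OF St_cont]) (use t in \<open>auto intro!: continuous_intros\<close>)
  thus "continuous_on UNIV (\<lambda>x. St x t)" by simp
  have "continuous_on UNIV (\<lambda>x. (\<lambda>x. St' (fst x) (snd x)) (x, t))"
    by (rule continuous_on_compose2[OF St'_cont]) (use t in \<open>auto intro!: continuous_intros\<close>)
  thus "continuous_on UNIV (\<lambda>x. St' x t)" by simp
qed

lemma lam1_nonneg: "lam1 N w \<ge> 0" using nsq_nonneg by (simp add: lam1_def)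

lemma nsq_PM [measurable]: "(\<lambda>w. nsq n (fst w)) \<in> borel_measurable PM"
  by (intro measurable_fst_PM nsq_measurable)

lemma snd_PM [measurable]: "(\<lambda>w. snd w) \<in> borel_measurable PM" by (rule measurable_snd_PM)

lemma lam_measurable [measurable]: "lam1 N \<in> borel_measurable PM" "lam2 N \<in> borel_measurable PM"
  "zz N \<in> borel_measurable PM"
  unfolding lam1_def[abs_def] lam2_def[abs_def] zz_def[abs_def] by measurable

lemma Dm_deriv:
  assumes "t > 0"
  shows "(Dm N w has_real_derivative Dm' N w t) (at t)"
    "(Dm' N w has_real_derivative (- lam1 N w / (4 * t) * Dm N w t)) (at t)"
proof -
  show "(Dm N w has_real_derivative Dm' N w t) (at t)"
    unfolding Dm_def[abs_def] Dm'_def by (rule has_real_derivative_Re[OF f_deriv[OF assms]])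
  have "- (complex_of_real (sqrt (lam1 N w)))\<^sup>2 / (4 * of_real t) = of_real (- lam1 N w / (4 * t))"
    using lam1_nonneg[of N w] by (simp flip: of_real_power)
  hence "Re (- (of_real (sqrt (lam1 N w)))\<^sup>2 / (4 * of_real t) * f (of_real (sqrt (lam1 N w))) t) = - lam1 N w / (4 * t) * Dm N w t"
    unfolding Dm_def by (simp only: Re_complex_of_real times_complex.sel Im_complex_of_real mult_zero_left diff_zero)
  thus "(Dm' N w has_real_derivative (- lam1 N w / (4 * t) * Dm N w t)) (at t)"
    using has_real_derivative_Re[OF f'_deriv[OF assms, of "of_real (sqrt (lam1 N w))"]] unfolding Dm'_def[abs_def] by (simp only:)
qed

lemma Sm_deriv:
  assumes "t > 0"
  shows "(Sm N w has_real_derivative Sm' N w t) (at t)"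
    "(Sm' N w has_real_derivative (- lam2 N w / (4 * t) * Sm N w t)) (at t)"
proof -
  show "(Sm N w has_real_derivative Sm' N w t) (at t)"
    unfolding Sm_def[abs_def] Sm'_def by (rule DERIV_cmult[OF St_deriv[OF assms]])
  show "(Sm' N w has_real_derivative (- lam2 N w / (4 * t) * Sm N w t)) (at t)"
    using DERIV_cmult[OF St'_deriv[OF assms, of "cut N * snd w"], of "2 / pi * cut N"]
    unfolding Sm'_def[abs_def] Sm_def lam2_def by (simp add: mult_ac)
qed

lemma Dm_T: "Dm N w T = 1" by (simp add: Dm_def f_T)
lemma Sm_T: "Sm N w T = 0" by (simp add: Sm_def St_T)

text \<open>The neighbourhood of the slab on which the solution is shown to be smooth. Its ends are
  the starting time of the modes and the last time covered by their estimates on the real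
  axis.\<close>

definition dom :: "nat \<Rightarrow> (nat \<Rightarrow> real) set" where
  "dom N = {p \<in> Rsp (Suc (n + N)). t1 < p 0 \<and> p 0 < T + 1}"

lemma dom_open: "openin (top_of_set (Rsp (Suc (n + N)))) (dom N)"
proof -
  have "open {p::nat\<Rightarrow>real. t1 < p 0 \<and> p 0 < T + 1}"
    by (intro open_Collect_conj open_Collect_less continuous_intros continuous_on_coord)
  thus ?thesis unfolding dom_def openin_open by (intro exI[of _ "{p. t1 < p 0 \<and> p 0 < T + 1}"]) auto
qed

definition ysq :: "nat \<Rightarrow> (nat \<Rightarrow> real) \<Rightarrow> real" where
  "ysq N p = (\<Sum>j<N. (p (Suc n + j))\<^sup>2)"

lemma ysq_yof: "ysq N p = nsq N (yof n N p)"
  unfolding ysq_def nsq_def by (rule sum.cong) (auto simp: yof_def)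

lemma ysq_nonneg: "ysq N p \<ge> 0" by (simp add: ysq_def sum_nonneg)

lemma ysq_upd: "ysq N (p(j := a)) = ysq N p + (if Suc n \<le> j \<and> j < Suc n + N then a\<^sup>2 - (p j)\<^sup>2 else 0)"
proof (cases "Suc n \<le> j \<and> j < Suc n + N")
  case True
  then obtain i where i: "j = Suc n + i" "i < N" by (metis add_less_cancel_left le_Suc_ex)
  have "ysq N (p(j := a)) = (\<Sum>l<N. (p (Suc n + l))\<^sup>2 + (if l = i then a\<^sup>2 - (p j)\<^sup>2 else 0))"
    unfolding ysq_def i by (rule sum.cong) auto
  also have "\<dots> = ysq N p + (a\<^sup>2 - (p j)\<^sup>2)" unfolding ysq_def using i by (simp add: sum.distrib)
  finally show ?thesis using True by simp
next
  case False
  thus ?thesis unfolding ysq_def by (auto intro!: sum.cong)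
qed

definition zt :: "nat \<Rightarrow> (nat \<Rightarrow> real) \<times> real \<Rightarrow> (nat \<Rightarrow> real) \<Rightarrow> real" where
  "zt N w p = zz N w * (ysq N p / (2 * real N))"

section \<open>Regularity of the wave integrand for fixed \<open>N\<close>\<close>

context
  fixes N :: nat
  assumes N: "N \<ge> 1"
begin

interpretation W: test_fn_domain n h "Suc (n + N)" "dom N"
  by standard (rule dom_open)

lemma dom_pos: "p \<in> dom N \<Longrightarrow> p 0 > 0" using t1 by (auto simp: dom_def)

lemma snd_range: "w \<in> space PM \<Longrightarrow> snd w \<in> {0..1}" by (auto simp: space_PM)

lemma zz_le: "w \<in> space PM \<Longrightarrow> \<bar>zz N w\<bar> \<le> real N * nsq n (fst w) + (cut N)\<^sup>2 / 2"
proof -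
  assume "w \<in> space PM"
  hence r: "0 \<le> snd w" "snd w \<le> 1" using snd_range by auto
  hence "(snd w)\<^sup>2 \<le> 1" by (simp add: power_le_one)
  hence "lam2 N w \<le> (cut N)\<^sup>2" unfolding lam2_def power_mult_distrib by (simp add: mult_left_le)
  moreover have "lam2 N w \<ge> 0" by (simp add: lam2_def)
  moreover have "real N * nsq n (fst w) \<ge> 0" using nsq_nonneg by simp
  ultimately show ?thesis unfolding zz_def by linarith
qed

lemma fam_lam1: "W.fam k (\<lambda>w p. lam1 N w)" unfolding lam1_def by (intro W.fam_mult W.fam_const W.fam_q)

lemma fam_lam2: "W.fam k (\<lambda>w p. lam2 N w)"
proof (rule W.fam_coeff[of _ "(cut N)\<^sup>2" 0])
  fix w assume "w \<in> space PM"
  hence r: "0 \<le> snd w" "snd w \<le> 1" using snd_range by auto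
  hence "(snd w)\<^sup>2 \<le> 1" by (simp add: power_le_one)
  thus "\<bar>lam2 N w\<bar> \<le> (cut N)\<^sup>2 * Q w ^ 0" unfolding lam2_def power_mult_distrib by (simp add: mult_left_le)
qed (rule lam_measurable)

lemma fam_zz: "W.fam k (\<lambda>w p. zz N w)"
proof -
  have "W.fam k (\<lambda>w p. real N * nsq n (fst w) + (- 1/2) * lam2 N w)"
    by (intro W.fam_add W.fam_mult W.fam_const W.fam_q fam_lam2)
  thus ?thesis by (simp add: zz_def)
qed

lemma fam_zt: "W.fam k (zt N)"
proof -
  have "W.fam k (\<lambda>w p. zz N w * ((1 / (2 * real N)) * (\<Sum>j<N. p (Suc n + j) * p (Suc n + j))))"
    by (intro W.fam_mult W.fam_const fam_zz W.fam_sum W.fam_coord) auto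
  thus ?thesis unfolding zt_def[abs_def] ysq_def by (simp add: power2_eq_square)
qed

lemma bess_cont: "continuous_on A (bess N l)"
  using bess_deriv[OF N] by (meson DERIV_isCont continuous_at_imp_continuous_on)

lemma fam_Ym: "W.fam k (\<lambda>w p. Ym N l w (zt N w p))"
proof (rule W.fam_compose[OF fam_zt])
  show "(Ym N l w has_real_derivative Ym N (Suc l) w (zt N w p)) (at (zt N w p))" for l w p
    unfolding Ym_def[abs_def] by (rule DERIV_cmult[OF bess_deriv[OF N]])
  show "W.fam0 (\<lambda>w p. Ym N l w (zt N w p))" for l
    unfolding W.fam0_def
  proof (intro conjI ballI)
    fix p assume p: "p \<in> dom N"
    show "(\<lambda>w. Ym N l w (zt N w p)) \<in> borel_measurable PM"
      unfolding Ym_def zt_def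
      by (intro borel_measurable_times measurable_compose[OF _ borel_measurable_continuous_onI[OF bess_cont]]) measurable
    define K where "K = ysq N p + 1"
    have K: "K > 0" using ysq_nonneg[of N p] by (simp add: K_def)
    have T0: "T > 0" using t1 t1T by simp
    \<comment> \<open>Chosen so that the leading part of
      \<open>\<epsilon> * \<bar>zt N w p'\<bar>\<close> is at most \<open>T * nsq n (fst w)\<close>,
      which the damping cancels exactly. \<open>K\<close> bounds \<open>ysq N\<close> near
      \<open>p\<close>, so \<open>\<epsilon>\<close> depends on the point but not on
      \<open>w\<close>.\<close>
    define \<epsilon> where "\<epsilon> = 2 * T / K"
    have \<epsilon>: "\<epsilon> > 0" using K T0 by (simp add: \<epsilon>_def)
    show "\<exists>U C m. open U \<and> p \<in> U \<and> (\<forall>w\<in>space PM. \<forall>p'\<in>dom N \<inter> U. \<bar>Ym N l w (zt N w p')\<bar> \<le> C * Q w ^ m)"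
    proof (intro exI conjI ballI)
      show "open {p'. ysq N p' < K}"
        unfolding ysq_def by (intro open_Collect_less continuous_intros continuous_on_coord)
      show "p \<in> {p'. ysq N p' < K}" by (simp add: K_def)
      fix w p' assume w: "w \<in> space PM" and p': "p' \<in> dom N \<inter> {p'. ysq N p' < K}"
      have "\<bar>zt N w p'\<bar> = \<bar>zz N w\<bar> * (ysq N p' / (2 * real N))" unfolding zt_def abs_mult using ysq_nonneg[of N p'] by simp
      also have "\<dots> \<le> (real N * nsq n (fst w) + (cut N)\<^sup>2 / 2) * (K / (2 * real N))"
        using zz_le[OF w] p' ysq_nonneg[of N p'] N nsq_nonneg[of n "fst w"]
        by (intro mult_mono divide_right_mono) auto
      finally have "\<epsilon> * \<bar>zt N w p'\<bar> \<le> \<epsilon> * ((real N * nsq n (fst w) + (cut N)\<^sup>2 / 2) * (K / (2 * real N)))"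
        using \<epsilon> by (intro mult_left_mono) auto
      also have "\<dots> = T * nsq n (fst w) + T * (cut N)\<^sup>2 / (2 * real N)"
        unfolding \<epsilon>_def using K N by (simp add: field_simps)
      finally have e: "exp (\<epsilon> * \<bar>zt N w p'\<bar>) \<le> exp (T * nsq n (fst w) + T * (cut N)\<^sup>2 / (2 * real N))" by simp
      have "\<bar>Ym N l w (zt N w p')\<bar> = exp (- (T * nsq n (fst w))) * \<bar>bess N l (zt N w p')\<bar>" unfolding Ym_def by (simp add: abs_mult)
      also have "\<dots> \<le> exp (- (T * nsq n (fst w))) * (exp (1/\<epsilon>) * exp (T * nsq n (fst w) + T * (cut N)\<^sup>2 / (2 * real N)))"
        using bess_bound[OF N \<epsilon>, of l "zt N w p'"] e by (intro mult_left_mono) (auto intro: order_trans mult_left_mono)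
      also have "\<dots> = exp (1/\<epsilon>) * exp (T * (cut N)\<^sup>2 / (2 * real N)) * (exp (- (T * nsq n (fst w))) * exp (T * nsq n (fst w)))"
        unfolding exp_add by (simp only: mult_ac)
      also have "\<dots> = exp (1/\<epsilon>) * exp (T * (cut N)\<^sup>2 / (2 * real N)) * Q w ^ 0" by (simp add: exp_minus)
      finally show "\<bar>Ym N l w (zt N w p')\<bar> \<le> exp (1/\<epsilon>) * exp (T * (cut N)\<^sup>2 / (2 * real N)) * Q w ^ 0" .
    qed
  next
    fix w assume "w \<in> space PM"
    show "continuous_on (dom N) (\<lambda>p. Ym N l w (zt N w p))"
      unfolding Ym_def zt_def ysq_def
      by (intro continuous_intros continuous_on_compose2[OF bess_cont[of UNIV]] continuous_on_coord) (use N in auto)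
  qed
qed

text \<open>The frequency \<open>sqrt (lam1 N w)\<close> is unbounded in \<open>w\<close>, so the
  bounds on \<open>f\<close> and \<open>f'\<close> over the whole real axis are needed; the time
  equation then yields all higher orders through \<open>fam_time\<close>.\<close>

lemma fam_Dm: "W.fam k (\<lambda>w p. Dm N w (p 0)) \<and> W.fam k (\<lambda>w p. Dm' N w (p 0))"
proof (rule W.fam_time)
  obtain C K where C: "C \<ge> 0" "\<And>x t. t \<in> {t1..T+1} \<Longrightarrow> norm (f (of_real x) t) \<le> C" using f_bounds by metis
  obtain C' where C': "\<And>x t. t \<in> {t1..T+1} \<Longrightarrow> norm (f' (of_real x) t) \<le> C' * (1 + x\<^sup>2)" "C' \<ge> 0" using f'_bound by metis
  have m: "(\<lambda>w. sqrt (lam1 N w)) \<in> borel_measurable PM" by measurable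
  have cont: "continuous_on (dom N) (\<lambda>p. F w (p 0))" if "\<And>w t. t > 0 \<Longrightarrow> \<exists>D. (F w has_real_derivative D) (at t)" for F :: "(nat \<Rightarrow> real) \<times> real \<Rightarrow> real \<Rightarrow> real" and w
  proof -
    have "continuous_on {0<..} (F w)" using that by (intro continuous_at_imp_continuous_on ballI) (metis DERIV_isCont greaterThan_iff)
    thus ?thesis by (rule continuous_on_compose2) (use dom_pos in \<open>auto intro!: continuous_on_coord\<close>)
  qed
  show "W.fam0 (\<lambda>w p. Dm N w (p 0))"
  proof (rule W.fam0I[of _ C 0])
    show "(\<lambda>w. Dm N w (p 0)) \<in> borel_measurable PM" if "p \<in> dom N" for p
      unfolding Dm_def using dom_pos[OF that]
      by (intro measurable_compose[OF m borel_measurable_continuous_onI] continuous_intros f_real_cont)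
    show "\<bar>Dm N w (p 0)\<bar> \<le> C * Q w ^ 0" if "p \<in> dom N" for w p
      using abs_Re_le_cmod[of "f (of_real (sqrt (lam1 N w))) (p 0)"] C(2)[of "p 0" "sqrt (lam1 N w)"] that
      by (auto simp: Dm_def dom_def)
    show "continuous_on (dom N) (\<lambda>p. Dm N w (p 0))" for w by (rule cont) (use Dm_deriv in blast)
  qed
  show "W.fam0 (\<lambda>w p. Dm' N w (p 0))"
  proof (rule W.fam0I[of _ "C' * (1 + 2 * real N)" 1])
    show "(\<lambda>w. Dm' N w (p 0)) \<in> borel_measurable PM" if "p \<in> dom N" for p
      unfolding Dm'_def using dom_pos[OF that]
      by (intro measurable_compose[OF m borel_measurable_continuous_onI] continuous_intros f'_real_cont)
    show "\<bar>Dm' N w (p 0)\<bar> \<le> C' * (1 + 2 * real N) * Q w ^ 1" if "p \<in> dom N" for w p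
    proof -
      have "\<bar>Dm' N w (p 0)\<bar> \<le> C' * (1 + lam1 N w)"
        using abs_Re_le_cmod[of "f' (of_real (sqrt (lam1 N w))) (p 0)"] C'(1)[of "p 0" "sqrt (lam1 N w)"] that lam1_nonneg[of N w]
        by (auto simp: Dm'_def dom_def)
      also have "\<dots> \<le> C' * ((1 + 2 * real N) * Q w)"
      proof (intro mult_left_mono C')
        have "1 + lam1 N w \<le> 1 + lam1 N w + (nsq n (fst w) + 2 * real N)" using nsq_nonneg by simp
        thus "1 + lam1 N w \<le> (1 + 2 * real N) * Q w" by (simp add: lam1_def Q_def algebra_simps)
      qed
      finally show ?thesis by (simp add: mult.assoc)
    qed
    show "continuous_on (dom N) (\<lambda>p. Dm' N w (p 0))" for w by (rule cont) (use Dm_deriv in blast)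
  qed
  show "0 < p 0" if "p \<in> dom N" for p by (rule dom_pos[OF that])
  show "(Dm N w has_real_derivative Dm' N w (p 0)) (at (p 0))" if "p \<in> dom N" for w p
    by (rule Dm_deriv(1)[OF dom_pos[OF that]])
  show "(Dm' N w has_real_derivative (- lam1 N w / (4 * p 0) * Dm N w (p 0))) (at (p 0))" if "p \<in> dom N" for w p
    by (rule Dm_deriv(2)[OF dom_pos[OF that]])
qed (rule fam_lam1)

text \<open>The packet frequencies stay in the compact interval \<open>{0..cut N}\<close>, so joint
  continuity bounds \<open>St\<close> and \<open>St'\<close>, with constants that may depend on
  \<open>N\<close>.\<close>

lemma fam_Sm: "W.fam k (\<lambda>w p. Sm N w (p 0)) \<and> W.fam k (\<lambda>w p. Sm' N w (p 0))"
proof (rule W.fam_time)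
  have cont: "continuous_on (dom N) (\<lambda>p. F w (p 0))" if "\<And>w t. t > 0 \<Longrightarrow> \<exists>D. (F w has_real_derivative D) (at t)" for F :: "(nat \<Rightarrow> real) \<times> real \<Rightarrow> real \<Rightarrow> real" and w
  proof -
    have "continuous_on {0<..} (F w)" using that by (intro continuous_at_imp_continuous_on ballI) (metis DERIV_isCont greaterThan_iff)
    thus ?thesis by (rule continuous_on_compose2) (use dom_pos in \<open>auto intro!: continuous_on_coord\<close>)
  qed
  have bd: "\<exists>C. \<forall>x\<in>{0..cut N}. \<forall>t\<in>{t1..T+1}. \<bar>F x t\<bar> \<le> C"
    if F: "continuous_on (UNIV \<times> {0<..}) (\<lambda>x. F (fst x) (snd x))" for F :: "real \<Rightarrow> real \<Rightarrow> real"
  proof -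
    have "compact ({0..cut N} \<times> {t1..T+1})" by (intro compact_Times) auto
    moreover have "continuous_on ({0..cut N} \<times> {t1..T+1}) (\<lambda>x. F (fst x) (snd x))"
      by (rule continuous_on_subset[OF F]) (use t1 in auto)
    ultimately have "bounded ((\<lambda>x. F (fst x) (snd x)) ` ({0..cut N} \<times> {t1..T+1}))"
      by (intro compact_imp_bounded compact_continuous_image)
    then obtain B where "\<And>x. x \<in> {0..cut N} \<times> {t1..T+1} \<Longrightarrow> norm (F (fst x) (snd x)) \<le> B" unfolding bounded_iff by blast
    hence "\<forall>x\<in>{0..cut N}. \<forall>t\<in>{t1..T+1}. \<bar>F x t\<bar> \<le> B" by fastforce
    thus ?thesis by blast
  qed
  have r: "cut N * snd w \<in> {0..cut N}" if "w \<in> space PM" for w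
    using snd_range[OF that] by (auto simp: cut_def mult_left_le)
  have c0: "cut N \<ge> 0" by (simp add: cut_def)
  have m: "(\<lambda>w. cut N * snd w) \<in> borel_measurable PM" by measurable
  obtain C where C: "\<forall>x\<in>{0..cut N}. \<forall>t\<in>{t1..T+1}. \<bar>St x t\<bar> \<le> C" using bd[OF St_cont] by blast
  obtain C' where C': "\<forall>x\<in>{0..cut N}. \<forall>t\<in>{t1..T+1}. \<bar>St' x t\<bar> \<le> C'" using bd[OF St'_cont] by blast
  show "W.fam0 (\<lambda>w p. Sm N w (p 0))"
  proof (rule W.fam0I[of _ "2 / pi * cut N * C" 0])
    show "(\<lambda>w. Sm N w (p 0)) \<in> borel_measurable PM" if "p \<in> dom N" for p
      unfolding Sm_def using dom_pos[OF that]
      by (intro borel_measurable_times borel_measurable_const measurable_compose[OF m borel_measurable_continuous_onI] St_x_cont)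
    show "\<bar>Sm N w (p 0)\<bar> \<le> 2 / pi * cut N * C * Q w ^ 0" if w: "w \<in> space PM" and p: "p \<in> dom N" for w p
    proof -
      have "\<bar>St (cut N * snd w) (p 0)\<bar> \<le> C" using C r[OF w] p by (auto simp: dom_def)
      thus ?thesis unfolding Sm_def abs_mult using c0 by (simp add: mult_left_mono divide_right_mono)
    qed
    show "continuous_on (dom N) (\<lambda>p. Sm N w (p 0))" for w by (rule cont) (use Sm_deriv in blast)
  qed
  show "W.fam0 (\<lambda>w p. Sm' N w (p 0))"
  proof (rule W.fam0I[of _ "2 / pi * cut N * C'" 0])
    show "(\<lambda>w. Sm' N w (p 0)) \<in> borel_measurable PM" if "p \<in> dom N" for p
      unfolding Sm'_def using dom_pos[OF that]
      by (intro borel_measurable_times borel_measurable_const measurable_compose[OF m borel_measurable_continuous_onI] St'_x_cont)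
    show "\<bar>Sm' N w (p 0)\<bar> \<le> 2 / pi * cut N * C' * Q w ^ 0" if w: "w \<in> space PM" and p: "p \<in> dom N" for w p
    proof -
      have "\<bar>St' (cut N * snd w) (p 0)\<bar> \<le> C'" using C' r[OF w] p by (auto simp: dom_def)
      thus ?thesis unfolding Sm'_def abs_mult using c0 by (simp add: mult_left_mono divide_right_mono)
    qed
    show "continuous_on (dom N) (\<lambda>p. Sm' N w (p 0))" for w by (rule cont) (use Sm_deriv in blast)
  qed
  show "0 < p 0" if "p \<in> dom N" for p by (rule dom_pos[OF that])
  show "(Sm N w has_real_derivative Sm' N w (p 0)) (at (p 0))" if "p \<in> dom N" for w p
    by (rule Sm_deriv(1)[OF dom_pos[OF that]])
  show "(Sm' N w has_real_derivative (- lam2 N w / (4 * p 0) * Sm N w (p 0))) (at (p 0))" if "p \<in> dom N" for w p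
    by (rule Sm_deriv(2)[OF dom_pos[OF that]])
qed (rule fam_lam2)

section \<open>The wave equation for the superposition\<close>

definition Am :: "(nat \<Rightarrow> real) \<times> real \<Rightarrow> (nat \<Rightarrow> real) \<Rightarrow> real" where
  "Am w p = Dm N w (p 0) + Sm N w (p 0) * Ym N 0 w (zt N w p)"

lemma fam_Am: "W.fam k Am"
  unfolding Am_def[abs_def] using fam_Dm fam_Sm by (intro W.fam_add W.fam_mult fam_Ym) auto

definition gN :: "(nat \<Rightarrow> real) \<Rightarrow> real" where
  "gN p = (\<integral>w. tr 0 w (th w p) * Am w p \<partial>PM)"

lemma gN_eq: "gN p = vN N (p 0) (xof n p) (yof n N p)"
  by (simp add: gN_def vN_def Am_def th_xof zt_def ysq_yof)

lemma fam_main: "W.fam k (\<lambda>w p. tr l w (th w p) * Am w p)"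
  by (intro W.fam_mult W.fam_tr fam_Am)

lemma gN_Ck: "Ck_on k (Suc (n + N)) (dom N) gN"
  unfolding gN_def[abs_def] by (rule W.Ck_on_integral[OF fam_main])

text \<open>The second time derivative of \<open>Am\<close> after insertion of the two mode
  equations; the radial factor does not involve \<open>p 0\<close>.\<close>

definition Att :: "(nat \<Rightarrow> real) \<times> real \<Rightarrow> (nat \<Rightarrow> real) \<Rightarrow> real" where
  "Att w p = - lam1 N w / (4 * p 0) * Dm N w (p 0) + - lam2 N w / (4 * p 0) * Sm N w (p 0) * Ym N 0 w (zt N w p)"

lemma fam_Att: "W.fam k Att"
proof -
  have it: "W.fam k (\<lambda>w p. 1 / (4 * p 0))" by (rule W.fam_inverse_time) (rule dom_pos)
  have "W.fam k (\<lambda>w p. ((-1) * lam1 N w) * (1 / (4 * p 0)) * Dm N w (p 0) + ((-1) * lam2 N w) * (1 / (4 * p 0)) * Sm N w (p 0) * Ym N 0 w (zt N w p))"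
    using fam_Dm fam_Sm by (intro W.fam_add W.fam_mult W.fam_const fam_lam1 fam_lam2 it fam_Ym) auto
  thus ?thesis unfolding Att_def[abs_def] by simp
qed

lemma pd_tt:
  assumes p: "p \<in> dom N"
  shows "pd 0 (pd 0 gN) p = (\<integral>w. tr 0 w (th w p) * Att w p \<partial>PM)"
  unfolding gN_def[abs_def]
proof (rule W.pd_pd_integral[OF W.fam_fam0[OF fam_main[of 0]] _ _ _ p])
  let ?A' = "\<lambda>w p. Dm' N w (p 0) + Sm' N w (p 0) * Ym N 0 w (zt N w p)"
  have "W.fam 0 (\<lambda>w p. tr 0 w (th w p) * ?A' w p)"
    using fam_Dm[of 0] fam_Sm[of 0] by (intro W.fam_mult W.fam_tr W.fam_add fam_Ym) auto
  thus "W.fam0 (\<lambda>w p. tr 0 w (th w p) * ?A' w p)" by simp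
  have "W.fam 0 (\<lambda>w p. tr 0 w (th w p) * Att w p)" by (intro W.fam_mult W.fam_tr fam_Att)
  thus "W.fam0 (\<lambda>w p. tr 0 w (th w p) * Att w p)" by simp
  have u: "th w (p(0 := s)) = th w p" "zt N w (p(0 := s)) = zt N w p" for w p s
    by (simp_all add: th_upd zt_def ysq_upd)
  fix w p assume "p \<in> dom N"
  hence t: "p 0 > 0" by (rule dom_pos)
  show "((\<lambda>s. tr 0 w (th w (p(0 := s))) * Am w (p(0 := s))) has_real_derivative tr 0 w (th w p) * ?A' w p) (at (p 0))"
    unfolding u Am_def by (simp, intro DERIV_cmult DERIV_add DERIV_cmult_right Dm_deriv Sm_deriv t)
  show "((\<lambda>s. tr 0 w (th w (p(0 := s))) * ?A' w (p(0 := s))) has_real_derivative tr 0 w (th w p) * Att w p) (at (p 0))"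
    unfolding u Att_def by (simp only: fun_upd_same, intro DERIV_cmult DERIV_add DERIV_cmult_right Dm_deriv Sm_deriv t)
qed simp

lemma pd_xx:
  assumes p: "p \<in> dom N" and k: "k \<in> {1..n}"
  shows "pd k (pd k gN) p = (\<integral>w. tr 0 w (th w p) * (- ((fst w (k-1))\<^sup>2 * Am w p)) \<partial>PM)"
  unfolding gN_def[abs_def]
proof (rule W.pd_pd_integral[OF W.fam_fam0[OF fam_main[of 0]] _ _ _ p])
  have xi: "W.fam 0 (\<lambda>w p. fst w (k-1))" using k by (intro W.fam_xi) auto
  have "W.fam 0 (\<lambda>w p. tr 1 w (th w p) * Am w p * fst w (k-1))" by (intro W.fam_mult[OF fam_main] xi)
  thus "W.fam0 (\<lambda>w p. tr 1 w (th w p) * Am w p * fst w (k-1))" by simp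
  have "W.fam 0 (\<lambda>w p. tr 0 w (th w p) * ((-1) * (fst w (k-1) * fst w (k-1) * Am w p)))"
    by (intro W.fam_mult W.fam_tr W.fam_const xi fam_Am)
  thus "W.fam0 (\<lambda>w p. tr 0 w (th w p) * (- ((fst w (k-1))\<^sup>2 * Am w p)))" by (simp add: power2_eq_square)
  have k0: "k \<noteq> 0" "\<not> (Suc n \<le> k \<and> k < Suc n + N)" using k by auto
  have u: "Am w (p(k := s)) = Am w p" for w p s using k by (auto simp: Am_def zt_def ysq_upd)
  fix w :: "(nat \<Rightarrow> real) \<times> real" and p :: "nat \<Rightarrow> real"
  show "((\<lambda>s. tr 0 w (th w (p(k := s))) * Am w (p(k := s))) has_real_derivative tr 1 w (th w p) * Am w p * fst w (k-1)) (at (p k))"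
    using DERIV_cmult_right[OF W.tr_th_deriv[of 0 w p k], of "Am w p"] k unfolding u by (simp add: mult_ac)
  show "((\<lambda>s. tr 1 w (th w (p(k := s))) * Am w (p(k := s)) * fst w (k-1)) has_real_derivative tr 0 w (th w p) * (- ((fst w (k-1))\<^sup>2 * Am w p))) (at (p k))"
    using DERIV_cmult_right[OF W.tr_th_deriv[of 1 w p k], of "Am w p * fst w (k-1)"] k unfolding u
    by (simp add: mult_ac numeral_2_eq_2[symmetric] tr_2 power2_eq_square)
qed (use k in auto)

text \<open>The second derivative of \<open>Am\<close> in the coordinate \<open>j\<close> of
  \<open>y\<close>, by the chain rule: \<open>zt\<close> has first derivative
  \<open>zz * p j / N\<close> and second derivative \<open>zz / N\<close> there.\<close>

definition Ajj :: "nat \<Rightarrow> (nat \<Rightarrow> real) \<times> real \<Rightarrow> (nat \<Rightarrow> real) \<Rightarrow> real" where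
  "Ajj j w p = Sm N w (p 0) * (Ym N 1 w (zt N w p) * (zz N w / real N) + Ym N 2 w (zt N w p) * (zz N w * p j / real N)\<^sup>2)"

lemma fam_Ajj: "W.fam k (Ajj j)"
proof -
  have "W.fam k (\<lambda>w p. Sm N w (p 0) * (Ym N 1 w (zt N w p) * (zz N w * (1 / real N))
       + Ym N 2 w (zt N w p) * ((zz N w * p j * (1 / real N)) * (zz N w * p j * (1 / real N)))))"
    using fam_Sm by (intro W.fam_add W.fam_mult W.fam_const fam_zz W.fam_coord fam_Ym) auto
  thus ?thesis unfolding Ajj_def[abs_def] by (simp add: power2_eq_square)
qed

lemma pd_yy:
  assumes p: "p \<in> dom N" and j: "j \<in> {Suc n..n + N}"
  shows "pd j (pd j gN) p = (\<integral>w. tr 0 w (th w p) * Ajj j w p \<partial>PM)"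
  unfolding gN_def[abs_def]
proof (rule W.pd_pd_integral[OF W.fam_fam0[OF fam_main[of 0]] _ _ _ p])
  let ?A' = "\<lambda>w p. Sm N w (p 0) * (Ym N 1 w (zt N w p) * (zz N w * p j / real N))"
  have "W.fam 0 (\<lambda>w p. tr 0 w (th w p) * (Sm N w (p 0) * (Ym N 1 w (zt N w p) * (zz N w * p j * (1 / real N)))))"
    using fam_Sm[of 0] by (intro W.fam_mult W.fam_tr W.fam_const W.fam_coord fam_zz fam_Ym) auto
  thus "W.fam0 (\<lambda>w p. tr 0 w (th w p) * ?A' w p)" by simp
  have "W.fam 0 (\<lambda>w p. tr 0 w (th w p) * Ajj j w p)" by (intro W.fam_mult W.fam_tr fam_Ajj)
  thus "W.fam0 (\<lambda>w p. tr 0 w (th w p) * Ajj j w p)" by simp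
  have j0: "j \<noteq> 0" "\<not> (1 \<le> j \<and> j \<le> n)" "Suc n \<le> j \<and> j < Suc n + N" using j by auto
  have u: "th w (p(j := s)) = th w p" "(p(j := s)) 0 = p 0" for w p s
    using j0 by (auto simp: th_upd)
  have zt': "((\<lambda>s. zt N w (p(j := s))) has_real_derivative (zz N w * p j / real N)) (at (p j))" for w p
  proof -
    have "((\<lambda>s. zz N w * ((ysq N p + (s\<^sup>2 - (p j)\<^sup>2)) / (2 * real N))) has_real_derivative (zz N w * ((0 + (2 * p j - 0)) / (2 * real N)))) (at (p j))"
      by (intro DERIV_cmult DERIV_cdivide DERIV_add DERIV_diff DERIV_const) (rule derivative_eq_intros refl | simp)+
    thus ?thesis unfolding zt_def ysq_upd using j0 by simp
  qed
  have Y': "((\<lambda>s. Ym N l w (zt N w (p(j := s)))) has_real_derivative (Ym N (Suc l) w (zt N w p) * (zz N w * p j / real N))) (at (p j))" for l w p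
  proof -
    have "(Ym N l w has_real_derivative Ym N (Suc l) w (zt N w (p(j := p j)))) (at (zt N w (p(j := p j))))"
      unfolding Ym_def[abs_def] by (rule DERIV_cmult[OF bess_deriv[OF N]])
    from DERIV_chain2[OF this zt'] show ?thesis by simp
  qed
  fix w p assume "p \<in> dom N"
  show "((\<lambda>s. tr 0 w (th w (p(j := s))) * Am w (p(j := s))) has_real_derivative tr 0 w (th w p) * ?A' w p) (at (p j))"
  proof -
    have "((\<lambda>s. tr 0 w (th w p) * (Dm N w (p 0) + Sm N w (p 0) * Ym N 0 w (zt N w (p(j := s))))) has_real_derivative
       tr 0 w (th w p) * (0 + Sm N w (p 0) * (Ym N (Suc 0) w (zt N w p) * (zz N w * p j / real N)))) (at (p j))"
      by (intro DERIV_cmult DERIV_add DERIV_const Y')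
    thus ?thesis unfolding u Am_def by simp
  qed
  show "((\<lambda>s. tr 0 w (th w (p(j := s))) * ?A' w (p(j := s))) has_real_derivative tr 0 w (th w p) * Ajj j w p) (at (p j))"
  proof -
    have lin: "((\<lambda>s. zz N w * s / real N) has_real_derivative (zz N w / real N)) (at (p j))"
      by (intro DERIV_cdivide DERIV_cmult_Id)
    have "((\<lambda>s. tr 0 w (th w p) * (Sm N w (p 0) * (Ym N 1 w (zt N w (p(j := s))) * (zz N w * s / real N)))) has_real_derivative
       tr 0 w (th w p) * (Sm N w (p 0) * (Ym N 1 w (zt N w (p(j := p j))) * (zz N w / real N)
         + Ym N (Suc 1) w (zt N w p) * (zz N w * p j / real N) * (zz N w * p j / real N)))) (at (p j))"
      by (intro DERIV_cmult DERIV_mult' Y' lin)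
    thus ?thesis unfolding u Ajj_def by (simp add: power2_eq_square numeral_2_eq_2 mult.assoc)
  qed
qed (use j in auto)

text \<open>All second derivatives pass under the integral, so the equation is checked for each
  \<open>w\<close>. The mode \<open>Dm\<close> balances because of the choice of
  \<open>lam1\<close>. For the packet, \<open>bess_ode\<close> sums the second derivatives over the
  \<open>y\<close> coordinates to \<open>zz / N\<close> times the packet.\<close>

lemma wave_pde:
  assumes p: "p \<in> dom N"
  shows "2 * p 0 / real N * pd 0 (pd 0 gN) p - (\<Sum>k\<in>{1..n + N}. pd k (pd k gN) p) = 0"
proof -
  have N0: "real N > 0" using N by simp
  have t: "p 0 > 0" by (rule dom_pos[OF p])
  let ?X = "\<lambda>k w. if k \<le> n then tr 0 w (th w p) * (- ((fst w (k-1))\<^sup>2 * Am w p)) else tr 0 w (th w p) * Ajj k w p"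
  have itt: "integrable PM (\<lambda>w. tr 0 w (th w p) * Att w p)"
    using W.fam0_integrable[OF W.fam_fam0[OF W.fam_mult[OF W.fam_tr fam_Att]] p] .
  have iX: "integrable PM (?X k)" if k: "k \<in> {1..n+N}" for k
  proof (cases "k \<le> n")
    case True
    have xi: "W.fam 0 (\<lambda>w p. fst w (k-1))" using True k by (intro W.fam_xi) auto
    have "W.fam 0 (\<lambda>w p. tr 0 w (th w p) * ((-1) * (fst w (k-1) * fst w (k-1) * Am w p)))"
      by (intro W.fam_mult W.fam_tr W.fam_const xi fam_Am)
    from W.fam0_integrable[OF W.fam_fam0[OF this] p] show ?thesis using True by (simp add: power2_eq_square)
  next
    case False
    thus ?thesis using W.fam0_integrable[OF W.fam_fam0[OF W.fam_mult[OF W.fam_tr fam_Ajj]] p] by simp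
  qed
  have "(\<Sum>k\<in>{1..n + N}. pd k (pd k gN) p) = (\<Sum>k\<in>{1..n + N}. (\<integral>w. ?X k w \<partial>PM))"
  proof (rule sum.cong[OF refl])
    fix k assume k: "k \<in> {1..n + N}"
    show "pd k (pd k gN) p = (\<integral>w. ?X k w \<partial>PM)"
    proof (cases "k \<le> n")
      case True
      thus ?thesis using pd_xx[OF p, of k] k by simp
    next
      case False
      thus ?thesis using pd_yy[OF p, of k] k by simp
    qed
  qed
  also have "\<dots> = (\<integral>w. (\<Sum>k\<in>{1..n + N}. ?X k w) \<partial>PM)"
    by (rule Bochner_Integration.integral_sum[symmetric]) (rule iX)
  finally have sx: "(\<Sum>k\<in>{1..n + N}. pd k (pd k gN) p) = (\<integral>w. (\<Sum>k\<in>{1..n + N}. ?X k w) \<partial>PM)" .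
  have alg: "(\<Sum>k\<in>{1..n + N}. ?X k w) = 2 * p 0 / real N * (tr 0 w (th w p) * Att w p)" for w
  proof -
    have "{1..n + N} = {1..n} \<union> {Suc n..n + N}" by auto
    hence "(\<Sum>k\<in>{1..n + N}. ?X k w) = (\<Sum>k\<in>{1..n}. ?X k w) + (\<Sum>k\<in>{Suc n..n + N}. ?X k w)"
      by (simp add: sum.union_disjoint)
    also have "(\<Sum>k\<in>{1..n}. ?X k w) = (\<Sum>k\<in>{1..n}. (tr 0 w (th w p) * (- Am w p)) * (fst w (k-1))\<^sup>2)"
      by (rule sum.cong) auto
    also have "\<dots> = (tr 0 w (th w p) * (- Am w p)) * nsq n (fst w)"
    proof -
      have "(\<Sum>k\<in>{1..n}. (fst w (k-1))\<^sup>2) = nsq n (fst w)"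
        unfolding nsq_def by (rule sum.reindex_bij_witness[of _ Suc "\<lambda>k. k - 1"]) auto
      thus ?thesis by (simp only: sum_distrib_left[symmetric])
    qed
    also have "(\<Sum>k\<in>{Suc n..n + N}. ?X k w) = (\<Sum>k\<in>{Suc n..n + N}. tr 0 w (th w p) * Ajj k w p)"
      by (rule sum.cong) auto
    also have "\<dots> = tr 0 w (th w p) * (\<Sum>k\<in>{Suc n..n + N}. Ajj k w p)" by (simp add: sum_distrib_left)
    also have "(\<Sum>k\<in>{Suc n..n + N}. Ajj k w p) = (\<Sum>j<N. Ajj (Suc n + j) w p)"
      by (rule sum.reindex_bij_witness[of _ "\<lambda>j. Suc n + j" "\<lambda>k. k - Suc n"]) auto
    also have "\<dots> = (\<Sum>j<N. Sm N w (p 0) * (Ym N 1 w (zt N w p) * (zz N w / real N)) + Sm N w (p 0) * Ym N 2 w (zt N w p) * (zz N w / real N)\<^sup>2 * (p (Suc n + j))\<^sup>2)"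
      by (rule sum.cong) (auto simp: Ajj_def power2_eq_square algebra_simps)
    also have "\<dots> = real N * (Sm N w (p 0) * (Ym N 1 w (zt N w p) * (zz N w / real N))) + Sm N w (p 0) * Ym N 2 w (zt N w p) * (zz N w / real N)\<^sup>2 * ysq N p"
      by (simp add: sum.distrib sum_distrib_left[symmetric] ysq_def)
    also have "\<dots> = (zz N w / real N) * Sm N w (p 0) * Ym N 0 w (zt N w p)"
    proof -
      have o: "Ym N 0 w (zt N w p) = 2 * (zt N w p * Ym N 2 w (zt N w p)) + real N * Ym N 1 w (zt N w p)"
        unfolding Ym_def bess_ode[OF N, of "zt N w p", symmetric] by (simp add: algebra_simps)
      have z: "2 * zt N w p = (zz N w / real N) * ysq N p" using N0 by (simp add: zt_def)
      have "(zz N w / real N) * Sm N w (p 0) * Ym N 0 w (zt N w p)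
         = (zz N w / real N) * Sm N w (p 0) * ((2 * zt N w p) * Ym N 2 w (zt N w p) + real N * Ym N 1 w (zt N w p))"
        unfolding o by (simp only: mult.assoc)
      also have "\<dots> = real N * (Sm N w (p 0) * (Ym N 1 w (zt N w p) * (zz N w / real N))) + Sm N w (p 0) * Ym N 2 w (zt N w p) * (zz N w / real N)\<^sup>2 * ysq N p"
        unfolding z by (simp add: power2_eq_square algebra_simps)
      finally show ?thesis by simp
    qed
    also have "(tr 0 w (th w p) * (- Am w p)) * nsq n (fst w) + tr 0 w (th w p) * ((zz N w / real N) * Sm N w (p 0) * Ym N 0 w (zt N w p))
       = 2 * p 0 / real N * (tr 0 w (th w p) * Att w p)"
    proof -
      have z: "zz N w / real N = nsq n (fst w) - lam2 N w / (2 * real N)" using N0 by (simp add: zz_def diff_divide_distrib)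
      have a: "2 * p 0 / real N * (- lam1 N w / (4 * p 0)) = - nsq n (fst w)" "2 * p 0 / real N * (- lam2 N w / (4 * p 0)) = - (lam2 N w / (2 * real N))"
        using t N0 by (simp_all add: lam1_def)
      have "2 * p 0 / real N * (tr 0 w (th w p) * Att w p) = tr 0 w (th w p) *
          ((2 * p 0 / real N * (- lam1 N w / (4 * p 0))) * Dm N w (p 0) + (2 * p 0 / real N * (- lam2 N w / (4 * p 0))) * Sm N w (p 0) * Ym N 0 w (zt N w p))"
        unfolding Att_def by (simp only: distrib_left mult_ac)
      also have "\<dots> = (tr 0 w (th w p) * (- Am w p)) * nsq n (fst w) + tr 0 w (th w p) * ((zz N w / real N) * Sm N w (p 0) * Ym N 0 w (zt N w p))"
        unfolding a z Am_def by (simp add: algebra_simps)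
      finally show ?thesis by simp
    qed
    finally show ?thesis .
  qed
  show ?thesis unfolding sx alg pd_tt[OF p] using itt by simp
qed

lemma vN_T: assumes x: "x \<in> Rsp n" shows "vN N T x y = h x"
proof -
  interpret b: prob_space unit_leb by (rule unit_leb_prob)
  have p1: "b.prob {0..1} = 1" using b.prob_space by simp
  have m: "(\<lambda>w. tr 0 w (dot n (fst w) x)) \<in> borel_measurable PM"
    by (intro tr_measurable measurable_fst_PM dot_measurable)
  have i: "integrable PM (\<lambda>w. tr 0 w (dot n (fst w) x))"
    by (rule Bochner_Integration.integrable_bound[of PM "\<lambda>w. 2 * Q w ^ 0", OF integrable_mult_right[OF Q_moments] m])
       (use tr_le in auto)
  have "vN N T x y = (\<integral>w. tr 0 w (dot n (fst w) x) \<partial>PM)" by (simp add: vN_def Dm_T Sm_T)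
  also have "\<dots> = (\<integral>\<xi>. rho \<xi> * (\<integral>r. tr 0 (\<xi>, r) (dot n \<xi> x) \<partial>unit_leb) \<partial>leb n)" using PM_integral[OF i] by simp
  also have "\<dots> = (\<integral>\<xi>. Gn x \<xi> \<partial>leb n)"
  proof (rule Bochner_Integration.integral_cong[OF refl])
    fix \<xi>
    have "(\<integral>r. tr 0 (\<xi>, r) (dot n \<xi> x) \<partial>unit_leb) = (\<integral>r. tr 0 (\<xi>, 0) (dot n \<xi> x) \<partial>unit_leb)" by (simp add: tr_def)
    also have "\<dots> = tr 0 (\<xi>, 0) (dot n \<xi> x)" by (simp add: p1)
    finally show "rho \<xi> * (\<integral>r. tr 0 (\<xi>, r) (dot n \<xi> x) \<partial>unit_leb) = Gn x \<xi>" using rho_tr by simp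
  qed
  finally show ?thesis using Gn_inversion[OF x] by simp
qed

lemma vN_wave_solution: assumes "t1 < t0" shows "wave_solution n N t0 T h (vN N)"
  unfolding wave_solution_def
proof (intro conjI exI[of _ "dom N"] exI[of _ gN] ballI)
  have sub: "slab (Suc (n + N)) t0 T \<subseteq> dom N" using assms by (auto simp: slab_def dom_def)
  show "Ck_ext 2 (Suc (n + N)) t0 T (\<lambda>p. vN N (p 0) (xof n p) (yof n N p)) (dom N) gN"
    unfolding Ck_ext_def using dom_open sub gN_Ck by (auto simp: gN_eq)
  show "2 * p 0 / real N * pd 0 (pd 0 gN) p - (\<Sum>k = 1..n + N. pd k (pd k gN) p) = 0" if "p \<in> slab (Suc (n + N)) t0 T" for p
    by (rule wave_pde) (use that sub in auto)
qed (rule vN_T)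

text \<open>A point of \<open>dom N\<close> with the given time, \<open>x\<close> and
  \<open>y\<close> is assembled, so that integrability in the family applies to it.\<close>

lemma vN_integrable:
  assumes t: "t1 < t" "t < T + 1" and x: "x \<in> Rsp n" and y: "y \<in> Rsp N"
  shows "integrable PM (\<lambda>w. tr 0 w (dot n (fst w) x) * (Dm N w t + Sm N w t * Ym N 0 w (zz N w * (nsq N y / (2 * real N)))))"
proof -
  define p where "p = (\<lambda>i. if i = 0 then t else if i \<le> n then x (i - 1) else y (i - Suc n))"
  have p: "p \<in> dom N" using t y by (auto simp: dom_def p_def Rsp_def)
  have 1: "xof n p = x" using x by (auto simp: xof_def p_def Rsp_def fun_eq_iff)
  have 2: "yof n N p = y" using y by (auto simp: yof_def p_def Rsp_def fun_eq_iff)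
  have 3: "p 0 = t" by (simp add: p_def)
  show ?thesis using W.fam0_integrable[OF W.fam_fam0[OF fam_main[of 0 0]] p]
    unfolding Am_def th_xof zt_def ysq_yof 1 2 3 .
qed

end

end

section \<open>The rescaled frequency variable and the radial variable\<close>

lemma unit_leb_integrable:
  fixes g :: "real \<Rightarrow> real"
  assumes "continuous_on UNIV g" shows "integrable unit_leb g"
proof -
  have "set_integrable lborel {0..1} g"
    by (intro borel_integrable_atLeastAtMost' continuous_on_subset[OF assms]) auto
  thus ?thesis by (subst integrable_restrict_space) (auto simp: set_integrable_def)
qed

lemma unit_leb_scale:
  fixes g :: "real \<Rightarrow> real"
  assumes g: "continuous_on UNIV g" and R: "R > 0"
  shows "(\<integral>r. R * g (R * r) \<partial>unit_leb) = integral {0..R} g"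
proof -
  have s: "set_integrable lborel {0..R} g"
    by (intro borel_integrable_atLeastAtMost' continuous_on_subset[OF g]) auto
  have "integral {0..R} g = (\<integral>x. indicator {0..R} x *\<^sub>R g x \<partial>lborel)"
    using set_borel_integral_eq_integral(2)[OF s] by (simp add: set_lebesgue_integral_def)
  also have "\<dots> = \<bar>R\<bar> *\<^sub>R (\<integral>r. indicator {0..R} (0 + R * r) *\<^sub>R g (0 + R * r) \<partial>lborel)"
    by (rule lborel_integral_real_affine) (use R in simp)
  also have "(\<lambda>r. indicator {0..R} (0 + R * r) *\<^sub>R g (0 + R * r)) = (\<lambda>r. g (R * r) * indicator {0..1} r)"
    using R by (auto simp: indicator_def fun_eq_iff zero_le_mult_iff)
  also have "\<bar>R\<bar> *\<^sub>R (\<integral>r. g (R * r) * indicator {0..1} r \<partial>lborel) = (\<integral>r. R * g (R * r) \<partial>unit_leb)"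
    using R by (simp add: unit_leb_integral mult.assoc)
  finally show ?thesis by simp
qed

text \<open>Expanding the squares and exchanging the sums brings out the Gram matrix of the columns
  of \<open>A\<close>, which is the identity. Since \<open>vN\<close> depends on \<open>y\<close>
  through \<open>nsq N y\<close>, this is the radial symmetry.\<close>

lemma nsq_SO:
  assumes "A \<in> SO N" shows "nsq N (matvec N A y) = nsq N y"
proof -
  have "nsq N (matvec N A y) = (\<Sum>i<N. (\<Sum>j<N. A i j * y j) * (\<Sum>k<N. A i k * y k))"
    unfolding nsq_def by (rule sum.cong) (auto simp: matvec_def power2_eq_square)
  also have "\<dots> = (\<Sum>i<N. \<Sum>j<N. \<Sum>k<N. (A i j * A i k) * (y j * y k))"
    by (simp add: sum_product mult_ac)
  also have "\<dots> = (\<Sum>j<N. \<Sum>i<N. \<Sum>k<N. (A i j * A i k) * (y j * y k))" by (rule sum.swap)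
  also have "\<dots> = (\<Sum>j<N. \<Sum>k<N. \<Sum>i<N. (A i j * A i k) * (y j * y k))" by (intro sum.cong refl sum.swap)
  also have "\<dots> = (\<Sum>j<N. \<Sum>k<N. (\<Sum>i<N. A i j * A i k) * (y j * y k))" by (simp add: sum_distrib_right)
  also have "\<dots> = (\<Sum>j<N. \<Sum>k<N. (if j = k then 1 else 0) * (y j * y k))"
    using assms by (intro sum.cong refl arg_cong2[of _ _ _ _ "(*)"]) (auto simp: SO_def)
  also have "\<dots> = (\<Sum>j<N. y j * y j)"
  proof (rule sum.cong[OF refl])
    fix j assume j: "j \<in> {..<N}"
    have "(\<Sum>k<N. (if j = k then 1 else 0) * (y j * y k)) = (\<Sum>k<N. if k = j then y j * y k else 0)"
      by (rule sum.cong) auto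
    thus "(\<Sum>k<N. (if j = k then 1 else 0) * (y j * y k)) = y j * y j" using j by simp
  qed
  finally show ?thesis by (simp add: nsq_def power2_eq_square)
qed

lemma nsq_ypt: "N \<ge> 1 \<Longrightarrow> t \<ge> 0 \<Longrightarrow> nsq N (ypt N t) = 2 * real N * t"
proof -
  assume N: "N \<ge> 1" "t \<ge> 0"
  have "nsq N (ypt N t) = (\<Sum>i<N. if i = 0 then (sqrt (2 * real N * t))\<^sup>2 else 0)"
    unfolding nsq_def ypt_def by (rule sum.cong) auto
  also have "\<dots> = (sqrt (2 * real N * t))\<^sup>2" using N by (simp add: sum.delta)
  finally show ?thesis using N by simp
qed

section \<open>The limit on the parabola\<close>

context wave_construction
begin

lemma cut4: "cut N ^ 4 = real N"
proof -
  have "cut N ^ 4 = ((cut N)\<^sup>2)\<^sup>2" by (simp flip: power_mult)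
  thus ?thesis by (simp add: cut_def)
qed

lemma cut_ge_1: "N \<ge> 1 \<Longrightarrow> cut N \<ge> 1" by (simp add: cut_def)

lemma cut_at_top: "filterlim cut at_top sequentially"
  unfolding cut_def
  by (intro filterlim_compose[OF sqrt_at_top] filterlim_real_sequentially)

text \<open>The packet at one frequency \<open>\<xi>\<close> on the parabola: there
  \<open>nsq N y / (2 N) = t\<close>, so the argument of the radial factor is
  \<open>zz * t\<close>.\<close>

definition Wm :: "nat \<Rightarrow> real \<Rightarrow> (nat \<Rightarrow> real) \<Rightarrow> real" where
  "Wm N t \<xi> = (\<integral>r. Sm N (\<xi>, r) t * Ym N 0 (\<xi>, r) (zz N (\<xi>, r) * t) \<partial>unit_leb)"

text \<open>What is left of \<open>Wm\<close> once the radial factor is replaced by its limit: the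
  truncated frequency integral, which tends to 1 for \<open>t < T\<close>.\<close>

definition Pm :: "nat \<Rightarrow> real \<Rightarrow> real" where
  "Pm N t = 2 / pi * integral {0..cut N} (\<lambda>x. St x t)"

lemma Wm_integrand_cont:
  assumes "N \<ge> 1" "t > 0"
  shows "continuous_on UNIV (\<lambda>r. Sm N (\<xi>, r) t * Ym N 0 (\<xi>, r) (zz N (\<xi>, r) * t))"
    "continuous_on UNIV (\<lambda>r. Sm N (\<xi>, r) t)"
proof -
  show 1: "continuous_on UNIV (\<lambda>r. Sm N (\<xi>, r) t)"
    unfolding Sm_def by (intro continuous_intros continuous_on_compose2[OF St_x_cont[OF assms(2)]]) auto
  have "continuous_on UNIV (\<lambda>r. Ym N 0 (\<xi>, r) (zz N (\<xi>, r) * t))"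
    unfolding Ym_def zz_def lam2_def by (intro continuous_intros continuous_on_compose2[OF bess_cont[OF assms(1), of UNIV]]) auto
  thus "continuous_on UNIV (\<lambda>r. Sm N (\<xi>, r) t * Ym N 0 (\<xi>, r) (zz N (\<xi>, r) * t))"
    by (intro continuous_on_mult 1)
qed

text \<open>With \<open>R = cut N\<close> the packet has total weight of order \<open>R\<close>, and
  \<open>bess_close\<close> gives a radial error of order
  \<open>q\<^sup>2 / N + R\<^sup>2 / N\<close>. Since \<open>N = R ^ 4\<close>, the product is of
  order \<open>q\<^sup>2 / R ^ 3 + 1 / R\<close>.\<close>

lemma Wm_close:
  assumes N: "N \<ge> 1" and t: "t \<in> {t1..T}" and C: "\<And>x. \<bar>St x t\<bar> \<le> C"
  shows "\<bar>Wm N t \<xi> - exp (- ((T - t) * nsq n \<xi>)) * Pm N t\<bar>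
     \<le> 2 / pi * C * ((T * nsq n \<xi>)\<^sup>2 / cut N ^ 3 + T / 2 * exp (T / 2) / cut N)"
proof -
  define R where "R = cut N"
  define q where "q = nsq n \<xi>"
  have R: "R \<ge> 1" using cut_ge_1[OF N] by (simp add: R_def)
  have N4: "real N = R ^ 4" using cut4 by (simp add: R_def)
  have q: "q \<ge> 0" using nsq_nonneg by (simp add: q_def)
  have t0: "t > 0" "t \<le> T" using t t1 by auto
  have C0: "C \<ge> 0" using C[of 0] by linarith
  interpret b: prob_space unit_leb by (rule unit_leb_prob)
  have p1: "b.prob {0..1} = 1" using b.prob_space by simp
  define a where "a = (\<lambda>r. Sm N (\<xi>, r) t * Ym N 0 (\<xi>, r) (zz N (\<xi>, r) * t))"
  define d where "d = (\<lambda>r. exp (- ((T - t) * q)) * Sm N (\<xi>, r) t)"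
  let ?B = "2 / pi * C * ((T * q)\<^sup>2 / R ^ 3 + T / 2 * exp (T / 2) / R)"
  have ia: "integrable unit_leb a" and ib: "integrable unit_leb d"
    unfolding a_def d_def using Wm_integrand_cont[OF N t0(1)] by (auto intro!: unit_leb_integrable integrable_mult_right)
  have "(\<integral>r. Sm N (\<xi>, r) t \<partial>unit_leb) = (\<integral>r. 2 / pi * (R * St (R * r) t) \<partial>unit_leb)"
    by (simp add: Sm_def R_def mult_ac)
  also have "\<dots> = Pm N t" using unit_leb_scale[OF St_x_cont[OF t0(1)], of R] R by (simp add: Pm_def R_def)
  finally have "(\<integral>r. d r \<partial>unit_leb) = exp (- ((T - t) * q)) * Pm N t" unfolding d_def by simp
  hence eq: "Wm N t \<xi> - exp (- ((T - t) * q)) * Pm N t = (\<integral>r. a r - d r \<partial>unit_leb)"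
    unfolding Wm_def a_def[symmetric] using Bochner_Integration.integral_diff[OF ia ib] by (simp add: a_def)
  have "\<bar>Wm N t \<xi> - exp (- ((T - t) * q)) * Pm N t\<bar> \<le> (\<integral>r. \<bar>a r - d r\<bar> \<partial>unit_leb)"
    unfolding eq by (rule integral_abs_bound)
  also have "\<dots> \<le> (\<integral>r. ?B \<partial>unit_leb)"
  proof (rule integral_mono)
    show "integrable unit_leb (\<lambda>r. \<bar>a r - d r\<bar>)" using ia ib by simp
    fix r assume "r \<in> space unit_leb"
    hence r: "0 \<le> r" "r \<le> 1" by auto
    define k where "k = (R * r)\<^sup>2 / 2"
    have k: "0 \<le> k" "k \<le> R\<^sup>2 / 2"
      using r R by (auto simp: k_def power_mult_distrib mult_left_le power_le_one)
    have e: "exp (- (T * q)) * exp (t * q) = exp (- ((T - t) * q))" by (simp flip: exp_add add: algebra_simps)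
    have z: "zz N (\<xi>, r) * t = t * (N * q - k)" by (simp add: zz_def lam2_def k_def R_def q_def algebra_simps)
    have S: "Sm N (\<xi>, r) t = 2 / pi * R * St (R * r) t" by (simp add: Sm_def R_def)
    have Y: "Ym N 0 (\<xi>, r) (t * (N * q - k)) = exp (- (T * q)) * bess N 0 (t * (N * q - k))" by (simp add: Ym_def q_def)
    have "a r - d r = 2 / pi * R * St (R * r) t * (exp (- (T * q)) * (bess N 0 (t * (N * q - k)) - exp (t * q)))"
      unfolding a_def d_def z S Y e[symmetric] by (simp only: right_diff_distrib mult_ac)
    hence "\<bar>a r - d r\<bar> = 2 / pi * R * \<bar>St (R * r) t\<bar> * (exp (- (T * q)) * \<bar>bess N 0 (t * (N * q - k)) - exp (t * q)\<bar>)"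
      using R by (simp add: abs_mult)
    also have "\<dots> \<le> 2 / pi * R * C * (exp (- (T * q)) * (exp (t * q) * ((t * q)\<^sup>2 / N + t * (R\<^sup>2 / 2) / N * exp (t * (R\<^sup>2 / 2) / N))))"
      using bess_close[OF N _ q k(1) k(2), of t] t0 R C[of "R * r"] C0
      by (intro mult_mono mult_nonneg_nonneg mult_left_mono) auto
    also have "exp (- (T * q)) * (exp (t * q) * ((t * q)\<^sup>2 / N + t * (R\<^sup>2 / 2) / N * exp (t * (R\<^sup>2 / 2) / N)))
        = exp (- ((T - t) * q)) * ((t * q)\<^sup>2 / N + t * (R\<^sup>2 / 2) / N * exp (t * (R\<^sup>2 / 2) / N))"
      by (simp only: mult.assoc[symmetric] e)
    also have "2 / pi * R * C * (exp (- ((T - t) * q)) * ((t * q)\<^sup>2 / N + t * (R\<^sup>2 / 2) / N * exp (t * (R\<^sup>2 / 2) / N)))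
       \<le> 2 / pi * R * C * (1 * ((T * q)\<^sup>2 / N + T / 2 / R\<^sup>2 * exp (T / 2)))"
    proof (intro mult_left_mono mult_mono add_mono)
      show "exp (- ((T - t) * q)) \<le> 1" using t0 q by simp
      show "(t * q)\<^sup>2 / N \<le> (T * q)\<^sup>2 / N" using t0 q by (intro divide_right_mono power_mono mult_right_mono) auto
      have eq: "t * (R\<^sup>2 / 2) / N = t / 2 / R\<^sup>2" unfolding N4 using R by (simp add: power2_eq_square power4_eq_xxxx)
      show "t * (R\<^sup>2 / 2) / N \<le> T / 2 / R\<^sup>2" unfolding eq using t0 by (intro divide_right_mono) auto
      have "t / 2 / R\<^sup>2 \<le> t / 2 / 1" using t0 R by (intro divide_left_mono) (auto simp: one_le_power)
      thus "exp (t * (R\<^sup>2 / 2) / N) \<le> exp (T / 2)" unfolding eq using t0 by simp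
    qed (use t0 R C0 in auto)
    also have "\<dots> = ?B"
    proof -
      have "R * ((T * q)\<^sup>2 / N) = (T * q)\<^sup>2 / R ^ 3" unfolding N4 using R by (simp add: power3_eq_cube power4_eq_xxxx)
      moreover have "R * (T / 2 / R\<^sup>2 * exp (T / 2)) = T / 2 * exp (T / 2) / R" using R by (simp add: power2_eq_square)
      ultimately have "R * ((T * q)\<^sup>2 / N + T / 2 / R\<^sup>2 * exp (T / 2)) = (T * q)\<^sup>2 / R ^ 3 + T / 2 * exp (T / 2) / R"
        by (simp only: distrib_left)
      hence "2 / pi * C * (R * ((T * q)\<^sup>2 / N + T / 2 / R\<^sup>2 * exp (T / 2))) = ?B" by (simp only:)
      thus ?thesis by (simp only: mult_ac mult_1_left)
    qed
    finally show "\<bar>a r - d r\<bar> \<le> ?B" .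
  qed simp
  finally show ?thesis by (simp add: p1 R_def q_def)
qed

lemma Pm_tendsto: assumes "t1 \<le> t" "t < T" shows "(\<lambda>N. Pm N t) \<longlonglongrightarrow> 1"
proof -
  have "(\<lambda>N. Pm N t - 1) \<longlonglongrightarrow> 0"
  proof (rule Lim_null_comparison)
    have "\<forall>\<^sub>F N in sequentially. N \<ge> 1" by (rule eventually_ge_at_top)
    thus "\<forall>\<^sub>F N in sequentially. norm (Pm N t - 1) \<le> arc t (cut N) / pi"
    proof eventually_elim
      case (elim N)
      have "cut N > 0" using cut_ge_1[OF elim] by simp
      hence "\<bar>2 * integral {0..cut N} (\<lambda>x. St x t) - pi\<bar> / pi \<le> arc t (cut N) / pi"
        using assms by (intro divide_right_mono integral_St) auto
      moreover have "\<bar>2 * integral {0..cut N} (\<lambda>x. St x t) - pi\<bar> / pi = \<bar>(2 * integral {0..cut N} (\<lambda>x. St x t) - pi) / pi\<bar>" by simp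
      moreover have "(2 * integral {0..cut N} (\<lambda>x. St x t) - pi) / pi = Pm N t - 1" by (simp add: Pm_def diff_divide_distrib)
      ultimately show ?case by (simp only: real_norm_def)
    qed
    have "(\<lambda>N. arc t (cut N) / pi) \<longlonglongrightarrow> 0 / pi"
      by (intro tendsto_intros arc_tendsto_0 assms cut_at_top) simp
    thus "(\<lambda>N. arc t (cut N) / pi) \<longlonglongrightarrow> 0" by simp
  qed
  thus ?thesis by (simp add: LIM_zero_iff)
qed

lemma Wm_tendsto: assumes t: "t1 \<le> t" "t < T" shows "(\<lambda>N. Wm N t \<xi>) \<longlonglongrightarrow> exp (- ((T - t) * nsq n \<xi>))"
proof -
  obtain C where C: "\<And>x t. t \<in> {t1..T} \<Longrightarrow> \<bar>St x t\<bar> \<le> C" using St_bounded by blast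
  define E where "E = exp (- ((T - t) * nsq n \<xi>))"
  have "(\<lambda>N. Wm N t \<xi> - E * Pm N t) \<longlonglongrightarrow> 0"
  proof (rule Lim_null_comparison)
    have "\<forall>\<^sub>F N in sequentially. N \<ge> 1" by (rule eventually_ge_at_top)
    thus "\<forall>\<^sub>F N in sequentially. norm (Wm N t \<xi> - E * Pm N t) \<le> 2 / pi * C * ((T * nsq n \<xi>)\<^sup>2 / cut N ^ 3 + T / 2 * exp (T / 2) / cut N)"
    proof eventually_elim
      case (elim N)
      show ?case using Wm_close[OF elim, of t C \<xi>] C t by (simp add: E_def)
    qed
    have "(\<lambda>N. 2 / pi * C * ((T * nsq n \<xi>)\<^sup>2 / cut N ^ 3 + T / 2 * exp (T / 2) / cut N)) \<longlonglongrightarrow> 2 / pi * C * (0 + 0)"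
      by (intro tendsto_intros tendsto_divide_0[OF tendsto_const] filterlim_at_top_imp_at_infinity cut_at_top filterlim_pow_at_top) auto
    thus "(\<lambda>N. 2 / pi * C * ((T * nsq n \<xi>)\<^sup>2 / cut N ^ 3 + T / 2 * exp (T / 2) / cut N)) \<longlonglongrightarrow> 0" by simp
  qed
  moreover have "(\<lambda>N. E * Pm N t) \<longlonglongrightarrow> E * 1" by (intro tendsto_intros Pm_tendsto t)
  ultimately have "(\<lambda>N. (Wm N t \<xi> - E * Pm N t) + E * Pm N t) \<longlonglongrightarrow> 0 + E * 1" by (rule tendsto_add)
  thus ?thesis by (simp add: E_def)
qed

text \<open>Unlike the convergence of \<open>Wm\<close>, the bound is uniform in \<open>N\<close>
  and holds up to \<open>t = T\<close>. Quadratic growth in \<open>1 + nsq n \<xi>\<close> is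
  affordable, as the moments of \<open>rho\<close> supply the majorant.\<close>

lemma Wm_bound: obtains K where "K \<ge> 0" "\<And>N t \<xi>. N \<ge> 1 \<Longrightarrow> t \<in> {t1..T} \<Longrightarrow> \<bar>Wm N t \<xi>\<bar> \<le> K * (1 + nsq n \<xi>)\<^sup>2"
proof -
  obtain C where C: "\<And>x t. t \<in> {t1..T} \<Longrightarrow> \<bar>St x t\<bar> \<le> C" "C \<ge> 0" using St_bounded by blast
  obtain A where A: "\<And>t R. t \<in> {t1..T} \<Longrightarrow> R > 0 \<Longrightarrow> arc t R \<le> A" "\<And>t R. 0 \<le> arc t R" using arc_bounded by blast
  have T0: "T > 0" using t1 t1T by simp
  have A0: "A \<ge> 0" using A(1)[of T 1] A(2)[of T 1] t1T by simp
  define K where "K = (1 + A / pi) + 2 / pi * C * (T\<^sup>2 + T / 2 * exp (T / 2))"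
  show thesis
  proof (rule that[of K])
    show "K \<ge> 0" unfolding K_def using A0 C T0 by (intro add_nonneg_nonneg mult_nonneg_nonneg) auto
    fix N :: nat and t :: real and \<xi> :: "nat \<Rightarrow> real" assume N: "N \<ge> 1" and t: "t \<in> {t1..T}"
    define q where "q = nsq n \<xi>"
    have q: "q \<ge> 0" using nsq_nonneg by (simp add: q_def)
    have R: "cut N \<ge> 1" by (rule cut_ge_1[OF N])
    have P: "\<bar>Pm N t\<bar> \<le> 1 + A / pi"
    proof -
      have "\<bar>2 * integral {0..cut N} (\<lambda>x. St x t) - pi\<bar> \<le> A" using integral_St[OF t, of "cut N"] A(1)[OF t, of "cut N"] R by simp
      hence "\<bar>2 * integral {0..cut N} (\<lambda>x. St x t)\<bar> \<le> pi + A"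
        using abs_triangle_ineq[of "2 * integral {0..cut N} (\<lambda>x. St x t) - pi" pi] by simp
      hence "\<bar>2 * integral {0..cut N} (\<lambda>x. St x t)\<bar> / pi \<le> (pi + A) / pi" by (intro divide_right_mono) auto
      thus ?thesis by (simp add: Pm_def abs_mult add_divide_distrib)
    qed
    have "\<bar>exp (- ((T - t) * q)) * Pm N t\<bar> \<le> 1 * (1 + A / pi)"
      unfolding abs_mult using t q A0 by (intro mult_mono P) auto
    moreover have "2 / pi * C * ((T * q)\<^sup>2 / cut N ^ 3 + T / 2 * exp (T / 2) / cut N) \<le> 2 / pi * C * ((T * q)\<^sup>2 / 1 + T / 2 * exp (T / 2) / 1)"
      using R T0 C(2) by (intro mult_left_mono add_mono divide_left_mono) (auto simp: one_le_power)
    ultimately have "\<bar>Wm N t \<xi>\<bar> \<le> (1 + A / pi) + 2 / pi * C * ((T * q)\<^sup>2 + T / 2 * exp (T / 2))"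
      using Wm_close[OF N t, of C \<xi>] C(1)[OF t] unfolding q_def[symmetric] by (simp add: q_def abs_le_iff)
    also have "\<dots> \<le> (1 + A / pi) * (1 + q)\<^sup>2 + 2 / pi * C * ((T\<^sup>2 + T / 2 * exp (T / 2)) * (1 + q)\<^sup>2)"
    proof (intro add_mono mult_left_mono)
      have q2: "1 \<le> (1 + q)\<^sup>2" using q by (simp add: one_le_power)
      show "1 + A / pi \<le> (1 + A / pi) * (1 + q)\<^sup>2" using mult_left_mono[OF q2, of "1 + A / pi"] A0 by simp
      have "T / 2 * exp (T / 2) * 1 \<le> T / 2 * exp (T / 2) * (1 + q)\<^sup>2" using q2 T0 by (intro mult_left_mono) auto
      moreover have "T\<^sup>2 * q\<^sup>2 \<le> T\<^sup>2 * (1 + q)\<^sup>2" using q by (intro mult_left_mono power_mono) auto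
      ultimately show "(T * q)\<^sup>2 + T / 2 * exp (T / 2) \<le> (T\<^sup>2 + T / 2 * exp (T / 2)) * (1 + q)\<^sup>2"
        by (simp add: power_mult_distrib distrib_right)
    qed (use C in auto)
    also have "\<dots> = K * (1 + q)\<^sup>2" by (simp add: K_def algebra_simps)
    finally show "\<bar>Wm N t \<xi>\<bar> \<le> K * (1 + nsq n \<xi>)\<^sup>2" by (simp add: q_def)
  qed
qed

lemma ypt_Rsp: "N \<ge> 1 \<Longrightarrow> ypt N t \<in> Rsp N" by (auto simp: ypt_def Rsp_def)

text \<open>In the iterated integral the average over \<open>r\<close> leaves the first mode
  unchanged and turns the packet into \<open>Wm\<close>, while the weight \<open>rho\<close>
  recombines with the bounded coefficients to \<open>Gn\<close>.\<close>

lemma vN_cone: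
  assumes N: "N \<ge> 1" and t: "t1 < t" "t \<le> T" and x: "x \<in> Rsp n"
  defines "\<Theta> \<equiv> \<lambda>\<xi>. Gn x \<xi> * (Re (f (of_real (sqrt (2 * real N) * sqrt (nsq n \<xi>))) t) + Wm N t \<xi>)"
  shows "vN N t x (ypt N t) = (\<integral>\<xi>. \<Theta> \<xi> \<partial>leb n)" "integrable (leb n) \<Theta>"
proof -
  interpret P: pair_sigma_finite mu unit_leb by (rule PM_pair)
  interpret b: prob_space unit_leb by (rule unit_leb_prob)
  have p1: "b.prob {0..1} = 1" using b.prob_space by simp
  have t0: "t > 0" using t t1 by simp
  have N0: "real N > 0" using N by simp
  define F where "F w = tr 0 w (dot n (fst w) x) * (Dm N w t + Sm N w t * Ym N 0 w (zz N w * t))" for w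
  have nt: "nsq N (ypt N t) / (2 * real N) = t" using nsq_ypt[OF N, of t] t0 N0 by simp
  have i: "integrable PM F"
    using vN_integrable[OF N t(1) _ x ypt_Rsp[OF N], of t] t unfolding nt F_def by simp
  have inner: "rho \<xi> * (\<integral>r. F (\<xi>, r) \<partial>unit_leb) = \<Theta> \<xi>" for \<xi>
  proof -
    have D: "Dm N (\<xi>, r) t = Re (f (of_real (sqrt (2 * real N) * sqrt (nsq n \<xi>))) t)" for r
      by (simp add: Dm_def lam1_def real_sqrt_mult)
    have w: "integrable unit_leb (\<lambda>r. Sm N (\<xi>, r) t * Ym N 0 (\<xi>, r) (zz N (\<xi>, r) * t))"
      by (rule unit_leb_integrable[OF Wm_integrand_cont(1)[OF N t0]])
    have "(\<integral>r. F (\<xi>, r) \<partial>unit_leb) = (\<integral>r. tr 0 (\<xi>, 0) (dot n \<xi> x) * (Re (f (of_real (sqrt (2 * real N) * sqrt (nsq n \<xi>))) t)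
        + Sm N (\<xi>, r) t * Ym N 0 (\<xi>, r) (zz N (\<xi>, r) * t)) \<partial>unit_leb)"
      unfolding F_def D by (simp add: tr_def)
    also have "\<dots> = tr 0 (\<xi>, 0) (dot n \<xi> x) * (Re (f (of_real (sqrt (2 * real N) * sqrt (nsq n \<xi>))) t) + Wm N t \<xi>)"
      using w by (simp add: Wm_def p1)
    finally show ?thesis unfolding \<Theta>_def using rho_tr[of \<xi> 0 x] by (simp add: mult.assoc[symmetric])
  qed
  have "vN N t x (ypt N t) = (\<integral>w. F w \<partial>PM)" unfolding vN_def nt F_def ..
  also have "\<dots> = (\<integral>\<xi>. rho \<xi> * (\<integral>r. F (\<xi>, r) \<partial>unit_leb) \<partial>leb n)" by (rule PM_integral[OF i])
  finally show "vN N t x (ypt N t) = (\<integral>\<xi>. \<Theta> \<xi> \<partial>leb n)" unfolding inner .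
  have "integrable mu (\<lambda>\<xi>. \<integral>r. F (\<xi>, r) \<partial>unit_leb)"
    using P.integrable_fst'[OF i[unfolded PM_def]] .
  moreover from this have "(\<lambda>\<xi>. \<integral>r. F (\<xi>, r) \<partial>unit_leb) \<in> borel_measurable (leb n)"
    by (simp cong: measurable_cong_sets)
  ultimately have "integrable (leb n) (\<lambda>\<xi>. rho \<xi> * (\<integral>r. F (\<xi>, r) \<partial>unit_leb))" using mu_integrable by blast
  thus "integrable (leb n) \<Theta>" unfolding inner .
qed

text \<open>The two summands converge for different reasons. The first oscillates like a fixed
  mean-zero function of \<open>sqrt (2 N)\<close> times the length of \<open>\<xi>\<close> and
  disappears by \<open>riemann_lebesgue\<close>; the packet converges for each \<open>\<xi>\<close>
  under the majorant from \<open>Wm_bound\<close>. Both use \<open>t < T\<close>.\<close>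

lemma vN_tendsto:
  assumes t: "t1 < t" "t < T" and x: "x \<in> Rsp n"
  shows "(\<lambda>N. vN N t x (ypt N t)) \<longlonglongrightarrow> heat T t x"
proof -
  have t0: "t > 0" using t t1 by simp
  define \<phi> where "\<phi> \<kappa> = Re (f (of_real \<kappa>) t)" for \<kappa>
  define X where "X N = sqrt (2 * real N)" for N
  obtain C K where C: "C \<ge> 0" "\<And>x t. t \<in> {t1..T+1} \<Longrightarrow> norm (f (of_real x) t) \<le> C" using f_bounds by metis
  have \<phi>c: "continuous_on UNIV \<phi>" unfolding \<phi>_def by (intro continuous_intros f_real_cont t0)
  have \<phi>b: "\<bar>\<phi> \<kappa>\<bar> \<le> C" for \<kappa>
    using abs_Re_le_cmod[of "f (of_real \<kappa>) t"] C(2)[of t \<kappa>] t by (simp add: \<phi>_def)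
  have mean: "((\<lambda>y. integral {0..y} \<phi> / y) \<longlongrightarrow> 0) at_top"
  proof (rule tendsto_at_topI_sequentially)
    fix Y :: "nat \<Rightarrow> real" assume Y: "filterlim Y at_top sequentially"
    show "(\<lambda>i. integral {0..Y i} \<phi> / Y i) \<longlonglongrightarrow> 0"
    proof (rule Lim_null_comparison)
      have "\<forall>\<^sub>F i in sequentially. Y i > 0" using Y by (simp add: filterlim_at_top_dense)
      thus "\<forall>\<^sub>F i in sequentially. norm (integral {0..Y i} \<phi> / Y i) \<le> arc t (Y i) / 2"
      proof eventually_elim
        case (elim i)
        have "\<bar>2 * integral {0..Y i} \<phi>\<bar> \<le> Y i * arc t (Y i)"
          using integral_Re_f[of t "Y i"] t elim unfolding \<phi>_def by simp
        thus ?case using elim by (simp add: abs_mult divide_simps mult.commute)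
      qed
      have "(\<lambda>i. arc t (Y i) / 2) \<longlonglongrightarrow> 0 / 2" using t by (intro tendsto_intros arc_tendsto_0 Y) auto
      thus "(\<lambda>i. arc t (Y i) / 2) \<longlonglongrightarrow> 0" by simp
    qed
  qed
  have Xl: "filterlim X at_top sequentially"
    unfolding X_def by (intro filterlim_compose[OF sqrt_at_top] filterlim_tendsto_pos_mult_at_top[OF tendsto_const] filterlim_real_sequentially) auto
  obtain D where D: "\<And>\<xi>. (1 + nsq n \<xi>) ^ n * \<bar>Gn x \<xi>\<bar> \<le> D"
  proof -
    obtain B where B: "\<And>x \<xi>. (1 + nsq n \<xi>) ^ n * \<bar>Gx n h x \<xi>\<bar> \<le> B" using Gx_decay[OF h n] by blast
    have "(1 + nsq n \<xi>) ^ n * \<bar>Gn x \<xi>\<bar> \<le> B / (2 * pi) ^ n" for \<xi>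
    proof -
      have "((1 + nsq n \<xi>) ^ n * \<bar>Gx n h x \<xi>\<bar>) / (2 * pi) ^ n \<le> B / (2 * pi) ^ n" using B by (intro divide_right_mono) auto
      thus ?thesis by (simp add: Gn_eq)
    qed
    thus ?thesis using that by blast
  qed
  have RL: "(\<lambda>N. \<integral>\<xi>. Gn x \<xi> * \<phi> (X N * sqrt (nsq n \<xi>)) \<partial>leb n) \<longlonglongrightarrow> 0"
    by (rule riemann_lebesgue[OF n Gn_cont Gn_emb D \<phi>c \<phi>b mean Xl])
  have i1: "integrable (leb n) (\<lambda>\<xi>. Gn x \<xi> * \<phi> (X N * sqrt (nsq n \<xi>)))" for N
  proof (rule Bochner_Integration.integrable_bound)
    show "integrable (leb n) (\<lambda>\<xi>. C * rho \<xi>)" using rho_moments[of 0] by simp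
    have "(\<lambda>\<xi>. \<phi> (X N * sqrt (nsq n \<xi>))) \<in> borel_measurable (leb n)"
      by (rule measurable_compose[OF _ borel_measurable_continuous_onI[OF \<phi>c]]) measurable
    thus "(\<lambda>\<xi>. Gn x \<xi> * \<phi> (X N * sqrt (nsq n \<xi>))) \<in> borel_measurable (leb n)" by measurable
    show "AE \<xi> in leb n. norm (Gn x \<xi> * \<phi> (X N * sqrt (nsq n \<xi>))) \<le> norm (C * rho \<xi>)"
    proof (intro AE_I2)
      fix \<xi>
      have "\<bar>Gn x \<xi>\<bar> * \<bar>\<phi> (X N * sqrt (nsq n \<xi>))\<bar> \<le> rho \<xi> * C" using rho_nonneg by (intro mult_mono Gn_le_rho \<phi>b) auto
      thus "norm (Gn x \<xi> * \<phi> (X N * sqrt (nsq n \<xi>))) \<le> norm (C * rho \<xi>)"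
        using C(1) rho_nonneg[of \<xi>] by (simp add: abs_mult mult.commute)
    qed
  qed
  have tot: "integrable (leb n) (\<lambda>\<xi>. Gn x \<xi> * (\<phi> (X N * sqrt (nsq n \<xi>)) + Wm N t \<xi>))"
    "vN N t x (ypt N t) = (\<integral>\<xi>. Gn x \<xi> * (\<phi> (X N * sqrt (nsq n \<xi>)) + Wm N t \<xi>) \<partial>leb n)" if "N \<ge> 1" for N
    using vN_cone[OF that t(1) _ x] t unfolding \<phi>_def X_def by auto
  have i2: "integrable (leb n) (\<lambda>\<xi>. Gn x \<xi> * Wm N t \<xi>)" if "N \<ge> 1" for N
    using Bochner_Integration.integrable_diff[OF tot(1)[OF that] i1[of N]] by (simp add: algebra_simps)
  obtain B where B: "B \<ge> 0" "\<And>N t \<xi>. N \<ge> 1 \<Longrightarrow> t \<in> {t1..T} \<Longrightarrow> \<bar>Wm N t \<xi>\<bar> \<le> B * (1 + nsq n \<xi>)\<^sup>2" using Wm_bound by blast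
  \<comment> \<open>The shifted index excludes \<open>N = 0\<close>, for which
    \<open>Wm_bound\<close> gives nothing.\<close>
  have "(\<lambda>k. \<integral>\<xi>. Gn x \<xi> * Wm (Suc k) t \<xi> \<partial>leb n) \<longlonglongrightarrow> (\<integral>\<xi>. Gn x \<xi> * exp (- ((T - t) * nsq n \<xi>)) \<partial>leb n)"
  proof (rule integral_dominated_convergence)
    show "integrable (leb n) (\<lambda>\<xi>. B * ((1 + nsq n \<xi>)\<^sup>2 * rho \<xi>))" using rho_moments[of 2] by simp
    show "AE \<xi> in leb n. (\<lambda>k. Gn x \<xi> * Wm (Suc k) t \<xi>) \<longlonglongrightarrow> Gn x \<xi> * exp (- ((T - t) * nsq n \<xi>))"
      using t by (intro AE_I2 tendsto_intros LIMSEQ_Suc[OF Wm_tendsto]) auto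
    show "AE \<xi> in leb n. norm (Gn x \<xi> * Wm (Suc k) t \<xi>) \<le> B * ((1 + nsq n \<xi>)\<^sup>2 * rho \<xi>)" for k
    proof (intro AE_I2)
      fix \<xi>
      have "\<bar>Gn x \<xi>\<bar> * \<bar>Wm (Suc k) t \<xi>\<bar> \<le> rho \<xi> * (B * (1 + nsq n \<xi>)\<^sup>2)"
        using t rho_nonneg by (intro mult_mono Gn_le_rho B) auto
      thus "norm (Gn x \<xi> * Wm (Suc k) t \<xi>) \<le> B * ((1 + nsq n \<xi>)\<^sup>2 * rho \<xi>)" by (simp add: abs_mult mult_ac)
    qed
    show "(\<lambda>\<xi>. Gn x \<xi> * Wm (Suc k) t \<xi>) \<in> borel_measurable (leb n)" for k
      using i2[of "Suc k"] by (intro borel_measurable_integrable) simp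
    show "(\<lambda>\<xi>. Gn x \<xi> * exp (- ((T - t) * nsq n \<xi>))) \<in> borel_measurable (leb n)" by measurable
  qed
  hence W: "(\<lambda>k. \<integral>\<xi>. Gn x \<xi> * Wm (Suc k) t \<xi> \<partial>leb n) \<longlonglongrightarrow> heat T t x" by (simp add: heat_def)
  have "vN (Suc k) t x (ypt (Suc k) t) = (\<integral>\<xi>. Gn x \<xi> * \<phi> (X (Suc k) * sqrt (nsq n \<xi>)) \<partial>leb n) + (\<integral>\<xi>. Gn x \<xi> * Wm (Suc k) t \<xi> \<partial>leb n)" for k
    using tot(2)[of "Suc k"] Bochner_Integration.integral_add[OF i1[of "Suc k"] i2[of "Suc k"]] by (simp add: distrib_left)
  hence "(\<lambda>k. vN (Suc k) t x (ypt (Suc k) t)) \<longlonglongrightarrow> 0 + heat T t x"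
    by (simp only:) (intro tendsto_add LIMSEQ_Suc[OF RL] W)
  hence "(\<lambda>k. vN (Suc k) t x (ypt (Suc k) t)) \<longlonglongrightarrow> heat T t x" by simp
  thus ?thesis by (rule LIMSEQ_imp_Suc)
qed

end

theorem theorem4p1:
  fixes n :: nat and t0 T :: real and h :: "(nat \<Rightarrow> real) \<Rightarrow> real"
  assumes "1 \<le> n" and "0 < t0" and "t0 < T" and "C0_inf n h"
  shows "\<exists>v :: nat \<Rightarrow> real \<Rightarrow> (nat \<Rightarrow> real) \<Rightarrow> (nat \<Rightarrow> real) \<Rightarrow> real.
           (\<forall>N\<ge>1. wave_solution n N t0 T h (v N) \<and>
              (\<forall>A\<in>SO N. \<forall>t\<in>{t0..T}. \<forall>x\<in>Rsp n. \<forall>y\<in>Rsp N. v N t x (matvec N A y) = v N t x y)) \<and>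
           (\<exists>u :: real \<Rightarrow> (nat \<Rightarrow> real) \<Rightarrow> real.
              (\<forall>t\<in>{t0..T}. \<forall>x\<in>Rsp n. (\<lambda>N. v N t x (ypt N t)) \<longlonglongrightarrow> u t x) \<and>
              backward_heat_smooth n t0 T h u)"
proof -
  \<comment> \<open>The starting time of the modes: positive, to stay away from the singular point
    \<open>t = 0\<close> of the time equation, and below \<open>t0\<close>, to leave a margin under
    the slab.\<close>
  have "0 < t0 / 2" using assms by simp
  from fundamental_solutions[OF this]
  obtain c c' s s' :: "complex \<Rightarrow> real \<Rightarrow> complex" where
    sol: "spectral c" "spectral c'" "spectral s" "spectral s'"
    "\<And>\<Lambda> t. t > 0 \<Longrightarrow> (c \<Lambda> has_vector_derivative c' \<Lambda> t) (at t)"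
    "\<And>\<Lambda> t. t > 0 \<Longrightarrow> (c' \<Lambda> has_vector_derivative (- \<Lambda> / (4 * of_real t) * c \<Lambda> t)) (at t)"
    "\<And>\<Lambda> t. t > 0 \<Longrightarrow> (s \<Lambda> has_vector_derivative s' \<Lambda> t) (at t)"
    "\<And>\<Lambda> t. t > 0 \<Longrightarrow> (s' \<Lambda> has_vector_derivative (- \<Lambda> / (4 * of_real t) * s \<Lambda> t)) (at t)"
    "\<And>\<Lambda>. c \<Lambda> (t0/2) = 1" "\<And>\<Lambda>. c' \<Lambda> (t0/2) = 0" "\<And>\<Lambda>. s \<Lambda> (t0/2) = 0" "\<And>\<Lambda>. s' \<Lambda> (t0/2) = 1" "\<And>t. c 0 t = 1"
    by metis
  interpret wave_construction "t0/2" T c c' s s' n h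
    by unfold_locales (rule sol assms | assumption | use assms in simp)+
  show ?thesis
  proof (intro exI[of _ vN] exI[of _ "heat T"] conjI allI impI ballI)
    fix N :: nat assume N: "1 \<le> N"
    show "wave_solution n N t0 T h (vN N)" using assms by (intro vN_wave_solution[OF N]) simp
    show "vN N t x (matvec N A y) = vN N t x y" if "A \<in> SO N" for A t x y
      by (simp add: vN_def nsq_SO[OF that])
  next
    fix t x assume t: "t \<in> {t0..T}" and x: "x \<in> Rsp n"
    show "(\<lambda>N. vN N t x (ypt N t)) \<longlonglongrightarrow> heat T t x"
    \<comment> \<open>At \<open>t = T\<close> the sequence equals \<open>h x\<close> for all
      \<open>N \<ge> 1\<close>. The argument for \<open>t < T\<close> does not reach this point,
      since the decay rate \<open>sqrt T - sqrt t\<close> along the arcs is 0 there.\<close>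
    proof (cases "t = T")
      case True
      have "\<forall>\<^sub>F N in sequentially. N \<ge> 1" by (rule eventually_ge_at_top)
      hence "\<forall>\<^sub>F N in sequentially. heat T t x = vN N t x (ypt N t)"
        by eventually_elim (simp add: True vN_T[OF _ x] heat_T[OF x])
      thus ?thesis by (rule Lim_transform_eventually[OF tendsto_const])
    next
      case False
      thus ?thesis using t x assms by (intro vN_tendsto) auto
    qed
  qed (rule heat_backward[OF assms(3)])
qed

end
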